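(* There is an absolute constant $C'$ such that, for each fixed $0<\varepsilon<1$, there is $n_1=n_1(\varepsilon)$ such that for every $n\ge n_1$ every compact convex body $K\subseteq\mathbb R^n$ with nonempty interior admits an $\varepsilon$-smooth lattice covering of density at most $C'\varepsilon^{-4}n^2$; that is, there is a full-rank lattice $\Lambda\subseteq\mathbb R^n$ with $\eta(K,\Lambda)<\varepsilon$ and $\operatorname{vol}(K)/\det\Lambda\le C'\varepsilon^{-4}n^2$.
   Context: For a full-rank lattice $\Lambda\subseteq\mathbb R^n$ with covolume $\det\Lambda$, a compact convex set $K\subseteq\mathbb R^n$ with nonempty interior, and $x\in\mathbb R^n$, write $N(\Lambda,K,x)=|\Lambda\cap(K+x)|$ and $$\eta(K,\Lambda)=\sup_{x\in\mathbb R^n}\left|\frac{N(\Lambda,K,x)}{\operatorname{vol}(K)/\det\Lambda}-1\right|.$$ The density (mean multiplicity) is $\operatorname{vol}(K)/\det\Lambda$. The lattice covering of $\mathbb R^n$ by the translates $\lambda+K$, $\lambda\in\Lambda$, is called $\varepsilon$-smooth if $\eta(K,\Lambda)<\varepsilon$. *)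

theory Defs
  imports "HOL-Analysis.Analysis"
begin

text \<open>
  The dimension is quantified inside the theorem, so it cannot be a type. A vector of
  \<open>\<real>\<^sup>n\<close> is a function \<open>nat \<Rightarrow> real\<close> that is extensional on \<open>{..<n}\<close>. This is the carrier both of
  the finite product topology of the real line, which is the Euclidean topology, and of the
  finite product of Lebesgue measures.
\<close>

definition rspace :: "nat \<Rightarrow> (nat \<Rightarrow> real) set" where
  "rspace n = {..<n} \<rightarrow>\<^sub>E UNIV"

definition rtop :: "nat \<Rightarrow> (nat \<Rightarrow> real) topology" where
  "rtop n = product_topology (\<lambda>_. euclideanreal) {..<n}"

definition vol :: "nat \<Rightarrow> (nat \<Rightarrow> real) set \<Rightarrow> real" where
  "vol n A = measure (Pi\<^sub>M {..<n} (\<lambda>_. lborel)) A"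

lemma topspace_rtop: "topspace (rtop n) = rspace n"
  by (simp add: rtop_def rspace_def)

lemma space_PiM_lborel: "space (Pi\<^sub>M {..<n} (\<lambda>_. lborel)) = rspace n"
  by (simp add: space_PiM rspace_def)

definition vadd :: "nat \<Rightarrow> (nat \<Rightarrow> real) \<Rightarrow> (nat \<Rightarrow> real) \<Rightarrow> nat \<Rightarrow> real" where
  "vadd n x y = (\<lambda>i\<in>{..<n}. x i + y i)"

definition vscale :: "nat \<Rightarrow> real \<Rightarrow> (nat \<Rightarrow> real) \<Rightarrow> nat \<Rightarrow> real" where
  "vscale n c x = (\<lambda>i\<in>{..<n}. c * x i)"

definition convex_in :: "nat \<Rightarrow> (nat \<Rightarrow> real) set \<Rightarrow> bool" where
  "convex_in n K \<longleftrightarrow> K \<subseteq> rspace n \<and>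
     (\<forall>x\<in>K. \<forall>y\<in>K. \<forall>u\<ge>0. \<forall>v\<ge>0. u + v = 1 \<longrightarrow> vadd n (vscale n u x) (vscale n v y) \<in> K)"

definition convex_body :: "nat \<Rightarrow> (nat \<Rightarrow> real) set \<Rightarrow> bool" where
  "convex_body n K \<longleftrightarrow>
     compactin (rtop n) K \<and> convex_in n K \<and> rtop n interior_of K \<noteq> {}"

definition lincomb :: "nat \<Rightarrow> (nat \<Rightarrow> real) \<Rightarrow> (nat \<Rightarrow> nat \<Rightarrow> real) \<Rightarrow> nat \<Rightarrow> real" where
  "lincomb n c b = (\<lambda>i\<in>{..<n}. \<Sum>j<n. c j * b j i)"

definition lin_indep :: "nat \<Rightarrow> (nat \<Rightarrow> nat \<Rightarrow> real) \<Rightarrow> bool" where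
  "lin_indep n b \<longleftrightarrow> (\<forall>c. lincomb n c b = (\<lambda>i\<in>{..<n}. 0) \<longrightarrow> (\<forall>j<n. c j = 0))"

definition lattice_basis :: "nat \<Rightarrow> (nat \<Rightarrow> nat \<Rightarrow> real) \<Rightarrow> (nat \<Rightarrow> real) set \<Rightarrow> bool" where
  "lattice_basis n b L \<longleftrightarrow> (\<forall>j<n. b j \<in> rspace n) \<and> lin_indep n b \<and>
     L = {lincomb n (\<lambda>j. of_int (z j)) b |z :: nat \<Rightarrow> int. True}"

definition full_rank_lattice :: "nat \<Rightarrow> (nat \<Rightarrow> real) set \<Rightarrow> bool" where
  "full_rank_lattice n L \<longleftrightarrow> (\<exists>b. lattice_basis n b L)"

definition fund_parallelepiped :: "nat \<Rightarrow> (nat \<Rightarrow> nat \<Rightarrow> real) \<Rightarrow> (nat \<Rightarrow> real) set" where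
  "fund_parallelepiped n b = {lincomb n t b |t. \<forall>j<n. 0 \<le> t j \<and> t j < 1}"

text \<open>The volume of the fundamental parallelepiped is the same for all bases of a lattice, so
  the choice of a basis below does not matter.\<close>

definition covolume :: "nat \<Rightarrow> (nat \<Rightarrow> real) set \<Rightarrow> real" where
  "covolume n L = vol n (fund_parallelepiped n (SOME b. lattice_basis n b L))"

definition lattice_count ::
  "nat \<Rightarrow> (nat \<Rightarrow> real) set \<Rightarrow> (nat \<Rightarrow> real) set \<Rightarrow> (nat \<Rightarrow> real) \<Rightarrow> nat" where
  "lattice_count n L K x = card (L \<inter> (\<lambda>k. vadd n k x) ` K)"

definition cover_density :: "nat \<Rightarrow> (nat \<Rightarrow> real) set \<Rightarrow> (nat \<Rightarrow> real) set \<Rightarrow> real" where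
  "cover_density n K L = vol n K / covolume n L"

text \<open>The supremum is taken in the extended reals, where it is meaningful without a proof that
  the family is bounded.\<close>

definition eta :: "nat \<Rightarrow> (nat \<Rightarrow> real) set \<Rightarrow> (nat \<Rightarrow> real) set \<Rightarrow> ereal" where
  "eta n K L =
     (SUP x\<in>rspace n. ereal \<bar>real (lattice_count n L K x) / cover_density n K L - 1\<bar>)"

end

theory Submission
  imports Defs "HOL-Library.Function_Algebras" "HOL-Computational_Algebra.Polynomial"
    "HOL-Computational_Algebra.Primes" "HOL-Real_Asymp.Real_Asymp"
begin

text \<open>
  Let \<open>K\<close> be a convex body of volume \<open>V\<close>. The lattice is built in two stages: a base
  lattice, and a refinement of it by fractional points.

  \<^bold>\<open>Reduction to a finite problem.\<close> Suppose that \<open>L\<close> is a lattice of covolume \<open>\<Delta>\<close> such that any translate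
  of the doubled body \<open>2K\<close> contains at most one point of \<open>L\<close>, while the translates of a bounded multiple
  \<open>R S\<close> of a symmetric body \<open>S \<subseteq> K\<close> cover space (\<open>base_lattice\<close>; \<open>\<Delta>\<close> may exceed \<open>V\<close> by a factor
  exponential in \<open>n\<close>). Let \<open>q\<close> be a prime of order \<open>n / \<epsilon>\<close>. The finer lattice \<open>\<Gamma> = L / q\<close> is covering
  with respect to \<open>\<rho> S\<close>, where \<open>\<rho> = R / q\<close> is of order \<open>\<epsilon> / n\<close>. Hence every translate of \<open>K\<close> lies
  between a translate of \<open>(1 - \<rho>) K\<close> and a translate of \<open>(1 + \<rho>) K\<close> by one and the same point of \<open>\<Gamma>\<close>,
  and passing from \<open>K\<close> to \<open>(1 \<plusminus> \<rho>) K\<close> changes the volume only by a factor \<open>1 + O(\<epsilon>)\<close>. The quotient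
  \<open>\<Gamma> / L\<close> is the space of \<open>n\<close>-vectors modulo \<open>q\<close>, and the number of points of \<open>L\<close> in the translate of
  \<open>(1 \<plusminus> \<rho>) K\<close> by a point of \<open>\<Gamma>\<close> is a 0/1-valued function \<open>f\<close> on this space. If \<open>L'\<close> is obtained from \<open>L\<close>
  by adjoining \<open>k\<close> points of \<open>\<Gamma>\<close>, the points of \<open>L'\<close> in such a translate are counted by the sum of \<open>f\<close>
  over a translate of the flat that these points generate. So it is enough to find \<open>k\<close> vectors such
  that all these sums are at least \<open>1 - \<epsilon>\<close> times their mean for \<open>(1 - \<rho>) K\<close> and at most \<open>1 + \<epsilon>\<close> times
  their mean for \<open>(1 + \<rho>) K\<close>.

  \<^bold>\<open>The finite problem.\<close> If \<open>f\<close> has mean \<open>\<sigma>\<close> and \<open>\<sigma> q\<^sup>k\<close> exceeds a constant times \<open>n q / \<epsilon>\<^sup>2\<close>, then such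
  vectors exist (\<open>two_sided_equidistribution\<close>). Otherwise, for one of the two functions \<open>f\<close>, at least half
  of all \<open>k\<close>-tuples of vectors are the directions of a flat on which \<open>f\<close> deviates. For a small number \<open>v\<close>, of order \<open>\<epsilon> / n\<close>
  up to its sign, the weight \<open>w = 1 + v f\<close> then has a large average on a flat for each of these
  tuples. A maximal inequality of Kakeya type (\<open>kakeya_maximal\<close>) bounds the sum of \<open>w\<^sup>n\<close> from below by
  almost what the constant weight with this average would give, and this contradicts the value of that sum,
  which is known because \<open>f\<close> is 0/1-valued. The inequality is proved by the polynomial method with
  multiplicities. Flats of dimension \<open>k\<close> are treated as lines over a field with \<open>q\<^sup>k\<close> elements; this
  field is replaced by the ring of integer polynomials in one variable modulo the prime element \<open>q\<close>,
  in which the tuple \<open>(u\<^sub>0, \<dots>, u\<^bsub>k-1\<^esub>)\<close> becomes the vector \<open>u\<^sub>0 + u\<^sub>1 T + \<dots> + u\<^bsub>k-1\<^esub> T\<^bsup>k-1\<^esup>\<close>.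

  \<^bold>\<open>The density.\<close> With \<open>k\<close> and \<open>\<Delta>\<close> adjusted to each other, \<open>V q\<^sup>k / \<Delta>\<close> is equal to a constant times
  \<open>n q / \<epsilon>\<^sup>2\<close>, hence of order \<open>n\<^sup>2 / \<epsilon>\<^sup>3\<close>. This number bounds the density of \<open>L'\<close>.

  \<^bold>\<open>The base lattice.\<close> Start from a fine cubic grid \<open>G\<close>, a huge prime \<open>P\<close> and the sublattice \<open>P G\<close>, and
  adjoin to the latter a random point of \<open>G\<close>. Counting shows that with probability at least one half no
  nonzero point of the lattice is twice a difference of points of \<open>K\<close>. A second moment estimate shows that few grid points
  stay uncovered by the translates of a multiple of \<open>S\<close>, and if a single point were uncovered by those of
  a slightly larger multiple, too many grid points near it would be uncovered. The symmetric
  body \<open>S\<close> is the intersection of \<open>K\<close> with its reflection in a point for which this intersection has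
  volume at least \<open>V / 4\<^sup>n\<close>.
\<close>

section \<open>Polynomial functions\<close>

text \<open>
  Polynomial functions of degree at most \<open>d\<close> in the first \<open>m\<close> coordinates, as a property of functions.
  Only values and restrictions to lines enter below, and the restrictions are polynomials in one variable.
\<close>

inductive polyfun :: "nat \<Rightarrow> nat \<Rightarrow> ((nat \<Rightarrow> 'a::comm_ring_1) \<Rightarrow> 'a) \<Rightarrow> bool" for m where
  const: "polyfun m d (\<lambda>x. c)"
| var: "i < m \<Longrightarrow> polyfun m (Suc d) (\<lambda>x. x i)"
| add: "polyfun m d f \<Longrightarrow> polyfun m d g \<Longrightarrow> polyfun m d (\<lambda>x. f x + g x)"
| mult: "polyfun m d f \<Longrightarrow> polyfun m d' g \<Longrightarrow> d + d' \<le> D \<Longrightarrow> polyfun m D (\<lambda>x. f x * g x)"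

lemma polyfun_mono: "polyfun m d f \<Longrightarrow> d \<le> d' \<Longrightarrow> polyfun m d' f"
proof (induction arbitrary: d' rule: polyfun.induct)
  case (const d c) show ?case by (rule polyfun.const)
next
  case (var i d) then show ?case by (cases d') (auto intro: polyfun.var)
next
  case (add d f g) then show ?case by (auto intro: polyfun.add)
next
  case (mult d f d'' g D) show ?case by (rule polyfun.mult[OF mult(1,2)]) (use mult in simp)
qed

lemma polyfun_cong: "polyfun m d f \<Longrightarrow> (\<And>i. i < m \<Longrightarrow> x i = y i) \<Longrightarrow> f x = f y"
  by (induction rule: polyfun.induct) auto

lemma polyfun_sum:
  "finite I \<Longrightarrow> (\<And>i. i \<in> I \<Longrightarrow> polyfun m d (f i)) \<Longrightarrow> polyfun m d (\<lambda>x. \<Sum>i\<in>I. f i x)"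
  by (induction rule: finite_induct) (auto intro: polyfun.intros)

lemma polyfun_power: "polyfun m d f \<Longrightarrow> polyfun m (k * d) (\<lambda>x. f x ^ k)"
  by (induction k) (auto intro: polyfun.intros)

lemma polyfun_prod:
  "finite I \<Longrightarrow> (\<And>i. i \<in> I \<Longrightarrow> polyfun m (d i) (f i)) \<Longrightarrow>
    polyfun m (\<Sum>i\<in>I. d i) (\<lambda>x. \<Prod>i\<in>I. f i x)"
  by (induction rule: finite_induct) (auto intro: polyfun.const intro!: polyfun.mult[OF _ _ order_refl])

lemma polyfun_subst:
  "polyfun m d f \<Longrightarrow> (\<And>i. i < m \<Longrightarrow> polyfun k 1 (g i)) \<Longrightarrow> polyfun k d (\<lambda>t. f (\<lambda>i. g i t))"
proof (induction rule: polyfun.induct)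
  case (var i d)
  then show ?case by (auto intro: polyfun_mono[where d=1])
qed (auto intro: polyfun.intros)

text \<open>
  Restriction to the lines of a fixed direction \<open>y\<close>. That the coefficients are again polynomial functions of the
  base point makes them available as (Hasse) derivatives in the direction \<open>y\<close>.
\<close>

lemma polyfun_directional:
  assumes "polyfun m d f"
  shows "\<exists>p. (\<forall>x z. f (\<lambda>i. x i + z * y i) = poly (p x) z) \<and>
             (\<forall>s. polyfun m d (\<lambda>x. coeff (p x) s)) \<and> (\<forall>x. degree (p x) \<le> d)"
  using assms
proof (induction rule: polyfun.induct)
  case (const d c)
  show ?case by (rule exI[of _ "\<lambda>x. [:c:]"]) (auto intro: polyfun.const)
next
  case (var i d)
  have "polyfun m (Suc d) (\<lambda>x. coeff [:x i, y i:] s)" for s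
    by (cases s) (auto intro: polyfun.intros var)
  then show ?case by (intro exI[of _ "\<lambda>x. [:x i, y i:]"]) auto
next
  case (add d f g)
  then obtain p q where "\<forall>x z. f (\<lambda>i. x i + z * y i) = poly (p x) z" "\<forall>s. polyfun m d (\<lambda>x. coeff (p x) s)"
     "\<forall>x. degree (p x) \<le> d"
     "\<forall>x z. g (\<lambda>i. x i + z * y i) = poly (q x) z" "\<forall>s. polyfun m d (\<lambda>x. coeff (q x) s)"
     "\<forall>x. degree (q x) \<le> d" by blast
  then show ?case by (intro exI[of _ "\<lambda>x. p x + q x"]) (auto intro: polyfun.intros degree_add_le)
next
  case (mult d f d' g D)
  then obtain p q where *: "\<forall>x z. f (\<lambda>i. x i + z * y i) = poly (p x) z" "\<forall>s. polyfun m d (\<lambda>x. coeff (p x) s)"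
     "\<forall>x. degree (p x) \<le> d"
     "\<forall>x z. g (\<lambda>i. x i + z * y i) = poly (q x) z" "\<forall>s. polyfun m d' (\<lambda>x. coeff (q x) s)"
     "\<forall>x. degree (q x) \<le> d'" by blast
  have "polyfun m D (\<lambda>x. coeff (p x * q x) s)" for s
    unfolding coeff_mult using * mult by (intro polyfun_sum polyfun.mult[where d=d and d'=d']) auto
  moreover have "degree (p x * q x) \<le> D" for x
    using degree_mult_le[of "p x" "q x"] *(3,6) mult(3) by (meson add_mono order_trans)
  ultimately show ?case using * by (intro exI[of _ "\<lambda>x. p x * q x"]) auto
qed

text \<open>
  A polynomial function is a polynomial in its last variable whose \<open>j\<close>-th coefficient has degree at most
  \<open>d - j\<close>. This is the step from \<open>m + 1\<close> to \<open>m\<close> variables in inductions.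
\<close>

lemma polyfun_split_last:
  assumes "polyfun (Suc m) d f"
  shows "\<exists>G. (\<forall>x. f x = poly (G x) (x m)) \<and> (\<forall>j. polyfun m (d - j) (\<lambda>x. coeff (G x) j)) \<and>
             (\<forall>x. degree (G x) \<le> d)"
  using assms
proof (induction rule: polyfun.induct)
  case (const d c)
  show ?case by (rule exI[of _ "\<lambda>x. [:c:]"]) (auto intro: polyfun.const)
next
  case (var i d)
  show ?case
  proof (cases "i = m")
    case True
    then show ?thesis by (intro exI[of _ "\<lambda>x. [:0,1:]"]) (auto intro: polyfun.const)
  next
    case False
    with var have "i < m" by simp
    then have "polyfun m (Suc d - j) (\<lambda>x. coeff [:x i:] j)" for j
      by (cases j) (auto intro: polyfun.intros)
    then show ?thesis by (intro exI[of _ "\<lambda>x. [:x i:]"]) auto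
  qed
next
  case (add d f g)
  then obtain p q where "\<forall>x. f x = poly (p x) (x m)" "\<forall>j. polyfun m (d - j) (\<lambda>x. coeff (p x) j)"
     "\<forall>x. degree (p x) \<le> d"
     "\<forall>x. g x = poly (q x) (x m)" "\<forall>j. polyfun m (d - j) (\<lambda>x. coeff (q x) j)"
     "\<forall>x. degree (q x) \<le> d" by blast
  then show ?case by (intro exI[of _ "\<lambda>x. p x + q x"]) (auto intro: polyfun.intros degree_add_le)
next
  case (mult d f d' g D)
  then obtain p q where *: "\<forall>x. f x = poly (p x) (x m)" "\<forall>j. polyfun m (d - j) (\<lambda>x. coeff (p x) j)"
     "\<forall>x. degree (p x) \<le> d"
     "\<forall>x. g x = poly (q x) (x m)" "\<forall>j. polyfun m (d' - j) (\<lambda>x. coeff (q x) j)"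
     "\<forall>x. degree (q x) \<le> d'" by blast
  have "polyfun m (D - j) (\<lambda>x. coeff (p x) i * coeff (q x) (j - i))" if "i \<le> j" for i j
  proof (cases "i \<le> d \<and> j - i \<le> d'")
    case True
    show ?thesis
    proof (rule polyfun.mult[where d="d - i" and d'="d' - (j - i)"])
      show "(d - i) + (d' - (j - i)) \<le> D - j" using that mult(3) True by linarith
      show "polyfun m (d - i) (\<lambda>x. coeff (p x) i)" using *(2) by (rule spec)
      show "polyfun m (d' - (j - i)) (\<lambda>x. coeff (q x) (j - i))" using *(5) by (rule spec)
    qed
  next
    case False
    then have "(\<lambda>x. coeff (p x) i * coeff (q x) (j - i)) = (\<lambda>x. 0)"
      using *(3,6) by (metis coeff_eq_0 le_less_trans mult_zero_left mult_zero_right not_le)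
    then show ?thesis by (simp add: polyfun.const)
  qed
  then have "polyfun m (D - j) (\<lambda>x. coeff (p x * q x) j)" for j
    unfolding coeff_mult by (intro polyfun_sum) auto
  moreover have "degree (p x * q x) \<le> D" for x
    using degree_mult_le[of "p x" "q x"] *(3,6) mult(3) by (meson add_mono order_trans)
  ultimately show ?case using * by (intro exI[of _ "\<lambda>x. p x * q x"]) auto
qed

section \<open>Zeros modulo a prime element\<close>

text \<open>
  Everything happens in a domain modulo a prime element \<open>\<pi>\<close>. The residue classes form an infinite integral
  domain, so a polynomial that vanishes modulo \<open>\<pi>\<close> everywhere has coefficients divisible by \<open>\<pi>\<close>; this
  identification of functions with coefficients would fail over a finite field.
\<close>

locale prime_modulus =
  fixes \<pi> :: "'a::{idom,ring_char_0}"
  assumes prime: "prime_elem \<pi>"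
    and inf_residues: "\<exists>z :: nat \<Rightarrow> 'a. \<forall>i j. i \<noteq> j \<longrightarrow> \<not> \<pi> dvd z i - z j"
begin

definition incong :: "'a set \<Rightarrow> bool" where
  "incong A \<longleftrightarrow> (\<forall>a\<in>A. \<forall>b\<in>A. a \<noteq> b \<longrightarrow> \<not> \<pi> dvd a - b)"

text \<open>
  A polynomial that is nonzero modulo \<open>\<pi>\<close> has at most as many zeros, with multiplicities, as its degree. The
  proof divides by \<open>[:- b, 1:]\<close> at one zero at a time. The number \<open>t\<close> is the degree modulo \<open>\<pi>\<close>, which may
  be smaller than the degree of \<open>p\<close>.
\<close>

lemma sum_orders_le_degree:
  assumes "finite A" "incong A"
    and "\<And>j. j > t \<Longrightarrow> \<pi> dvd coeff p j"
    and "\<And>b s. b \<in> A \<Longrightarrow> s < w b \<Longrightarrow> \<pi> dvd coeff (p \<circ>\<^sub>p [:b, 1:]) s"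
    and "\<not> \<pi> dvd coeff p j0"
  shows "(\<Sum>b\<in>A. w b) \<le> t"
proof (rule ccontr)
  assume "\<not> ?thesis"
  then have "(\<Sum>b\<in>A. w b) > t" by simp
  with assms(3,4) have "\<pi> dvd coeff p j0"
  proof (induction t arbitrary: p w j0 rule: less_induct)
    case (less t p w j0)
    from less.prems(3) have "\<exists>b\<in>A. w b \<noteq> 0"
      by (metis less_nat_zero_code sum.neutral)
    then obtain b where b: "b \<in> A" "w b > 0" by auto
    define p' where "p' = synthetic_div p b"
    have peq: "p = [:-b, 1:] * p' + [:poly p b:]" unfolding p'_def by (rule synthetic_div_correct'[symmetric])
    have pb: "\<pi> dvd poly p b" using less.prems(2)[OF b] by (simp add: poly_pcompose flip: poly_0_coeff_0)
    have coefS: "coeff p (Suc j) = coeff p' j - b * coeff p' (Suc j)" for j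
      by (subst peq) (simp add: algebra_simps)
    have coef0: "coeff p 0 = poly p b - b * coeff p' 0"
      by (subst peq) (simp add: algebra_simps)
    have high: "\<pi> dvd coeff p' j" if "j \<ge> t" for j
    proof (cases "j \<le> degree p'")
      case True
      then show ?thesis using that
      proof (induction rule: inc_induct)
        case base
        then show ?case using coefS[of "degree p'"] less.prems(1)[of "Suc (degree p')"]
          by (simp add: coeff_eq_0)
      next
        case (step j)
        then have "\<pi> dvd coeff p' (Suc j)" "\<pi> dvd coeff p (Suc j)" using less.prems(1)[of "Suc j"] by auto
        then have "\<pi> dvd coeff p (Suc j) + b * coeff p' (Suc j)" by simp
        then show ?case using coefS[of j] by simp
      qed
    qed (simp add: coeff_eq_0)
    have "\<pi> dvd coeff p' j" for j
    proof (cases t)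
      case 0
      then show ?thesis using high by simp
    next
      case (Suc t')
      define w' where "w' = w(b := w b - 1)"
      have sw: "(\<Sum>b\<in>A. w' b) > t'"
      proof -
        have "(\<Sum>b\<in>A. w b) = w b + (\<Sum>c\<in>A-{b}. w c)" using b assms(1) by (simp add: sum.remove)
        moreover have "(\<Sum>b\<in>A. w' b) = w' b + (\<Sum>c\<in>A-{b}. w' c)" using b assms(1) by (simp add: sum.remove)
        moreover have "(\<Sum>c\<in>A-{b}. w' c) = (\<Sum>c\<in>A-{b}. w c)" unfolding w'_def by (intro sum.cong) auto
        ultimately show ?thesis using b less.prems(3) Suc by (simp add: w'_def)
      qed
      have ord: "\<pi> dvd coeff (p' \<circ>\<^sub>p [:c, 1:]) s" if c: "c \<in> A" "s < w' c" for c s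
      proof -
        define P' where "P' = p' \<circ>\<^sub>p [:c,1:]"
        have "p \<circ>\<^sub>p [:c,1:] = ([:-b, 1:] \<circ>\<^sub>p [:c,1:]) * P' + [:poly p b:]"
          by (subst peq) (simp only: pcompose_add pcompose_mult pcompose_const P'_def)
        moreover have "[:-b, 1:] \<circ>\<^sub>p [:c,1:] = [:c - b, 1:]" by (simp add: pcompose_pCons)
        ultimately have PP: "p \<circ>\<^sub>p [:c,1:] = [:c - b, 1:] * P' + [:poly p b:]" by simp
        have cS: "coeff (p \<circ>\<^sub>p [:c,1:]) (Suc s) = (c - b) * coeff P' (Suc s) + coeff P' s" for s
          unfolding PP by simp
        have c0: "coeff (p \<circ>\<^sub>p [:c,1:]) 0 = (c - b) * coeff P' 0 + poly p b"
          unfolding PP by simp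
        show ?thesis
        proof (cases "c = b")
          case True
          then have "\<pi> dvd coeff (p \<circ>\<^sub>p [:c,1:]) (Suc s)" using c b less.prems(2)[of c "Suc s"] by (simp add: w'_def)
          then show ?thesis using cS[of s] True by (simp add: P'_def)
        next
          case False
          \<comment> \<open>At the other zeros the divisor has a value that \<open>\<pi>\<close> does not divide, so the multiplicity is kept.\<close>
          then have nd: "\<not> \<pi> dvd c - b" using c b assms(2) by (auto simp: incong_def)
          have "s < w c" using c False by (simp add: w'_def)
          then have "\<pi> dvd coeff P' s"
          proof (induction s)
            case 0
            then have "\<pi> dvd (c - b) * coeff P' 0 + poly p b" using less.prems(2)[OF c(1) 0] c0 by simp
            then have "\<pi> dvd (c - b) * coeff P' 0" using pb dvd_add_left_iff by blast
            then show ?case using nd prime prime_elem_dvd_mult_iff by blast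
          next
            case (Suc s)
            then have "\<pi> dvd (c - b) * coeff P' (Suc s) + coeff P' s" "\<pi> dvd coeff P' s"
              using less.prems(2)[OF c(1), of "Suc s"] cS[of s] by auto
            then have "\<pi> dvd (c - b) * coeff P' (Suc s)" using dvd_add_left_iff by blast
            then show ?case using nd prime prime_elem_dvd_mult_iff by blast
          qed
          then show ?thesis by (simp add: P'_def)
        qed
      qed
      show ?thesis
        by (rule less.IH[of t' p' w']) (use Suc high ord sw in auto)
    qed
    then show ?case using pb coefS coef0 by (cases j0) auto
  qed
  with assms(5) show False by simp
qed

lemma incong_infinite: "\<exists>A. finite A \<and> card A = n \<and> incong A"
proof -
  obtain z :: "nat \<Rightarrow> 'a" where z: "\<forall>i j. i \<noteq> j \<longrightarrow> \<not> \<pi> dvd z i - z j" using inf_residues by blast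
  then have "inj z" by (metis diff_self dvd_0_right injI)
  then have "card (z ` {..<n}) = n" by (simp add: card_image inj_on_subset)
  moreover have "incong (z ` {..<n})" unfolding incong_def using z by (metis imageE)
  ultimately show ?thesis by (intro exI[of _ "z ` {..<n}"]) simp
qed

lemma coeffs_vanish:
  assumes "\<And>z. \<pi> dvd poly p z"
  shows "\<pi> dvd coeff p j"
proof (rule ccontr)
  assume nd: "\<not> ?thesis"
  obtain A where A: "finite A" "card A = Suc (degree p)" "incong A" using incong_infinite by blast
  have "(\<Sum>b\<in>A. (1::nat)) \<le> degree p"
  proof (rule sum_orders_le_degree[OF A(1,3), of _ p])
    show "\<pi> dvd coeff (p \<circ>\<^sub>p [:b, 1:]) s" if "s < 1" for b s
      using that assms[of b] by (simp add: poly_pcompose flip: poly_0_coeff_0)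
  qed (use nd in \<open>auto simp: coeff_eq_0\<close>)
  then show False using A by simp
qed

text \<open>
  The multiplicity of \<open>f\<close> at \<open>a\<close> modulo \<open>\<pi>\<close> is at least \<open>w\<close>: on every line through \<open>a\<close> the terms of order less than
  \<open>w\<close> vanish modulo \<open>\<pi>\<close>.
\<close>

definition ord_ge :: "((nat \<Rightarrow> 'a) \<Rightarrow> 'a) \<Rightarrow> (nat \<Rightarrow> 'a) \<Rightarrow> nat \<Rightarrow> bool" where
  "ord_ge f a w \<longleftrightarrow>
     (\<forall>y. \<exists>p. (\<forall>z. f (\<lambda>i. a i + z * y i) = poly p z) \<and> (\<forall>s<w. \<pi> dvd coeff p s))"

lemma ord_geD:
  assumes "ord_ge f a w" "\<And>z. f (\<lambda>i. a i + z * y i) = poly p z" "s < w"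
  shows "\<pi> dvd coeff p s"
proof -
  obtain q where "\<forall>z. f (\<lambda>i. a i + z * y i) = poly q z" "\<forall>s<w. \<pi> dvd coeff q s"
    using assms(1) unfolding ord_ge_def by blast
  moreover from this have "q = p" using assms(2) by (metis poly_eq_poly_eq_iff ext)
  ultimately show ?thesis using assms(3) by auto
qed

text \<open>
  The derivative of order \<open>s\<close> in the direction \<open>y\<close> (the coefficient \<open>s\<close> of \<open>p x\<close>) has multiplicity at least
  \<open>w - s\<close> at \<open>a\<close> if the function itself has multiplicity at least \<open>w\<close> there. The line through \<open>a\<close> in the direction
  \<open>v + \<xi> y\<close> gives a relation for each \<open>\<xi>\<close>, and comparing the coefficients of \<open>\<xi>\<^sup>s\<close> isolates the mixed term of
  order \<open>r\<close> in \<open>v\<close> and \<open>s\<close> in \<open>y\<close>.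
\<close>

lemma ord_ge_two_directions:
  assumes f: "polyfun m d f" and "ord_ge f a w"
    and p: "\<And>x z. f (\<lambda>i. x i + z * y i) = poly (p x) z" and deg: "\<And>x. degree (p x) \<le> d"
    and p': "\<And>s z. coeff (p (\<lambda>i. a i + z * v i)) s = poly (p' s) z"
    and rs: "r + s < w"
  shows "\<pi> dvd coeff (p' s) r"
proof -
  let ?N = "r + s"
  have z0: "p' s = 0" if "s > d" for s
  proof -
    have "poly (p' s) z = poly 0 z" for z using p'[of z s] deg that by (metis coeff_eq_0 le_less_trans poly_0)
    then show ?thesis by (metis poly_eq_poly_eq_iff ext)
  qed
  \<comment> \<open>\<open>C\<close> collects the terms of total order \<open>r + s\<close>, as a polynomial in \<open>\<xi>\<close>.\<close>
  define C where "C = (\<Sum>s\<le>min d ?N. monom (coeff (p' s) (?N - s)) s)"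
  have "\<pi> dvd poly C \<xi>" for \<xi>
  proof -
    define Q where "Q = (\<Sum>s\<le>d. smult (\<xi> ^ s) (monom 1 s * p' s))"
    have "f (\<lambda>i. a i + z * (v i + \<xi> * y i)) = poly Q z" for z
    proof -
      have "f (\<lambda>i. a i + z * (v i + \<xi> * y i)) = f (\<lambda>i. (a i + z * v i) + (z * \<xi>) * y i)"
        by (simp add: algebra_simps)
      also have "\<dots> = poly (p (\<lambda>i. a i + z * v i)) (z * \<xi>)" by (rule p)
      also have "\<dots> = (\<Sum>s\<le>d. coeff (p (\<lambda>i. a i + z * v i)) s * (z * \<xi>) ^ s)"
        unfolding poly_altdef by (rule sum.mono_neutral_left) (use deg in \<open>auto simp: coeff_eq_0\<close>)
      also have "\<dots> = poly Q z" unfolding Q_def p'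
        by (simp add: poly_sum poly_monom power_mult_distrib algebra_simps)
      finally show ?thesis .
    qed
    from ord_geD[OF assms(2) this rs]
    have "\<pi> dvd coeff Q ?N" .
    also have "coeff Q ?N = (\<Sum>s\<le>d. if s \<le> ?N then \<xi> ^ s * coeff (p' s) (?N - s) else 0)"
      unfolding Q_def coeff_sum by (intro sum.cong) (auto simp: coeff_monom_mult)
    also have "\<dots> = (\<Sum>s\<le>min d ?N. \<xi> ^ s * coeff (p' s) (?N - s))"
      by (rule sum.mono_neutral_cong_right) auto
    also have "\<dots> = poly C \<xi>" unfolding C_def by (simp add: poly_sum poly_monom mult.commute)
    finally show ?thesis .
  qed
  then have "\<pi> dvd coeff C s" by (rule coeffs_vanish)
  moreover have "coeff C s = (if s \<le> min d ?N then coeff (p' s) r else 0)"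
    unfolding C_def coeff_sum by (simp add: coeff_monom)
  ultimately show ?thesis using z0[of s] by (cases "s \<le> d") auto
qed

end

lemma sum_PiE_lessThan_Suc:
  "(\<Sum>a\<in>PiE {..<Suc m} (\<lambda>_. A). g a) = (\<Sum>a\<in>PiE {..<m} (\<lambda>_. A). \<Sum>b\<in>A. g (a(m := b)))"
proof -
  have "(\<Sum>a\<in>PiE {..<Suc m} (\<lambda>_. A). g a) = (\<Sum>(b,a)\<in>A \<times> PiE {..<m} (\<lambda>_. A). g (a(m := b)))"
    unfolding lessThan_Suc PiE_insert_eq
    by (subst sum.reindex[OF inj_combinator]) (simp_all add: case_prod_unfold comp_def)
  also have "\<dots> = (\<Sum>b\<in>A. \<Sum>a\<in>PiE {..<m} (\<lambda>_. A). g (a(m := b)))"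
    by (rule sum.cartesian_product[symmetric])
  also have "\<dots> = (\<Sum>a\<in>PiE {..<m} (\<lambda>_. A). \<Sum>b\<in>A. g (a(m := b)))"
    by (rule sum.swap)
  finally show ?thesis .
qed

context prime_modulus
begin

text \<open>
  The Schwartz--Zippel lemma with multiplicities (Dvir, Kopparty, Saraf, Sudan). Let \<open>t\<close> be the degree
  modulo \<open>\<pi>\<close> in the last variable, and \<open>v a\<close> the multiplicity of the leading coefficient at \<open>a\<close>. On the
  line above \<open>a\<close>, a suitable derivative of order \<open>v a\<close> is a polynomial in the last variable, of degree \<open>t\<close>
  modulo \<open>\<pi>\<close>, and its multiplicity at \<open>b\<close> is at least \<open>w (a, b) - v a\<close>. Summing over \<open>b\<close> and then applying the
  induction hypothesis to the leading coefficient gives the bound.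
\<close>

theorem sum_orders_le:
  assumes "polyfun m d f" "\<not> \<pi> dvd f x" "finite A" "incong A"
    and "\<And>a. a \<in> PiE {..<m} (\<lambda>_. A) \<Longrightarrow> ord_ge f a (w a)"
  shows "card A * (\<Sum>a\<in>PiE {..<m} (\<lambda>_. A). w a) \<le> d * card A ^ m"
  using assms(1,2,5)
proof (induction m arbitrary: d f x w)
  case 0
  have "w (\<lambda>_. undefined) = 0"
  proof (rule ccontr)
    assume "w (\<lambda>_. undefined) \<noteq> 0"
    moreover have "ord_ge f (\<lambda>_. undefined) (w (\<lambda>_. undefined))" using 0(3) by simp
    moreover have "f (\<lambda>i. undefined + z * 0) = poly [:f x:] z" for z
      using polyfun_cong[OF 0(1), of _ x] by simp
    ultimately have "\<pi> dvd coeff [:f x:] 0"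
      by (intro ord_geD[where y="\<lambda>_. 0" and f=f and a="\<lambda>_. undefined"]) auto
    then show False using 0(2) by simp
  qed
  then show ?case by simp
next
  case (Suc m)
  obtain G where G: "\<And>x. f x = poly (G x) (x m)" "\<And>j. polyfun m (d - j) (\<lambda>x. coeff (G x) j)"
    "\<And>x. degree (G x) \<le> d" using polyfun_split_last[OF Suc.prems(1)] by blast
  define T where "T = {j. \<exists>x. \<not> \<pi> dvd coeff (G x) j}"
  have "coeff (G x) j = 0" if "j > d" for x j using that G(3)[of x] by (intro coeff_eq_0) simp
  then have T_le: "T \<subseteq> {..d}" unfolding T_def by (force simp: not_less[symmetric])
  have "T \<noteq> {}"
  proof
    assume "T = {}"
    then have "\<pi> dvd coeff (G x) j" for j unfolding T_def by auto
    then have "\<pi> dvd poly (G x) (x m)" unfolding poly_altdef by (intro dvd_sum) auto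
    then show False using Suc.prems(2) G(1) by simp
  qed
  define t where "t = Max T"
  have finT: "finite T" using T_le finite_subset by blast
  have tT: "t \<in> T" unfolding t_def using finT \<open>T \<noteq> {}\<close> by (rule Max_in)
  have t_max: "\<pi> dvd coeff (G x) j" if "j > t" for j x
    using that Max_ge[OF finT, of j] unfolding T_def t_def by force
  have "t \<le> d" using tT T_le by auto
  define g where "g = (\<lambda>x. coeff (G x) t)"
  obtain x0 where x0: "\<not> \<pi> dvd g x0" using tT unfolding T_def g_def by auto
  have gpf: "polyfun m (d - t) g" unfolding g_def by (rule G(2))
  \<comment> \<open>\<open>L a y j\<close> is the restriction of the \<open>j\<close>-th coefficient to the line through \<open>a\<close> in the direction \<open>y\<close>.\<close>
  define L where "L = (\<lambda>a y j. SOME p. \<forall>z. coeff (G (\<lambda>i. a i + z * y i)) j = poly p z)"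
  have L: "coeff (G (\<lambda>i. a i + z * y i)) j = poly (L a y j) z" for a y j z
  proof -
    have "\<exists>p. \<forall>z. coeff (G (\<lambda>i. a i + z * y i)) j = poly p z"
      using polyfun_directional[OF G(2)] by meson
    from someI_ex[OF this] show ?thesis unfolding L_def by blast
  qed
  define v where "v = (\<lambda>a. LEAST s. \<exists>y. \<not> \<pi> dvd coeff (L a y t) s)"
  have vex: "\<exists>s y. \<not> \<pi> dvd coeff (L a y t) s" for a
  proof (rule ccontr)
    assume "\<not> ?thesis"
    then have "\<pi> dvd poly (L a (\<lambda>i. x0 i - a i) t) 1" unfolding poly_altdef by (intro dvd_sum) auto
    then show False using L[of a 1 "\<lambda>i. x0 i - a i" t] x0 by (simp add: g_def)
  qed
  have v1: "\<exists>y. \<not> \<pi> dvd coeff (L a y t) (v a)" for a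
    unfolding v_def using vex[of a] by (rule LeastI_ex)
  have v2: "\<pi> dvd coeff (L a y t) s" if "s < v a" for a y s
    using not_less_Least[OF that[unfolded v_def]] by blast
  have ordg: "ord_ge g a (v a)" for a unfolding ord_ge_def g_def using L v2 by blast
  have IH: "card A * (\<Sum>a\<in>PiE {..<m} (\<lambda>_. A). v a) \<le> (d - t) * card A ^ m"
    by (rule Suc.IH[OF gpf x0]) (rule ordg)
  have line: "(\<Sum>b\<in>A. w (a(m := b))) \<le> t + card A * v a" if a: "a \<in> PiE {..<m} (\<lambda>_. A)" for a
  proof -
    obtain y0 where y0: "\<not> \<pi> dvd coeff (L a y0 t) (v a)" using v1 by blast
    \<comment> \<open>The derivative is taken within the first \<open>m\<close> coordinates, so that the last coordinate is kept.\<close>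
    define y where "y = y0(m := 0)"
    obtain p where p: "\<And>x z. f (\<lambda>i. x i + z * y i) = poly (p x) z" "\<And>x. degree (p x) \<le> d"
      using polyfun_directional[OF Suc.prems(1), of y] by blast
    \<comment> \<open>\<open>\<Gamma> s\<close> is the derivative of order \<open>s\<close> on the line above \<open>a\<close>, as a polynomial in the last variable.\<close>
    define \<Gamma> where "\<Gamma> = (\<lambda>s. \<Sum>j\<le>d. monom (coeff (L a y0 j) s) j)"
    have cG: "coeff (\<Gamma> s) j = (if j \<le> d then coeff (L a y0 j) s else 0)" for s j
      unfolding \<Gamma>_def by (simp add: coeff_sum coeff_monom)
    have ord: "\<pi> dvd coeff (\<Gamma> (v a) \<circ>\<^sub>p [:b, 1:]) r" if "b \<in> A" "r < w (a(m := b)) - v a" for b r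
    proof (rule ord_ge_two_directions[where f=f and m="Suc m" and d=d and a="a(m := b)" and y=y and p=p
            and p'="\<lambda>s. \<Gamma> s \<circ>\<^sub>p [:b, 1:]" and s="v a" and r=r and v="\<lambda>i. if i = m then 1 else 0"])
      show "ord_ge f (a(m := b)) (w (a(m := b)))"
        using a that by (intro Suc.prems(3)) (auto simp: PiE_def extensional_def Pi_def less_Suc_eq)
      show "r + v a < w (a(m := b))" using that by simp
      fix s z
      let ?x = "\<lambda>i. (a(m := b)) i + z * (if i = m then 1 else 0)"
      have "poly (p ?x) \<zeta> = poly (\<Sum>j\<le>d. smult ((b + z) ^ j) (L a y0 j)) \<zeta>" for \<zeta>
      proof -
        have "poly (p ?x) \<zeta> = f (\<lambda>i. ?x i + \<zeta> * y i)" by (rule p(1)[symmetric])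
        also have "\<dots> = poly (G (\<lambda>i. ?x i + \<zeta> * y i)) (b + z)" by (simp add: G(1) y_def)
        also have "\<dots> = (\<Sum>j\<le>d. coeff (G (\<lambda>i. ?x i + \<zeta> * y i)) j * (b + z) ^ j)"
          unfolding poly_altdef by (rule sum.mono_neutral_left) (use G(3) in \<open>auto simp: coeff_eq_0\<close>)
        also have "\<dots> = (\<Sum>j\<le>d. coeff (G (\<lambda>i. a i + \<zeta> * y0 i)) j * (b + z) ^ j)"
          by (intro sum.cong arg_cong2[where f="(*)"] refl polyfun_cong[OF G(2)]) (auto simp: y_def)
        also have "\<dots> = poly (\<Sum>j\<le>d. smult ((b + z) ^ j) (L a y0 j)) \<zeta>"
          by (simp add: L poly_sum mult.commute)
        finally show ?thesis .
      qed
      then have px: "p ?x = (\<Sum>j\<le>d. smult ((b + z) ^ j) (L a y0 j))"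
        by (intro poly_eq_poly_eq_iff[THEN iffD1] ext)
      show "coeff (p ?x) s = poly (\<Gamma> s \<circ>\<^sub>p [:b, 1:]) z"
        unfolding px
        by (simp add: poly_pcompose \<Gamma>_def poly_sum poly_monom coeff_sum mult.commute)
    qed (use Suc.prems p in auto)
    have "(\<Sum>b\<in>A. w (a(m := b)) - v a) \<le> t"
    proof (rule sum_orders_le_degree[OF assms(3,4)])
      show "\<pi> dvd coeff (\<Gamma> (v a)) j" if "j > t" for j
      proof -
        have "\<pi> dvd coeff (L a y0 j) (v a)"
        proof (rule coeffs_vanish)
          show "\<pi> dvd poly (L a y0 j) z" for z unfolding L[symmetric] by (rule t_max[OF that])
        qed
        then show ?thesis by (simp add: cG)
      qed
      show "\<not> \<pi> dvd coeff (\<Gamma> (v a)) t" using y0 \<open>t \<le> d\<close> by (simp add: cG)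
    qed (use ord in auto)
    moreover have "(\<Sum>b\<in>A. w (a(m := b))) \<le> (\<Sum>b\<in>A. (w (a(m := b)) - v a) + v a)"
      by (intro sum_mono) simp
    ultimately show ?thesis by (simp add: sum.distrib)
  qed
  have "(\<Sum>a\<in>PiE {..<Suc m} (\<lambda>_. A). w a) \<le> (\<Sum>a\<in>PiE {..<m} (\<lambda>_. A). t + card A * v a)"
    unfolding sum_PiE_lessThan_Suc by (intro sum_mono line)
  also have "\<dots> = t * card A ^ m + card A * (\<Sum>a\<in>PiE {..<m} (\<lambda>_. A). v a)"
    by (simp add: sum.distrib sum_distrib_left card_PiE mult.commute)
  also have "\<dots> \<le> t * card A ^ m + (d - t) * card A ^ m" using IH by simp
  also have "\<dots> = d * card A ^ m" using \<open>t \<le> d\<close> by (simp flip: add_mult_distrib)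
  finally have "card A * (\<Sum>a\<in>PiE {..<Suc m} (\<lambda>_. A). w a) \<le> card A * (d * card A ^ m)" by simp
  then show ?case by (simp add: algebra_simps)
qed

end

text \<open>
  A homogeneous linear system with more unknowns than equations has a solution that is nontrivial modulo \<open>q\<close>:
  two different vectors with entries in \<open>{0..<q}\<close> have the same image, and their difference is a solution.
\<close>

lemma pigeonhole_linear_system_mod:
  fixes a :: "'i \<Rightarrow> 'j \<Rightarrow> int"
  assumes "finite I" "finite J" "card J < card I" "q > (1::nat)"
  shows "\<exists>c. (\<exists>i\<in>I. \<not> int q dvd c i) \<and> (\<forall>j\<in>J. int q dvd (\<Sum>i\<in>I. c i * a i j))"
proof -
  define A where "A = PiE I (\<lambda>_. {0..<int q})"
  define F where "F = (\<lambda>c. \<lambda>j\<in>J. (\<Sum>i\<in>I. c i * a i j) mod int q)"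
  have "F ` A \<subseteq> PiE J (\<lambda>_. {0..<int q})" using assms(4) by (auto simp: F_def)
  then have "card (F ` A) \<le> card (PiE J (\<lambda>_. {0..<int q}))"
    by (intro card_mono finite_PiE) (use assms in auto)
  also have "\<dots> = q ^ card J" using assms by (simp add: card_PiE)
  also have "\<dots> < q ^ card I" using assms by (intro power_strict_increasing) auto
  also have "\<dots> = card A" unfolding A_def using assms by (simp add: card_PiE)
  finally have "\<not> inj_on F A" by (rule pigeonhole)
  then obtain c d where cd: "c \<in> A" "d \<in> A" "F c = F d" "c \<noteq> d" unfolding inj_on_def by blast
  then obtain i where i: "c i \<noteq> d i" by blast
  have iI: "i \<in> I" using cd(1,2) i unfolding A_def by (metis PiE_arb)
  have "\<not> int q dvd c i - d i"
  proof
    assume "int q dvd c i - d i"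
    moreover have "0 \<le> c i" "c i < int q" "0 \<le> d i" "d i < int q"
      using PiE_mem[OF cd(1)[unfolded A_def] iI] PiE_mem[OF cd(2)[unfolded A_def] iI] by auto
    then have "\<bar>c i - d i\<bar> < int q" by linarith
    ultimately show False using i zdvd_not_zless[of "\<bar>c i - d i\<bar>" "int q"] by auto
  qed
  moreover have "int q dvd (\<Sum>i\<in>I. (c i - d i) * a i j)" if "j \<in> J" for j
  proof -
    have "(\<Sum>i\<in>I. c i * a i j) mod int q = (\<Sum>i\<in>I. d i * a i j) mod int q"
      using fun_cong[OF cd(3), of j] that by (simp add: F_def)
    then have "int q dvd (\<Sum>i\<in>I. c i * a i j) - (\<Sum>i\<in>I. d i * a i j)" by (simp add: mod_eq_dvd_iff)
    then show ?thesis by (simp add: left_diff_distrib sum_subtractf)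
  qed
  ultimately show ?thesis using iI by (intro exI[of _ "\<lambda>i. c i - d i"]) auto
qed

definition exponents :: "nat \<Rightarrow> nat \<Rightarrow> (nat \<Rightarrow> nat) set" where
  "exponents n d = {e \<in> PiE {..<n} (\<lambda>_. {..d}). (\<Sum>i<n. e i) \<le> d}"

lemma finite_exponents [simp]: "finite (exponents n d)"
  unfolding exponents_def by (intro finite_subset[OF _ finite_PiE[of "{..<n}" "\<lambda>_. {..d}"]]) auto

text \<open>
  Adding the slack \<open>d - \<Sum> e\<close> as a last entry turns the exponents into the weak compositions of \<open>d\<close> into
  \<open>n + 1\<close> parts.
\<close>

lemma card_exponents: "card (exponents n d) = (n + d) choose n"
proof -
  have "bij_betw (\<lambda>e. map e [0..<n] @ [d - (\<Sum>i<n. e i)]) (exponents n d)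
          {l::nat list. size l = Suc n \<and> sum_list l = d}"
  proof (rule bij_betw_byWitness[where f'="\<lambda>l. \<lambda>i\<in>{..<n}. l ! i"])
    show "\<forall>a\<in>exponents n d. (\<lambda>i\<in>{..<n}. (map a [0..<n] @ [d - sum a {..<n}]) ! i) = a"
      by (auto simp: exponents_def nth_append PiE_def extensional_def fun_eq_iff)
    have *: "sum_list (map e [0..<n]) = sum e {..<n}" for e :: "nat \<Rightarrow> nat"
      by (simp add: sum_list_distinct_conv_sum_set lessThan_atLeast0)
    have **: "sum_list l = sum ((!) l) {..<n} + l ! n" if "length l = Suc n" for l :: "nat list"
      using that by (simp add: sum_list_sum_nth lessThan_atLeast0)
    show "\<forall>l\<in>{l. length l = Suc n \<and> sum_list l = d}.
       map (\<lambda>i\<in>{..<n}. l ! i) [0..<n] @ [d - sum (\<lambda>i\<in>{..<n}. l ! i) {..<n}] = l"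
      using ** by (auto intro!: nth_equalityI simp: nth_append less_Suc_eq)
    show "(\<lambda>e. map e [0..<n] @ [d - sum e {..<n}]) ` exponents n d
      \<subseteq> {l. length l = Suc n \<and> sum_list l = d}" using * by (auto simp: exponents_def)
    have le: "l ! i \<le> sum ((!) l) {..<n}" if "i < n" for l :: "nat list" and i
      using that by (intro member_le_sum) auto
    show "(\<lambda>l. \<lambda>i\<in>{..<n}. l ! i) ` {l. length l = Suc n \<and> sum_list l = d} \<subseteq> exponents n d"
    proof (intro image_subsetI)
      fix l :: "nat list" assume l: "l \<in> {l. length l = Suc n \<and> sum_list l = d}"
      have "sum ((!) l) {..<n} \<le> d" using l **[of l] by simp
      moreover from this have "l ! i \<le> d" if "i < n" for i using le[OF that, of l] by simp
      ultimately show "(\<lambda>i\<in>{..<n}. l ! i) \<in> exponents n d" by (auto simp: exponents_def)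
    qed
  qed
  then have "card (exponents n d) = card {l::nat list. size l = Suc n \<and> sum_list l = d}"
    by (rule bij_betw_same_card)
  also have "\<dots> = (d + n) choose d" by (simp add: card_length_sum_list)
  finally show ?thesis using binomial_symmetric[of d "d + n"] by (simp add: add.commute)
qed

lemma poly_linear_power_expand:
  fixes x y :: "'a::comm_ring_1"
  assumes "k \<le> d"
  shows "[:x, y:] ^ k = (\<Sum>j\<le>d. smult (of_nat (k choose j) * x ^ (k - j)) (monom (y ^ j) j))"
proof -
  have "[:x, y:] ^ k = (monom y 1 + [:x:]) ^ k" by (simp add: monom_altdef)
  also have "\<dots> = (\<Sum>j\<le>k. of_nat (k choose j) * monom y 1 ^ j * [:x:] ^ (k - j))" by (rule binomial_ring)
  also have "\<dots> = (\<Sum>j\<le>k. smult (of_nat (k choose j) * x ^ (k - j)) (monom (y ^ j) j))"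
    by (intro sum.cong) (simp_all add: monom_power of_nat_poly poly_const_pow smult_monom mult_ac)
  also have "\<dots> = (\<Sum>j\<le>d. smult (of_nat (k choose j) * x ^ (k - j)) (monom (y ^ j) j))"
  proof (rule sum.mono_neutral_left)
    show "\<forall>j\<in>{..d} - {..k}. smult (of_nat (k choose j) * x ^ (k - j)) (monom (y ^ j) j) = 0"
      by (simp add: binomial_eq_0)
  qed (use assms in auto)
  finally show ?thesis .
qed

lemma prod_smult_monom:
  "finite I \<Longrightarrow> (\<Prod>i\<in>I. smult (a i) (monom (b i) (k i))) =
     smult (\<Prod>i\<in>I. a i) (monom (\<Prod>i\<in>I. (b i :: 'a::comm_ring_1)) (\<Sum>i\<in>I. k i))"
  by (induction rule: finite_induct) (auto simp: mult_monom smult_monom mult_ac monom_0)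

text \<open>
  Taylor expansion on the line through \<open>x\<close> in the direction \<open>y\<close>: the coefficient \<open>s\<close> is a combination of the Hasse
  derivatives of order \<open>s\<close> at \<open>x\<close>. So a multiplicity at \<open>x\<close> is forced by linear conditions on the coefficients
  \<open>c e\<close> that do not involve the direction.
\<close>

lemma coeff_line_restriction:
  fixes x y :: "nat \<Rightarrow> 'a::comm_ring_1"
  assumes "E \<subseteq> PiE {..<n} (\<lambda>_. {..d})"
  shows "coeff (\<Sum>e\<in>E. smult (c e) (\<Prod>i<n. [:x i, y i:] ^ e i)) s =
    (\<Sum>\<iota> \<in> {\<iota> \<in> PiE {..<n} (\<lambda>_. {..d}). (\<Sum>i<n. \<iota> i) = s}.
      (\<Sum>e\<in>E. c e * (\<Prod>i<n. of_nat (e i choose \<iota> i) * x i ^ (e i - \<iota> i))) * (\<Prod>i<n. y i ^ \<iota> i))"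
proof -
  let ?I = "PiE {..<n} (\<lambda>_. {..d})"
  have fin: "finite ?I" by (intro finite_PiE) auto
  have "coeff (\<Prod>i<n. [:x i, y i:] ^ e i) s =
     (\<Sum>\<iota> \<in> {\<iota> \<in> ?I. (\<Sum>i<n. \<iota> i) = s}.
       (\<Prod>i<n. of_nat (e i choose \<iota> i) * x i ^ (e i - \<iota> i)) * (\<Prod>i<n. y i ^ \<iota> i))" if "e \<in> E" for e
  proof -
    have "(\<Prod>i<n. [:x i, y i:] ^ e i) =
        (\<Prod>i<n. \<Sum>j\<le>d. smult (of_nat (e i choose j) * x i ^ (e i - j)) (monom (y i ^ j) j))"
      using that assms by (intro prod.cong poly_linear_power_expand) (auto simp: PiE_def Pi_def)
    also have "\<dots> = (\<Sum>\<iota>\<in>?I. \<Prod>i<n. smult (of_nat (e i choose \<iota> i) * x i ^ (e i - \<iota> i)) (monom (y i ^ \<iota> i) (\<iota> i)))"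
      by (rule prod_sum_PiE) auto
    finally show ?thesis using fin
      by (simp add: coeff_sum prod_smult_monom coeff_monom sum.If_cases if_distrib Int_def cong: if_cong)
  qed
  then have "coeff (\<Sum>e\<in>E. smult (c e) (\<Prod>i<n. [:x i, y i:] ^ e i)) s =
     (\<Sum>e\<in>E. \<Sum>\<iota> \<in> {\<iota> \<in> ?I. (\<Sum>i<n. \<iota> i) = s}.
       c e * ((\<Prod>i<n. of_nat (e i choose \<iota> i) * x i ^ (e i - \<iota> i)) * (\<Prod>i<n. y i ^ \<iota> i)))"
    by (simp add: coeff_sum sum_distrib_left)
  also have "\<dots> = (\<Sum>\<iota> \<in> {\<iota> \<in> ?I. (\<Sum>i<n. \<iota> i) = s}. \<Sum>e\<in>E.
       c e * ((\<Prod>i<n. of_nat (e i choose \<iota> i) * x i ^ (e i - \<iota> i)) * (\<Prod>i<n. y i ^ \<iota> i)))"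
    by (rule sum.swap)
  finally show ?thesis by (simp only: sum_distrib_right mult.assoc)
qed

text \<open>
  The top coefficient is multiplicative even over a ring with zero divisors, if top is understood with respect
  to the degree bounds and not the degrees.
\<close>

lemma coeff_prod_linear:
  fixes \<alpha> \<beta> :: "'i \<Rightarrow> 'a::comm_ring_1"
  assumes "finite I"
  shows "coeff (\<Prod>i\<in>I. [:\<alpha> i, \<beta> i:] ^ e i) (\<Sum>i\<in>I. e i) = (\<Prod>i\<in>I. \<beta> i ^ e i) \<and>
         degree (\<Prod>i\<in>I. [:\<alpha> i, \<beta> i:] ^ e i) \<le> (\<Sum>i\<in>I. e i)"
proof -
  have prod_top: "coeff (p * q) (m + n) = coeff p m * coeff q n \<and> degree (p * q) \<le> m + n"
    if "degree p \<le> m" "degree q \<le> n" for p q :: "'a poly" and m n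
  proof -
    have "coeff (p * q) (m + n) = (\<Sum>i\<le>m + n. if i = m then coeff p m * coeff q n else 0)"
      unfolding coeff_mult
    proof (intro sum.cong refl)
      fix i assume "i \<in> {..m + n}"
      show "coeff p i * coeff q (m + n - i) = (if i = m then coeff p m * coeff q n else 0)"
      proof (cases i m rule: linorder_cases)
        case less
        then have "coeff q (m + n - i) = 0" using that by (intro coeff_eq_0) auto
        then show ?thesis using less by simp
      next
        case greater
        then have "coeff p i = 0" using that by (intro coeff_eq_0) auto
        then show ?thesis using greater by simp
      qed simp
    qed
    then show ?thesis using that degree_mult_le[of p q] by simp
  qed
  have pow: "coeff ([:a, b:] ^ k) k = b ^ k \<and> degree ([:a, b:] ^ k) \<le> k" for a b :: 'a and k
  proof (induction k)
    case (Suc k)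
    then show ?case using prod_top[of "[:a,b:]" 1 "[:a,b:] ^ k" k] by simp
  qed simp
  show ?thesis using assms
  proof (induction rule: finite_induct)
    case (insert i I)
    then show ?case using prod_top[of "[:\<alpha> i, \<beta> i:] ^ e i" "e i" "\<Prod>i\<in>I. [:\<alpha> i, \<beta> i:] ^ e i" "\<Sum>i\<in>I. e i"]
       pow[of "\<alpha> i" "\<beta> i" "e i"] by simp
  qed simp
qed

context prime_modulus
begin

lemma polyfun_congruent:
  assumes "polyfun m d f" "\<And>i. i < m \<Longrightarrow> \<pi> dvd x i - y i"
  shows "\<pi> dvd f x - f y"
  using assms(1)
proof (induction rule: polyfun.induct)
  case (add d f g)
  from dvd_add[OF add.IH] have "\<pi> dvd (f x - f y) + (g x - g y)" .
  then show ?case by (simp add: algebra_simps)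
next
  case (mult d f d' g D)
  from dvd_add[OF dvd_mult2[OF mult.IH(1), of "g x"] dvd_mult[OF mult.IH(2), of "f y"]]
  have "\<pi> dvd (f x - f y) * g x + f y * (g x - g y)" .
  then show ?case by (simp add: algebra_simps)
qed (use assms(2) in auto)

lemma ord_ge_congruent:
  assumes "polyfun m d f" "\<And>i. i < m \<Longrightarrow> \<pi> dvd a i - b i" "ord_ge f a w"
  shows "ord_ge f b w"
  unfolding ord_ge_def
proof
  fix y
  obtain p where p: "\<And>x z. f (\<lambda>i. x i + z * y i) = poly (p x) z"
    using polyfun_directional[OF assms(1), of y] by blast
  have "\<pi> dvd coeff (p a - p b) s" for s
  proof (rule coeffs_vanish)
    fix z
    have "\<pi> dvd f (\<lambda>i. a i + z * y i) - f (\<lambda>i. b i + z * y i)"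
      by (rule polyfun_congruent[OF assms(1)]) (use assms(2) in simp)
    then show "\<pi> dvd poly (p a - p b) z" by (simp add: p)
  qed
  moreover have "\<pi> dvd coeff (p a) s" if "s < w" for s
    by (rule ord_geD[OF assms(3) _ that]) (rule p)
  ultimately have "\<pi> dvd coeff (p b) s" if "s < w" for s
    using that by (metis coeff_diff dvd_diff_right_iff)
  then show "\<exists>p. (\<forall>z. f (\<lambda>i. b i + z * y i) = poly p z) \<and> (\<forall>s<w. \<pi> dvd coeff p s)"
    using p by blast
qed

lemma monomials_independent:
  fixes n :: nat
  assumes "\<And>x. \<pi> dvd (\<Sum>e\<in>PiE {..<n} (\<lambda>_. {..d}). c e * (\<Prod>i<n. x i ^ e i))"
    and "e \<in> PiE {..<n} (\<lambda>_. {..d::nat})"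
  shows "\<pi> dvd c e"
  using assms
proof (induction n arbitrary: c e)
  case 0
  then show ?case by simp
next
  case (Suc n)
  have "\<pi> dvd (\<Sum>e\<in>PiE {..<n} (\<lambda>_. {..d}). c (e(n := j)) * (\<Prod>i<n. x i ^ e i))" if "j \<le> d" for j x
  proof -
    define C where "C = (\<Sum>j\<le>d. monom (\<Sum>e\<in>PiE {..<n} (\<lambda>_. {..d}). c (e(n := j)) * (\<Prod>i<n. x i ^ e i)) j)"
    have "\<pi> dvd poly C z" for z
    proof -
      have "(\<Prod>i<n. (if i = n then z else x i) ^ (if i = n then j else e i)) = (\<Prod>i<n. x i ^ e i)" for e j
        by (intro prod.cong) auto
      then have "(\<Sum>e\<in>PiE {..<Suc n} (\<lambda>_. {..d}). c e * (\<Prod>i<Suc n. (x(n := z)) i ^ e i)) =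
         (\<Sum>e\<in>PiE {..<n} (\<lambda>_. {..d}). \<Sum>j\<le>d. c (e(n := j)) * (\<Prod>i<n. x i ^ e i) * z ^ j)"
        unfolding sum_PiE_lessThan_Suc by (simp add: fun_upd_def mult.assoc)
      also have "\<dots> = poly C z" unfolding C_def
        by (subst sum.swap) (simp add: poly_sum poly_monom sum_distrib_right)
      finally show ?thesis using Suc.prems(1)[of "x(n := z)"] by simp
    qed
    then have "\<pi> dvd coeff C j" by (rule coeffs_vanish)
    then show ?thesis using that by (simp add: C_def coeff_sum coeff_monom)
  qed
  note IH = Suc.IH[of "\<lambda>e. c (e(n := j))" for j, OF this]
  have "e n \<le> d" "e(n := undefined) \<in> PiE {..<n} (\<lambda>_. {..d})"
    using Suc.prems(2) by (auto simp: PiE_def Pi_def extensional_def)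
  from IH[OF this] have "\<pi> dvd c ((e(n := undefined))(n := e n))" .
  moreover have "(e(n := undefined))(n := e n) = e" by (simp only: fun_upd_upd fun_upd_triv)
  ultimately show ?case by (simp only:)
qed

end

text \<open>
  Modulo a prime \<open>q\<close> the ring \<open>\<int>[T]\<close> is the polynomial ring over the field with \<open>q\<close> elements. The powers of \<open>T\<close>
  are pairwise incongruent.
\<close>

lemma prime_modulus_int_poly:
  assumes "prime (q::nat)"
  shows "prime_modulus [:int q:]"
proof
  show "prime_elem [:int q:]" using assms by (simp add: prime_elem_const_poly_iff)
  have "\<not> [:int q:] dvd monom 1 i - monom 1 j" if "i \<noteq> j" for i j
  proof
    assume "[:int q:] dvd monom 1 i - monom 1 j"
    then have "int q dvd coeff (monom 1 i - monom 1 j) i" by (simp only: const_poly_dvd_iff)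
    then have "int q dvd 1" using that by (simp add: coeff_monom)
    then show False using assms by simp
  qed
  then show "\<exists>z :: nat \<Rightarrow> int poly. \<forall>i j. i \<noteq> j \<longrightarrow> \<not> [:int q:] dvd z i - z j"
    by (intro exI[of _ "\<lambda>i. monom 1 i"]) blast
qed

lemma const_dvd_of_int: "[:int q:] dvd of_int k \<longleftrightarrow> int q dvd k"
  by (simp add: of_int_poly)

section \<open>An auxiliary polynomial with prescribed multiplicities\<close>

definition zbox :: "nat \<Rightarrow> nat \<Rightarrow> (nat \<Rightarrow> int) set" where
  "zbox n q = PiE {..<n} (\<lambda>_. {0..<int q})"

lemma finite_zbox [simp]: "finite (zbox n q)" unfolding zbox_def by (intro finite_PiE) auto

lemma card_zbox [simp]: "card (zbox n q) = q ^ n" unfolding zbox_def by (simp add: card_PiE)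

lemma polyfun_monomials:
  assumes "finite E" "\<And>e. e \<in> E \<Longrightarrow> c e = 0 \<or> (\<Sum>i<n. e i) \<le> D"
  shows "polyfun n D (\<lambda>x. \<Sum>e\<in>E. c e * (\<Prod>i<n. x i ^ e i))"
proof (rule polyfun_sum[OF assms(1)])
  fix e assume e: "e \<in> E"
  show "polyfun n D (\<lambda>x. c e * (\<Prod>i<n. x i ^ e i))"
  proof (cases "c e = 0")
    case True
    then show ?thesis by (simp add: polyfun.const)
  next
    case False
    have "polyfun n (e i) (\<lambda>x. x i ^ e i)" if "i < n" for i :: nat
      using polyfun_power[OF polyfun.var[OF that, of 0], of "e i"] by simp
    then have "polyfun n (\<Sum>i<n. e i) (\<lambda>x. \<Prod>i<n. x i ^ e i)" by (intro polyfun_prod) auto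
    then have "polyfun n D (\<lambda>x. \<Prod>i<n. x i ^ e i)"
      by (rule polyfun_mono) (use assms(2)[OF e] False in simp)
    from polyfun.mult[OF polyfun.const[of n 0 "c e"] this] show ?thesis by simp
  qed
qed

lemma poly_line_restriction:
  "(\<Sum>e\<in>E. c e * (\<Prod>i<n. (x i + z * y i) ^ e i)) =
    poly (\<Sum>e\<in>E. smult (c e) (\<Prod>i<n. [:x i, y i:] ^ e i)) (z :: 'a::comm_ring_1)"
  by (simp add: poly_sum poly_prod)

lemma exponents_subset: "exponents n d \<subseteq> PiE {..<n} (\<lambda>_. {..d})"
  by (auto simp: exponents_def)

text \<open>
  If the multiplicities \<open>m x\<close> impose fewer conditions than there are monomials of degree at most \<open>d\<close>, there is a
  polynomial with these multiplicities that is nonzero modulo \<open>q\<close>. The coefficients above the degree modulo \<open>q\<close>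
  are divisible by \<open>q\<close>; they are replaced by \<open>0\<close>, so that \<open>D\<close> bounds the degree itself and the form of degree \<open>D\<close> is
  nonzero modulo \<open>q\<close>.
\<close>

theorem exists_vanishing_polynomial:
  fixes m :: "(nat \<Rightarrow> int) \<Rightarrow> nat"
  assumes q: "prime q"
    and count: "(\<Sum>x\<in>zbox n q. if m x = 0 then 0 else (n + (m x - 1)) choose n) < (n + d) choose n"
  obtains c D where "D \<le> d" "\<And>e. e \<in> exponents n d \<Longrightarrow> (\<Sum>i<n. e i) > D \<Longrightarrow> c e = (0::int)"
    "\<exists>e\<in>exponents n d. (\<Sum>i<n. e i) = D \<and> \<not> int q dvd c e"
    "\<And>x. x \<in> zbox n q \<Longrightarrow> prime_modulus.ord_ge [:int q:]
       (\<lambda>X. \<Sum>e\<in>exponents n d. of_int (c e) * (\<Prod>i<n. X i ^ e i)) (\<lambda>i. of_int (x i)) (m x)"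
proof -
  interpret prime_modulus "[:int q:]" by (rule prime_modulus_int_poly[OF q])
  \<comment> \<open>\<open>J\<close> indexes the conditions: all Hasse derivatives of order less than \<open>m x\<close> at \<open>x\<close>.\<close>
  define J where "J = Sigma (zbox n q) (\<lambda>x. if m x = 0 then {} else exponents n (m x - 1))"
  define a where "a = (\<lambda>e (x,\<iota>). \<Prod>i<n. int (e i choose \<iota> i) * x i ^ (e i - \<iota> i))"
  have "card J = (\<Sum>x\<in>zbox n q. card (if m x = 0 then {} else exponents n (m x - 1)))"
    unfolding J_def by (rule card_SigmaI) auto
  also have "\<dots> = (\<Sum>x\<in>zbox n q. if m x = 0 then 0 else (n + (m x - 1)) choose n)"
    by (intro sum.cong) (auto simp: card_exponents)
  finally have "card J < card (exponents n d)" using count by (simp add: card_exponents)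
  moreover have "finite J" unfolding J_def by auto
  ultimately obtain c0 where c0: "\<exists>e\<in>exponents n d. \<not> int q dvd c0 e"
      "\<forall>j\<in>J. int q dvd (\<Sum>e\<in>exponents n d. c0 e * a e j)"
    using pigeonhole_linear_system_mod[of "exponents n d" J q a] prime_gt_1_nat[OF q] by auto
  define T where "T = (\<lambda>e. \<Sum>i<n. e i) ` {e\<in>exponents n d. \<not> int q dvd c0 e}"
  define D where "D = Max T"
  have T: "finite T" "T \<noteq> {}" using c0(1) by (auto simp: T_def)
  define c where "c = (\<lambda>e. if (\<Sum>i<n. e i) > D then 0 else c0 e)"
  have big: "int q dvd c0 e" if "e \<in> exponents n d" "(\<Sum>i<n. e i) > D" for e
  proof (rule ccontr)
    assume "\<not> int q dvd c0 e"
    then have "(\<Sum>i<n. e i) \<in> T" using that(1) unfolding T_def by blast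
    then show False using that(2) Max_ge[OF T(1)] unfolding D_def by (simp add: not_le[symmetric])
  qed
  show thesis
  proof (rule that)
    have "D \<in> T" unfolding D_def using T by (rule Max_in)
    then obtain e where e: "e \<in> exponents n d" "\<not> int q dvd c0 e" "(\<Sum>i<n. e i) = D" unfolding T_def by auto
    then show "D \<le> d" by (auto simp: exponents_def)
    show "\<exists>e\<in>exponents n d. (\<Sum>i<n. e i) = D \<and> \<not> int q dvd c e"
      using e by (intro bexI[of _ e]) (auto simp: c_def)
    show "c e = 0" if "e \<in> exponents n d" "(\<Sum>i<n. e i) > D" for e using that by (simp add: c_def)
    fix x assume x: "x \<in> zbox n q"
    have van: "int q dvd (\<Sum>e\<in>exponents n d. c e * a e (x, \<iota>))"
      if \<iota>: "\<iota> \<in> PiE {..<n} (\<lambda>_. {..d})" "(\<Sum>i<n. \<iota> i) < m x" for \<iota>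
    proof -
      have "\<iota> i \<le> m x - 1" if "i < n" for i
        using member_le_sum[of i "{..<n}" \<iota>] that \<iota>(2) by auto
      then have "(x, \<iota>) \<in> J" unfolding J_def exponents_def using x \<iota> by (auto simp: PiE_def Pi_def)
      then have "int q dvd (\<Sum>e\<in>exponents n d. c0 e * a e (x, \<iota>))" using c0(2) by blast
      moreover have "int q dvd (\<Sum>e\<in>exponents n d. (c0 e - c e) * a e (x, \<iota>))"
        using big by (intro dvd_sum) (auto simp: c_def)
      ultimately have "int q dvd (\<Sum>e\<in>exponents n d. c0 e * a e (x, \<iota>)) - (\<Sum>e\<in>exponents n d. (c0 e - c e) * a e (x, \<iota>))"
        by (rule dvd_diff)
      then show ?thesis by (simp flip: sum_subtractf add: algebra_simps)
    qed
    show "ord_ge (\<lambda>X. \<Sum>e\<in>exponents n d. of_int (c e) * (\<Prod>i<n. X i ^ e i)) (\<lambda>i. of_int (x i)) (m x)"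
      unfolding ord_ge_def
    proof (intro allI exI conjI impI)
      fix y :: "nat \<Rightarrow> int poly" and s
      let ?p = "\<Sum>e\<in>exponents n d. smult (of_int (c e)) (\<Prod>i<n. [:of_int (x i), y i:] ^ e i)"
      show "(\<Sum>e\<in>exponents n d. of_int (c e) * (\<Prod>i<n. (of_int (x i) + z * y i) ^ e i)) = poly ?p z" for z
        by (rule poly_line_restriction)
      assume s: "s < m x"
      have "[:int q:] dvd (\<Sum>e\<in>exponents n d. of_int (c e) *
             (\<Prod>i<n. of_nat (e i choose \<iota> i) * of_int (x i) ^ (e i - \<iota> i)))"
        if "\<iota> \<in> PiE {..<n} (\<lambda>_. {..d})" "(\<Sum>i<n. \<iota> i) = s" for \<iota>
      proof -
        have "[:int q:] dvd of_int (\<Sum>e\<in>exponents n d. c e * a e (x, \<iota>))"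
          unfolding const_dvd_of_int using van that s by auto
        then show ?thesis by (simp add: a_def)
      qed
      then have "[:int q:] dvd (\<Sum>\<iota> \<in> {\<iota> \<in> PiE {..<n} (\<lambda>_. {..d}). (\<Sum>i<n. \<iota> i) = s}.
         (\<Sum>e\<in>exponents n d. of_int (c e) * (\<Prod>i<n. of_nat (e i choose \<iota> i) * of_int (x i) ^ (e i - \<iota> i))) *
         (\<Prod>i<n. y i ^ \<iota> i))"
        by - (rule dvd_sum, rule dvd_mult2, blast)
      then show "[:int q:] dvd coeff ?p s"
        by (simp only: coeff_line_restriction[OF exponents_subset])
    qed
  qed
qed

lemma (in prime_modulus) ord_ge_0: "polyfun m d f \<Longrightarrow> ord_ge f a 0"
  unfolding ord_ge_def using polyfun_directional[of m d f] by (meson not_less_zero)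

section \<open>Kakeya sets with multiplicities\<close>

text \<open>
  Vanishing along a line passes to the point at infinity of the line: if \<open>P\<close> vanishes to order \<open>w\<close> at all points
  \<open>a + Z b\<close>, then the form \<open>H\<close> of top degree vanishes to order \<open>w\<close> at \<open>b\<close>. Indeed, \<open>P (a + Z (b + z y))\<close> is a polynomial
  in \<open>z\<close> and \<open>Z\<close> whose coefficient of \<open>Z\<^sup>D\<close> is \<open>H (b + z y)\<close>.
\<close>

lemma top_form_order:
  fixes P H :: "(nat \<Rightarrow> int poly) \<Rightarrow> int poly" and c :: "(nat \<Rightarrow> nat) \<Rightarrow> int poly"
  assumes q: "prime q" and fin: "finite E"
    and P: "\<And>x. P x = (\<Sum>e\<in>E. c e * (\<Prod>i<n. x i ^ e i))"
    and H: "\<And>x. H x = (\<Sum>e\<in>{e\<in>E. (\<Sum>i<n. e i) = D}. c e * (\<Prod>i<n. x i ^ e i))"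
    and D: "\<And>e. e \<in> E \<Longrightarrow> c e = 0 \<or> (\<Sum>i<n. e i) \<le> D"
    and van: "\<And>Z y p s. (\<And>z. P (\<lambda>i. (a i + Z * b i) + z * y i) = poly p z) \<Longrightarrow> s < w \<Longrightarrow> [:int q:] dvd coeff p s"
  shows "prime_modulus.ord_ge [:int q:] H b w"
proof -
  interpret prime_modulus "[:int q:]" by (rule prime_modulus_int_poly[OF q])
  show ?thesis unfolding ord_ge_def
  proof
    fix y :: "nat \<Rightarrow> int poly"
    define hY where "hY = (\<Sum>e\<in>{e\<in>E. (\<Sum>i<n. e i) = D}. smult (c e) (\<Prod>i<n. [:b i, y i:] ^ e i))"
    \<comment> \<open>A polynomial in \<open>Z\<close> whose coefficients are polynomials in \<open>z\<close>.\<close>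
    define \<Phi> where "\<Phi> = (\<Sum>e\<in>E. smult [:c e:] (\<Prod>i<n. [:[:a i:], [:b i, y i:]:] ^ e i))"
    have top: "coeff \<Phi> D = hY"
    proof -
      have "coeff (smult [:c e:] (\<Prod>i<n. [:[:a i:], [:b i, y i:]:] ^ e i)) D =
          (if (\<Sum>i<n. e i) = D then smult (c e) (\<Prod>i<n. [:b i, y i:] ^ e i) else 0)" if "e \<in> E" for e
      proof -
        note cl = coeff_prod_linear[of "{..<n}" "\<lambda>i. [:a i:]" "\<lambda>i. [:b i, y i:]" e]
        note De = D[OF that]
        consider "(\<Sum>i<n. e i) = D" | "(\<Sum>i<n. e i) < D" | "c e = 0" "(\<Sum>i<n. e i) \<noteq> D"
          using De by (meson linorder_cases not_le)
        then show ?thesis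
        proof cases
          case 1
          then show ?thesis using cl by simp
        next
          case 2
          then have "degree (\<Prod>i<n. [:[:a i:], [:b i, y i:]:] ^ e i) < D" using cl by simp
          then show ?thesis using 2 by (simp add: coeff_eq_0)
        qed auto
      qed
      then have "coeff \<Phi> D = (\<Sum>e\<in>E. if (\<Sum>i<n. e i) = D then smult (c e) (\<Prod>i<n. [:b i, y i:] ^ e i) else 0)"
        unfolding \<Phi>_def coeff_sum by (intro sum.cong) auto
      also have "\<dots> = hY" unfolding hY_def
        by (rule sum.mono_neutral_cong_right) (use fin in auto)
      finally show ?thesis .
    qed
    have "[:int q:] dvd coeff hY s" if "s < w" for s
    proof -
      define C where "C = map_poly (\<lambda>p. coeff p s) \<Phi>"
      have "[:int q:] dvd poly C Z" for Z
      proof -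
        have "P (\<lambda>i. (a i + Z * b i) + z * (Z * y i)) = poly (poly \<Phi> [:Z:]) z" for z
          unfolding P \<Phi>_def by (simp add: poly_sum poly_prod algebra_simps)
        then have "[:int q:] dvd coeff (poly \<Phi> [:Z:]) s" using that by (rule van)
        also have "coeff (poly \<Phi> [:Z:]) s = (\<Sum>r\<le>degree \<Phi>. coeff (coeff \<Phi> r) s * Z ^ r)"
          unfolding poly_altdef by (simp add: coeff_sum poly_const_pow mult.commute)
        also have "\<dots> = (\<Sum>r\<le>degree \<Phi>. coeff C r * Z ^ r)"
          unfolding C_def by (simp add: coeff_map_poly)
        also have "\<dots> = poly C Z"
        proof -
          have "degree C \<le> degree \<Phi>" by (rule degree_le) (simp add: C_def coeff_map_poly coeff_eq_0)
          then show ?thesis unfolding poly_altdef by (intro sum.mono_neutral_right) (auto simp: coeff_eq_0)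
        qed
        finally show ?thesis .
      qed
      then have "[:int q:] dvd coeff C D" by (rule coeffs_vanish)
      then show ?thesis using top by (simp add: C_def coeff_map_poly)
    qed
    moreover have "H (\<lambda>i. b i + z * y i) = poly hY z" for z
      unfolding H hY_def by (rule poly_line_restriction)
    ultimately show "\<exists>p. (\<forall>z. H (\<lambda>i. b i + z * y i) = poly p z) \<and> (\<forall>s<w. [:int q:] dvd coeff p s)" by blast
  qed
qed

text \<open>
  A nonnegative integer weight \<open>m\<close> on the vectors modulo \<open>q\<close> cannot be small if, for at least half of the tuples \<open>u\<close>, it
  has a large sum on some flat \<open>a + span u\<close>. Otherwise there is a polynomial \<open>P\<close> of degree at most \<open>d\<close> with
  multiplicity \<open>m x\<close> at each \<open>x\<close>. A derivative of order \<open>s \<le> j\<close> of \<open>P\<close>, restricted to a rich flat, has more zeros than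
  its degree allows, hence vanishes on the flat modulo \<open>q\<close>, and this also after extending the flat to the points with
  coordinates in \<open>\<int>[T]\<close>. The extended flat contains the line through \<open>a\<close> in the direction \<open>\<Sum> u\<^sub>l T\<^sup>l\<close>. So the
  top form of \<open>P\<close> has multiplicity more than \<open>j\<close> in this direction. As this happens for at least half of the points of a
  grid of side \<open>q\<^sup>k\<close>, the Schwartz--Zippel lemma contradicts \<open>2 * d < (j + 1) * q ^ k\<close>.
\<close>

theorem kakeya_multiplicities:
  fixes m :: "(nat \<Rightarrow> int) \<Rightarrow> nat"
  assumes q: "prime q"
    and per: "\<And>x y. (\<And>i. i < n \<Longrightarrow> int q dvd x i - y i) \<Longrightarrow> m x = m y"
    and U: "U \<subseteq> PiE {..<k} (\<lambda>_. zbox n q)" "q ^ (n * k) \<le> 2 * card U"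
    and rich: "\<And>u. u \<in> U \<Longrightarrow>
       \<exists>a. d * q ^ k + j * q ^ (k + 1) < q * (\<Sum>t\<in>zbox k q. m (\<lambda>i. a i + (\<Sum>l<k. t l * u l i)))"
    and jd: "2 * d < (j + 1) * q ^ k"
  shows "(n + d) choose n \<le> (\<Sum>x\<in>zbox n q. if m x = 0 then 0 else (n + (m x - 1)) choose n)"
proof (rule ccontr)
  assume "\<not> ?thesis"
  then have count: "(\<Sum>x\<in>zbox n q. if m x = 0 then 0 else (n + (m x - 1)) choose n) < (n + d) choose n" by simp
  interpret prime_modulus "[:int q:]" by (rule prime_modulus_int_poly[OF q])
  have q0: "q > 0" using prime_gt_0_nat[OF q] .
  obtain D c where D: "D \<le> d" and c0: "\<And>e. e \<in> exponents n d \<Longrightarrow> (\<Sum>i<n. e i) > D \<Longrightarrow> c e = (0::int)"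
    and cD: "\<exists>e\<in>exponents n d. (\<Sum>i<n. e i) = D \<and> \<not> int q dvd c e"
    and ordP: "\<And>x. x \<in> zbox n q \<Longrightarrow> ord_ge
       (\<lambda>X. \<Sum>e\<in>exponents n d. of_int (c e) * (\<Prod>i<n. X i ^ e i)) (\<lambda>i. of_int (x i)) (m x)"
    by (rule exists_vanishing_polynomial[OF q count]) (rule that, assumption+)
  define P :: "(nat \<Rightarrow> int poly) \<Rightarrow> int poly"
    where "P = (\<lambda>X. \<Sum>e\<in>exponents n d. of_int (c e) * (\<Prod>i<n. X i ^ e i))"
  define H :: "(nat \<Rightarrow> int poly) \<Rightarrow> int poly"
    where "H = (\<lambda>X. \<Sum>e\<in>{e\<in>exponents n d. (\<Sum>i<n. e i) = D}. of_int (c e) * (\<Prod>i<n. X i ^ e i))"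
  have Ppf: "polyfun n D P" unfolding P_def
    by (rule polyfun_monomials) (use c0 in \<open>auto simp: not_le\<close>)
  have Hpf: "polyfun n D H" unfolding H_def
    by (rule polyfun_monomials) auto
  have Hnz: "\<exists>x. \<not> [:int q:] dvd H x"
  proof (rule ccontr)
    assume "\<not> ?thesis"
    moreover have "H x = (\<Sum>e\<in>PiE {..<n} (\<lambda>_. {..d}).
       (if e \<in> exponents n d \<and> (\<Sum>i<n. e i) = D then of_int (c e) else 0) * (\<Prod>i<n. x i ^ e i))" for x
      unfolding H_def by (rule sum.mono_neutral_cong_left) (auto simp: exponents_def intro!: finite_PiE)
    ultimately have *: "[:int q:] dvd (\<Sum>e\<in>PiE {..<n} (\<lambda>_. {..d}).
       (if e \<in> exponents n d \<and> (\<Sum>i<n. e i) = D then of_int (c e) else 0) * (\<Prod>i<n. x i ^ e i))" for x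
      by simp
    obtain e where e: "e \<in> exponents n d" "(\<Sum>i<n. e i) = D" "\<not> int q dvd c e" using cD by blast
    then have "e \<in> PiE {..<n} (\<lambda>_. {..d})" by (simp add: exponents_def)
    from monomials_independent[OF * this] show False using e by (simp add: const_dvd_of_int)
  qed
  have ordP': "ord_ge P (\<lambda>i. of_int (x i)) (m x)" for x :: "nat \<Rightarrow> int"
  proof -
    let ?x = "\<lambda>i\<in>{..<n}. x i mod int q"
    have "?x \<in> zbox n q" using q0 by (auto simp: zbox_def)
    then have "ord_ge P (\<lambda>i. of_int (?x i)) (m ?x)" unfolding P_def by (rule ordP)
    moreover have "m ?x = m x" by (rule per) (simp add: mod_eq_dvd_iff[symmetric])
    moreover have "[:int q:] dvd of_int (?x i) - of_int (x i)" if "i < n" for i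
      using that const_dvd_of_int[of q "?x i - x i"] by (simp add: mod_eq_dvd_iff[symmetric])
    ultimately show ?thesis using ord_ge_congruent[OF Ppf, of "\<lambda>i. of_int (?x i)" "\<lambda>i. of_int (x i)" "m x"] by simp
  qed
  \<comment> \<open>A \<open>k\<close>-tuple of scalars as a polynomial in \<open>T\<close>; the set \<open>A\<close> of these plays the field with \<open>q\<^sup>k\<close> elements.\<close>
  define enc :: "(nat \<Rightarrow> int) \<Rightarrow> int poly" where "enc = (\<lambda>v. \<Sum>l<k. monom (v l) l)"
  have coeff_enc: "coeff (enc v) l = (if l < k then v l else 0)" for v l
    by (simp add: enc_def coeff_sum coeff_monom)
  define A where "A = enc ` zbox k q"
  have small: "x = y" if "int q dvd x - y" "x \<in> {0..<int q}" "y \<in> {0..<int q}" for x y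
    using that by (simp add: mod_eq_dvd_iff[symmetric])
  have box_eqI: "v = v'" if "v \<in> zbox k q" "v' \<in> zbox k q" and dv: "\<And>l. l < k \<Longrightarrow> int q dvd v l - v' l" for v v' k
  proof (rule PiE_ext)
    show v: "v \<in> PiE {..<k} (\<lambda>_. {0..<int q})" "v' \<in> PiE {..<k} (\<lambda>_. {0..<int q})"
      using that by (simp_all add: zbox_def)
    show "v l = v' l" if "l \<in> {..<k}" for l
      by (rule small[OF dv PiE_mem[OF v(1)] PiE_mem[OF v(2)]]) (use that in auto)
  qed
  have enc_inj: "v = v'" if "v \<in> zbox k q" "v' \<in> zbox k q" "[:int q:] dvd enc v - enc v'" for v v'
  proof (rule box_eqI[OF that(1,2)])
    fix l assume "l < k"
    have "int q dvd coeff (enc v - enc v') l" using that(3) by (simp only: const_poly_dvd_iff)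
    then show "int q dvd v l - v' l" using \<open>l < k\<close> by (simp add: coeff_enc)
  qed
  have "inj_on enc (zbox k q)" by (rule inj_onI) (rule enc_inj, auto)
  then have cardA: "card A = q ^ k" unfolding A_def by (simp add: card_image)
  have finA: "finite A" unfolding A_def by simp
  have incA: "incong A" unfolding incong_def A_def using enc_inj by blast
  define pt where "pt = (\<lambda>u. \<lambda>i\<in>{..<n}. enc (\<lambda>l. u l i))"
  have pt_in: "pt u \<in> PiE {..<n} (\<lambda>_. A)" if "u \<in> U" for u
  proof -
    have "enc (\<lambda>l. u l i) \<in> A" if "i < n" for i
    proof -
      have "(\<lambda>l\<in>{..<k}. u l i) \<in> zbox k q" using \<open>u \<in> U\<close> U(1) that by (auto simp: zbox_def PiE_def Pi_def)
      moreover have "enc (\<lambda>l\<in>{..<k}. u l i) = enc (\<lambda>l. u l i)" by (rule poly_eqI) (simp add: coeff_enc)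
      ultimately show ?thesis unfolding A_def by (metis imageI)
    qed
    then show ?thesis by (auto simp: pt_def)
  qed
  have pt_inj: "inj_on pt U"
  proof (rule inj_onI)
    fix u u' assume u: "u \<in> U" "u' \<in> U" "pt u = pt u'"
    show "u = u'"
    proof (rule PiE_ext[of u "{..<k}" _ u'])
      show "u \<in> PiE {..<k} (\<lambda>_. zbox n q)" "u' \<in> PiE {..<k} (\<lambda>_. zbox n q)" using u U by auto
      fix l assume l: "l \<in> {..<k}"
      show "u l = u' l"
      proof (rule box_eqI[of _ n])
        show "u l \<in> zbox n q" "u' l \<in> zbox n q" using u U l by auto
        fix i assume i: "i < n"
        have "enc (\<lambda>l. u l i) = enc (\<lambda>l. u' l i)" using fun_cong[OF u(3), of i] i by (simp add: pt_def)
        then have "coeff (enc (\<lambda>l. u l i)) l = coeff (enc (\<lambda>l. u' l i)) l" by simp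
        then show "int q dvd u l i - u' l i" using l by (simp add: coeff_enc)
      qed
    qed
  qed
  have ordH: "ord_ge H (pt u) (Suc j)" if u: "u \<in> U" for u
  proof -
    obtain a where a: "d * q ^ k + j * q ^ (k + 1) < q * (\<Sum>t\<in>zbox k q. m (\<lambda>i. a i + (\<Sum>l<k. t l * u l i)))"
      using rich[OF u] by blast
    \<comment> \<open>The flat, parametrised by \<open>t\<close> with entries in \<open>\<int>[T]\<close>.\<close>
    define X :: "(nat \<Rightarrow> int poly) \<Rightarrow> nat \<Rightarrow> int poly"
      where "X = (\<lambda>t i. of_int (a i) + (\<Sum>l<k. t l * of_int (u l i)))"
    have Xpf: "polyfun k 1 (\<lambda>t. X t i)" for i
    proof -
      have "polyfun k 1 (\<lambda>t. t l * of_int (u l i))" if "l < k" for l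
        using polyfun.mult[OF polyfun.var[OF that, of 0] polyfun.const[of k 0 "of_int (u l i)"], of 1] by simp
      then have "polyfun k 1 (\<lambda>t. \<Sum>l<k. t l * of_int (u l i))" by (intro polyfun_sum) auto
      from polyfun.add[OF polyfun.const this] show ?thesis by (simp add: X_def)
    qed
    have "ord_ge H (\<lambda>i. enc (\<lambda>l. u l i)) (Suc j)"
    proof (rule top_form_order[OF q, where P=P and E="exponents n d" and c="\<lambda>e. of_int (c e)" and n=n and D=D
          and a="\<lambda>i. of_int (a i)"])
      fix Z y p s
      assume p: "\<And>z. P (\<lambda>i. (of_int (a i) + Z * enc (\<lambda>l. u l i)) + z * y i) = poly p z" and s: "s < Suc j"
      obtain py where py: "\<And>x z. P (\<lambda>i. x i + z * y i) = poly (py x) z"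
          "\<And>s. polyfun n D (\<lambda>x. coeff (py x) s)" "\<And>x. degree (py x) \<le> D"
        using polyfun_directional[OF Ppf, of y] by blast
      \<comment> \<open>A derivative of order \<open>s\<close> of \<open>P\<close>, pulled back to the flat.\<close>
      define h where "h = (\<lambda>t. coeff (py (X t)) s)"
      have hpf: "polyfun k D h" unfolding h_def
        using polyfun_subst[OF py(2), of k "\<lambda>i t. X t i"] Xpf by simp
      \<comment> \<open>On the grid \<open>A0\<close> of constant parameters the multiplicities of \<open>h\<close> have a larger sum than the degree allows.\<close>
      have h0: "[:int q:] dvd h t" for t
      proof (rule ccontr)
        assume nz: "\<not> [:int q:] dvd h t"
        define A0 :: "int poly set" where "A0 = of_int ` {0..<int q}"
        define w where "w = (\<lambda>t. m (\<lambda>i. a i + (\<Sum>l<k. coeff (t l) 0 * u l i)) - s)"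
        have inj0: "inj_on (of_int :: int \<Rightarrow> int poly) {0..<int q}" by (simp add: inj_on_def)
        have card0: "card A0 = q" unfolding A0_def by (simp add: card_image[OF inj0])
        have inc0: "incong A0" unfolding incong_def A0_def
        proof clarify
          fix x y assume xy: "x \<in> {0..<int q}" "y \<in> {0..<int q}" "of_int x \<noteq> (of_int y :: int poly)"
            "[:int q:] dvd of_int x - of_int y"
          then have "int q dvd x - y" using const_dvd_of_int[of q "x - y"] by simp
          then show False using small xy by blast
        qed
        have coeff_of_int: "coeff (of_int z :: int poly) 0 = z" for z by (simp add: of_int_poly)
        have "card A0 * (\<Sum>t\<in>PiE {..<k} (\<lambda>_. A0). w t) \<le> D * card A0 ^ k"
        proof (rule sum_orders_le[OF hpf nz _ inc0])
          show "finite A0" unfolding A0_def by simp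
          fix t assume t: "t \<in> PiE {..<k} (\<lambda>_. A0)"
          define x where "x = (\<lambda>i. a i + (\<Sum>l<k. coeff (t l) 0 * u l i))"
          have tl: "t l = of_int (coeff (t l) 0)" if "l < k" for l
          proof -
            have "t l \<in> A0" using t that by auto
            then obtain z where "t l = of_int z" unfolding A0_def by blast
            then show ?thesis by (simp only: coeff_of_int)
          qed
          have "X t i = of_int (x i)" for i
          proof -
            have "(\<Sum>l<k. t l * of_int (u l i)) = (\<Sum>l<k. of_int (coeff (t l) 0) * of_int (u l i))"
              by (intro sum.cong) (use tl in auto)
            then show ?thesis unfolding X_def x_def by simp
          qed
          then have "X t = (\<lambda>i. of_int (x i))" by (rule ext)
          then have ordX: "ord_ge P (X t) (m x)" using ordP'[of x] by (simp only:)
          show "ord_ge h t (w t)" unfolding ord_ge_def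
          proof
            fix \<eta> :: "nat \<Rightarrow> int poly"
            define v :: "nat \<Rightarrow> int poly" where "v = (\<lambda>i. \<Sum>l<k. \<eta> l * of_int (u l i))"
            define p' where "p' = (\<lambda>s. SOME p. \<forall>z. coeff (py (\<lambda>i. X t i + z * v i)) s = poly p z)"
            have p': "coeff (py (\<lambda>i. X t i + z * v i)) s = poly (p' s) z" for s z
            proof -
              have "\<exists>p. \<forall>z. coeff (py (\<lambda>i. X t i + z * v i)) s = poly p z"
                using polyfun_directional[OF py(2)] by meson
              from someI_ex[OF this] show ?thesis unfolding p'_def by blast
            qed
            have "h (\<lambda>i. t i + z * \<eta> i) = poly (p' s) z" for z
            proof -
              have "X (\<lambda>i. t i + z * \<eta> i) = (\<lambda>i. X t i + z * v i)"
                by (auto simp: X_def v_def algebra_simps sum.distrib sum_distrib_left)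
              then show ?thesis by (simp add: h_def p')
            qed
            moreover have "[:int q:] dvd coeff (p' s) r" if "r < w t" for r
            proof (rule ord_ge_two_directions[OF Ppf ordX py(1,3) p'])
              show "r + s < m x" using that by (simp add: w_def x_def)
            qed
            ultimately show "\<exists>p. (\<forall>z. h (\<lambda>i. t i + z * \<eta> i) = poly p z) \<and> (\<forall>s<w t. [:int q:] dvd coeff p s)"
              by blast
          qed
        qed
        moreover have "(\<Sum>t\<in>PiE {..<k} (\<lambda>_. A0). w t) = (\<Sum>t\<in>zbox k q. m (\<lambda>i. a i + (\<Sum>l<k. t l * u l i)) - s)"
        proof (rule sum.reindex_bij_witness[where i="\<lambda>t. \<lambda>l\<in>{..<k}. of_int (t l)" and j="\<lambda>t. \<lambda>l\<in>{..<k}. coeff (t l) 0"])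
          fix t assume t: "t \<in> PiE {..<k} (\<lambda>_. A0)"
          show "(\<lambda>l\<in>{..<k}. of_int ((\<lambda>l\<in>{..<k}. coeff (t l) 0) l)) = t"
          proof
            fix l show "(\<lambda>l\<in>{..<k}. of_int ((\<lambda>l\<in>{..<k}. coeff (t l) 0) l)) l = t l"
              using t coeff_of_int by (cases "l < k") (force simp: A0_def PiE_def Pi_def extensional_def)+
          qed
          show "(\<lambda>l\<in>{..<k}. coeff (t l) 0) \<in> zbox k q"
            using t coeff_of_int by (force simp: A0_def zbox_def PiE_def Pi_def)
          show "m (\<lambda>i. a i + (\<Sum>l<k. (\<lambda>l\<in>{..<k}. coeff (t l) 0) l * u l i)) - s = w t"
            by (simp add: w_def)
        next
          fix t assume t: "t \<in> zbox k q"
          show "(\<lambda>l\<in>{..<k}. coeff ((\<lambda>l\<in>{..<k}. of_int (t l)) l) 0) = t"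
            using t coeff_of_int by (auto simp: zbox_def PiE_def extensional_def fun_eq_iff)
          show "(\<lambda>l\<in>{..<k}. of_int (t l)) \<in> PiE {..<k} (\<lambda>_. A0)"
            using t by (auto simp: A0_def zbox_def)
        qed
        ultimately have "q * (\<Sum>t\<in>zbox k q. m (\<lambda>i. a i + (\<Sum>l<k. t l * u l i)) - s) \<le> D * q ^ k"
          by (simp add: card0)
        moreover have "(\<Sum>t\<in>zbox k q. m (\<lambda>i. a i + (\<Sum>l<k. t l * u l i))) \<le>
            (\<Sum>t\<in>zbox k q. (m (\<lambda>i. a i + (\<Sum>l<k. t l * u l i)) - s) + s)"
          by (intro sum_mono) simp
        then have "q * (\<Sum>t\<in>zbox k q. m (\<lambda>i. a i + (\<Sum>l<k. t l * u l i))) \<le>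
            q * (\<Sum>t\<in>zbox k q. m (\<lambda>i. a i + (\<Sum>l<k. t l * u l i)) - s) + s * q ^ (k + 1)"
          using q0 by (simp add: sum.distrib algebra_simps flip: distrib_left)
        moreover have "D * q ^ k \<le> d * q ^ k" "s * q ^ (k + 1) \<le> j * q ^ (k + 1)"
          using D s by (auto intro!: mult_right_mono)
        ultimately show False using a by linarith
      qed
      \<comment> \<open>The parameters \<open>t\<^sub>l = Z T\<^sup>l\<close> run through the line in the direction \<open>enc u\<close>.\<close>
      have "X (\<lambda>l. Z * monom 1 l) i = of_int (a i) + Z * enc (\<lambda>l. u l i)" for i
      proof -
        have "Z * monom 1 l * of_int c = Z * monom c l" for l c
          by (simp add: of_int_poly smult_monom flip: mult_smult_right)
        then show ?thesis by (simp only: X_def enc_def sum_distrib_left)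
      qed
      then have "X (\<lambda>l. Z * monom 1 l) = (\<lambda>i. of_int (a i) + Z * enc (\<lambda>l. u l i))" by (rule ext)
      then have "h (\<lambda>l. Z * monom 1 l) = coeff (py (\<lambda>i. of_int (a i) + Z * enc (\<lambda>l. u l i))) s"
        unfolding h_def by (rule arg_cong)
      moreover have "py (\<lambda>i. of_int (a i) + Z * enc (\<lambda>l. u l i)) = p"
      proof (rule poly_eq_poly_eq_iff[THEN iffD1], rule ext)
        fix z
        show "poly (py (\<lambda>i. of_int (a i) + Z * enc (\<lambda>l. u l i))) z = poly p z"
          using p[of z] py(1)[of "\<lambda>i. of_int (a i) + Z * enc (\<lambda>l. u l i)" z] by simp
      qed
      ultimately show "[:int q:] dvd coeff p s" using h0[of "\<lambda>l. Z * monom 1 l"] by simp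
    qed (use c0 in \<open>auto simp: P_def H_def not_le\<close>)
    then show ?thesis
      by (rule ord_ge_congruent[OF Hpf, rotated]) (simp add: pt_def)
  qed
  define w where "w = (\<lambda>p. if p \<in> pt ` U then Suc j else 0)"
  obtain x where "\<not> [:int q:] dvd H x" using Hnz by blast
  then have "card A * (\<Sum>p\<in>PiE {..<n} (\<lambda>_. A). w p) \<le> D * card A ^ n"
  proof (rule sum_orders_le[OF Hpf _ finA incA])
    show "ord_ge H p (w p)" for p
      using ordH ord_ge_0[OF Hpf] by (auto simp: w_def)
  qed
  moreover have "(\<Sum>p\<in>PiE {..<n} (\<lambda>_. A). w p) = Suc j * card U"
  proof -
    have "(\<Sum>p\<in>PiE {..<n} (\<lambda>_. A). w p) = (\<Sum>p\<in>pt ` U. Suc j)"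
      by (rule sum.mono_neutral_cong_right) (use pt_in finA in \<open>auto simp: w_def intro: finite_PiE\<close>)
    then show ?thesis using pt_inj by (simp add: card_image)
  qed
  ultimately have "q ^ k * (Suc j * card U) \<le> d * q ^ (n * k)"
    using D by (simp add: cardA power_mult[symmetric] mult.commute[of n k]) (meson le_trans mult_le_mono1)
  also have "\<dots> \<le> d * (2 * card U)" using U(2) by simp
  finally have "(q ^ k * Suc j) * card U \<le> (2 * d) * card U" by (simp add: algebra_simps)
  moreover have "card U > 0" using U(2) q0 by (metis gr0I mult_0_right not_le zero_less_power)
  ultimately have "q ^ k * Suc j \<le> 2 * d" by simp
  then show False using jd by (simp add: algebra_simps)
qed

section \<open>A maximal inequality and equidistribution on flats\<close>

text \<open>
  In the limit of large multiplicities a point of multiplicity \<open>m\<close> costs about \<open>m\<^sup>n / n!\<close> conditions and a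
  polynomial of degree \<open>d\<close> has about \<open>d\<^sup>n / n!\<close> coefficients. This is the lower bound for the latter.
\<close>

lemma fact_times_binomial_lower: "(d + 1) ^ n \<le> fact n * ((n + d) choose n)"
proof (induction n)
  case (Suc n)
  have "fact (Suc n) * ((Suc n + d) choose Suc n) = fact n * (Suc n * (Suc (n + d) choose Suc n))"
    by (simp add: algebra_simps)
  also have "Suc n * (Suc (n + d) choose Suc n) = Suc (n + d) * ((n + d) choose n)"
    by (rule Suc_times_binomial)
  also have "fact n * (Suc (n + d) * ((n + d) choose n)) = (fact n * ((n + d) choose n)) * Suc (n + d)"
    by (simp only: mult_ac)
  finally have "fact (Suc n) * ((Suc n + d) choose Suc n) = (fact n * ((n + d) choose n)) * Suc (n + d)" .
  moreover have "(d + 1) ^ n * (d + 1) \<le> (fact n * ((n + d) choose n)) * Suc (n + d)"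
    using Suc by (intro mult_mono) auto
  ultimately show ?case by (simp add: mult.commute)
qed simp

text \<open>
  The passage from integer to real weights: apply \<open>kakeya_multiplicities\<close> to the multiplicities \<open>\<lfloor>r w x\<rfloor>\<close>, divide by
  \<open>r\<^sup>n\<close>, and let \<open>r\<close> tend to infinity. If \<open>w\<close> is equal to \<open>\<alpha>\<close> everywhere, the right-hand side is \<open>(\<alpha> q)\<^sup>n\<close>, so the
  inequality is sharp up to the factor \<open>(1 + 2 q / q\<^sup>k)\<^sup>n\<close>.
\<close>

theorem kakeya_maximal:
  fixes w :: "(nat \<Rightarrow> int) \<Rightarrow> real"
  assumes q: "prime q" and \<alpha>: "\<alpha> \<ge> 0"
    and w: "\<And>x. w x \<ge> 0"
    and per: "\<And>x y. (\<And>i. i < n \<Longrightarrow> int q dvd x i - y i) \<Longrightarrow> w x = w y"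
    and U: "U \<subseteq> PiE {..<k} (\<lambda>_. zbox n q)" "q ^ (n * k) \<le> 2 * card U"
    and rich: "\<And>u. u \<in> U \<Longrightarrow> \<exists>a. \<alpha> * real q ^ k \<le> (\<Sum>t\<in>zbox k q. w (\<lambda>i. a i + (\<Sum>l<k. t l * u l i)))"
  shows "(\<alpha> / (1 / real q + 2 / real q ^ k)) ^ n \<le> (\<Sum>x\<in>zbox n q. w x ^ n)"
proof (rule ccontr)
  define S where "S = (\<Sum>x\<in>zbox n q. w x ^ n)"
  define c where "c = 1 / real q + 2 / real q ^ k"
  have q0: "q > 0" using prime_gt_0_nat[OF q] .
  then have c0: "c > 0" unfolding c_def by (intro add_pos_nonneg) auto
  have cq: "c * real q ^ (k + 1) = real q ^ k + 2 * real q" using q0 by (simp add: c_def field_simps)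
  assume "\<not> ?thesis"
  then have less: "S < (\<alpha> / c) ^ n" by (simp add: S_def c_def)
  have S0: "S \<ge> 0" unfolding S_def using w by (intro sum_nonneg) auto
  have "n \<noteq> 0"
  proof
    assume "n = 0"
    then show False using less by (simp add: S_def zbox_def)
  qed
  then have "\<alpha> \<noteq> 0" using less S0 by (auto simp: power_0_left)
  then have \<alpha>0: "\<alpha> > 0" using \<alpha> by simp
  have "((\<lambda>\<epsilon>. ((\<alpha> - \<epsilon>) / c) ^ n) \<longlongrightarrow> ((\<alpha> - 0) / c) ^ n) (at_right 0)"
    by (intro tendsto_intros) (use c0 in auto)
  then have "\<forall>\<^sub>F \<epsilon> in at_right 0. S < ((\<alpha> - \<epsilon>) / c) ^ n"
    using less by (intro order_tendstoD(1)) auto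
  moreover have "\<forall>\<^sub>F \<epsilon> in at_right (0::real). \<epsilon> \<in> {0<..<\<alpha>}" using \<alpha>0 by (rule eventually_at_right_real)
  ultimately have "\<forall>\<^sub>F \<epsilon> in at_right (0::real). S < ((\<alpha> - \<epsilon>) / c) ^ n \<and> \<epsilon> \<in> {0<..<\<alpha>}"
    by eventually_elim simp
  then obtain \<epsilon> where \<epsilon>: "S < ((\<alpha> - \<epsilon>) / c) ^ n" "\<epsilon> > 0" "\<epsilon> < \<alpha>"
    using eventually_happens'[OF trivial_limit_at_right_real] by fastforce
  \<comment> \<open>A little room, \<open>\<epsilon>\<close>, absorbs the rounding to integers; it does not depend on \<open>r\<close>.\<close>
  define \<delta> where "\<delta> = (\<alpha> - \<epsilon>) / c"
  have \<delta>: "\<delta> > 0" "\<delta> * c = \<alpha> - \<epsilon>" using \<epsilon> c0 by (auto simp: \<delta>_def)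
  have main: "\<delta> ^ n \<le> (\<Sum>x\<in>zbox n q. (w x + real n / real r) ^ n)" if r: "real r * \<epsilon> > 1" for r :: nat
  proof -
    have r0: "r > 0" using r by (cases r) auto
    define m where "m = (\<lambda>x. nat \<lfloor>real r * w x\<rfloor>)"
    define d where "d = nat \<lfloor>\<delta> * real r\<rfloor>"
    \<comment> \<open>The least \<open>j\<close> that is admissible for \<open>d\<close>.\<close>
    define j where "j = 2 * d div q ^ k"
    have m_le: "real (m x) \<le> real r * w x" for x using w[of x] by (simp add: m_def)
    have m_ge: "real (m x) \<ge> real r * w x - 1" for x unfolding m_def by linarith
    have d_le: "real d \<le> \<delta> * real r" using \<delta> by (simp add: d_def)
    have d_ge: "\<delta> * real r \<le> real (d + 1)" unfolding d_def by linarith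
    have "(n + d) choose n \<le> (\<Sum>x\<in>zbox n q. if m x = 0 then 0 else (n + (m x - 1)) choose n)"
    proof (rule kakeya_multiplicities[OF q _ U, where d=d and j=j])
      show "m x = m y" if "\<And>i. i < n \<Longrightarrow> int q dvd x i - y i" for x y
        using per[OF that] by (simp add: m_def)
      show "2 * d < (j + 1) * q ^ k" unfolding j_def using q0
        by (metis add.commute dividend_less_times_div mult.commute mult_Suc_right plus_1_eq_Suc zero_less_power)
      fix u assume "u \<in> U"
      from rich[OF this] obtain a where a: "\<alpha> * real q ^ k \<le> (\<Sum>t\<in>zbox k q. w (\<lambda>i. a i + (\<Sum>l<k. t l * u l i)))" by blast
      let ?M = "\<Sum>t\<in>zbox k q. m (\<lambda>i. a i + (\<Sum>l<k. t l * u l i))"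
      have "(\<Sum>t\<in>zbox k q. real r * w (\<lambda>i. a i + (\<Sum>l<k. t l * u l i)) - 1) \<le> real ?M"
        unfolding of_nat_sum by (intro sum_mono m_ge)
      then have "real r * (\<Sum>t\<in>zbox k q. w (\<lambda>i. a i + (\<Sum>l<k. t l * u l i))) - real q ^ k \<le> real ?M"
        by (simp add: sum_subtractf sum_distrib_left)
      moreover have "real r * (\<alpha> * real q ^ k) \<le> real r * (\<Sum>t\<in>zbox k q. w (\<lambda>i. a i + (\<Sum>l<k. t l * u l i)))"
        using a by (intro mult_left_mono) auto
      ultimately have "real r * (\<alpha> * real q ^ k) - real q ^ k \<le> real ?M" by linarith
      then have M: "real q * (real r * (\<alpha> * real q ^ k) - real q ^ k) \<le> real q * real ?M"
        by (intro mult_left_mono) auto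
      have "j * q ^ k \<le> 2 * d" unfolding j_def by (metis div_times_less_eq_dividend)
      then have "j * q ^ k * q \<le> 2 * d * q" by (rule mult_le_mono1)
      then have jj: "real (j * q ^ (k + 1)) \<le> 2 * real d * real q"
        by (metis mult.assoc mult.commute of_nat_le_iff of_nat_mult of_nat_numeral power_add power_one_right)
      have "real d * real q ^ k + 2 * real d * real q = real d * (c * real q ^ (k + 1))"
        unfolding cq by (simp add: algebra_simps)
      also have "\<dots> \<le> (\<delta> * real r) * (c * real q ^ (k + 1))"
        using d_le c0 by (intro mult_right_mono) auto
      also have "\<dots> = (\<delta> * c) * real r * real q ^ (k + 1)" by (simp only: mult_ac)
      also have "\<dots> = (\<alpha> - \<epsilon>) * real r * real q ^ (k + 1)" by (simp only: \<delta>(2))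
      also have "\<dots> < (real r * \<alpha> - 1) * real q ^ (k + 1)"
        using r q0 by (intro mult_strict_right_mono) (auto simp: algebra_simps)
      also have "\<dots> = real q * (real r * (\<alpha> * real q ^ k) - real q ^ k)" by (simp add: algebra_simps)
      also note M
      finally have "real (d * q ^ k + j * q ^ (k + 1)) < real (q * ?M)" using jj by simp
      then show "\<exists>a. d * q ^ k + j * q ^ (k + 1) < q * (\<Sum>t\<in>zbox k q. m (\<lambda>i. a i + (\<Sum>l<k. t l * u l i)))"
        by (intro exI[of _ a]) (simp only: of_nat_less_iff)
    qed
    then have "fact n * ((n + d) choose n) \<le> fact n * (\<Sum>x\<in>zbox n q. if m x = 0 then 0 else (n + (m x - 1)) choose n)"
      by (rule mult_le_mono2)
    also have "\<dots> = (\<Sum>x\<in>zbox n q. fact n * (if m x = 0 then 0 else (n + (m x - 1)) choose n))"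
      by (rule sum_distrib_left)
    also have "\<dots> \<le> (\<Sum>x\<in>zbox n q. (n + m x) ^ n)"
    proof (intro sum_mono)
      fix x
      have "((n + (m x - 1)) choose n) * fact n \<le> (n + (m x - 1)) ^ n" by (rule binomial_fact_pow)
      also have "\<dots> \<le> (n + m x) ^ n" by (intro power_mono) auto
      finally have "fact n * ((n + (m x - 1)) choose n) \<le> (n + m x) ^ n" by (simp only: mult.commute)
      then show "fact n * (if m x = 0 then 0 else (n + (m x - 1)) choose n) \<le> (n + m x) ^ n"
        by (cases "m x = 0") (simp_all only: if_True if_False mult_0_right zero_le simp_thms)
    qed
    finally have *: "(d + 1) ^ n \<le> (\<Sum>x\<in>zbox n q. (n + m x) ^ n)"
      using fact_times_binomial_lower[of d n] by simp
    have "(\<delta> * real r) ^ n \<le> real (d + 1) ^ n" using d_ge \<delta> by (intro power_mono) auto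
    also have "\<dots> \<le> real (\<Sum>x\<in>zbox n q. (n + m x) ^ n)" using * by (metis of_nat_le_iff of_nat_power)
    also have "\<dots> \<le> (\<Sum>x\<in>zbox n q. (real r * (w x + real n / real r)) ^ n)"
      unfolding of_nat_sum of_nat_power using m_le r0 by (intro sum_mono power_mono) (auto simp: algebra_simps)
    also have "\<dots> = real r ^ n * (\<Sum>x\<in>zbox n q. (w x + real n / real r) ^ n)"
      by (simp add: power_mult_distrib sum_distrib_left)
    finally have "real r ^ n * \<delta> ^ n \<le> real r ^ n * (\<Sum>x\<in>zbox n q. (w x + real n / real r) ^ n)"
      by (simp add: power_mult_distrib mult.commute)
    then show ?thesis using r0 by simp
  qed
  have "(\<lambda>r::nat. \<Sum>x\<in>zbox n q. (w x + real n / real r) ^ n) \<longlonglongrightarrow> (\<Sum>x\<in>zbox n q. (w x + 0) ^ n)"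
    by (intro tendsto_intros lim_const_over_n)
  then have lim: "(\<lambda>r::nat. \<Sum>x\<in>zbox n q. (w x + real n / real r) ^ n) \<longlonglongrightarrow> S" by (simp add: S_def)
  obtain N :: nat where N: "real N * \<epsilon> > 1" using reals_Archimedean3[OF \<epsilon>(2)] by blast
  have "\<delta> ^ n \<le> S"
  proof (rule LIMSEQ_le_const[OF lim], intro exI[of _ N] allI impI main)
    fix r assume "N \<le> r"
    then have "real N * \<epsilon> \<le> real r * \<epsilon>" using \<epsilon> by (intro mult_right_mono) auto
    then show "1 < real r * \<epsilon>" using N by linarith
  qed
  then show False using \<epsilon>(1) by (simp add: \<delta>_def)
qed

text \<open>
  The maximal inequality for the weight \<open>1 + v f\<close>, whose \<open>n\<close>-th power is \<open>1 + f ((1 + v)\<^sup>n - 1)\<close> because \<open>f\<close> takes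
  the values \<open>0\<close> and \<open>1\<close> only.
\<close>

lemma kakeya_perturbed_indicator:
  fixes f :: "(nat \<Rightarrow> int) \<Rightarrow> real"
  assumes q: "prime q"
    and f: "\<And>x. f x = 0 \<or> f x = 1"
    and per: "\<And>x y. (\<And>i. i < n \<Longrightarrow> int q dvd x i - y i) \<Longrightarrow> f x = f y"
    and mean: "(\<Sum>x\<in>zbox n q. f x) = \<sigma> * real q ^ n"
    and U: "U \<subseteq> PiE {..<k} (\<lambda>_. zbox n q)" "q ^ (n * k) \<le> 2 * card U"
    and v: "1 + v \<ge> 0" "1 + v * \<beta> \<ge> 0"
    and rich: "\<And>u. u \<in> U \<Longrightarrow> \<exists>a. v * \<beta> * real q ^ k \<le> v * (\<Sum>t\<in>zbox k q. f (\<lambda>i. a i + (\<Sum>l<k. t l * u l i)))"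
    and small: "2 * real q / real q ^ k \<le> 1"
  shows "(1 + v * \<beta>) ^ n * (1 - real n * (2 * real q / real q ^ k)) \<le> 1 + \<sigma> * ((1 + v) ^ n - 1)"
proof -
  define \<kappa> where "\<kappa> = 2 * real q / real q ^ k"
  have q0: "q > 0" using prime_gt_0_nat[OF q] .
  have \<kappa>: "0 \<le> \<kappa>" "\<kappa> \<le> 1" using small by (auto simp: \<kappa>_def)
  have c: "1 / real q + 2 / real q ^ k = (1 + \<kappa>) / real q" using q0 by (simp add: \<kappa>_def field_simps)
  have "((1 + v * \<beta>) / (1 / real q + 2 / real q ^ k)) ^ n \<le> (\<Sum>x\<in>zbox n q. (1 + v * f x) ^ n)"
  proof (rule kakeya_maximal[OF q v(2) _ _ U])
    show "0 \<le> 1 + v * f x" for x using f[of x] v by auto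
    show "1 + v * f x = 1 + v * f y" if "\<And>i. i < n \<Longrightarrow> int q dvd x i - y i" for x y
      using per[OF that] by simp
    fix u assume "u \<in> U"
    from rich[OF this] obtain a where
      "v * \<beta> * real q ^ k \<le> v * (\<Sum>t\<in>zbox k q. f (\<lambda>i. a i + (\<Sum>l<k. t l * u l i)))" by blast
    then show "\<exists>a. (1 + v * \<beta>) * real q ^ k \<le> (\<Sum>t\<in>zbox k q. 1 + v * f (\<lambda>i. a i + (\<Sum>l<k. t l * u l i)))"
      by (intro exI[of _ a]) (simp add: sum.distrib sum_distrib_left algebra_simps)
  qed
  also have "(\<Sum>x\<in>zbox n q. (1 + v * f x) ^ n) = (\<Sum>x\<in>zbox n q. 1 + f x * ((1 + v) ^ n - 1))"
  proof (intro sum.cong refl)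
    show "(1 + v * f x) ^ n = 1 + f x * ((1 + v) ^ n - 1)" for x using f[of x] by auto
  qed
  also have "\<dots> = real q ^ n * (1 + \<sigma> * ((1 + v) ^ n - 1))"
    by (simp only: sum.distrib sum_distrib_right[symmetric] mean) (simp add: algebra_simps)
  also have "((1 + v * \<beta>) / (1 / real q + 2 / real q ^ k)) ^ n = real q ^ n * ((1 + v * \<beta>) * (1 / (1 + \<kappa>))) ^ n"
    unfolding c power_mult_distrib[symmetric] by (simp add: mult.commute)
  finally have "((1 + v * \<beta>) * (1 / (1 + \<kappa>))) ^ n \<le> 1 + \<sigma> * ((1 + v) ^ n - 1)"
    using q0 by simp
  moreover have "1 - real n * \<kappa> \<le> (1 / (1 + \<kappa>)) ^ n"
  proof -
    have "1 + real n * (- \<kappa>) \<le> (1 + (- \<kappa>)) ^ n" using \<kappa> by (intro Bernoulli_inequality) auto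
    also have "\<dots> \<le> (1 / (1 + \<kappa>)) ^ n"
    proof (intro power_mono)
      have "(1 + - \<kappa>) * (1 + \<kappa>) \<le> 1" by (simp add: algebra_simps)
      then show "1 + - \<kappa> \<le> 1 / (1 + \<kappa>)" using \<kappa> by (simp add: pos_le_divide_eq)
    qed (use \<kappa> in auto)
    finally show ?thesis by simp
  qed
  then have "(1 + v * \<beta>) ^ n * (1 - real n * \<kappa>) \<le> (1 + v * \<beta>) ^ n * (1 / (1 + \<kappa>)) ^ n"
    using v by (intro mult_left_mono) auto
  ultimately have "(1 + v * \<beta>) ^ n * (1 - real n * \<kappa>) \<le> 1 + \<sigma> * ((1 + v) ^ n - 1)"
    unfolding power_mult_distrib by linarith
  then show ?thesis unfolding \<kappa>_def .
qed

text \<open>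
  The weight \<open>1 + v f\<close> with \<open>v = \<epsilon> / (2 n)\<close>. By the maximal inequality, an excess of \<open>\<epsilon> \<sigma>\<close> over the mean on the
  flats contributes \<open>\<sigma> \<epsilon>\<^sup>2 / 2\<close> to the left-hand side. The quadratic term of \<open>(1 + v)\<^sup>n\<close> can account for \<open>\<sigma> \<epsilon>\<^sup>2 / 4\<close>
  only, and by hypothesis the loss in the maximal inequality, at most \<open>4 n q / q\<^sup>k\<close>, is less than the remaining \<open>\<sigma> \<epsilon>\<^sup>2 / 4\<close>.
\<close>

lemma kakeya_upper_tail:
  fixes f :: "(nat \<Rightarrow> int) \<Rightarrow> real"
  assumes q: "prime q" and n: "n \<ge> 1" and \<epsilon>: "0 < \<epsilon>" "\<epsilon> \<le> 1"
    and f: "\<And>x. f x = 0 \<or> f x = 1"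
    and per: "\<And>x y. (\<And>i. i < n \<Longrightarrow> int q dvd x i - y i) \<Longrightarrow> f x = f y"
    and mean: "(\<Sum>x\<in>zbox n q. f x) = \<sigma> * real q ^ n"
    and U: "U \<subseteq> PiE {..<k} (\<lambda>_. zbox n q)" "q ^ (n * k) \<le> 2 * card U"
    and large: "16 * real n * real q / \<epsilon>\<^sup>2 < \<sigma> * real q ^ k"
    and rich: "\<And>u. u \<in> U \<Longrightarrow> \<exists>a. (1 + \<epsilon>) * \<sigma> * real q ^ k < (\<Sum>t\<in>zbox k q. f (\<lambda>i. a i + (\<Sum>l<k. t l * u l i)))"
  shows False
proof -
  have q0: "q > 0" using prime_gt_0_nat[OF q] .
  define s where "s = \<epsilon> / 2"
  define v where "v = s / real n"
  define \<kappa> where "\<kappa> = 2 * real q / real q ^ k"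
  have "0 \<le> f x" "f x \<le> 1" for x using f[of x] by auto
  then have "0 \<le> (\<Sum>x\<in>zbox n q. f x)" "(\<Sum>x\<in>zbox n q. f x) \<le> (\<Sum>x\<in>zbox n q. 1)"
    by (simp_all only: sum_nonneg sum_mono)
  moreover have "\<sigma> = (\<Sum>x\<in>zbox n q. f x) / real q ^ n" using mean q0 by simp
  ultimately have \<sigma>: "0 \<le> \<sigma>" "\<sigma> \<le> 1" using q0 by (simp_all add: pos_divide_le_eq)
  have n\<kappa>: "real n * \<kappa> < \<sigma> * \<epsilon>\<^sup>2 / 8"
    using large q0 \<epsilon> by (simp add: \<kappa>_def field_simps)
  have "\<epsilon>\<^sup>2 \<le> 1" using \<epsilon> by (simp add: power_le_one)
  then have "\<sigma> * \<epsilon>\<^sup>2 \<le> 1 * 1" using \<sigma> by (intro mult_mono) auto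
  moreover have "1 * \<kappa> \<le> real n * \<kappa>" using n by (intro mult_right_mono) (auto simp: \<kappa>_def)
  ultimately have \<kappa>1: "\<kappa> \<le> 1" using n\<kappa> by linarith
  have v0: "v > 0" "real n * v = s" using n \<epsilon> by (auto simp: v_def s_def)
  have "(1 + v * ((1 + \<epsilon>) * \<sigma>)) ^ n * (1 - real n * (2 * real q / real q ^ k)) \<le> 1 + \<sigma> * ((1 + v) ^ n - 1)"
  proof (rule kakeya_perturbed_indicator[OF q f per mean U])
    show "0 \<le> 1 + v * ((1 + \<epsilon>) * \<sigma>)" using v0 \<epsilon> \<sigma> by simp
    show "\<exists>a. v * ((1 + \<epsilon>) * \<sigma>) * real q ^ k \<le> v * (\<Sum>t\<in>zbox k q. f (\<lambda>i. a i + (\<Sum>l<k. t l * u l i)))"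
      if u: "u \<in> U" for u
    proof -
      obtain a where "(1 + \<epsilon>) * \<sigma> * real q ^ k < (\<Sum>t\<in>zbox k q. f (\<lambda>i. a i + (\<Sum>l<k. t l * u l i)))"
        using rich[OF u] by blast
      then show ?thesis using v0(1) by (intro exI[of _ a]) (simp add: mult.assoc)
    qed
    show "2 * real q / real q ^ k \<le> 1" using \<kappa>1 by (simp add: \<kappa>_def)
  qed (use v0 in auto)
  then have A: "(1 + v * ((1 + \<epsilon>) * \<sigma>)) ^ n * (1 - real n * \<kappa>) \<le> 1 + \<sigma> * ((1 + v) ^ n - 1)" by (simp add: \<kappa>_def)
  have "(1 + s / real n) ^ n \<le> exp s" using n \<epsilon> by (intro exp_ge_one_plus_x_over_n_power_n) (auto simp: s_def)
  also have "\<dots> \<le> 1 + s + s\<^sup>2" using \<epsilon> by (intro exp_bound) (auto simp: s_def)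
  finally have "(1 + v) ^ n - 1 \<le> s + s\<^sup>2" by (simp add: v_def)
  then have B: "\<sigma> * ((1 + v) ^ n - 1) \<le> \<sigma> * (s + s\<^sup>2)" using \<sigma>(1) by (intro mult_left_mono)
  have vp: "0 \<le> v * ((1 + \<epsilon>) * \<sigma>)" using v0 \<epsilon> \<sigma> by simp
  have "1 + real n * (v * ((1 + \<epsilon>) * \<sigma>)) \<le> (1 + v * ((1 + \<epsilon>) * \<sigma>)) ^ n"
    by (intro Bernoulli_inequality) (use vp in linarith)
  moreover have "real n * (v * ((1 + \<epsilon>) * \<sigma>)) = s * ((1 + \<epsilon>) * \<sigma>)" using v0(2) by (metis mult.assoc)
  ultimately have "1 + s * ((1 + \<epsilon>) * \<sigma>) \<le> (1 + v * ((1 + \<epsilon>) * \<sigma>)) ^ n" by simp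
  moreover have "0 \<le> 1 - real n * \<kappa>" using n\<kappa> \<open>\<sigma> * \<epsilon>\<^sup>2 \<le> 1 * 1\<close> by linarith
  ultimately have C: "(1 + s * ((1 + \<epsilon>) * \<sigma>)) * (1 - real n * \<kappa>) \<le> (1 + v * ((1 + \<epsilon>) * \<sigma>)) ^ n * (1 - real n * \<kappa>)"
    by (rule mult_right_mono)
  have "s * ((1 + \<epsilon>) * \<sigma>) \<le> (1/2) * (2 * 1)" using \<epsilon> \<sigma> unfolding s_def by (intro mult_mono) auto
  moreover have nk0: "0 \<le> real n * \<kappa>" by (simp add: \<kappa>_def)
  ultimately have "s * ((1 + \<epsilon>) * \<sigma>) * (real n * \<kappa>) \<le> 1 * (real n * \<kappa>)" by (intro mult_right_mono) auto
  then have "1 + s * ((1 + \<epsilon>) * \<sigma>) - 2 * (real n * \<kappa>) \<le> 1 + \<sigma> * (s + s\<^sup>2)"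
    using A B C by (simp add: algebra_simps)
  then have "\<sigma> * (s * \<epsilon> - s\<^sup>2) \<le> 2 * (real n * \<kappa>)" by (simp add: algebra_simps)
  moreover have "s * \<epsilon> - s\<^sup>2 = \<epsilon>\<^sup>2 / 4" by (simp add: s_def power2_eq_square field_simps)
  ultimately show False using n\<kappa> by simp
qed

text \<open>
  The same computation with \<open>v = - \<epsilon> / (2 n)\<close>.
\<close>

lemma kakeya_lower_tail:
  fixes f :: "(nat \<Rightarrow> int) \<Rightarrow> real"
  assumes q: "prime q" and n: "n \<ge> 1" and \<epsilon>: "0 < \<epsilon>" "\<epsilon> \<le> 1"
    and f: "\<And>x. f x = 0 \<or> f x = 1"
    and per: "\<And>x y. (\<And>i. i < n \<Longrightarrow> int q dvd x i - y i) \<Longrightarrow> f x = f y"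
    and mean: "(\<Sum>x\<in>zbox n q. f x) = \<sigma> * real q ^ n"
    and U: "U \<subseteq> PiE {..<k} (\<lambda>_. zbox n q)" "q ^ (n * k) \<le> 2 * card U"
    and large: "16 * real n * real q / \<epsilon>\<^sup>2 < \<sigma> * real q ^ k"
    and rich: "\<And>u. u \<in> U \<Longrightarrow> \<exists>a. (\<Sum>t\<in>zbox k q. f (\<lambda>i. a i + (\<Sum>l<k. t l * u l i))) < (1 - \<epsilon>) * \<sigma> * real q ^ k"
  shows False
proof -
  have q0: "q > 0" using prime_gt_0_nat[OF q] .
  define s where "s = \<epsilon> / 2"
  define v where "v = s / real n"
  define \<kappa> where "\<kappa> = 2 * real q / real q ^ k"
  have "0 \<le> f x" "f x \<le> 1" for x using f[of x] by auto
  then have "0 \<le> (\<Sum>x\<in>zbox n q. f x)" "(\<Sum>x\<in>zbox n q. f x) \<le> (\<Sum>x\<in>zbox n q. 1)"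
    by (simp_all only: sum_nonneg sum_mono)
  moreover have "\<sigma> = (\<Sum>x\<in>zbox n q. f x) / real q ^ n" using mean q0 by simp
  ultimately have \<sigma>: "0 \<le> \<sigma>" "\<sigma> \<le> 1" using q0 by (simp_all add: pos_divide_le_eq)
  have n\<kappa>: "real n * \<kappa> < \<sigma> * \<epsilon>\<^sup>2 / 8"
    using large q0 \<epsilon> by (simp add: \<kappa>_def field_simps)
  have "\<epsilon>\<^sup>2 \<le> 1" using \<epsilon> by (simp add: power_le_one)
  then have "\<sigma> * \<epsilon>\<^sup>2 \<le> 1 * 1" using \<sigma> by (intro mult_mono) auto
  moreover have "1 * \<kappa> \<le> real n * \<kappa>" using n by (intro mult_right_mono) (auto simp: \<kappa>_def)
  ultimately have \<kappa>1: "\<kappa> \<le> 1" using n\<kappa> by linarith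
  have v0: "v > 0" "real n * v = s" using n \<epsilon> by (auto simp: v_def s_def)
  have "v \<le> s / 1" unfolding v_def using n \<epsilon> by (intro divide_left_mono) (auto simp: s_def)
  then have v1: "v \<le> 1/2" using \<epsilon> by (simp add: s_def)
  have "(1 - \<epsilon>) * \<sigma> \<le> 1 * 1" using \<epsilon> \<sigma> by (intro mult_mono) auto
  then have "v * ((1 - \<epsilon>) * \<sigma>) \<le> (1/2) * 1" using v0 v1 \<epsilon> \<sigma> by (intro mult_mono) auto
  then have vp: "-1 \<le> (- v) * ((1 - \<epsilon>) * \<sigma>)" by simp
  have "(1 + (- v) * ((1 - \<epsilon>) * \<sigma>)) ^ n * (1 - real n * (2 * real q / real q ^ k)) \<le> 1 + \<sigma> * ((1 + (- v)) ^ n - 1)"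
  proof (rule kakeya_perturbed_indicator[OF q f per mean U])
    show "0 \<le> 1 + (- v) * ((1 - \<epsilon>) * \<sigma>)" using vp by linarith
    show "\<exists>a. (- v) * ((1 - \<epsilon>) * \<sigma>) * real q ^ k \<le> (- v) * (\<Sum>t\<in>zbox k q. f (\<lambda>i. a i + (\<Sum>l<k. t l * u l i)))"
      if u: "u \<in> U" for u
    proof -
      obtain a where "(\<Sum>t\<in>zbox k q. f (\<lambda>i. a i + (\<Sum>l<k. t l * u l i))) < (1 - \<epsilon>) * \<sigma> * real q ^ k"
        using rich[OF u] by blast
      then show ?thesis using v0(1) by (intro exI[of _ a]) (simp add: mult.assoc)
    qed
    show "2 * real q / real q ^ k \<le> 1" using \<kappa>1 by (simp add: \<kappa>_def)
  qed (use v0 v1 in auto)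
  then have A: "(1 + (- v) * ((1 - \<epsilon>) * \<sigma>)) ^ n * (1 - real n * \<kappa>) \<le> 1 + \<sigma> * ((1 + (- v)) ^ n - 1)" by (simp add: \<kappa>_def)
  have s0: "0 < s" "s \<le> 1/2" using \<epsilon> by (auto simp: s_def)
  have "(1 - v) ^ n \<le> exp (- v) ^ n" using exp_ge_add_one_self[of "- v"] v1 by (intro power_mono) auto
  also have "\<dots> = exp (- s)" using v0(2) by (simp flip: exp_of_nat_mult)
  also have "\<dots> = 1 / exp s" by (simp add: exp_minus divide_inverse)
  also have "\<dots> \<le> 1 / (1 + s)" using s0 by (intro divide_left_mono exp_ge_add_one_self) (auto intro: add_pos_pos)
  also have "\<dots> \<le> 1 - s + s\<^sup>2"
  proof -
    have "1 \<le> (1 - s + s\<^sup>2) * (1 + s)" using s0 by (simp add: algebra_simps power2_eq_square)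
    then show ?thesis using s0 by (simp add: pos_divide_le_eq)
  qed
  finally have "(1 + (- v)) ^ n - 1 \<le> - s + s\<^sup>2" by simp
  then have B: "\<sigma> * ((1 + (- v)) ^ n - 1) \<le> \<sigma> * (- s + s\<^sup>2)" using \<sigma>(1) by (intro mult_left_mono)
  have "1 + real n * ((- v) * ((1 - \<epsilon>) * \<sigma>)) \<le> (1 + (- v) * ((1 - \<epsilon>) * \<sigma>)) ^ n"
    by (intro Bernoulli_inequality vp)
  moreover have "real n * ((- v) * ((1 - \<epsilon>) * \<sigma>)) = - (s * ((1 - \<epsilon>) * \<sigma>))"
    unfolding v0(2)[symmetric] by (simp add: algebra_simps)
  ultimately have "1 - s * ((1 - \<epsilon>) * \<sigma>) \<le> (1 + (- v) * ((1 - \<epsilon>) * \<sigma>)) ^ n" by linarith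
  moreover have "0 \<le> 1 - real n * \<kappa>" using n\<kappa> \<open>\<sigma> * \<epsilon>\<^sup>2 \<le> 1 * 1\<close> by linarith
  ultimately have C: "(1 - s * ((1 - \<epsilon>) * \<sigma>)) * (1 - real n * \<kappa>) \<le> (1 + (- v) * ((1 - \<epsilon>) * \<sigma>)) ^ n * (1 - real n * \<kappa>)"
    by (rule mult_right_mono)
  have "0 \<le> s * ((1 - \<epsilon>) * \<sigma>) * (real n * \<kappa>)" using s0 \<epsilon> \<sigma> by (simp add: \<kappa>_def)
  then have "1 - s * ((1 - \<epsilon>) * \<sigma>) - real n * \<kappa> \<le> 1 + \<sigma> * (- s + s\<^sup>2)"
    using A B C by (simp add: algebra_simps)
  then have "\<sigma> * (s * \<epsilon> - s\<^sup>2) \<le> real n * \<kappa>" by (simp add: algebra_simps)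
  moreover have "s * \<epsilon> - s\<^sup>2 = \<epsilon>\<^sup>2 / 4" by (simp add: s_def power2_eq_square field_simps)
  moreover have "\<sigma> * \<epsilon>\<^sup>2 \<ge> 0" using \<sigma> by simp
  ultimately show False using n\<kappa> by simp
qed

text \<open>
  If no tuple is good for both functions, then at least half of all tuples are bad for \<open>f\<close> or at least half
  are bad for \<open>g\<close>, and one of the two tail estimates applies.
\<close>

theorem two_sided_equidistribution:
  fixes f g :: "(nat \<Rightarrow> int) \<Rightarrow> real"
  assumes q: "prime q" and n: "n \<ge> 1" and \<epsilon>: "0 < \<epsilon>" "\<epsilon> \<le> 1"
    and f: "\<And>x. f x = 0 \<or> f x = 1"
    and perf: "\<And>x y. (\<And>i. i < n \<Longrightarrow> int q dvd x i - y i) \<Longrightarrow> f x = f y"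
    and meanf: "(\<Sum>x\<in>zbox n q. f x) = \<sigma> * real q ^ n"
    and largef: "16 * real n * real q / \<epsilon>\<^sup>2 < \<sigma> * real q ^ k"
    and g: "\<And>x. g x = 0 \<or> g x = 1"
    and perg: "\<And>x y. (\<And>i. i < n \<Longrightarrow> int q dvd x i - y i) \<Longrightarrow> g x = g y"
    and meang: "(\<Sum>x\<in>zbox n q. g x) = \<tau> * real q ^ n"
    and largeg: "16 * real n * real q / \<epsilon>\<^sup>2 < \<tau> * real q ^ k"
  shows "\<exists>u. \<forall>a. (1 - \<epsilon>) * \<sigma> * real q ^ k \<le> (\<Sum>t\<in>zbox k q. f (\<lambda>i. a i + (\<Sum>l<k. t l * u l i))) \<and>
                 (\<Sum>t\<in>zbox k q. g (\<lambda>i. a i + (\<Sum>l<k. t l * u l i))) \<le> (1 + \<epsilon>) * \<tau> * real q ^ k"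
proof (rule ccontr)
  assume contra: "\<not> ?thesis"
  define T where "T = PiE {..<k} (\<lambda>_. zbox n q)"
  define A where "A = {u\<in>T. \<exists>a. (\<Sum>t\<in>zbox k q. f (\<lambda>i. a i + (\<Sum>l<k. t l * u l i))) < (1 - \<epsilon>) * \<sigma> * real q ^ k}"
  define B where "B = {u\<in>T. \<exists>a. (1 + \<epsilon>) * \<tau> * real q ^ k < (\<Sum>t\<in>zbox k q. g (\<lambda>i. a i + (\<Sum>l<k. t l * u l i)))}"
  have finT: "finite T" unfolding T_def by (intro finite_PiE) auto
  have cardT: "card T = q ^ (n * k)" unfolding T_def by (simp add: card_PiE power_mult)
  have "T \<subseteq> A \<union> B" unfolding A_def B_def using contra by (force simp: not_le)
  then have "card T \<le> card (A \<union> B)" using finT by (intro card_mono) (auto simp: A_def B_def)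
  also have "\<dots> \<le> card A + card B" by (rule card_Un_le)
  finally consider "q ^ (n * k) \<le> 2 * card A" | "q ^ (n * k) \<le> 2 * card B"
    unfolding cardT by linarith
  then show False
  proof cases
    case 1
    then show ?thesis
      by (intro kakeya_lower_tail[OF q n \<epsilon> f perf meanf _ _ largef, of A]) (auto simp: A_def T_def)
  next
    case 2
    then show ?thesis
      by (intro kakeya_upper_tail[OF q n \<epsilon> g perg meang _ _ largeg, of B]) (auto simp: B_def T_def)
  qed
qed

section \<open>A weak form of Bertrand's postulate\<close>

text \<open>
  A common multiple of \<open>1, \<dots>, N\<close> is a multiple of every entry of the Leibniz harmonic triangle. Induction along the recursion
  \<open>1 / ((k + 1) (n choose k + 1)) = 1 / (k (n - 1 choose k)) - 1 / (k (n choose k))\<close> between the reciprocals of the entries.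
\<close>

lemma mult_binomial_dvd:
  fixes D N :: nat
  assumes "\<And>m. 1 \<le> m \<Longrightarrow> m \<le> N \<Longrightarrow> m dvd D" "1 \<le> k" "k \<le> n" "n \<le> N"
  shows "k * (n choose k) dvd D"
  using assms(2-4)
proof (induction k arbitrary: n rule: dec_induct)
  case base
  then show ?case using assms(1)[of n] by simp
next
  case (step k)
  define m where "m = n - 1"
  have n: "n = Suc m" and km: "k \<le> m" and k0: "k \<ge> 1" using step unfolding m_def by auto
  obtain a where a: "D = k * (m choose k) * a" using step.IH[of m] km step.prems n by (auto elim: dvdE)
  obtain b where b: "D = k * (n choose k) * b" using step.IH[of n] step.prems by (auto elim: dvdE)
  have pos: "real (m choose k) > 0" "real k > 0" using km k0 by auto
  have "(Suc m - k) * (Suc m choose k) = Suc m * (m choose k)"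
    using binomial_absorb_comp[of "Suc m" k] by simp
  then have c: "(real (Suc m) - real k) * real (Suc m choose k) = real (Suc m) * real (m choose k)"
  proof -
    assume "(Suc m - k) * (Suc m choose k) = Suc m * (m choose k)"
    then have "real ((Suc m - k) * (Suc m choose k)) = real (Suc m * (m choose k))" by (simp only:)
    then show ?thesis by (simp only: of_nat_mult of_nat_diff[OF le_SucI[OF km]])
  qed
  have "Suc k * (n choose Suc k) = Suc m * (m choose k)" unfolding n by (rule Suc_times_binomial)
  moreover have "real D = real (Suc m * (m choose k)) * (real a - real b)"
  proof -
    have "real D * real k = real (Suc m) * real D - (real (Suc m) - real k) * real D" by (simp add: algebra_simps)
    also have "\<dots> = real (Suc m) * real (k * (m choose k) * a) - (real (Suc m) - real k) * real (k * (n choose k) * b)"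
      by (simp only: a[symmetric] b[symmetric])
    also have "\<dots> = real k * (real (Suc m) * real (m choose k) * real a - ((real (Suc m) - real k) * real (Suc m choose k)) * real b)"
      unfolding n by (simp add: algebra_simps)
    also have "\<dots> = real k * (real (Suc m * (m choose k)) * (real a - real b))"
      unfolding c by (simp add: algebra_simps)
    finally show ?thesis using pos by simp
  qed
  ultimately have "real D = real (Suc k * (n choose Suc k)) * (real a - real b)" by (simp only:)
  then have "real_of_int (int D) = real_of_int (int (Suc k * (n choose Suc k)) * (int a - int b))"
    by (simp only: of_int_mult of_int_diff of_int_of_nat_eq)
  then have "int D = int (Suc k * (n choose Suc k)) * (int a - int b)" by (simp only: of_int_eq_iff)
  then have "int (Suc k * (n choose Suc k)) dvd int D" by simp
  then show ?case by (simp only: int_dvd_int_iff)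
qed

definition primorial :: "nat \<Rightarrow> nat" where "primorial n = (\<Prod>p\<in>{p. prime p \<and> p \<le> n}. p)"

lemma finite_primes_le: "finite {p::nat. prime p \<and> p \<le> n}" by (rule finite_subset[of _ "{..n}"]) auto

lemma prod_primes_dvd:
  fixes m :: nat
  assumes "finite A" "\<And>p. p \<in> A \<Longrightarrow> prime p \<and> p dvd m"
  shows "\<Prod>A dvd m"
  using assms
proof (induction rule: finite_induct)
  case (insert p A)
  have "coprime p (\<Prod>A)"
    by (rule prod_coprime_right) (use insert in \<open>metis insertCI primes_coprime\<close>)
  then show ?case using insert by (simp add: divides_mult)
qed simp

text \<open>
  For \<open>n = 2 m + 1\<close>, the primes in \<open>{m + 2..n}\<close> divide \<open>n choose m\<close>, which is at most \<open>4\<^sup>m\<close>.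
\<close>

lemma primorial_le: "primorial n \<le> 4 ^ n"
proof (induction n rule: less_induct)
  case (less n)
  consider "n \<le> 1" | "n = 2" | "n > 2" "even n" | m where "n = 2 * m + 1" "m \<ge> 1"
  proof -
    have "n \<le> 1 \<or> n = 2 \<or> (n > 2 \<and> even n) \<or> (\<exists>m. n = 2 * m + 1 \<and> m \<ge> 1)" by presburger
    then show ?thesis using that by blast
  qed
  then show ?case
  proof cases
    case 1
    then have "{p::nat. prime p \<and> p \<le> n} = {}" by (auto dest!: prime_ge_2_nat)
    then show ?thesis by (simp only: primorial_def prod.empty one_le_power one_le_numeral)
  next
    case 2
    have "p = 2" if "prime p" "p \<le> 2" for p :: nat using prime_ge_2_nat[OF that(1)] that(2) by simp
    then have "{p::nat. prime p \<and> p \<le> 2} = {2}" by auto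
    then show ?thesis using 2 by (simp add: primorial_def)
  next
    case 3
    then have "\<not> prime n" using prime_odd_nat by blast
    then have "p \<le> n \<longleftrightarrow> p \<le> n - 1" if "prime p" for p using that 3(1) by (cases "p = n") auto
    then have "{p. prime p \<and> p \<le> n} = {p. prime p \<and> p \<le> n - 1}" by blast
    then have "primorial n = primorial (n - 1)" by (simp add: primorial_def)
    also have "\<dots> \<le> 4 ^ (n - 1)" using less 3 by simp
    also have "\<dots> \<le> 4 ^ n" by (intro power_increasing) auto
    finally show ?thesis .
  next
    case (4 m)
    define B where "B = {p. prime p \<and> m + 1 < p \<and> p \<le> 2 * m + 1}"
    have finB: "finite B" unfolding B_def by (rule finite_subset[of _ "{..2*m+1}"]) auto
    have "{p. prime p \<and> p \<le> n} = {p. prime p \<and> p \<le> m + 1} \<union> B" using 4 by (auto simp: B_def)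
    then have "primorial n = primorial (m + 1) * \<Prod>B" unfolding primorial_def
      by (simp only:) (rule prod.union_disjoint[OF finite_primes_le finB], auto simp: B_def)
    moreover have "primorial (m + 1) \<le> 4 ^ (m + 1)" using less[of "m + 1"] 4 by simp
    moreover have "\<Prod>B \<le> 4 ^ m"
    proof -
      have "\<Prod>B dvd (2 * m + 1) choose m"
      proof (rule prod_primes_dvd[OF finB])
        fix p assume p: "p \<in> B"
        have "fact m * fact (m + 1) * ((2 * m + 1) choose m) = (fact (2 * m + 1) :: nat)"
          using binomial_fact_lemma[of m "2 * m + 1"] by simp
        moreover have pp: "prime p" using p by (simp add: B_def)
        moreover have "p dvd (fact (2 * m + 1) :: nat)"
          by (simp only: prime_dvd_fact_iff[OF pp]) (use p in \<open>simp add: B_def\<close>)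
        moreover have "\<not> p dvd (fact m :: nat)" "\<not> p dvd (fact (m + 1) :: nat)"
          by (simp_all only: prime_dvd_fact_iff[OF pp]) (use p in \<open>simp_all add: B_def\<close>)
        ultimately have "p dvd (2 * m + 1) choose m"
          by (metis (no_types) prime_dvd_multD)
        then show "prime p \<and> p dvd (2 * m + 1) choose m" using p by (simp add: B_def)
      qed
      then have "\<Prod>B \<le> (2 * m + 1) choose m" by (rule dvd_imp_le) simp
      moreover have "2 * ((2 * m + 1) choose m) \<le> 2 ^ (2 * m + 1)"
      proof -
        have "(2 * m + 1) choose m = (2 * m + 1) choose (m + 1)"
          using binomial_symmetric[of m "2 * m + 1"] by simp
        then have "2 * ((2 * m + 1) choose m) = (\<Sum>k\<in>{m, m + 1}. (2 * m + 1) choose k)" by simp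
        also have "\<dots> \<le> (\<Sum>k\<le>2 * m + 1. (2 * m + 1) choose k)" by (rule sum_mono2) auto
        also have "\<dots> = 2 ^ (2 * m + 1)" by (rule choose_row_sum)
        finally show ?thesis .
      qed
      ultimately show ?thesis by (simp add: power_mult)
    qed
    ultimately have "primorial n \<le> 4 ^ (m + 1) * 4 ^ m" by (simp add: mult_mono)
    also have "\<dots> = 4 ^ n" using 4 by (simp flip: power_add)
    finally show ?thesis .
  qed
qed

text \<open>
  If there is no prime between \<open>X\<close> and \<open>N\<close>, the least common multiple \<open>D\<close> of \<open>1, \<dots>, N\<close> is small: a prime up to \<open>sqrt N\<close>
  contributes at most \<open>N\<close>, and a larger one contributes itself once.
\<close>

lemma no_prime_bound:
  fixes X N s :: nat
  assumes "\<And>p. prime p \<Longrightarrow> X < p \<Longrightarrow> N < p" "N < (s + 1)\<^sup>2" "m \<ge> 1" "2 * m \<le> N"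
  shows "m * (2 * m choose m) \<le> N ^ s * 4 ^ X"
proof -
  define P where "P = {p::nat. prime p \<and> p \<le> N}"
  have finP: "finite P" unfolding P_def by (rule finite_primes_le)
  define e where "e = (\<lambda>p. Max {e. p ^ e \<le> N})"
  have finE: "finite {e. p ^ e \<le> N}" if "p \<in> P" for p
  proof (rule finite_subset)
    have "p \<ge> 2" using that prime_ge_2_nat by (auto simp: P_def)
    then have le: "e \<le> p ^ e" for e using power_gt_expt[of p e] by (simp add: less_imp_le)
    show "{e. p ^ e \<le> N} \<subseteq> {..N}"
    proof
      fix e assume "e \<in> {e. p ^ e \<le> N}"
      then show "e \<in> {..N}" using le[of e] by simp
    qed
  qed simp
  have N0: "N \<ge> 1" using assms(3,4) by linarith
  have e1: "p ^ e p \<le> N" if "p \<in> P" for p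
    using Max_in[OF finE[OF that]] N0 unfolding e_def by (metis (mono_tags, lifting) empty_iff mem_Collect_eq power_0)
  have e2: "j \<le> e p" if "p \<in> P" "p ^ j \<le> N" for p j
    unfolding e_def using Max_ge[OF finE[OF that(1)]] that(2) by simp
  define D where "D = (\<Prod>p\<in>P. p ^ e p)"
  have "k dvd D" if k: "1 \<le> k" "k \<le> N" for k
  proof -
    have "k = (\<Prod>p\<in>prime_factors k. p ^ multiplicity p k)" using k prime_factorization_nat[of k] by simp
    also have "\<dots> dvd D" unfolding D_def
    proof (rule prod_dvd_prod_subset2[OF finP])
      show sub: "prime_factors k \<subseteq> P"
      proof
        fix p assume "p \<in> prime_factors k"
        then have "prime p" "p dvd k" by auto
        then have "p \<le> k" using k by (intro dvd_imp_le) auto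
        then show "p \<in> P" using \<open>prime p\<close> k by (simp add: P_def)
      qed
      fix p assume p: "p \<in> prime_factors k"
      have "p ^ multiplicity p k \<le> k" using k by (intro dvd_imp_le multiplicity_dvd) auto
      then have "multiplicity p k \<le> e p" using p sub k by (intro e2) auto
      then show "p ^ multiplicity p k dvd p ^ e p" by (rule le_imp_power_dvd)
    qed
    finally show ?thesis .
  qed
  then have "m * (2 * m choose m) dvd D" using assms(3,4) by (intro mult_binomial_dvd[where N=N]) auto
  moreover have "D > 0" unfolding D_def P_def by (intro prod_pos) (auto dest: prime_gt_0_nat)
  ultimately have "m * (2 * m choose m) \<le> D" by (rule dvd_imp_le)
  also have "D = (\<Prod>p\<in>{p\<in>P. p \<le> s}. p ^ e p) * (\<Prod>p\<in>{p\<in>P. \<not> p \<le> s}. p ^ e p)"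
  proof -
    have "(\<Prod>p\<in>{p\<in>P. p \<le> s} \<union> {p\<in>P. \<not> p \<le> s}. p ^ e p) =
        (\<Prod>p\<in>{p\<in>P. p \<le> s}. p ^ e p) * (\<Prod>p\<in>{p\<in>P. \<not> p \<le> s}. p ^ e p)"
      by (rule prod.union_disjoint) (use finP in auto)
    moreover have "{p\<in>P. p \<le> s} \<union> {p\<in>P. \<not> p \<le> s} = P" by blast
    ultimately show ?thesis unfolding D_def by (simp only:)
  qed
  also have "\<dots> \<le> N ^ s * 4 ^ X"
  proof (rule mult_mono)
    have "(\<Prod>p\<in>{p\<in>P. p \<le> s}. p ^ e p) \<le> (\<Prod>p\<in>{p\<in>P. p \<le> s}. N)" using e1 by (intro prod_mono) auto
    also have "\<dots> = N ^ card {p\<in>P. p \<le> s}" by simp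
    also have "\<dots> \<le> N ^ s"
    proof (rule power_increasing[OF _ N0])
      have "card {p\<in>P. p \<le> s} \<le> card {1..s}" by (rule card_mono) (auto simp: P_def Suc_le_eq dest: prime_gt_0_nat)
      then show "card {p\<in>P. p \<le> s} \<le> s" by simp
    qed
    finally show "(\<Prod>p\<in>{p\<in>P. p \<le> s}. p ^ e p) \<le> N ^ s" .
    have "(\<Prod>p\<in>{p\<in>P. \<not> p \<le> s}. p ^ e p) \<le> (\<Prod>p\<in>{p\<in>P. \<not> p \<le> s}. p)"
    proof (intro prod_mono conjI)
      fix p assume p: "p \<in> {p\<in>P. \<not> p \<le> s}"
      have "e p < 2"
      proof (rule ccontr)
        assume "\<not> e p < 2"
        then have "p\<^sup>2 \<le> p ^ e p" using p prime_gt_0_nat by (intro power_increasing) (auto simp: P_def Suc_le_eq)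
        also have "p ^ e p \<le> N" by (rule e1) (use p in simp)
        finally have "p\<^sup>2 \<le> N" .
        moreover have "(s + 1)\<^sup>2 \<le> p\<^sup>2" using p by (intro power_mono) auto
        ultimately have "(s + 1)\<^sup>2 \<le> N" by (rule order_trans[rotated])
        then show False using assms(2) by (meson not_le)
      qed
      then have "e p \<le> 1" by simp
      then have "p ^ e p \<le> p ^ 1" using p prime_gt_0_nat by (intro power_increasing) (auto simp: P_def Suc_le_eq)
      then show "p ^ e p \<le> p" by simp
    qed auto
    also have "\<dots> \<le> primorial X" unfolding primorial_def
    proof (rule dvd_imp_le[OF prod_dvd_prod_subset])
      show "{p\<in>P. \<not> p \<le> s} \<subseteq> {p. prime p \<and> p \<le> X}" using assms(1) unfolding P_def by (auto simp: not_less[symmetric])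
      show "0 < \<Prod>{p. prime p \<and> p \<le> X}" by (intro prod_pos) (auto dest: prime_gt_0_nat)
    qed (rule finite_primes_le)
    also have "\<dots> \<le> 4 ^ X" by (rule primorial_le)
    finally show "(\<Prod>p\<in>{p\<in>P. \<not> p \<le> s}. p ^ e p) \<le> 4 ^ X" .
  qed auto
  finally show ?thesis .
qed

text \<open>
  Without a prime in \<open>{X<..3 * X}\<close> the central binomial coefficient \<open>2 m choose m\<close> with \<open>m = \<lfloor>3 X / 2\<rfloor>\<close>, which is
  about \<open>8\<^sup>X\<close>, would be at most \<open>4\<^sup>X\<close> up to a factor \<open>exp (O (sqrt X ln X))\<close>.
\<close>

theorem weak_bertrand: "\<exists>X0. \<forall>X\<ge>X0. \<exists>p::nat. prime p \<and> X < p \<and> p \<le> 3 * X"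
proof -
  have "\<forall>\<^sub>F x in at_top. sqrt (3 * x) * ln (3 * x) < (x - 4) * ln (2::real)" by real_asymp
  then have "\<forall>\<^sub>F X in sequentially. sqrt (3 * real X) * ln (3 * real X) < (real X - 4) * ln 2"
    by (rule eventually_compose_filterlim[OF _ filterlim_real_sequentially])
  then obtain X1 where X1: "\<And>X. X \<ge> X1 \<Longrightarrow> sqrt (3 * real X) * ln (3 * real X) < (real X - 4) * ln 2"
    by (auto simp: eventually_sequentially)
  show ?thesis
  proof (rule exI[of _ "max X1 1"], intro allI impI)
    fix X assume X: "max X1 1 \<le> X"
    show "\<exists>p. prime p \<and> X < p \<and> p \<le> 3 * X"
    proof (rule ccontr)
      assume "\<not> ?thesis"
      then have none: "\<And>p. prime p \<Longrightarrow> X < p \<Longrightarrow> 3 * X < p" by (meson not_le)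
      define s where "s = nat \<lfloor>sqrt (3 * real X)\<rfloor>"
      define m where "m = 3 * X div 2"
      have s: "real s \<le> sqrt (3 * real X)" "sqrt (3 * real X) < real s + 1"
        unfolding s_def by (simp add: of_nat_floor, linarith)
      have "3 * X < (s + 1)\<^sup>2"
      proof -
        have "3 * real X = (sqrt (3 * real X))\<^sup>2" by simp
        also have "\<dots> < (real s + 1)\<^sup>2" using s(2) by (intro power_strict_mono) auto
        finally have "real (3 * X) < real ((s + 1)\<^sup>2)" by (simp add: add.commute)
        then show ?thesis by (simp only: of_nat_less_iff)
      qed
      then have "m * (2 * m choose m) \<le> (3 * X) ^ s * 4 ^ X"
        using X by (intro no_prime_bound[OF none]) (auto simp: m_def)
      then have *: "real m * real (2 * m choose m) \<le> (3 * real X) ^ s * 4 ^ X"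
        by (metis (mono_tags) of_nat_le_iff of_nat_mult of_nat_numeral of_nat_power)
      have m0: "m > 0" using X by (auto simp: m_def)
      then have "4 ^ m / (2 * real m) \<le> real (2 * m choose m)" by (rule central_binomial_lower_bound)
      then have "real m * (4 ^ m / (2 * real m)) \<le> real m * real (2 * m choose m)" by (rule mult_left_mono) simp
      then have "4 ^ m / 2 \<le> (3 * real X) ^ s * 4 ^ X" using m0 * by simp
      moreover have "2 ^ (3 * X) \<le> (2::real) ^ (2 * m + 1)" unfolding m_def by (intro power_increasing) auto
      then have "2 ^ (3 * X) \<le> 2 * (4::real) ^ m" by (simp add: power_mult)
      moreover have "(2::real) ^ (3 * X) = 2 ^ X * 4 ^ X"
        by (simp add: power_mult flip: power_mult_distrib)
      ultimately have "2 ^ X * 4 ^ X \<le> (4 * (3 * real X) ^ s) * (4::real) ^ X" by linarith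
      then have "(2::real) ^ X \<le> 4 * (3 * real X) ^ s" by simp
      then have "ln (2 ^ X) \<le> ln (4 * (3 * real X) ^ s)" using X by (subst ln_le_cancel_iff) auto
      then have "real X * ln 2 \<le> ln 4 + real s * ln (3 * real X)" using X by (simp add: ln_mult ln_realpow algebra_simps)
      also have "\<dots> \<le> ln 4 + sqrt (3 * real X) * ln (3 * real X)"
        using s X by (intro add_left_mono mult_right_mono) auto
      also have "ln 4 = 2 * ln (2::real)" using ln_realpow[of 2 2] by simp
      finally have "(real X - 2) * ln 2 \<le> sqrt (3 * real X) * ln (3 * real X)" by (simp add: algebra_simps)
      moreover have "(real X - 4) * ln 2 \<le> (real X - 2) * ln 2" by (intro mult_right_mono) auto
      moreover have "X1 \<le> X" using X by simp
      ultimately show False using X1[of X] by linarith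
    qed
  qed
qed

section \<open>Volume\<close>

text \<open>
  Vectors are padded with zeros instead of being extensional. In this form pointwise addition and subtraction of functions
  are the vector operations in every dimension. The measure \<open>leb n\<close> is the Lebesgue measure carried over.
\<close>

definition espace :: "nat \<Rightarrow> (nat \<Rightarrow> real) set" where
  "espace n = {x. \<forall>i\<ge>n. x i = 0}"

definition ext0 :: "nat \<Rightarrow> (nat \<Rightarrow> real) \<Rightarrow> nat \<Rightarrow> real" where
  "ext0 n x = (\<lambda>i. if i < n then x i else 0)"

definition sc :: "real \<Rightarrow> (nat \<Rightarrow> real) \<Rightarrow> nat \<Rightarrow> real" where
  "sc c x = (\<lambda>i. c * x i)"

definition leb :: "nat \<Rightarrow> (nat \<Rightarrow> real) measure" where
  "leb n = distr (Pi\<^sub>M {..<n} (\<lambda>_. lborel)) borel (ext0 n)"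

lemma sc_apply [simp]: "sc c x i = c * x i" by (simp add: sc_def)
lemma sc_add: "sc c (x + y) = sc c x + sc c y" by (simp add: fun_eq_iff algebra_simps)
lemma sc_diff: "sc c (x - y) = sc c x - sc c y" by (simp add: fun_eq_iff algebra_simps)
lemma sc_minus: "sc c (- x) = - sc c x" by (simp add: fun_eq_iff)
lemma sc_sc [simp]: "sc c (sc d x) = sc (c * d) x" by (simp add: fun_eq_iff)
lemma sc_1 [simp]: "sc 1 x = x" by (simp add: fun_eq_iff)
lemma sc_0 [simp]: "sc c 0 = 0" "sc 0 x = 0" by (simp_all add: fun_eq_iff)
lemma sc_add_left: "sc (c + d) x = sc c x + sc d x" by (simp add: fun_eq_iff algebra_simps)

lemma espace_simps [simp]: "0 \<in> espace n" "ext0 n x \<in> espace n"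
  and espace_closed: "x \<in> espace n \<Longrightarrow> y \<in> espace n \<Longrightarrow> x + y \<in> espace n"
    "x \<in> espace n \<Longrightarrow> y \<in> espace n \<Longrightarrow> x - y \<in> espace n"
    "x \<in> espace n \<Longrightarrow> - x \<in> espace n" "x \<in> espace n \<Longrightarrow> sc c x \<in> espace n"
  by (auto simp: espace_def ext0_def)

lemma ext0_espace: "x \<in> espace n \<Longrightarrow> ext0 n x = x"
  by (auto simp: espace_def ext0_def fun_eq_iff)

lemma ext0_restrict: "ext0 n (restrict x {..<n}) = ext0 n x"
  by (auto simp: ext0_def fun_eq_iff)

lemma restrict_ext0: "x \<in> rspace n \<Longrightarrow> restrict (ext0 n x) {..<n} = x"
  by (auto simp: ext0_def fun_eq_iff rspace_def PiE_def extensional_def)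

lemma restrict_in_rspace [simp]: "restrict x {..<n} \<in> rspace n" by (auto simp: rspace_def)

lemma sets_leb [simp, measurable_cong]: "sets (leb n) = sets borel" by (simp add: leb_def)
lemma space_leb [simp]: "space (leb n) = UNIV" by (simp add: leb_def)

lemma measurable_ext0 [measurable]: "ext0 n \<in> Pi\<^sub>M {..<n} (\<lambda>_. lborel) \<rightarrow>\<^sub>M borel"
proof (rule measurable_coordinatewise_then_product)
  fix i
  show "(\<lambda>x. ext0 n x i) \<in> borel_measurable (Pi\<^sub>M {..<n} (\<lambda>_. lborel))"
    unfolding ext0_def by (cases "i < n") (auto intro: measurable_component_singleton)
qed

lemma emeasure_leb:
  "X \<in> sets borel \<Longrightarrow> emeasure (leb n) X = emeasure (Pi\<^sub>M {..<n} (\<lambda>_. lborel)) {x \<in> rspace n. ext0 n x \<in> X}"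
  unfolding leb_def by (subst emeasure_distr) (auto simp: space_PiM_lborel intro!: arg_cong2[where f=emeasure])

lemma restrict_image_eq:
  assumes "X \<subseteq> espace n"
  shows "(\<lambda>x. restrict x {..<n}) ` X = {x \<in> rspace n. ext0 n x \<in> X}"
proof (intro equalityI subsetI)
  fix x assume "x \<in> (\<lambda>x. restrict x {..<n}) ` X"
  then show "x \<in> {x \<in> rspace n. ext0 n x \<in> X}" using assms by (auto simp: ext0_restrict ext0_espace subset_iff)
next
  fix x assume "x \<in> {x \<in> rspace n. ext0 n x \<in> X}"
  then show "x \<in> (\<lambda>x. restrict x {..<n}) ` X" using restrict_ext0 by (metis (no_types, lifting) imageI mem_Collect_eq)
qed

text \<open>
  The translation back to the volume of extensional vectors.
\<close>

lemma vol_restrict: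
  assumes "X \<in> sets borel" "X \<subseteq> espace n"
  shows "vol n ((\<lambda>x. restrict x {..<n}) ` X) = measure (leb n) X"
  unfolding vol_def measure_def restrict_image_eq[OF assms(2)] emeasure_leb[OF assms(1)] ..

lemma emeasure_lborel_affine:
  assumes "c \<noteq> (0::real)" "A \<in> sets borel"
  shows "emeasure lborel A = ennreal \<bar>c\<bar> * emeasure lborel ((\<lambda>x. t + c * x) -` A)"
proof -
  have "emeasure lborel A = emeasure (density (distr lborel borel (\<lambda>x. t + c * x)) (\<lambda>_. ennreal \<bar>c\<bar>)) A"
    using lborel_real_affine[OF assms(1), of t] by simp
  also have "\<dots> = ennreal \<bar>c\<bar> * emeasure (distr lborel borel (\<lambda>x. t + c * x)) A"
    using assms(2) by (simp add: emeasure_density_const)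
  also have "\<dots> = ennreal \<bar>c\<bar> * emeasure lborel ((\<lambda>x. t + c * x) -` A)"
    using assms(2) by (simp add: emeasure_distr)
  finally show ?thesis .
qed

lemma PiM_lborel_affine:
  assumes c: "c \<noteq> (0::real)"
  shows "Pi\<^sub>M {..<n} (\<lambda>_. lborel) =
    scale_measure (ennreal \<bar>c\<bar> ^ n) (distr (Pi\<^sub>M {..<n} (\<lambda>_. lborel)) (Pi\<^sub>M {..<n} (\<lambda>_. lborel)) (\<lambda>x. \<lambda>i\<in>{..<n}. a i + c * x i))"
    (is "?M = ?S")
proof -
  interpret product_sigma_finite "\<lambda>_::nat. lborel :: real measure" ..
  have T: "(\<lambda>x. \<lambda>i\<in>{..<n}. a i + c * x i) \<in> ?M \<rightarrow>\<^sub>M ?M"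
    by (intro measurable_restrict) simp
  have "?S = ?M"
  proof (rule PiM_eqI)
    fix A :: "nat \<Rightarrow> real set" assume A: "\<And>i. i \<in> {..<n} \<Longrightarrow> A i \<in> sets lborel"
    have Ab: "(\<lambda>x. a i + c * x) -` A i \<in> sets lborel" if "i < n" for i
      using measurable_sets[of "\<lambda>x. a i + c * x" lborel lborel "A i"] A that by simp
    have "emeasure ?S (Pi\<^sub>E {..<n} A) =
       ennreal \<bar>c\<bar> ^ n * emeasure ?M ((\<lambda>x. \<lambda>i\<in>{..<n}. a i + c * x i) -` Pi\<^sub>E {..<n} A \<inter> space ?M)"
      using A T by (subst emeasure_scale_measure, subst emeasure_distr) (auto intro!: sets_PiM_I_finite)
    also have "(\<lambda>x. \<lambda>i\<in>{..<n}. a i + c * x i) -` Pi\<^sub>E {..<n} A \<inter> space ?M = Pi\<^sub>E {..<n} (\<lambda>i. (\<lambda>x. a i + c * x) -` A i)"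
      by (auto simp: space_PiM PiE_def Pi_def extensional_def)
    also have "emeasure ?M \<dots> = (\<Prod>i<n. emeasure lborel ((\<lambda>x. a i + c * x) -` A i))"
      using Ab by (intro emeasure_PiM) auto
    also have "ennreal \<bar>c\<bar> ^ n * \<dots> = (\<Prod>i<n. ennreal \<bar>c\<bar> * emeasure lborel ((\<lambda>x. a i + c * x) -` A i))"
      by (simp add: prod.distrib)
    also have "\<dots> = (\<Prod>i<n. emeasure lborel (A i))"
      using A c by (intro prod.cong refl emeasure_lborel_affine[symmetric]) auto
    finally show "emeasure ?S (Pi\<^sub>E {..<n} A) = (\<Prod>i<n. emeasure lborel (A i))" .
  qed auto
  then show ?thesis by simp
qed

lemma continuous_affine: "continuous_on UNIV (\<lambda>x. a + sc c x)"
  by (intro continuous_on_coordinatewise_then_product) (auto intro!: continuous_intros simp: continuous_on_product_coordinates)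

lemma borel_affine_preimage:
  "X \<in> sets borel \<Longrightarrow> {x. a + sc c x \<in> X} \<in> sets borel"
  using measurable_sets[OF borel_measurable_continuous_onI[OF continuous_affine[of a c]], of X]
  by (simp add: vimage_def)

lemma emeasure_leb_affine:
  assumes c: "c \<noteq> 0" and X: "X \<in> sets borel" and a: "a \<in> espace n"
  shows "emeasure (leb n) X = ennreal \<bar>c\<bar> ^ n * emeasure (leb n) {x. a + sc c x \<in> X}"
proof -
  let ?M = "Pi\<^sub>M {..<n} (\<lambda>_. lborel :: real measure)"
  let ?X = "{x \<in> rspace n. ext0 n x \<in> X}"
  have T: "(\<lambda>x. \<lambda>i\<in>{..<n}. a i + c * x i) \<in> ?M \<rightarrow>\<^sub>M ?M"
    by (intro measurable_restrict) simp
  have mX: "?X \<in> sets ?M"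
    using measurable_sets[OF measurable_ext0 X, of n] by (simp add: space_PiM_lborel vimage_def Int_def conj_commute)
  have "emeasure (leb n) X = emeasure ?M ?X" by (rule emeasure_leb[OF X])
  also have "\<dots> = ennreal \<bar>c\<bar> ^ n * emeasure ?M ((\<lambda>x. \<lambda>i\<in>{..<n}. a i + c * x i) -` ?X \<inter> space ?M)"
    by (subst PiM_lborel_affine[OF c, of n a]) (simp add: emeasure_scale_measure emeasure_distr[OF T mX])
  also have "(\<lambda>x. \<lambda>i\<in>{..<n}. a i + c * x i) -` ?X \<inter> space ?M = {x \<in> rspace n. ext0 n x \<in> {x. a + sc c x \<in> X}}"
  proof -
    have "ext0 n (\<lambda>i\<in>{..<n}. a i + c * x i) = a + sc c (ext0 n x)" for x
      using a by (auto simp: ext0_def fun_eq_iff espace_def)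
    then show ?thesis by (auto simp: space_PiM_lborel rspace_def)
  qed
  also have "emeasure ?M \<dots> = emeasure (leb n) {x. a + sc c x \<in> X}"
    by (rule emeasure_leb[symmetric, OF borel_affine_preimage[OF X]])
  finally show ?thesis .
qed

lemma emeasure_leb_translate:
  "X \<in> sets borel \<Longrightarrow> a \<in> espace n \<Longrightarrow> emeasure (leb n) {x. a + x \<in> X} = emeasure (leb n) X"
  using emeasure_leb_affine[of 1 X a n] by simp

lemma emeasure_leb_sc:
  assumes c: "c > 0" and X: "X \<in> sets borel"
  shows "emeasure (leb n) (sc c ` X) = ennreal c ^ n * emeasure (leb n) X" "sc c ` X \<in> sets borel"
proof -
  have eq: "sc c ` X = {x. 0 + sc (1 / c) x \<in> X}"
  proof (intro equalityI subsetI)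
    fix x assume "x \<in> {x. 0 + sc (1 / c) x \<in> X}"
    then have "x = sc c (sc (1 / c) x)" "sc (1/c) x \<in> X" using c by auto
    then show "x \<in> sc c ` X" by blast
  qed (use c in auto)
  show m: "sc c ` X \<in> sets borel" unfolding eq by (rule borel_affine_preimage[OF X])
  have "emeasure (leb n) (sc c ` X) = ennreal \<bar>c\<bar> ^ n * emeasure (leb n) {x. 0 + sc c x \<in> sc c ` X}"
    by (rule emeasure_leb_affine) (use c m in auto)
  also have "{x. 0 + sc c x \<in> sc c ` X} = X"
  proof -
    have "sc c x = sc c y \<longleftrightarrow> x = y" for x y using c by (auto simp: fun_eq_iff)
    then show ?thesis by auto
  qed
  finally show "emeasure (leb n) (sc c ` X) = ennreal c ^ n * emeasure (leb n) X"
    by (simp only: abs_of_pos[OF c])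
qed

lemma emeasure_leb_cube:
  assumes "g \<ge> 0"
  shows "emeasure (leb n) {x. \<forall>i<n. 0 \<le> x i \<and> x i < g} = ennreal g ^ n"
    "{x. \<forall>i<n. 0 \<le> x i \<and> x i < (g::real)} \<in> sets borel"
proof -
  show m: "{x. \<forall>i<n. 0 \<le> x i \<and> x i < (g::real)} \<in> sets borel"
  proof -
    have "{x. \<forall>i<n. 0 \<le> x i \<and> x i < g} = (\<Inter>i\<in>{..<n}. (\<lambda>x. x i) -` {0..<g}) \<inter> UNIV" by auto
    also have "\<dots> \<in> sets borel"
    proof (cases "n = 0")
      case False
      have "(\<lambda>x. x i) -` {0..<g} \<in> sets borel" for i :: nat
        using measurable_sets[OF borel_measurable_continuous_onI[OF continuous_on_product_coordinates[of i]], of "{0..<g}"] by simp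
      then show ?thesis using False by (intro sets.Int sets.finite_INT) auto
    qed auto
    finally show ?thesis .
  qed
  interpret product_sigma_finite "\<lambda>_::nat. lborel :: real measure" ..
  have "emeasure (leb n) {x. \<forall>i<n. 0 \<le> x i \<and> x i < g} = emeasure (Pi\<^sub>M {..<n} (\<lambda>_. lborel)) (Pi\<^sub>E {..<n} (\<lambda>_. {0..<g}))"
    unfolding emeasure_leb[OF m]
    by (rule arg_cong2[where f=emeasure]) (auto simp: rspace_def ext0_def PiE_def Pi_def)
  also have "\<dots> = (\<Prod>i<n. emeasure lborel {0..<g})" by (rule emeasure_PiM) auto
  finally show "emeasure (leb n) {x. \<forall>i<n. 0 \<le> x i \<and> x i < g} = ennreal g ^ n" using assms by simp
qed

lemma emeasure_leb_compl_espace: "X \<in> sets borel \<Longrightarrow> X \<inter> espace n = {} \<Longrightarrow> emeasure (leb n) X = 0"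
  by (subst emeasure_leb) (auto, metis (no_types, lifting) Collect_empty_eq disjoint_iff emeasure_empty espace_simps(2))

lemma borel_espace: "espace n \<in> sets borel"
proof -
  have "closed (espace n)"
  proof -
    have "espace n = (\<Inter>i\<in>{n..}. {x. x i = 0})" by (auto simp: espace_def)
    moreover have "closed {x::nat \<Rightarrow> real. x i = 0}" for i
      by (intro closed_Collect_eq continuous_on_product_coordinates continuous_intros)
    ultimately show ?thesis by (simp add: closed_INT)
  qed
  then show ?thesis by simp
qed

section \<open>Lattices\<close>

definition lc :: "nat \<Rightarrow> (nat \<Rightarrow> real) \<Rightarrow> (nat \<Rightarrow> nat \<Rightarrow> real) \<Rightarrow> nat \<Rightarrow> real" where
  "lc n c b = (\<lambda>i. \<Sum>j<n. c j * b j i)"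

definition zspan :: "nat \<Rightarrow> (nat \<Rightarrow> nat \<Rightarrow> real) \<Rightarrow> (nat \<Rightarrow> real) set" where
  "zspan n b = range (\<lambda>z::nat \<Rightarrow> int. lc n (\<lambda>j. of_int (z j)) b)"

definition indep :: "nat \<Rightarrow> (nat \<Rightarrow> nat \<Rightarrow> real) \<Rightarrow> bool" where
  "indep n b \<longleftrightarrow> (\<forall>j<n. b j \<in> espace n) \<and> (\<forall>c. lc n c b = 0 \<longrightarrow> (\<forall>j<n. c j = 0))"

definition spans :: "nat \<Rightarrow> (nat \<Rightarrow> nat \<Rightarrow> real) \<Rightarrow> bool" where
  "spans n b \<longleftrightarrow> (\<forall>x\<in>espace n. \<exists>c. lc n c b = x)"

definition para :: "nat \<Rightarrow> (nat \<Rightarrow> nat \<Rightarrow> real) \<Rightarrow> (nat \<Rightarrow> real) set" where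
  "para n b = {lc n t b | t. \<forall>j<n. 0 \<le> t j \<and> t j < 1}"

definition tiles :: "nat \<Rightarrow> (nat \<Rightarrow> real) set \<Rightarrow> (nat \<Rightarrow> real) set \<Rightarrow> bool" where
  "tiles n L F \<longleftrightarrow> F \<in> sets borel \<and> F \<subseteq> espace n \<and> (\<forall>x\<in>espace n. \<exists>!l. l \<in> L \<and> x - l \<in> F)"

text \<open>
  The covolume \<open>v\<close> is part of the predicate. It is a property of \<open>L\<close> alone, by \<open>lat_any_basis\<close>.
\<close>

definition lat :: "nat \<Rightarrow> (nat \<Rightarrow> real) set \<Rightarrow> real \<Rightarrow> bool" where
  "lat n L v \<longleftrightarrow> v > 0 \<and> (\<exists>b. indep n b \<and> spans n b \<and> L = zspan n b \<and> emeasure (leb n) (para n b) = ennreal v)"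

definition lcount :: "(nat \<Rightarrow> real) set \<Rightarrow> (nat \<Rightarrow> real) set \<Rightarrow> (nat \<Rightarrow> real) \<Rightarrow> nat" where
  "lcount L X x = card {l \<in> L. x + l \<in> X}"

lemma lc_add: "lc n (\<lambda>j. s j + t j) b = lc n s b + lc n t b"
  by (simp add: lc_def fun_eq_iff distrib_right sum.distrib)
lemma lc_diff: "lc n (\<lambda>j. s j - t j) b = lc n s b - lc n t b"
  by (simp add: lc_def fun_eq_iff left_diff_distrib sum_subtractf)
lemma lc_sc: "lc n (\<lambda>j. c * t j) b = sc c (lc n t b)"
  by (simp add: lc_def fun_eq_iff sum_distrib_left mult.assoc)
lemma lc_cong: "(\<And>j. j < n \<Longrightarrow> s j = t j) \<Longrightarrow> lc n s b = lc n t b"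
  by (simp add: lc_def fun_eq_iff)
lemma lc_zero: "lc n (\<lambda>j. 0) b = 0"
  by (simp add: lc_def fun_eq_iff)
lemma lc_espace: "(\<And>j. j < n \<Longrightarrow> b j \<in> espace n) \<Longrightarrow> lc n t b \<in> espace n"
  by (auto simp: lc_def espace_def)

lemma lc_inj:
  assumes "indep n b" "lc n s b = lc n t b" "j < n"
  shows "s j = t j"
proof -
  have "lc n (\<lambda>j. s j - t j) b = 0" using assms(2) by (simp add: lc_diff)
  then have "s j - t j = 0" using assms(1,3) unfolding indep_def by blast
  then show ?thesis by simp
qed

lemma lc_unit:
  assumes "j < n" shows "lc n (\<lambda>k. if k = j then c else 0) b = sc c (b j)"
proof
  fix i
  have "lc n (\<lambda>k. if k = j then c else 0) b i = (\<Sum>k<n. if k = j then c * b j i else 0)"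
    unfolding lc_def by (intro sum.cong) auto
  then show "lc n (\<lambda>k. if k = j then c else 0) b i = sc c (b j) i" using assms by simp
qed

lemma zspan_iff: "x \<in> zspan n b \<longleftrightarrow> (\<exists>z::nat \<Rightarrow> int. x = lc n (\<lambda>j. of_int (z j)) b)"
  by (auto simp: zspan_def)

lemma zspan_0: "0 \<in> zspan n b"
  unfolding zspan_iff by (rule exI[of _ "\<lambda>_. 0"]) (simp add: lc_zero)

lemma zspan_add:
  assumes "x \<in> zspan n b" "y \<in> zspan n b" shows "x + y \<in> zspan n b"
proof -
  obtain u v :: "nat \<Rightarrow> int" where "x = lc n (\<lambda>j. of_int (u j)) b" "y = lc n (\<lambda>j. of_int (v j)) b"
    using assms by (auto simp: zspan_iff)
  then have "x + y = lc n (\<lambda>j. of_int (u j + v j)) b" by (simp add: lc_add)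
  then show ?thesis unfolding zspan_iff by (rule exI[of _ "\<lambda>j. u j + v j"])
qed

lemma zspan_zsc:
  assumes "x \<in> zspan n b" shows "sc (of_int z) x \<in> zspan n b"
proof -
  obtain u :: "nat \<Rightarrow> int" where "x = lc n (\<lambda>j. of_int (u j)) b"
    using assms by (auto simp: zspan_iff)
  then have "sc (of_int z) x = lc n (\<lambda>j. of_int (z * u j)) b" by (simp add: lc_sc)
  then show ?thesis unfolding zspan_iff by (rule exI[of _ "\<lambda>j. z * u j"])
qed

lemma zspan_minus: "x \<in> zspan n b \<Longrightarrow> - x \<in> zspan n b"
proof -
  have "sc (of_int (-1)) x = - x" by (simp add: fun_eq_iff)
  then show "x \<in> zspan n b \<Longrightarrow> - x \<in> zspan n b" using zspan_zsc[of x n b "-1"] by simp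
qed

lemma zspan_diff: "x \<in> zspan n b \<Longrightarrow> y \<in> zspan n b \<Longrightarrow> x - y \<in> zspan n b"
  using zspan_add[of x n b "- y"] zspan_minus[of y n b] by simp

lemma zspan_restrict_coeffs:
  "zspan n b = (\<lambda>z. lc n (\<lambda>j. of_int (z j)) b) ` PiE {..<n} (\<lambda>_. UNIV :: int set)"
proof (intro equalityI subsetI)
  fix x assume "x \<in> zspan n b"
  then obtain z :: "nat \<Rightarrow> int" where "x = lc n (\<lambda>j. of_int (z j)) b" by (auto simp: zspan_iff)
  then have "x = lc n (\<lambda>j. of_int (restrict z {..<n} j)) b" by (simp add: lc_def)
  then show "x \<in> (\<lambda>z. lc n (\<lambda>j. of_int (z j)) b) ` PiE {..<n} (\<lambda>_. UNIV :: int set)"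
    by (rule image_eqI[where x="restrict z {..<n}" and f="\<lambda>z::nat \<Rightarrow> int. lc n (\<lambda>j. of_int (z j)) b"]) simp
next
  fix x assume "x \<in> (\<lambda>z. lc n (\<lambda>j. of_int (z j)) b) ` PiE {..<n} (\<lambda>_. UNIV :: int set)"
  then obtain z :: "nat \<Rightarrow> int" where "x = lc n (\<lambda>j. of_int (z j)) b" by (elim imageE)
  then show "x \<in> zspan n b" unfolding zspan_iff by (rule exI[of _ z])
qed

lemma countable_zspan: "countable (zspan n b)"
  unfolding zspan_restrict_coeffs by (rule countable_image, rule countable_PiE) simp_all

text \<open>
  The dual basis. Coordinates with respect to \<open>b\<close> are linear in the point, hence measurable and bounded on bounded sets.
\<close>

lemma dual_functionals:
  assumes "indep n b" "spans n b"
  shows "\<exists>C. \<forall>t. \<forall>j<n. t j = (\<Sum>i<n. C j i * lc n t b i)"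
proof -
  have "\<exists>c. lc n c b = (\<lambda>k. if k = i then 1 else 0)" if "i < n" for i
  proof -
    have "(\<lambda>k. if k = i then 1 else 0) \<in> espace n" using that by (auto simp: espace_def)
    then show ?thesis using assms(2) unfolding spans_def by blast
  qed
  then obtain D where D: "\<And>i. i < n \<Longrightarrow> lc n (D i) b = (\<lambda>k. if k = i then 1 else 0)" by metis
  have "t j = (\<Sum>i<n. D i j * lc n t b i)" if "j < n" for t j
  proof -
    have "lc n (\<lambda>j. \<Sum>i<n. D i j * lc n t b i) b = lc n t b"
    proof
      fix k
      have "lc n (\<lambda>j. \<Sum>i<n. D i j * lc n t b i) b k = (\<Sum>j<n. \<Sum>i<n. lc n t b i * (D i j * b j k))"
        unfolding lc_def[of n "\<lambda>j. \<Sum>i<n. D i j * lc n t b i"] by (simp add: sum_distrib_right sum_distrib_left mult_ac)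
      also have "\<dots> = (\<Sum>i<n. lc n t b i * lc n (D i) b k)"
        by (subst sum.swap) (simp add: lc_def sum_distrib_left)
      also have "\<dots> = (\<Sum>i<n. if i = k then lc n t b k else 0)"
        by (intro sum.cong) (auto simp: D)
      also have "\<dots> = (if k < n then lc n t b k else 0)" by simp
      also have "\<dots> = lc n t b k"
        using lc_espace[of n b t] assms(1) by (auto simp: indep_def espace_def)
      finally show "lc n (\<lambda>j. \<Sum>i<n. D i j * lc n t b i) b k = lc n t b k" .
    qed
    from lc_inj[OF assms(1) this that] show ?thesis by simp
  qed
  then show ?thesis by (intro exI[of _ "\<lambda>j i. D i j"]) blast
qed

lemma para_tiles:
  assumes b: "indep n b" "spans n b"
  shows "tiles n (zspan n b) (para n b)"
proof -
  have be: "\<And>j. j < n \<Longrightarrow> b j \<in> espace n" using b by (simp add: indep_def)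
  obtain C where C: "\<And>t j. j < n \<Longrightarrow> t j = (\<Sum>i<n. C j i * lc n t b i)" using dual_functionals[OF b] by blast
  define \<phi> where "\<phi> = (\<lambda>j x. \<Sum>i<n. C j i * x i)"
  have \<phi>: "t j = \<phi> j (lc n t b)" if "j < n" for t j using C[OF that, of t] unfolding \<phi>_def .
  have eq: "para n b = espace n \<inter> {x. \<forall>j\<in>{..<n}. \<phi> j x \<in> {0..<1}}"
  proof (intro equalityI subsetI)
    fix x assume "x \<in> para n b"
    then obtain t where t: "x = lc n t b" "\<forall>j<n. 0 \<le> t j \<and> t j < 1" by (auto simp: para_def)
    then show "x \<in> espace n \<inter> {x. \<forall>j\<in>{..<n}. \<phi> j x \<in> {0..<1}}" using \<phi>[of _ t] lc_espace[OF be] by auto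
  next
    fix x assume x: "x \<in> espace n \<inter> {x. \<forall>j\<in>{..<n}. \<phi> j x \<in> {0..<1}}"
    then obtain t where t: "lc n t b = x" using b by (auto simp: spans_def)
    then show "x \<in> para n b" using x \<phi>[of _ t] by (auto simp: para_def)
  qed
  have \<phi>m: "\<phi> j \<in> borel_measurable borel" for j
    unfolding \<phi>_def by (intro borel_measurable_continuous_onI continuous_intros continuous_on_product_coordinates)
  have "{x. \<forall>j\<in>{..<n}. \<phi> j x \<in> {0..<1}} \<in> sets borel"
  proof -
    have "{x. \<forall>j\<in>{..<n}. \<phi> j x \<in> {0..<1}} = {x \<in> space borel. \<forall>j\<in>{..<n}. \<phi> j x \<in> {0..<1}}" by simp
    also have "\<dots> \<in> sets borel"
      by (intro sets.sets_Collect_finite_All' sets.sets_Collect_finite_All) (use measurable_sets[OF \<phi>m, of "{0..<1}"] in \<open>auto simp: vimage_def\<close>)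
    finally show ?thesis .
  qed
  then have m: "para n b \<in> sets borel" unfolding eq by (intro sets.Int borel_espace)
  have "\<exists>!l. l \<in> zspan n b \<and> x - l \<in> para n b" if x: "x \<in> espace n" for x
  proof -
    obtain t where t: "lc n t b = x" using b(2) x by (auto simp: spans_def)
    show ?thesis
    proof (rule ex1I)
      have "x - lc n (\<lambda>j. of_int \<lfloor>t j\<rfloor>) b = lc n (\<lambda>j. t j - of_int \<lfloor>t j\<rfloor>) b" by (simp add: lc_diff t)
      moreover have "0 \<le> t j - of_int \<lfloor>t j\<rfloor> \<and> t j - of_int \<lfloor>t j\<rfloor> < 1" for j by linarith
      ultimately have "x - lc n (\<lambda>j. of_int \<lfloor>t j\<rfloor>) b \<in> para n b"
        unfolding para_def by (intro CollectI exI[of _ "\<lambda>j. t j - of_int \<lfloor>t j\<rfloor>"]) auto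
      then show "lc n (\<lambda>j. of_int \<lfloor>t j\<rfloor>) b \<in> zspan n b \<and> x - lc n (\<lambda>j. of_int \<lfloor>t j\<rfloor>) b \<in> para n b"
        unfolding zspan_iff by (intro conjI exI[of _ "\<lambda>j. \<lfloor>t j\<rfloor>"]) auto
    next
      fix l assume l: "l \<in> zspan n b \<and> x - l \<in> para n b"
      then obtain z :: "nat \<Rightarrow> int" where z: "l = lc n (\<lambda>j. of_int (z j)) b" by (auto simp: zspan_iff)
      obtain s where s: "x - l = lc n s b" "\<forall>j<n. 0 \<le> s j \<and> s j < 1" using l by (auto simp: para_def)
      have "lc n s b = lc n (\<lambda>j. t j - of_int (z j)) b" using s z t by (simp add: lc_diff)
      then have "s j = t j - of_int (z j)" if "j < n" for j using lc_inj[OF b(1) _ that, of s] by simp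
      then have "z j = \<lfloor>t j\<rfloor>" if "j < n" for j using s(2) that by (intro floor_unique[symmetric]) force+
      then show "l = lc n (\<lambda>j. of_int \<lfloor>t j\<rfloor>) b" unfolding z by (intro lc_cong) simp
    qed
  qed
  then show ?thesis unfolding tiles_def using m lc_espace[OF be] by (auto simp: para_def)
qed

lemma AE_leb_espace: "AE x in leb n. x \<in> espace n"
proof (rule AE_I)
  show "{x \<in> space (leb n). x \<notin> espace n} \<subseteq> UNIV - espace n" by auto
  show "emeasure (leb n) (UNIV - espace n) = 0"
    by (rule emeasure_leb_compl_espace) (use borel_espace in auto)
  show "UNIV - espace n \<in> sets (leb n)" using borel_espace by auto
qed

lemma borel_translate: "(X :: (nat \<Rightarrow> real) set) \<in> sets borel \<Longrightarrow> {x. a + x \<in> X} \<in> sets borel"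
  using borel_affine_preimage[of X a 1] by simp

text \<open>
  The unfolding identity: cutting space into the translates of \<open>F\<close> and moving all pieces back to \<open>F\<close>, the measure of \<open>X\<close>
  becomes the average over \<open>F\<close> of the number of lattice points in translates of \<open>X\<close>.
\<close>

lemma emeasure_average:
  assumes t: "tiles n L F" and L: "countable L" "L \<subseteq> espace n" and X: "X \<in> sets borel"
  shows "emeasure (leb n) X = (\<integral>\<^sup>+x. indicator F x * (\<integral>\<^sup>+l. indicator X (x + l) \<partial>count_space L) \<partial>leb n)"
proof -
  have F: "F \<in> sets borel" "F \<subseteq> espace n" and ex1: "\<And>x. x \<in> espace n \<Longrightarrow> \<exists>!l. l \<in> L \<and> x - l \<in> F"
    using t by (simp_all add: tiles_def)
  have one: "(\<integral>\<^sup>+l. indicator F (x - l) \<partial>count_space L) = 1" if x: "x \<in> espace n" for x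
  proof -
    have "\<exists>l0. (l0 \<in> L \<and> x - l0 \<in> F) \<and> (\<forall>l. l \<in> L \<and> x - l \<in> F \<longrightarrow> l = l0)"
      using ex1[OF x] by (simp only: Ex1_def)
    then obtain l0 where l0: "l0 \<in> L \<and> x - l0 \<in> F"
      and uniq: "\<forall>l. l \<in> L \<and> x - l \<in> F \<longrightarrow> l = l0" by (elim exE) (erule conjE, rule that, assumption+)
    have "(\<integral>\<^sup>+l. indicator F (x - l) \<partial>count_space L) = (\<integral>\<^sup>+l. indicator {l0} l \<partial>count_space L)"
    proof (rule nn_integral_cong)
      fix l assume "l \<in> space (count_space L)"
      then have "x - l \<in> F \<longleftrightarrow> l = l0" using l0 uniq by (metis space_count_space)
      then show "indicator F (x - l) = (indicator {l0} l :: ennreal)" by (simp add: indicator_def)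
    qed
    also have "\<dots> = 1" using conjunct1[OF l0] by simp
    finally show ?thesis .
  qed
  have Fm: "{x. x - l \<in> F} \<in> sets borel" for l using borel_translate[OF F(1), of "- l"] by simp
  have Xm: "{x. x + l \<in> X} \<in> sets borel" for l using borel_translate[OF X, of l] by (simp add: add.commute)
  have e1: "(\<lambda>x. indicator X x * indicator F (x - l) :: ennreal) = indicator (X \<inter> {x. x - l \<in> F})" for l
    by (rule ext) (simp add: indicator_def)
  have e2: "(\<lambda>x. indicator F x * indicator X (x + l) :: ennreal) = indicator (F \<inter> {x. x + l \<in> X})" for l
    by (rule ext) (simp add: indicator_def)
  have s1: "X \<inter> {x. x - l \<in> F} \<in> sets borel" and s2: "F \<inter> {x. x + l \<in> X} \<in> sets borel" for l
    using X F(1) Fm Xm by auto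
  have m1: "(\<lambda>x. indicator X x * indicator F (x - l) :: ennreal) \<in> borel_measurable (leb n)" for l
    unfolding e1 using s1 by (intro borel_measurable_indicator) simp
  have m2: "(\<lambda>x. indicator F x * indicator X (x + l) :: ennreal) \<in> borel_measurable (leb n)" for l
    unfolding e2 using s2 by (intro borel_measurable_indicator) simp
  have "emeasure (leb n) X = (\<integral>\<^sup>+x. indicator X x \<partial>leb n)" using X by simp
  also have "\<dots> = (\<integral>\<^sup>+x. \<integral>\<^sup>+l. indicator X x * indicator F (x - l) \<partial>count_space L \<partial>leb n)"
  proof (rule nn_integral_cong_AE, rule AE_mp[OF AE_leb_espace], rule AE_I2, rule impI)
    fix x assume "x \<in> espace n"
    then show "indicator X x = (\<integral>\<^sup>+l. indicator X x * indicator F (x - l) \<partial>count_space L)"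
      by (subst nn_integral_cmult) (simp_all add: one)
  qed
  also have "\<dots> = (\<integral>\<^sup>+l. \<integral>\<^sup>+x. indicator X x * indicator F (x - l) \<partial>leb n \<partial>count_space L)"
    by (rule nn_integral_count_space_nn_integral[OF L(1) m1])
  also have "\<dots> = (\<integral>\<^sup>+l. \<integral>\<^sup>+x. indicator F x * indicator X (x + l) \<partial>leb n \<partial>count_space L)"
  proof (rule nn_integral_cong)
    fix l assume "l \<in> space (count_space L)"
    then have l: "l \<in> espace n" using L by auto
    have "(\<integral>\<^sup>+x. indicator X x * indicator F (x - l) \<partial>leb n) = emeasure (leb n) (X \<inter> {x. x - l \<in> F})"
      unfolding e1 using s1 by (intro nn_integral_indicator) simp
    also have "\<dots> = emeasure (leb n) {x. l + x \<in> X \<inter> {x. x - l \<in> F}}"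
      by (rule emeasure_leb_translate[symmetric, OF s1 l])
    also have "\<dots> = emeasure (leb n) (F \<inter> {x. x + l \<in> X})"
      by (rule arg_cong2[where f=emeasure]) (auto simp: add.commute)
    also have "\<dots> = (\<integral>\<^sup>+x. indicator F x * indicator X (x + l) \<partial>leb n)"
      unfolding e2 using s2 by (intro nn_integral_indicator[symmetric]) simp
    finally show "(\<integral>\<^sup>+x. indicator X x * indicator F (x - l) \<partial>leb n) =
       (\<integral>\<^sup>+x. indicator F x * indicator X (x + l) \<partial>leb n)" .
  qed
  also have "\<dots> = (\<integral>\<^sup>+x. \<integral>\<^sup>+l. indicator F x * indicator X (x + l) \<partial>count_space L \<partial>leb n)"
    by (rule nn_integral_count_space_nn_integral[OF L(1) m2, symmetric])
  also have "\<dots> = (\<integral>\<^sup>+x. indicator F x * (\<integral>\<^sup>+l. indicator X (x + l) \<partial>count_space L) \<partial>leb n)"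
    by (simp add: nn_integral_cmult)
  finally show ?thesis .
qed

lemma nn_integral_count:
  assumes "finite {l\<in>L. x + l \<in> X}"
  shows "(\<integral>\<^sup>+l. indicator X (x + l) \<partial>count_space L) = ennreal (real (lcount L X x))"
proof -
  have "(\<integral>\<^sup>+l. indicator X (x + l) \<partial>count_space L) = (\<integral>\<^sup>+l. indicator {l\<in>L. x + l \<in> X} l \<partial>count_space L)"
    by (intro nn_integral_cong) (auto simp: indicator_def)
  also have "\<dots> = emeasure (count_space L) {l\<in>L. x + l \<in> X}" by (rule nn_integral_indicator) auto
  also have "\<dots> = ennreal (real (lcount L X x))" unfolding lcount_def
    using assms by (subst emeasure_count_space_finite) (auto simp: ennreal_of_nat_eq_real_of_nat)
  finally show ?thesis .
qed

text \<open>
  A second tiling set \<open>G\<close> meets each coset exactly once, so the average of its lattice count over \<open>F\<close> is \<open>1\<close>.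
\<close>

lemma tiles_emeasure_unique:
  assumes "tiles n (zspan n b) F" "tiles n (zspan n b) G" "zspan n b \<subseteq> espace n"
  shows "emeasure (leb n) F = emeasure (leb n) G"
proof -
  have G: "G \<in> sets borel" "\<And>x. x \<in> espace n \<Longrightarrow> \<exists>!l. l \<in> zspan n b \<and> x - l \<in> G"
    and F: "F \<in> sets borel" "F \<subseteq> espace n" using assms by (auto simp: tiles_def)
  have "emeasure (leb n) G = (\<integral>\<^sup>+x. indicator F x * (\<integral>\<^sup>+l. indicator G (x + l) \<partial>count_space (zspan n b)) \<partial>leb n)"
    by (rule emeasure_average[OF assms(1) countable_zspan assms(3) G(1)])
  also have "\<dots> = (\<integral>\<^sup>+x. indicator F x \<partial>leb n)"
  proof (rule nn_integral_cong)
    fix x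
    show "indicator F x * (\<integral>\<^sup>+l. indicator G (x + l) \<partial>count_space (zspan n b)) = (indicator F x :: ennreal)"
    proof (cases "x \<in> F")
      case True
      then obtain l0 where l0: "l0 \<in> zspan n b" "x - l0 \<in> G" "\<And>l. l \<in> zspan n b \<Longrightarrow> x - l \<in> G \<Longrightarrow> l = l0"
        using G(2)[OF subsetD[OF F(2) True]] by (elim ex1E) blast
      have "{l\<in>zspan n b. x + l \<in> G} = {- l0}"
      proof (intro equalityI subsetI)
        fix l assume "l \<in> {l\<in>zspan n b. x + l \<in> G}"
        then have "l \<in> zspan n b" "x - (- l) \<in> G" by simp_all
        then have "- l = l0" using l0(3) zspan_minus by blast
        then show "l \<in> {- l0}" by auto
      next
        fix l assume "l \<in> {- l0}"
        then show "l \<in> {l\<in>zspan n b. x + l \<in> G}" using l0(2) zspan_minus[OF l0(1)] by simp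
      qed
      then have "finite {l\<in>zspan n b. x + l \<in> G}" "lcount (zspan n b) G x = 1" by (simp_all add: lcount_def)
      then show ?thesis using nn_integral_count[of "zspan n b" x G] by simp
    qed simp
  qed
  also have "\<dots> = emeasure (leb n) F" using F by simp
  finally show ?thesis by simp
qed

lemma zspan_espace: "indep n b \<Longrightarrow> zspan n b \<subseteq> espace n"
  using lc_espace[of n b] by (auto simp: indep_def zspan_iff)

lemma lat_espace: "lat n L v \<Longrightarrow> L \<subseteq> espace n"
  using zspan_espace by (auto simp: lat_def)

lemma lat_group:
  assumes "lat n L v"
  shows "0 \<in> L" "x \<in> L \<Longrightarrow> y \<in> L \<Longrightarrow> x + y \<in> L" "x \<in> L \<Longrightarrow> y \<in> L \<Longrightarrow> x - y \<in> L"
    "x \<in> L \<Longrightarrow> - x \<in> L" "x \<in> L \<Longrightarrow> sc (of_int z) x \<in> L"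
  using assms zspan_0 zspan_add zspan_diff zspan_minus zspan_zsc by (auto simp: lat_def)

lemma lat_any_basis:
  assumes "lat n L v" "indep n b'" "L = zspan n b'"
  shows "spans n b'" "emeasure (leb n) (para n b') = ennreal v"
proof -
  obtain b where b: "indep n b" "spans n b" "L = zspan n b" "emeasure (leb n) (para n b) = ennreal v"
    using assms(1) by (auto simp: lat_def)
  have "\<exists>z::nat \<Rightarrow> int. b j = lc n (\<lambda>k. of_int (z k)) b'" if "j < n" for j
  proof -
    have "b j = lc n (\<lambda>k. of_int (if k = j then 1 else 0)) b"
      using lc_unit[OF that, of 1 b] by (simp add: if_distrib[of real_of_int] cong: if_cong)
    then have "b j \<in> L" unfolding b(3) zspan_iff by (rule exI[of _ "\<lambda>k. if k = j then 1 else 0"])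
    then show ?thesis using assms(3) by (simp add: zspan_iff)
  qed
  then obtain Z :: "nat \<Rightarrow> nat \<Rightarrow> int" where Z: "\<And>j. j < n \<Longrightarrow> b j = lc n (\<lambda>k. of_int (Z j k)) b'" by metis
  show sp: "spans n b'" unfolding spans_def
  proof
    fix x assume "x \<in> espace n"
    then obtain c where c: "lc n c b = x" using b by (auto simp: spans_def)
    have "x = lc n (\<lambda>k. \<Sum>j<n. c j * of_int (Z j k)) b'"
    proof
      fix i
      have "x i = (\<Sum>j<n. c j * lc n (\<lambda>k. of_int (Z j k)) b' i)"
        unfolding c[symmetric] lc_def[of n c b] by (intro sum.cong) (auto simp: Z)
      also have "\<dots> = lc n (\<lambda>k. \<Sum>j<n. c j * of_int (Z j k)) b' i"
        unfolding lc_def sum_distrib_left sum_distrib_right by (subst sum.swap) (simp add: mult.assoc)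
      finally show "x i = lc n (\<lambda>k. \<Sum>j<n. c j * of_int (Z j k)) b' i" .
    qed
    then show "\<exists>c. lc n c b' = x" by metis
  qed
  have "emeasure (leb n) (para n b') = emeasure (leb n) (para n b)"
    using para_tiles[OF b(1,2)] para_tiles[OF assms(2) sp] lat_espace[OF assms(1)] b(3) assms(3)
    by (intro tiles_emeasure_unique[of n b]) auto
  then show "emeasure (leb n) (para n b') = ennreal v" using b(4) by simp
qed

definition bdd :: "nat \<Rightarrow> (nat \<Rightarrow> real) set \<Rightarrow> bool" where
  "bdd n X \<longleftrightarrow> X \<subseteq> espace n \<and> (\<exists>D. \<forall>x\<in>X. \<forall>i<n. \<bar>x i\<bar> \<le> D)"

lemma finite_lattice_points:
  assumes "lat n L v" "bdd n X"
  shows "finite {l \<in> L. x + l \<in> X}"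
proof -
  obtain b where b: "indep n b" "spans n b" "L = zspan n b" using assms(1) by (auto simp: lat_def)
  obtain D where D: "\<And>x i. x \<in> X \<Longrightarrow> i < n \<Longrightarrow> \<bar>x i\<bar> \<le> D" using assms(2) by (auto simp: bdd_def)
  obtain C where C: "\<And>t j. j < n \<Longrightarrow> t j = (\<Sum>i<n. C j i * lc n t b i)" using dual_functionals[OF b(1,2)] by blast
  define M where "M = (\<lambda>j. \<lceil>\<Sum>i<n. \<bar>C j i\<bar> * (D + \<bar>x i\<bar>)\<rceil>)"
  have "{l \<in> L. x + l \<in> X} \<subseteq> (\<lambda>z. lc n (\<lambda>j. of_int (z j)) b) ` PiE {..<n} (\<lambda>j. {- M j..M j})"
  proof
    fix l assume l: "l \<in> {l \<in> L. x + l \<in> X}"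
    then obtain z where z: "z \<in> PiE {..<n} (\<lambda>_. UNIV :: int set)" "l = lc n (\<lambda>j. of_int (z j)) b"
      unfolding b(3) zspan_restrict_coeffs by blast
    have "\<bar>z j\<bar> \<le> M j" if "j < n" for j
    proof -
      have "\<bar>real_of_int (z j)\<bar> = \<bar>\<Sum>i<n. C j i * l i\<bar>" using C[OF that, of "\<lambda>j. of_int (z j)"] z by simp
      also have "\<dots> \<le> (\<Sum>i<n. \<bar>C j i * l i\<bar>)" by (rule sum_abs)
      also have "\<dots> \<le> (\<Sum>i<n. \<bar>C j i\<bar> * (D + \<bar>x i\<bar>))"
      proof (intro sum_mono)
        fix i assume "i \<in> {..<n}"
        then have "\<bar>x i + l i\<bar> \<le> D" using D[of "x + l" i] l by simp
        then have "\<bar>l i\<bar> \<le> D + \<bar>x i\<bar>" by linarith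
        then show "\<bar>C j i * l i\<bar> \<le> \<bar>C j i\<bar> * (D + \<bar>x i\<bar>)" by (simp add: abs_mult mult_left_mono)
      qed
      finally have "real_of_int \<bar>z j\<bar> \<le> (\<Sum>i<n. \<bar>C j i\<bar> * (D + \<bar>x i\<bar>))" by simp
      then have "real_of_int \<bar>z j\<bar> \<le> real_of_int (M j)" unfolding M_def using le_of_int_ceiling order_trans by blast
      then show ?thesis by (simp only: of_int_le_iff)
    qed
    then have "z j \<in> {- M j..M j}" if "j < n" for j using that by (fastforce simp: abs_le_iff)
    then have "z \<in> PiE {..<n} (\<lambda>j. {- M j..M j})" using z(1) by (auto simp: PiE_def Pi_def)
    then show "l \<in> (\<lambda>z. lc n (\<lambda>j. of_int (z j)) b) ` PiE {..<n} (\<lambda>j. {- M j..M j})" using z(2) by blast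
  qed
  moreover have "finite \<dots>" by (intro finite_imageI finite_PiE) auto
  ultimately show ?thesis by (rule finite_subset)
qed

lemma emeasure_bdd_finite:
  assumes "bdd n X"
  shows "emeasure (leb n) X < \<infinity>"
proof -
  obtain D where D: "\<And>x i. x \<in> X \<Longrightarrow> i < n \<Longrightarrow> \<bar>x i\<bar> \<le> D" using assms by (auto simp: bdd_def)
  define a where "a = (\<lambda>i. if i < n then \<bar>D\<bar> else 0)"
  define Q where "Q = {x. \<forall>i<n. 0 \<le> x i \<and> x i < 2 * \<bar>D\<bar> + 1}"
  have Q: "Q \<in> sets borel" "emeasure (leb n) Q = ennreal (2 * \<bar>D\<bar> + 1) ^ n"
    unfolding Q_def by (intro emeasure_leb_cube; simp)+
  have "X \<subseteq> {x. a + x \<in> Q}"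
  proof
    fix x assume x: "x \<in> X"
    have "0 \<le> \<bar>D\<bar> + x i \<and> \<bar>D\<bar> + x i < 2 * \<bar>D\<bar> + 1" if "i < n" for i using D[OF x that] by linarith
    then show "x \<in> {x. a + x \<in> Q}" by (auto simp: Q_def a_def)
  qed
  then have "emeasure (leb n) X \<le> emeasure (leb n) {x. a + x \<in> Q}"
    using borel_translate[OF Q(1)] by (intro emeasure_mono) auto
  also have "\<dots> = emeasure (leb n) Q" by (rule emeasure_leb_translate[OF Q(1)]) (simp add: a_def espace_def)
  also have "\<dots> = ennreal ((2 * \<bar>D\<bar> + 1) ^ n)" unfolding Q(2) by (rule ennreal_power) simp
  also have "\<dots> < \<infinity>" by (simp only: infinity_ennreal_def ennreal_less_top)
  finally show ?thesis .
qed

text \<open>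
  The measure of \<open>X\<close> is \<open>v\<close> times the average number of lattice points in a translate of \<open>X\<close>.
\<close>

lemma average_upper:
  assumes "lat n L v" "X \<in> sets borel" "bdd n X" "\<And>x. x \<in> espace n \<Longrightarrow> real (lcount L X x) \<le> c"
  shows "measure (leb n) X \<le> c * v"
proof -
  obtain b where b: "indep n b" "spans n b" "L = zspan n b" "emeasure (leb n) (para n b) = ennreal v" and v: "v > 0"
    using assms(1) by (auto simp: lat_def)
  have t: "tiles n L (para n b)" using para_tiles[OF b(1,2)] b(3) by simp
  have Fs: "para n b \<subseteq> espace n" "para n b \<in> sets borel" using t by (auto simp: tiles_def)
  have c0: "c \<ge> 0" using assms(4)[of 0] by (simp add: order_trans[OF of_nat_0_le_iff])
  have "emeasure (leb n) X = (\<integral>\<^sup>+x. indicator (para n b) x * (\<integral>\<^sup>+l. indicator X (x + l) \<partial>count_space L) \<partial>leb n)"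
    by (rule emeasure_average[OF t _ lat_espace[OF assms(1)] assms(2)]) (simp add: b(3) countable_zspan)
  also have "\<dots> \<le> (\<integral>\<^sup>+x. ennreal c * indicator (para n b) x \<partial>leb n)"
  proof (rule nn_integral_mono)
    fix x
    show "indicator (para n b) x * (\<integral>\<^sup>+l. indicator X (x + l) \<partial>count_space L) \<le> ennreal c * indicator (para n b) x"
    proof (cases "x \<in> para n b")
      case True
      then show ?thesis using assms(4)[of x] Fs
        by (auto simp: nn_integral_count[OF finite_lattice_points[OF assms(1,3)]] intro!: ennreal_leI)
    qed simp
  qed
  also have "\<dots> = ennreal c * ennreal v" using Fs b(4) by (simp add: nn_integral_cmult)
  also have "\<dots> = ennreal (c * v)" using c0 by (simp add: ennreal_mult')
  finally show ?thesis using c0 v by (simp add: measure_def enn2real_leI)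
qed

lemma average_lower:
  assumes "lat n L v" "X \<in> sets borel" "bdd n X" "\<And>x. x \<in> espace n \<Longrightarrow> c \<le> real (lcount L X x)" "c \<ge> 0"
  shows "c * v \<le> measure (leb n) X"
proof -
  obtain b where b: "indep n b" "spans n b" "L = zspan n b" "emeasure (leb n) (para n b) = ennreal v" and v: "v > 0"
    using assms(1) by (auto simp: lat_def)
  have t: "tiles n L (para n b)" using para_tiles[OF b(1,2)] b(3) by simp
  have Fs: "para n b \<subseteq> espace n" "para n b \<in> sets borel" using t by (auto simp: tiles_def)
  have "ennreal (c * v) = ennreal c * ennreal v" using assms(5) by (simp add: ennreal_mult')
  also have "\<dots> = (\<integral>\<^sup>+x. ennreal c * indicator (para n b) x \<partial>leb n)" using Fs b(4) by (simp add: nn_integral_cmult)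
  also have "\<dots> \<le> (\<integral>\<^sup>+x. indicator (para n b) x * (\<integral>\<^sup>+l. indicator X (x + l) \<partial>count_space L) \<partial>leb n)"
  proof (rule nn_integral_mono)
    fix x
    show "ennreal c * indicator (para n b) x \<le> indicator (para n b) x * (\<integral>\<^sup>+l. indicator X (x + l) \<partial>count_space L)"
    proof (cases "x \<in> para n b")
      case True
      then show ?thesis using assms(4)[of x] Fs
        by (auto simp: nn_integral_count[OF finite_lattice_points[OF assms(1,3)]] intro!: ennreal_leI)
    qed simp
  qed
  also have "\<dots> = emeasure (leb n) X"
    by (rule emeasure_average[symmetric, OF t _ lat_espace[OF assms(1)] assms(2)]) (simp add: b(3) countable_zspan)
  also have "\<dots> = ennreal (measure (leb n) X)"
    using emeasure_bdd_finite[OF assms(3)] by (intro emeasure_eq_ennreal_measure) auto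
  finally show ?thesis using measure_nonneg by (simp add: ennreal_le_iff)
qed

definition covers :: "nat \<Rightarrow> (nat \<Rightarrow> real) set \<Rightarrow> (nat \<Rightarrow> real) set \<Rightarrow> bool" where
  "covers n L D \<longleftrightarrow> (\<forall>x\<in>espace n. \<exists>l\<in>L. x - l \<in> D)"

text \<open>
  A point of the torus can be moved to any other one by an element of \<open>D\<close>; thickening \<open>X\<close> by \<open>D\<close> compensates for the move.
\<close>

lemma count_mono_cover:
  assumes L: "lat n L v" and D: "covers n L D" and Z: "bdd n Z"
    and XZ: "\<And>x d. x \<in> X \<Longrightarrow> d \<in> D \<Longrightarrow> x + d \<in> Z" and x: "x \<in> espace n" "x' \<in> espace n"
  shows "lcount L X x \<le> lcount L Z x'"
proof -
  obtain l0 where l0: "l0 \<in> L" "x' - x - l0 \<in> D"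
    using D espace_closed(2)[OF x(2,1)] by (auto simp: covers_def)
  have "card {l \<in> L. x + l \<in> X} \<le> card {l \<in> L. x' + l \<in> Z}"
  proof (rule card_inj_on_le[where f="\<lambda>l. l - l0"])
    show "(\<lambda>l. l - l0) ` {l \<in> L. x + l \<in> X} \<subseteq> {l \<in> L. x' + l \<in> Z}"
    proof clarify
      fix l assume l: "l \<in> L" "x + l \<in> X"
      have "(x + l) + (x' - x - l0) \<in> Z" by (rule XZ[OF l(2) l0(2)])
      moreover have "(x + l) + (x' - x - l0) = x' + (l - l0)" by (simp add: algebra_simps)
      ultimately show "l - l0 \<in> L \<and> x' + (l - l0) \<in> Z" using lat_group(3)[OF L l(1) l0(1)] by simp
    qed
  qed (auto simp: inj_on_def intro: finite_lattice_points[OF L Z])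
  then show ?thesis by (simp add: lcount_def)
qed

text \<open>
  With a covering set \<open>D\<close>, the count at one single point controls the average count. In this way counts are compared with
  volumes without any integral.
\<close>

lemma measure_le_count:
  assumes "lat n L v" "covers n L D" "bdd n X" "bdd n Y" "Y \<in> sets borel"
    "\<And>y d. y \<in> Y \<Longrightarrow> d \<in> D \<Longrightarrow> y + d \<in> X" "x \<in> espace n"
  shows "measure (leb n) Y \<le> real (lcount L X x) * v"
proof (rule average_upper[OF assms(1,5,4)])
  fix x' assume "x' \<in> espace n"
  then have "lcount L Y x' \<le> lcount L X x" using assms by (intro count_mono_cover[OF assms(1,2,3)]) auto
  then show "real (lcount L Y x') \<le> real (lcount L X x)" by simp
qed

lemma count_le_measure:
  assumes "lat n L v" "covers n L D" "bdd n Z" "Z \<in> sets borel"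
    "\<And>x d. x \<in> X \<Longrightarrow> d \<in> D \<Longrightarrow> x + d \<in> Z" "x \<in> espace n"
  shows "real (lcount L X x) * v \<le> measure (leb n) Z"
proof (rule average_lower[OF assms(1,4,3)])
  fix x' assume "x' \<in> espace n"
  then have "lcount L X x \<le> lcount L Z x'" using assms by (intro count_mono_cover[OF assms(1,2,3)]) auto
  then show "real (lcount L X x) \<le> real (lcount L Z x')" by simp
qed simp

section \<open>Cubic grids and scaling\<close>

definition zgrid :: "nat \<Rightarrow> real \<Rightarrow> (nat \<Rightarrow> real) set" where
  "zgrid n g = {x \<in> espace n. \<forall>i<n. \<exists>m::int. x i = g * of_int m}"

lemma lc_diagonal: "lc n t (\<lambda>j i. if i = j then g else 0) = (\<lambda>i. if i < n then g * t i else 0)"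
proof
  fix i
  have "lc n t (\<lambda>j i. if i = j then g else 0) i = (\<Sum>j<n. if j = i then g * t i else 0)"
    unfolding lc_def by (intro sum.cong) auto
  then show "lc n t (\<lambda>j i. if i = j then g else 0) i = (if i < n then g * t i else 0)" by simp
qed

lemma lat_zgrid:
  assumes "g > 0"
  shows "lat n (zgrid n g) (g ^ n)"
proof -
  define b :: "nat \<Rightarrow> nat \<Rightarrow> real" where "b = (\<lambda>j i. if i = j then g else 0)"
  have lcb: "lc n t b = (\<lambda>i. if i < n then g * t i else 0)" for t unfolding b_def by (rule lc_diagonal)
  have "indep n b" unfolding indep_def lcb
  proof (intro conjI allI impI)
    fix c j assume "(\<lambda>i. if i < n then g * c i else 0) = 0" "j < n"
    then show "c j = 0" using assms by (auto simp: fun_eq_iff split: if_splits)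
  qed (auto simp: b_def espace_def)
  moreover have "spans n b" unfolding spans_def
  proof
    fix x assume "x \<in> espace n"
    then have "lc n (\<lambda>i. x i / g) b = x" unfolding lcb using assms by (auto simp: espace_def fun_eq_iff)
    then show "\<exists>c. lc n c b = x" by blast
  qed
  moreover have "zgrid n g = zspan n b"
  proof (intro equalityI subsetI)
    fix x assume x: "x \<in> zgrid n g"
    define m where "m = (\<lambda>i. SOME m::int. x i = g * of_int m)"
    have m: "x i = g * of_int (m i)" if "i < n" for i
      unfolding m_def by (rule someI_ex) (use x that in \<open>simp add: zgrid_def\<close>)
    have "x = lc n (\<lambda>j. of_int (m j)) b" unfolding lcb using x m by (auto simp: zgrid_def espace_def fun_eq_iff)
    then show "x \<in> zspan n b" unfolding zspan_iff by (rule exI[of _ m])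
  next
    fix x assume "x \<in> zspan n b"
    then obtain z :: "nat \<Rightarrow> int" where "x = lc n (\<lambda>j. of_int (z j)) b" unfolding zspan_iff by (elim exE)
    then show "x \<in> zgrid n g" unfolding lcb by (auto simp: zgrid_def espace_def)
  qed
  moreover have "emeasure (leb n) (para n b) = ennreal (g ^ n)"
  proof -
    have "para n b = espace n \<inter> {x. \<forall>i<n. 0 \<le> x i \<and> x i < g}"
    proof (intro equalityI subsetI)
      fix x assume "x \<in> para n b"
      then obtain t where t: "x = lc n t b" "\<forall>j<n. 0 \<le> t j \<and> t j < 1" by (auto simp: para_def)
      then show "x \<in> espace n \<inter> {x. \<forall>i<n. 0 \<le> x i \<and> x i < g}" using assms by (auto simp: lcb espace_def)
    next
      fix x assume x: "x \<in> espace n \<inter> {x. \<forall>i<n. 0 \<le> x i \<and> x i < g}"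
      then have "x = lc n (\<lambda>i. x i / g) b" unfolding lcb using assms by (auto simp: espace_def fun_eq_iff)
      moreover have "\<forall>j<n. 0 \<le> x j / g \<and> x j / g < 1" using x assms by simp
      ultimately show "x \<in> para n b" unfolding para_def by blast
    qed
    then have "emeasure (leb n) (para n b) = emeasure (leb n) (espace n \<inter> {x. \<forall>i<n. 0 \<le> x i \<and> x i < g})" by simp
    also have "\<dots> = emeasure (leb n) {x. \<forall>i<n. 0 \<le> x i \<and> x i < g}"
      using emeasure_leb_cube(2)[of g n] assms borel_espace
      by (subst (1 2) emeasure_leb) (auto intro!: arg_cong2[where f=emeasure])
    also have "\<dots> = ennreal g ^ n" by (rule emeasure_leb_cube) (use assms in simp)
    also have "\<dots> = ennreal (g ^ n)" by (rule ennreal_power) (use assms in simp)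
    finally show ?thesis .
  qed
  ultimately show ?thesis unfolding lat_def using assms by (intro conjI exI[of _ b]) simp_all
qed

lemma lat_scale:
  assumes L: "lat n L v" and c: "c > 0"
  shows "lat n (sc c ` L) (c ^ n * v)"
proof -
  obtain b where b: "indep n b" "spans n b" "L = zspan n b" "emeasure (leb n) (para n b) = ennreal v" and v: "v > 0"
    using L by (auto simp: lat_def)
  define b' where "b' = (\<lambda>j. sc c (b j))"
  have lcb: "lc n t b' = sc c (lc n t b)" for t
    by (simp add: lc_def b'_def fun_eq_iff sum_distrib_left mult_ac)
  have sc0: "sc c x = 0 \<longleftrightarrow> x = 0" for x using c by (auto simp: fun_eq_iff)
  have "\<forall>j<n. b' j \<in> espace n" using b(1) by (simp add: indep_def b'_def espace_closed)
  moreover have "\<forall>t. lc n t b' = 0 \<longrightarrow> (\<forall>j<n. t j = 0)" using b(1) by (simp add: indep_def lcb sc0)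
  ultimately have "indep n b'" by (simp add: indep_def)
  moreover have "spans n b'" unfolding spans_def
  proof
    fix x assume "x \<in> espace n"
    then have "sc (1 / c) x \<in> espace n" by (rule espace_closed)
    then obtain t where "lc n t b = sc (1 / c) x" using b(2) unfolding spans_def by blast
    then have "lc n t b' = x" using c by (simp add: lcb)
    then show "\<exists>c. lc n c b' = x" by blast
  qed
  moreover have "sc c ` L = zspan n b'" unfolding b(3) zspan_def lcb by (simp add: image_image)
  moreover have "para n b' = sc c ` para n b" unfolding para_def lcb by auto
  moreover have "emeasure (leb n) (sc c ` para n b) = ennreal (c ^ n * v)"
    using para_tiles[OF b(1,2)] b(4) c v
    by (subst emeasure_leb_sc) (auto simp: tiles_def ennreal_power ennreal_mult')
  ultimately show ?thesis unfolding lat_def using c v by (intro conjI exI[of _ b']) simp_all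
qed

section \<open>Adjoining a vector of prime order\<close>

definition adjoin :: "(nat \<Rightarrow> real) set \<Rightarrow> (nat \<Rightarrow> real) \<Rightarrow> (nat \<Rightarrow> real) set" where
  "adjoin L h = {l + sc (of_int z) h | l z. l \<in> L}"

lemma adjoin_unique_rep:
  assumes L: "lat n L v" and p: "prime (p::nat)" and ph: "sc (real p) h \<in> L" and h: "h \<notin> L"
    and eq: "l + sc (real t) h = l' + sc (real t') h" "l \<in> L" "l' \<in> L" "t < p" "t' < p"
  shows "t = t'"
proof (rule ccontr)
  assume ne: "t \<noteq> t'"
  define d where "d = int t - int t'"
  have "sc (of_int d) h = l' - l"
    using eq(1) by (simp add: d_def fun_eq_iff algebra_simps)
  then have dh: "sc (of_int d) h \<in> L" using lat_group(3)[OF L] eq by simp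
  have "coprime d (int p)"
  proof -
    have "\<not> int p dvd d"
      using ne eq(4,5) zdvd_not_zless[of "\<bar>d\<bar>" "int p"] by (auto simp: d_def)
    then show ?thesis using p by (metis coprime_commute prime_imp_coprime prime_nat_int_transfer)
  qed
  then obtain x y where xy: "x * d + y * int p = 1" by (metis bezout_int coprime_imp_gcd_eq_1)
  have "sc (of_int x) (sc (of_int d) h) + sc (of_int y) (sc (of_int (int p)) h) = sc (of_int (x * d + y * int p)) h"
    by (simp add: fun_eq_iff algebra_simps)
  also have "\<dots> = h" unfolding xy by simp
  finally show False using h lat_group[OF L] dh ph by (metis of_int_of_nat_eq)
qed

lemma adjoin_reps:
  assumes L: "lat n L v" and p: "prime (p::nat)" and ph: "sc (real p) h \<in> L" and x: "x \<in> adjoin L h"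
  shows "\<exists>l\<in>L. \<exists>t<p. x = l + sc (real t) h"
proof -
  obtain l z where lz: "x = l + sc (of_int z) h" "l \<in> L" using x by (auto simp: adjoin_def)
  define t where "t = nat (z mod int p)"
  have p0: "int p > 0" using prime_gt_0_nat[OF p] by simp
  then have t: "t < p" "z = int t + (z div int p) * int p" by (simp_all add: t_def nat_less_iff)
  have "sc (of_int z) h = sc (real t) h + sc (of_int (z div int p)) (sc (real p) h)"
    by (subst t(2)) (simp add: fun_eq_iff algebra_simps)
  then have "x = (l + sc (of_int (z div int p)) (sc (real p) h)) + sc (real t) h" using lz by (simp add: algebra_simps)
  moreover have "l + sc (of_int (z div int p)) (sc (real p) h) \<in> L" by (rule lat_group(2)[OF L lz(2) lat_group(5)[OF L ph]])
  ultimately show ?thesis using t(1) by blast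
qed

text \<open>
  Replace a suitable basis vector \<open>b j0\<close>. Some coefficient \<open>a j0\<close> of \<open>p h\<close> is prime to \<open>p\<close>; a multiple \<open>s h\<close> with
  \<open>s * a j0 = 1 + p m\<close> has the coefficient \<open>1 / p + m\<close> there, and \<open>h' = s h - m (b j0)\<close> has the coefficient \<open>1 / p\<close>.
\<close>

lemma adjoin_basis:
  assumes b: "indep n b" "spans n b" and p: "prime (p::nat)" and he: "h \<in> espace n"
    and ph: "sc (real p) h \<in> zspan n b" and h: "h \<notin> zspan n b"
  shows "\<exists>b'. indep n b' \<and> spans n b' \<and> adjoin (zspan n b) h = zspan n b'"
proof -
  have p0: "real p > 0" using prime_gt_0_nat[OF p] by simp
  obtain a :: "nat \<Rightarrow> int" where a: "sc (real p) h = lc n (\<lambda>j. of_int (a j)) b" using ph unfolding zspan_iff by (elim exE)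
  have h_eq: "h = lc n (\<lambda>j. of_int (a j) / p) b"
  proof -
    have "h = sc (1 / p) (sc (real p) h)" using p0 by simp
    also have "\<dots> = lc n (\<lambda>j. (1 / p) * of_int (a j)) b" unfolding a lc_sc ..
    finally show ?thesis by simp
  qed
  have "\<exists>j<n. \<not> int p dvd a j"
  proof (rule ccontr)
    assume "\<not> ?thesis"
    then have "of_int (a j) / real p = of_int (a j div int p)" if "j < n" for j
      using that p0 by (simp add: real_of_int_div)
    then have "h = lc n (\<lambda>j. of_int (a j div int p)) b" unfolding h_eq by (intro lc_cong) simp
    then have "h \<in> zspan n b" unfolding zspan_iff by (rule exI[of _ "\<lambda>j. a j div int p"])
    then show False using h by blast
  qed
  then obtain j0 where j0: "j0 < n" "\<not> int p dvd a j0" by blast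
  then have "coprime (a j0) (int p)" using p by (metis coprime_commute prime_imp_coprime prime_nat_int_transfer)
  then obtain s m' where "s * a j0 + m' * int p = 1" by (metis bezout_int coprime_imp_gcd_eq_1)
  then have "s * a j0 = 1 + int p * (- m')" by (simp add: algebra_simps)
  then obtain m where sm: "s * a j0 = 1 + int p * m" by blast
  define h' where "h' = sc (of_int s) h - sc (of_int m) (b j0)"
  define b' where "b' = b(j0 := h')"
  have bj0: "lc n (\<lambda>k. if k = j0 then c else 0) b = sc c (b j0)" for c by (rule lc_unit[OF j0(1)])
  have be: "\<And>j. j < n \<Longrightarrow> b j \<in> espace n" using b by (simp add: indep_def)
  have h'_eq: "h' = lc n (\<lambda>j. (if j = j0 then 1 else of_int (s * a j)) / p) b"
  proof -
    have "h' = lc n (\<lambda>j. of_int s * (of_int (a j) / p) - (if j = j0 then of_int m else 0)) b"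
      unfolding h'_def lc_diff bj0 lc_sc h_eq[symmetric] ..
    also have "\<dots> = lc n (\<lambda>j. (if j = j0 then 1 else of_int (s * a j)) / p) b"
    proof (rule lc_cong)
      fix j
      show "of_int s * (of_int (a j) / p) - (if j = j0 then of_int m else 0) = (if j = j0 then 1 else of_int (s * a j)) / real p"
      proof (cases "j = j0")
        case True
        have "real_of_int (s * a j0) = 1 + real p * of_int m" unfolding sm by simp
        then show ?thesis using True p0 by (simp add: field_simps)
      qed simp
    qed
    finally show ?thesis .
  qed
  have key: "lc n c b' = lc n (\<lambda>j. if j = j0 then c j0 / p else c j + c j0 * of_int (s * a j) / p) b" for c
  proof -
    have "lc n c b' = lc n (\<lambda>j. (if j = j0 then 0 else c j)) b + sc (c j0) h'"
    proof
      fix i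
      have "lc n c b' i = (\<Sum>j<n. (if j = j0 then 0 else c j) * b j i + (if j = j0 then c j0 * h' i else 0))"
        unfolding lc_def b'_def by (intro sum.cong) auto
      also have "\<dots> = lc n (\<lambda>j. (if j = j0 then 0 else c j)) b i + c j0 * h' i"
        using j0(1) by (simp add: sum.distrib lc_def)
      finally show "lc n c b' i = (lc n (\<lambda>j. (if j = j0 then 0 else c j)) b + sc (c j0) h') i" by simp
    qed
    also have "sc (c j0) h' = lc n (\<lambda>j. c j0 * ((if j = j0 then 1 else of_int (s * a j)) / p)) b"
      unfolding h'_eq lc_sc ..
    finally show ?thesis unfolding lc_add[symmetric] by (auto intro!: lc_cong)
  qed
  have h'L: "h' \<in> adjoin (zspan n b) h"
  proof -
    have "b j0 \<in> zspan n b" using bj0[of 1] unfolding zspan_iff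
      by (intro exI[of _ "\<lambda>k. if k = j0 then 1 else 0"]) (simp add: if_distrib[of real_of_int] cong: if_cong)
    then have "- sc (of_int m) (b j0) \<in> zspan n b" by (intro zspan_minus zspan_zsc)
    moreover have "h' = - sc (of_int m) (b j0) + sc (of_int s) h" by (simp add: h'_def)
    ultimately show ?thesis unfolding adjoin_def by blast
  qed
  have ind: "indep n b'" unfolding indep_def
  proof (intro conjI allI impI)
    show "b' j \<in> espace n" if "j < n" for j
      using that be he j0 by (auto simp: b'_def h'_def intro!: espace_closed)
    fix c j assume c: "lc n c b' = 0" and j: "j < n"
    then have "lc n (\<lambda>j. if j = j0 then c j0 / p else c j + c j0 * of_int (s * a j) / p) b = 0" by (simp only: key)
    then have *: "\<forall>j<n. (if j = j0 then c j0 / p else c j + c j0 * of_int (s * a j) / p) = 0"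
      using b(1) unfolding indep_def by blast
    then have "c j0 = 0" using j0(1) p0 by (auto dest!: spec[of _ j0])
    then show "c j = 0" using * j by (auto dest!: spec[of _ j] split: if_splits)
  qed
  have coeffs: "lc n t b = lc n (\<lambda>j. if j = j0 then real p * t j0 else t j - t j0 * of_int (s * a j)) b'" for t
    unfolding key using p0 by (auto intro!: lc_cong)
  have sp: "spans n b'" unfolding spans_def
  proof
    fix x assume "x \<in> espace n"
    then obtain t where "lc n t b = x" using b(2) by (auto simp: spans_def)
    then show "\<exists>c. lc n c b' = x" using coeffs[of t] by metis
  qed
  have sub: "zspan n b \<subseteq> zspan n b'"
  proof
    fix x assume "x \<in> zspan n b"
    then obtain z :: "nat \<Rightarrow> int" where "x = lc n (\<lambda>j. of_int (z j)) b" unfolding zspan_iff by (elim exE)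
    then have "x = lc n (\<lambda>j. if j = j0 then real p * of_int (z j0) else of_int (z j) - of_int (z j0) * of_int (s * a j)) b'"
      using coeffs by simp
    also have "\<dots> = lc n (\<lambda>j. of_int (if j = j0 then int p * z j0 else z j - z j0 * (s * a j))) b'"
      by (intro lc_cong) simp
    finally show "x \<in> zspan n b'" unfolding zspan_iff by (rule exI[of _ "\<lambda>j. if j = j0 then int p * z j0 else z j - z j0 * (s * a j)"])
  qed
  have hin: "h \<in> zspan n b'"
  proof -
    have "h = lc n (\<lambda>j. if j = j0 then real p * (of_int (a j0) / p) else of_int (a j) / p - (of_int (a j0) / p) * of_int (s * a j)) b'"
      unfolding h_eq by (subst coeffs) (rule refl)
    also have "\<dots> = lc n (\<lambda>j. of_int (if j = j0 then a j0 else - (a j * m))) b'"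
    proof (rule lc_cong)
      fix j
      have "of_int (a j) / p - (of_int (a j0) / p) * of_int (s * a j) = of_int (a j * (1 - s * a j0)) / real p"
        by (simp add: diff_divide_distrib algebra_simps)
      also have "1 - s * a j0 = - (int p * m)" using sm by simp
      finally have "of_int (a j) / p - (of_int (a j0) / p) * of_int (s * a j) = - (of_int (a j) * of_int m)"
        using p0 by simp
      then show "(if j = j0 then real p * (of_int (a j0) / p) else of_int (a j) / p - (of_int (a j0) / p) * of_int (s * a j)) =
         of_int (if j = j0 then a j0 else - (a j * m))" using p0 by simp
    qed
    finally show ?thesis unfolding zspan_iff by (rule exI[of _ "\<lambda>j. if j = j0 then a j0 else - (a j * m)"])
  qed
  have "adjoin (zspan n b) h = zspan n b'"
  proof (intro equalityI subsetI)
    fix x assume "x \<in> adjoin (zspan n b) h"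
    then obtain l z where lz: "x = l + sc (of_int z) h" "l \<in> zspan n b" unfolding adjoin_def by blast
    show "x \<in> zspan n b'" unfolding lz(1) using sub lz(2) hin by (intro zspan_add zspan_zsc) auto
  next
    fix x assume "x \<in> zspan n b'"
    then obtain z :: "nat \<Rightarrow> int" where z: "x = lc n (\<lambda>j. of_int (z j)) b'" unfolding zspan_iff by (elim exE)
    have "x = lc n (\<lambda>j. of_int (if j = j0 then 0 else z j)) b + sc (of_int (z j0)) h'"
    proof
      fix i
      have "x i = (\<Sum>j<n. of_int (if j = j0 then 0 else z j) * b j i + (if j = j0 then of_int (z j0) * h' i else 0))"
        unfolding z lc_def b'_def by (intro sum.cong) auto
      also have "\<dots> = lc n (\<lambda>j. of_int (if j = j0 then 0 else z j)) b i + of_int (z j0) * h' i"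
        using j0(1) by (simp add: sum.distrib lc_def)
      finally show "x i = (lc n (\<lambda>j. of_int (if j = j0 then 0 else z j)) b + sc (of_int (z j0)) h') i" by simp
    qed
    moreover obtain l w where "h' = l + sc (of_int w) h" "l \<in> zspan n b" using h'L by (auto simp: adjoin_def)
    ultimately have "x = (lc n (\<lambda>j. of_int (if j = j0 then 0 else z j)) b + sc (of_int (z j0)) l) + sc (of_int (z j0 * w)) h"
      by (simp add: sc_add algebra_simps)
    moreover have "lc n (\<lambda>j. of_int (if j = j0 then 0 else z j)) b + sc (of_int (z j0)) l \<in> zspan n b"
      by (intro zspan_add zspan_zsc \<open>l \<in> zspan n b\<close>) (unfold zspan_iff, rule exI[of _ "\<lambda>j. if j = j0 then 0 else z j"], rule refl)
    ultimately show "x \<in> adjoin (zspan n b) h" unfolding adjoin_def by blast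
  qed
  then show ?thesis using ind sp by blast
qed

text \<open>
  The \<open>p\<close> translates of a tiling set for \<open>adjoin L h\<close> by multiples of \<open>h\<close> are disjoint and form a tiling set for \<open>L\<close>.
\<close>

lemma adjoin_covolume:
  assumes L: "lat n L v" and p: "prime (p::nat)" and he: "h \<in> espace n"
    and ph: "sc (real p) h \<in> L" and h: "h \<notin> L"
  shows "lat n (adjoin L h) (v / p)"
proof -
  obtain b where b: "indep n b" "spans n b" "L = zspan n b" "emeasure (leb n) (para n b) = ennreal v" and v: "v > 0"
    using L by (auto simp: lat_def)
  obtain b' where b': "indep n b'" "spans n b'" "adjoin L h = zspan n b'"
    using adjoin_basis[OF b(1,2) p he] ph h b(3) by blast
  have p0: "real p > 0" using prime_gt_0_nat[OF p] by simp
  define F where "F = para n b'"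
  have tF: "F \<in> sets borel" "F \<subseteq> espace n" and exF: "\<And>x. x \<in> espace n \<Longrightarrow> \<exists>!l. l \<in> adjoin L h \<and> x - l \<in> F"
    using para_tiles[OF b'(1,2)] b'(3) by (simp_all add: tiles_def F_def)
  define G where "G = (\<lambda>t. {x. - sc (real t) h + x \<in> F})"
  have Gm: "G t \<in> sets borel" for t unfolding G_def by (rule borel_translate[OF tF(1)])
  have Ge: "G t \<subseteq> espace n" for t
  proof
    fix x assume "x \<in> G t"
    then have "- sc (real t) h + x \<in> espace n" using tF(2) by (auto simp: G_def)
    from espace_closed(1)[OF espace_closed(4)[OF he] this]
    have "sc (real t) h + (- sc (real t) h + x) \<in> espace n" .
    moreover have "sc (real t) h + (- sc (real t) h + x) = x" by simp
    ultimately show "x \<in> espace n" by (simp only:)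
  qed
  have inA: "l + sc (real t) h \<in> adjoin L h" if "l \<in> L" for l t
    unfolding adjoin_def using that by (metis (mono_tags, lifting) mem_Collect_eq of_int_of_nat_eq)
  have disj: "t = t'" if x: "x \<in> espace n" "l \<in> L" "l' \<in> L" "t < p" "t' < p" "x - l \<in> G t" "x - l' \<in> G t'" for x l l' t t'
  proof -
    have "x - (l + sc (real t) h) \<in> F" "x - (l' + sc (real t') h) \<in> F"
      using x by (simp_all add: G_def algebra_simps)
    then have "l + sc (real t) h = l' + sc (real t') h" using exF[OF x(1)] inA x(2,3) by (metis (no_types, lifting))
    then show ?thesis using adjoin_unique_rep[OF L p ph h] x by blast
  qed
  have "tiles n L (\<Union>t<p. G t)" unfolding tiles_def
  proof (intro conjI ballI)
    show "(\<Union>t<p. G t) \<in> sets borel" using Gm by (intro sets.finite_UN) auto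
    show "(\<Union>t<p. G t) \<subseteq> espace n" using Ge by blast
    fix x assume x: "x \<in> espace n"
    obtain y where y: "y \<in> adjoin L h" "x - y \<in> F" using ex1_implies_ex[OF exF[OF x]] by blast
    obtain l t where lt: "l \<in> L" "t < p" "y = l + sc (real t) h" using adjoin_reps[OF L p ph y(1)] by blast
    show "\<exists>!l. l \<in> L \<and> x - l \<in> (\<Union>t<p. G t)"
    proof (rule ex1I)
      have "x - l \<in> G t" using y lt by (simp add: G_def algebra_simps)
      then show "l \<in> L \<and> x - l \<in> (\<Union>t<p. G t)" using lt by blast
      fix l' assume "l' \<in> L \<and> x - l' \<in> (\<Union>t<p. G t)"
      then obtain t' where t': "l' \<in> L" "t' < p" "x - l' \<in> G t'" by blast
      have tt: "t = t'" using disj[OF x lt(1) t'(1) lt(2) t'(2) \<open>x - l \<in> G t\<close> t'(3)] .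
      have "x - (l + sc (real t) h) \<in> F" "x - (l' + sc (real t') h) \<in> F"
        using \<open>x - l \<in> G t\<close> t'(3) by (simp_all add: G_def algebra_simps)
      then have "l + sc (real t) h = l' + sc (real t') h" using exF[OF x] inA lt(1) t'(1) by (metis (no_types, lifting))
      then show "l' = l" unfolding tt by simp
    qed
  qed
  then have "emeasure (leb n) (\<Union>t<p. G t) = ennreal v"
    using tiles_emeasure_unique[of n b "para n b" "\<Union>t<p. G t"] para_tiles[OF b(1,2)] zspan_espace[OF b(1)] b(3,4) by simp
  moreover have "emeasure (leb n) (\<Union>t<p. G t) = (\<Sum>t<p. emeasure (leb n) (G t))"
  proof (rule sum_emeasure[symmetric])
    show "disjoint_family_on G {..<p}" unfolding disjoint_family_on_def
    proof (intro ballI impI)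
      fix t t' assume t: "t \<in> {..<p}" "t' \<in> {..<p}" "t \<noteq> t'"
      show "G t \<inter> G t' = {}"
      proof (rule ccontr)
        assume "G t \<inter> G t' \<noteq> {}"
        then obtain x where x: "x \<in> G t" "x \<in> G t'" by blast
        have "x \<in> espace n" using x Ge by blast
        from disj[OF this lat_group(1)[OF L] lat_group(1)[OF L], of t t'] x t show False by simp
      qed
    qed
  qed (use Gm in auto)
  moreover have "emeasure (leb n) (G t) = emeasure (leb n) F" for t
    unfolding G_def by (rule emeasure_leb_translate[OF tF(1)]) (use he in \<open>intro espace_closed\<close>)
  ultimately have *: "of_nat p * emeasure (leb n) F = ennreal v" by simp
  have fin: "emeasure (leb n) F \<noteq> \<infinity>"
  proof
    assume "emeasure (leb n) F = \<infinity>"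
    then show False using * p0 by (simp add: ennreal_mult_top)
  qed
  define f where "f = enn2real (emeasure (leb n) F)"
  have f: "emeasure (leb n) F = ennreal f" "f \<ge> 0" using fin unfolding f_def by (auto simp: less_top)
  have "ennreal (real p * f) = ennreal v"
    using * f by (simp add: ennreal_mult' ennreal_of_nat_eq_real_of_nat)
  then have "real p * f = v" using f v by (subst (asm) ennreal_inj) auto
  then have "f = v / p" using p0 by (simp add: field_simps)
  then show ?thesis unfolding lat_def using b' f v p0 F_def by (intro conjI exI[of _ b']) simp_all
qed

lemma lcount_lattice_shift:
  assumes L: "lat n L v" and l0: "l0 \<in> L"
  shows "lcount L X (x + l0) = lcount L X x"
proof -
  have "bij_betw (\<lambda>l. l0 + l) {l \<in> L. x + l0 + l \<in> X} {l \<in> L. x + l \<in> X}"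
  proof (rule bij_betw_byWitness[where f'="\<lambda>l. l - l0"])
    show "(\<lambda>l. l0 + l) ` {l \<in> L. x + l0 + l \<in> X} \<subseteq> {l \<in> L. x + l \<in> X}"
      using lat_group(2)[OF L l0] by (auto simp: add.assoc)
    show "(\<lambda>l. l - l0) ` {l \<in> L. x + l \<in> X} \<subseteq> {l \<in> L. x + l0 + l \<in> X}"
    proof (rule image_subsetI)
      fix l assume "l \<in> {l \<in> L. x + l \<in> X}"
      moreover have "x + l0 + (l - l0) = x + l" by simp
      ultimately show "l - l0 \<in> {l \<in> L. x + l0 + l \<in> X}"
        using lat_group(3)[OF L _ l0] by simp
    qed
  qed auto
  then show ?thesis unfolding lcount_def by (rule bij_betw_same_card)
qed

text \<open>
  A version that also admits \<open>h \<in> L\<close>, in which case nothing changes. This spares the discussion whether the vectors adjoined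
  later are independent modulo \<open>L\<close>; degenerate vectors only make the lattice less dense than announced, whence the
  inequality \<open>v \<le> real p * v'\<close>.
\<close>

lemma adjoin_count:
  assumes L: "lat n L v" and p: "prime (p::nat)" and he: "h \<in> espace n" and ph: "sc (real p) h \<in> L"
  shows "\<exists>v'. lat n (adjoin L h) v' \<and> v \<le> real p * v' \<and>
     (\<forall>X x. bdd n X \<longrightarrow> v' * real (lcount (adjoin L h) X x) = v / p * (\<Sum>t<p. real (lcount L X (x + sc (real t) h))))"
proof (cases "h \<in> L")
  case True
  have p0: "real p > 0" using prime_gt_0_nat[OF p] by simp
  have v: "v > 0" using L by (simp add: lat_def)
  have "adjoin L h = L"
  proof (intro equalityI subsetI)
    fix x assume "x \<in> adjoin L h"
    then obtain l z where "x = l + sc (of_int z) h" "l \<in> L" unfolding adjoin_def by blast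
    then show "x \<in> L" using lat_group(2)[OF L _ lat_group(5)[OF L True]] by simp
  next
    fix x assume "x \<in> L"
    then show "x \<in> adjoin L h" unfolding adjoin_def by (intro CollectI exI[of _ x] exI[of _ 0]) simp
  qed
  moreover have "lcount L X (x + sc (real t) h) = lcount L X x" for X x t
    using lcount_lattice_shift[OF L lat_group(5)[OF L True, of "int t"]] by simp
  moreover have "v * 1 \<le> v * real p" using v prime_gt_0_nat[OF p] by (intro mult_left_mono) auto
  ultimately show ?thesis using L p0 by (intro exI[of _ v]) (simp add: mult.commute)
next
  case False
  have p0: "real p > 0" using prime_gt_0_nat[OF p] by simp
  have inA: "l + sc (real t) h \<in> adjoin L h" if "l \<in> L" for l t
    unfolding adjoin_def using that by (metis (mono_tags, lifting) mem_Collect_eq of_int_of_nat_eq)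
  have "lcount (adjoin L h) X x = (\<Sum>t<p. lcount L X (x + sc (real t) h))" if X: "bdd n X" for X x
  proof -
    have "{l\<in>adjoin L h. x + l \<in> X} = (\<Union>t<p. (\<lambda>l. l + sc (real t) h) ` {l\<in>L. (x + sc (real t) h) + l \<in> X})"
    proof (intro equalityI subsetI)
      fix y assume y: "y \<in> {l\<in>adjoin L h. x + l \<in> X}"
      then obtain l t where lt: "l \<in> L" "t < p" "y = l + sc (real t) h" using adjoin_reps[OF L p ph] by blast
      then have "l \<in> {l\<in>L. (x + sc (real t) h) + l \<in> X}" using y by (simp add: algebra_simps)
      then show "y \<in> (\<Union>t<p. (\<lambda>l. l + sc (real t) h) ` {l\<in>L. (x + sc (real t) h) + l \<in> X})" using lt by blast
    next
      fix y assume "y \<in> (\<Union>t<p. (\<lambda>l. l + sc (real t) h) ` {l\<in>L. (x + sc (real t) h) + l \<in> X})"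
      then show "y \<in> {l\<in>adjoin L h. x + l \<in> X}" using inA by (auto simp: algebra_simps)
    qed
    moreover have "card (\<Union>t<p. (\<lambda>l. l + sc (real t) h) ` {l\<in>L. (x + sc (real t) h) + l \<in> X}) =
        (\<Sum>t<p. card ((\<lambda>l. l + sc (real t) h) ` {l\<in>L. (x + sc (real t) h) + l \<in> X}))"
    proof (rule card_UN_disjoint)
      show "\<forall>t\<in>{..<p}. finite ((\<lambda>l. l + sc (real t) h) ` {l\<in>L. (x + sc (real t) h) + l \<in> X})"
        using finite_lattice_points[OF L X] by simp
      show "\<forall>t\<in>{..<p}. \<forall>t'\<in>{..<p}. t \<noteq> t' \<longrightarrow> (\<lambda>l. l + sc (real t) h) ` {l\<in>L. (x + sc (real t) h) + l \<in> X} \<inter>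
          (\<lambda>l. l + sc (real t') h) ` {l\<in>L. (x + sc (real t') h) + l \<in> X} = {}"
        using adjoin_unique_rep[OF L p ph False] by blast
    qed simp
    ultimately show ?thesis unfolding lcount_def by (simp add: card_image inj_on_def)
  qed
  then show ?thesis using adjoin_covolume[OF L p he ph False] p0
    by (intro exI[of _ "v / p"]) (simp add: field_simps)
qed

section \<open>Convex bodies\<close>

definition cvx :: "(nat \<Rightarrow> real) set \<Rightarrow> bool" where
  "cvx K \<longleftrightarrow> (\<forall>x\<in>K. \<forall>y\<in>K. \<forall>u\<ge>0. \<forall>v\<ge>0. u + v = 1 \<longrightarrow> sc u x + sc v y \<in> K)"

definition body :: "nat \<Rightarrow> (nat \<Rightarrow> real) set \<Rightarrow> bool" where
  "body n K \<longleftrightarrow> K \<in> sets borel \<and> bdd n K \<and> cvx K"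

definition cube :: "nat \<Rightarrow> real \<Rightarrow> (nat \<Rightarrow> real) set" where
  "cube n r = {x \<in> espace n. \<forall>i<n. \<bar>x i\<bar> \<le> r}"

lemma cube_0: "r \<ge> 0 \<Longrightarrow> 0 \<in> cube n r" by (simp add: cube_def)

lemma cube_mono: "r \<le> s \<Longrightarrow> cube n r \<subseteq> cube n s" by (auto simp: cube_def)

lemma cube_scale: assumes "r > 0" "d \<in> cube n (t * r)" "t > 0" shows "d \<in> sc t ` cube n r"
proof (rule image_eqI[where x="sc (1 / t) d"])
  show "d = sc t (sc (1 / t) d)" using assms by simp
  show "sc (1 / t) d \<in> cube n r" using assms by (auto simp: cube_def espace_closed abs_mult divide_le_eq mult.commute)
qed

lemma bdd_subset: "bdd n X \<Longrightarrow> Y \<subseteq> X \<Longrightarrow> bdd n Y" unfolding bdd_def by blast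

lemma bdd_sc: "bdd n X \<Longrightarrow> bdd n (sc t ` X)"
proof -
  assume "bdd n X"
  then obtain D where X: "X \<subseteq> espace n" and D: "\<And>x i. x \<in> X \<Longrightarrow> i < n \<Longrightarrow> \<bar>x i\<bar> \<le> D" by (auto simp: bdd_def)
  have "\<bar>(sc t x) i\<bar> \<le> \<bar>t\<bar> * D" if "x \<in> X" "i < n" for x i
    using D[OF that] by (simp add: abs_mult mult_left_mono)
  then have "\<exists>D. \<forall>x\<in>sc t ` X. \<forall>i<n. \<bar>x i\<bar> \<le> D" by blast
  moreover have "sc t ` X \<subseteq> espace n" using X espace_closed(4) by blast
  ultimately show ?thesis unfolding bdd_def by blast
qed

lemma bdd_diff:
  assumes "bdd n X" "bdd n Y" shows "bdd n {x - y | x y. x \<in> X \<and> y \<in> Y}"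
proof -
  obtain D where X: "X \<subseteq> espace n" and D: "\<And>x i. x \<in> X \<Longrightarrow> i < n \<Longrightarrow> \<bar>x i\<bar> \<le> D" using assms(1) by (auto simp: bdd_def)
  obtain D' where Y: "Y \<subseteq> espace n" and D': "\<And>x i. x \<in> Y \<Longrightarrow> i < n \<Longrightarrow> \<bar>x i\<bar> \<le> D'" using assms(2) by (auto simp: bdd_def)
  have b: "\<bar>(x - y) i\<bar> \<le> D + D'" if "x \<in> X" "y \<in> Y" "i < n" for x y i
    using D[OF that(1,3)] D'[OF that(2,3)] by simp
  have e: "x - y \<in> espace n" if "x \<in> X" "y \<in> Y" for x y using that X Y espace_closed(2) by blast
  show ?thesis unfolding bdd_def using b e by blast
qed

lemma cvx_sc: assumes "cvx K" shows "cvx (sc t ` K)"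
  unfolding cvx_def
proof (intro ballI allI impI)
  fix x y u v assume xy: "x \<in> sc t ` K" "y \<in> sc t ` K" and uv: "(0::real) \<le> u" "(0::real) \<le> v" "u + v = 1"
  then obtain a b where ab: "x = sc t a" "y = sc t b" "a \<in> K" "b \<in> K" by blast
  have "sc u a + sc v b \<in> K" using assms ab(3,4) uv unfolding cvx_def by blast
  moreover have "sc u x + sc v y = sc t (sc u a + sc v b)" unfolding ab by (simp add: sc_add mult.commute)
  ultimately show "sc u x + sc v y \<in> sc t ` K" by blast
qed

lemma body_sc: assumes "body n K" "t > 0" shows "body n (sc t ` K)"
  using assms emeasure_leb_sc(2)[of t K] bdd_sc[of n K t] cvx_sc[of K t] by (simp add: body_def)

lemma measure_sc:
  assumes "body n K" "t > 0" shows "measure (leb n) (sc t ` K) = t ^ n * measure (leb n) K"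
proof -
  have "emeasure (leb n) (sc t ` K) = ennreal t ^ n * emeasure (leb n) K"
    using assms by (intro emeasure_leb_sc) (auto simp: body_def)
  then show ?thesis using assms(2) by (simp add: measure_def enn2real_mult ennreal_power)
qed

text \<open>
  Convexity in the form \<open>s K + t K \<subseteq> (s + t) K\<close>.
\<close>

lemma sc_image_add:
  assumes "cvx K" "s \<ge> 0" "t \<ge> 0" "x \<in> sc s ` K" "y \<in> sc t ` K"
  shows "x + y \<in> sc (s + t) ` K"
proof (cases "s + t = 0")
  case True
  then have "s = 0" "t = 0" using assms by auto
  then have "x = 0" "y = 0" using assms by auto
  then show ?thesis using assms True by (auto simp: \<open>s = 0\<close> \<open>t = 0\<close>)
next
  case False
  obtain a b where ab: "x = sc s a" "y = sc t b" "a \<in> K" "b \<in> K" using assms by blast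
  have st: "s + t > 0" using False assms by simp
  have "s / (s + t) + t / (s + t) = 1" using st by (simp add: add_divide_distrib[symmetric])
  then have "sc (s / (s + t)) a + sc (t / (s + t)) b \<in> K"
    using assms(1-3) ab st unfolding cvx_def by (simp add: divide_nonneg_pos)
  moreover have "x + y = sc (s + t) (sc (s / (s + t)) a + sc (t / (s + t)) b)"
    using st unfolding ab by (simp add: sc_add)
  ultimately show ?thesis by blast
qed

lemma sc_image_mono:
  assumes "cvx K" "0 \<in> K" "0 \<le> s" "s \<le> t" shows "sc s ` K \<subseteq> sc t ` K"
proof
  fix x assume x: "x \<in> sc s ` K"
  have "0 \<in> sc (t - s) ` K" using assms(2) by (intro image_eqI[where x=0]) simp_all
  from sc_image_add[OF assms(1,3) _ x this] assms(4) show "x \<in> sc t ` K" by simp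
qed

lemma sc_image_add_cube:
  assumes "cvx K" "cube n r \<subseteq> K" "r > 0" "s \<ge> 0" "t > 0" "g \<le> t * r" "x \<in> sc s ` K" "d \<in> cube n g"
  shows "x + d \<in> sc (s + t) ` K"
proof -
  have "d \<in> cube n (t * r)" using assms(6,8) cube_mono by blast
  then have "d \<in> sc t ` cube n r" using assms by (intro cube_scale) auto
  then have "d \<in> sc t ` K" using assms(2) by blast
  then show ?thesis using assms by (intro sc_image_add) auto
qed

lemma zgrid_covers:
  assumes "g > 0" shows "covers n (zgrid n g) (cube n g)"
  unfolding covers_def
proof
  fix x assume x: "x \<in> espace n"
  define l where "l = (\<lambda>i. if i < n then g * of_int \<lfloor>x i / g\<rfloor> else 0)"
  have "\<bar>x i - g * of_int \<lfloor>x i / g\<rfloor>\<bar> \<le> g" for i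
  proof -
    have "g * of_int \<lfloor>x i / g\<rfloor> \<le> x i" "x i \<le> g * of_int \<lfloor>x i / g\<rfloor> + g"
      using floor_divide_lower[OF assms, of "x i"] floor_divide_upper[OF assms, of "x i"]
      by (simp_all add: algebra_simps)
    then show ?thesis using assms by linarith
  qed
  then have "x - l \<in> cube n g" using x by (auto simp: cube_def l_def espace_def)
  moreover have "l \<in> zgrid n g" by (auto simp: zgrid_def l_def espace_def)
  ultimately show "\<exists>l\<in>zgrid n g. x - l \<in> cube n g" by blast
qed

lemma body_measure_pos:
  assumes "body n K" "cube n r \<subseteq> K" "r > 0"
  shows "measure (leb n) K > 0"
proof -
  note L = lat_zgrid[OF assms(3), of n]
  have "real (lcount (zgrid n r) {0} 0) * r ^ n \<le> measure (leb n) K"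
    by (rule count_le_measure[OF L zgrid_covers[OF assms(3)]]) (use assms in \<open>auto simp: body_def\<close>)
  moreover have "{l \<in> zgrid n r. 0 + l \<in> {0}} = {0}" using lat_group(1)[OF L] by auto
  ultimately show ?thesis using assms(3) by (simp add: lcount_def) (meson less_le_trans zero_less_power)
qed

text \<open>
  The sums of pairs from \<open>P\<close> all lie in \<open>Z\<close>, so some element of \<open>Z\<close> is hit at least as often as the average.
\<close>

lemma pair_counting:
  fixes P Z :: "'a::ab_group_add set"
  assumes "finite P" "finite Z" "\<And>x y. x \<in> P \<Longrightarrow> y \<in> P \<Longrightarrow> x + y \<in> Z" "P \<noteq> {}"
  shows "\<exists>z\<in>Z. real (card P) ^ 2 \<le> real (card Z) * real (card {x\<in>P. z - x \<in> P})"
proof (rule ccontr)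
  assume "\<not> ?thesis"
  then have *: "\<And>z. z \<in> Z \<Longrightarrow> real (card Z) * real (card {x\<in>P. z - x \<in> P}) < real (card P) ^ 2" by (meson not_le)
  have "Z \<noteq> {}" using assms(3,4) by blast
  have "P \<times> P = (\<Union>z\<in>Z. (\<lambda>x. (x, z - x)) ` {x\<in>P. z - x \<in> P})"
  proof (intro equalityI subsetI)
    fix w assume w: "w \<in> P \<times> P"
    obtain x y where xy: "w = (x, y)" by (cases w)
    then have "x \<in> {x'\<in>P. (x + y) - x' \<in> P}" "x + y \<in> Z" "w = (x, (x + y) - x)" using w assms(3) by auto
    then show "w \<in> (\<Union>z\<in>Z. (\<lambda>x. (x, z - x)) ` {x\<in>P. z - x \<in> P})" by blast
  qed auto
  then have "card P * card P = card (\<Union>z\<in>Z. (\<lambda>x. (x, z - x)) ` {x\<in>P. z - x \<in> P})"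
    by (simp only: card_cartesian_product[symmetric])
  also have "\<dots> \<le> (\<Sum>z\<in>Z. card ((\<lambda>x. (x, z - x)) ` {x\<in>P. z - x \<in> P}))" by (rule card_UN_le[OF assms(2)])
  also have "\<dots> \<le> (\<Sum>z\<in>Z. card {x\<in>P. z - x \<in> P})"
    by (intro sum_mono card_image_le) (use assms in auto)
  finally have "real (card P) ^ 2 \<le> (\<Sum>z\<in>Z. real (card {x\<in>P. z - x \<in> P}))"
    by (simp add: power2_eq_square flip: of_nat_mult of_nat_sum of_nat_le_iff)
  then have "real (card Z) * real (card P) ^ 2 \<le> real (card Z) * (\<Sum>z\<in>Z. real (card {x\<in>P. z - x \<in> P}))"
    by (rule mult_left_mono) simp
  also have "\<dots> = (\<Sum>z\<in>Z. real (card Z) * real (card {x\<in>P. z - x \<in> P}))" by (rule sum_distrib_left)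
  also have "\<dots> < (\<Sum>z\<in>Z. real (card P) ^ 2)" using assms(2) \<open>Z \<noteq> {}\<close> * by (rule sum_strict_mono)
  finally show False by simp
qed

text \<open>
  The largest symmetric body around the origin that fits into \<open>K - c\<close>.
\<close>

definition symbody :: "(nat \<Rightarrow> real) set \<Rightarrow> (nat \<Rightarrow> real) \<Rightarrow> nat \<Rightarrow> (nat \<Rightarrow> real) set" where
  "symbody K c n = {y \<in> espace n. c + y \<in> K \<and> c - y \<in> K}"

lemma body_symbody:
  assumes K: "body n K" and c: "c \<in> espace n" shows "body n (symbody K c n)"
proof -
  have "symbody K c n = espace n \<inter> ({y. c + sc 1 y \<in> K} \<inter> {y. c + sc (-1) y \<in> K})"
    unfolding symbody_def by (auto simp: sc_def fun_diff_def plus_fun_def)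
  then have "symbody K c n \<in> sets borel"
    using borel_affine_preimage[of K c 1] borel_affine_preimage[of K c "-1"] K borel_espace
    by (auto simp: body_def)
  moreover have "bdd n (symbody K c n)"
  proof -
    have K': "K \<subseteq> espace n" "bdd n K" using K by (auto simp: body_def bdd_def)
    have "bdd n {x - y | x y. x \<in> K \<and> y \<in> {c}}"
      by (rule bdd_diff[OF K'(2)]) (use c in \<open>auto simp: bdd_def intro: exI[of _ "Max (insert 0 ((\<lambda>i. \<bar>c i\<bar>) ` {..<n}))"]\<close>)
    moreover have "symbody K c n \<subseteq> {x - y | x y. x \<in> K \<and> y \<in> {c}}"
    proof
      fix y assume "y \<in> symbody K c n"
      then have "c + y \<in> K" "y = (c + y) - c" by (auto simp: symbody_def)
      then show "y \<in> {x - y | x y. x \<in> K \<and> y \<in> {c}}" by blast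
    qed
    ultimately show ?thesis by (rule bdd_subset)
  qed
  moreover have "cvx (symbody K c n)" unfolding cvx_def
  proof (intro ballI allI impI)
    fix x y u v assume xy: "x \<in> symbody K c n" "y \<in> symbody K c n" and uv: "(0::real) \<le> u" "(0::real) \<le> v" "u + v = 1"
    have "sc u (c + x) + sc v (c + y) \<in> K" "sc u (c - x) + sc v (c - y) \<in> K"
      using K xy uv by (auto simp: body_def cvx_def symbody_def)
    moreover have "sc u c + sc v c = c" using uv by (simp flip: sc_add_left)
    then have "sc u (c + x) + sc v (c + y) = c + (sc u x + sc v y)" "sc u (c - x) + sc v (c - y) = c - (sc u x + sc v y)"
      by (simp_all add: sc_add sc_diff algebra_simps)
    moreover have "sc u x + sc v y \<in> espace n" using xy by (auto simp: symbody_def intro!: espace_closed)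
    ultimately show "sc u x + sc v y \<in> symbody K c n" by (simp add: symbody_def)
  qed
  ultimately show ?thesis by (simp add: body_def)
qed

text \<open>
  Count pairs of points of a fine grid in \<open>K\<close>. Their sums lie in \<open>2 K\<close>, which has volume \<open>2\<^sup>n V\<close>, so a popular sum \<open>z\<close>
  yields the center \<open>c = z / 2\<close> with \<open>vol (K \<inter> (z - K)) \<ge> V / 2\<^sup>n\<close>. The grid needs some room at the boundary, which
  costs the difference between \<open>2\<^sup>n\<close> and \<open>4\<^sup>n\<close>.
\<close>

theorem exists_center:
  assumes K: "body n K" and cubeK: "cube n \<eta> \<subseteq> K" and \<eta>: "\<eta> > 0"
  shows "\<exists>c\<in>espace n. \<exists>r>0. (\<forall>d\<in>cube n r. c + d \<in> K) \<and> measure (leb n) K \<le> 4 ^ n * measure (leb n) (symbody K c n)"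
proof -
  define V where "V = measure (leb n) K"
  have V: "V > 0" unfolding V_def by (rule body_measure_pos[OF K cubeK \<eta>])
  have cK: "cvx K" and Ke: "K \<subseteq> espace n" using K by (auto simp: body_def bdd_def)
  have K0: "0 \<in> K" using cubeK cube_0[of \<eta> n] \<eta> by auto
  \<comment> \<open>Any positive \<open>\<kappa>\<close> with \<open>(1 - \<kappa>)\<^sup>4 \<ge> 3 / 4\<close> works.\<close>
  define \<kappa> :: real where "\<kappa> = 1 / 16"
  define g where "g = \<kappa> * (1 - \<kappa>) * \<eta>"
  have g: "g > 0" "g \<le> \<kappa> * \<eta>" "g \<le> 1 * \<eta>" using \<eta> by (auto simp: g_def \<kappa>_def)
  define G where "G = zgrid n g"
  have L: "lat n G (g ^ n)" unfolding G_def by (rule lat_zgrid[OF g(1)])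
  have cov: "covers n G (cube n g)" unfolding G_def by (rule zgrid_covers[OF g(1)])
  define K1 where "K1 = sc (1 - \<kappa>) ` K"
  have bK1: "body n K1" unfolding K1_def by (rule body_sc[OF K]) (simp add: \<kappa>_def)
  have K1_cube: "x + d \<in> K" if "x \<in> K1" "d \<in> cube n (\<kappa> * \<eta>)" for x d
    using sc_image_add_cube[OF cK cubeK \<eta>, of "1 - \<kappa>" \<kappa> "\<kappa> * \<eta>" x d] that unfolding K1_def by (simp add: \<kappa>_def)
  define P where "P = {l\<in>G. l \<in> K1}"
  define Z where "Z = {l\<in>G. l \<in> sc 2 ` K1}"
  have b2K1: "body n (sc 2 ` K1)" by (rule body_sc[OF bK1]) simp
  have finP: "finite P" unfolding P_def using finite_lattice_points[OF L, of K1 0] bK1 by (simp add: body_def)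
  have finZ: "finite Z" unfolding Z_def using finite_lattice_points[OF L, of "sc 2 ` K1" 0] b2K1 by (simp add: body_def)
  have cP: "card P = lcount G K1 0" "card Z = lcount G (sc 2 ` K1) 0" unfolding P_def Z_def lcount_def by simp_all
  have "measure (leb n) (sc ((1 - \<kappa>)\<^sup>2) ` K) \<le> real (lcount G K1 0) * g ^ n"
  proof (rule measure_le_count[OF L cov])
    show "bdd n K1" "bdd n (sc ((1 - \<kappa>)\<^sup>2) ` K)" "sc ((1 - \<kappa>)\<^sup>2) ` K \<in> sets borel"
      using bK1 body_sc[OF K, of "(1 - \<kappa>)\<^sup>2"] by (auto simp: body_def \<kappa>_def)
    fix y d assume "y \<in> sc ((1 - \<kappa>)\<^sup>2) ` K" "d \<in> cube n g"
    then have "y + d \<in> sc ((1 - \<kappa>)\<^sup>2 + \<kappa> * (1 - \<kappa>)) ` K"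
      by (intro sc_image_add_cube[OF cK cubeK \<eta>]) (auto simp: \<kappa>_def g_def)
    then show "y + d \<in> K1" unfolding K1_def by (simp add: \<kappa>_def power2_eq_square)
  qed simp
  also have "measure (leb n) (sc ((1 - \<kappa>)\<^sup>2) ` K) = ((1 - \<kappa>)\<^sup>2) ^ n * V"
    unfolding V_def by (rule measure_sc[OF K]) (simp add: \<kappa>_def)
  finally have lower: "((1 - \<kappa>)\<^sup>2) ^ n * V \<le> real (card P) * g ^ n" unfolding cP .
  have "real (lcount G (sc 2 ` K1) 0) * g ^ n \<le> measure (leb n) (sc 3 ` K)"
  proof (rule count_le_measure[OF L cov])
    show "bdd n (sc 3 ` K)" "sc 3 ` K \<in> sets borel" using body_sc[OF K, of 3] by (auto simp: body_def)
    fix x d assume x: "x \<in> sc 2 ` K1" "d \<in> cube n g"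
    have "x \<in> sc (2 * (1 - \<kappa>)) ` K" using x(1) unfolding K1_def by (simp add: image_image)
    moreover have "sc (2 * (1 - \<kappa>)) ` K \<subseteq> sc 2 ` K" by (rule sc_image_mono[OF cK K0]) (simp_all add: \<kappa>_def)
    ultimately have "x + d \<in> sc (2 + 1) ` K" using x(2) g by (intro sc_image_add_cube[OF cK cubeK \<eta>]) auto
    then show "x + d \<in> sc 3 ` K" by simp
  qed simp
  also have "measure (leb n) (sc 3 ` K) = 3 ^ n * V" unfolding V_def by (rule measure_sc[OF K]) simp
  finally have upper: "real (card Z) * g ^ n \<le> 3 ^ n * V" unfolding cP .
  have Pne: "P \<noteq> {}"
  proof
    assume "P = {}"
    then have "((1 - \<kappa>)\<^sup>2) ^ n * V \<le> 0" using lower by simp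
    moreover have "((1 - \<kappa>)\<^sup>2) ^ n * V > 0" using V by (simp add: \<kappa>_def)
    ultimately show False by simp
  qed
  have "x + y \<in> Z" if "x \<in> P" "y \<in> P" for x y
  proof -
    have "x + y \<in> sc (1 + 1) ` K1"
      by (rule sc_image_add) (use that bK1 in \<open>auto simp: P_def body_def\<close>)
    then show ?thesis using that lat_group(2)[OF L] by (simp add: P_def Z_def)
  qed
  from pair_counting[OF finP finZ this Pne] obtain z where
    z: "z \<in> Z" "real (card P) ^ 2 \<le> real (card Z) * real (card {x\<in>P. z - x \<in> P})" by blast
  define Q where "Q = {x\<in>P. z - x \<in> P}"
  define c where "c = sc (1 / 2) z"
  have zc: "z = c + c" unfolding c_def by (simp flip: sc_add_left)
  have ze: "z \<in> espace n" using z(1) lat_espace[OF L] by (auto simp: Z_def)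
  then have ce: "c \<in> espace n" unfolding c_def by (rule espace_closed)
  have Vn: "0 < ((1 - \<kappa>)\<^sup>2) ^ n * V" using V by (simp add: \<kappa>_def)
  have Qne: "Q \<noteq> {}"
  proof
    assume "Q = {}"
    then have "card {x\<in>P. z - x \<in> P} = 0" unfolding Q_def by (simp only: card.empty)
    then have "real (card P) ^ 2 \<le> 0" using z(2) by simp
    then show False using Pne finP by simp
  qed
  then obtain x where x: "x \<in> P" "z - x \<in> P" by (auto simp: Q_def)
  have cK1: "c \<in> K1"
  proof -
    have "sc (1/2) x + sc (1/2) (z - x) \<in> K1"
      using x bK1 by (simp add: P_def body_def cvx_def)
    moreover have "sc (1/2) x + sc (1/2) (z - x) = c" unfolding c_def by (simp add: sc_diff)
    ultimately show ?thesis by simp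
  qed
  define B1 where "B1 = symbody K1 c n"
  have "card Q = lcount G B1 (- c)"
  proof -
    have "Q = {l\<in>G. - c + l \<in> B1}"
    proof (intro equalityI subsetI)
      fix l assume l: "l \<in> Q"
      have le: "l \<in> espace n" using l lat_espace[OF L] by (auto simp: Q_def P_def)
      have "c + (- c + l) \<in> K1" "c - (- c + l) \<in> K1" using l zc by (auto simp: Q_def P_def)
      moreover have "- c + l \<in> espace n" by (intro espace_closed ce le)
      ultimately show "l \<in> {l\<in>G. - c + l \<in> B1}" using l by (simp add: B1_def symbody_def Q_def P_def)
    next
      fix l assume l: "l \<in> {l\<in>G. - c + l \<in> B1}"
      then have "l \<in> G" "l \<in> K1" "c - (- c + l) \<in> K1" by (auto simp: B1_def symbody_def)
      moreover have "c - (- c + l) = z - l" using zc by simp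
      moreover have "z - l \<in> G" using lat_group(3)[OF L, of z l] z(1) \<open>l \<in> G\<close> by (simp add: Z_def)
      ultimately show "l \<in> Q" by (simp add: Q_def P_def)
    qed
    then show ?thesis by (simp add: lcount_def)
  qed
  moreover have "real (lcount G B1 (- c)) * g ^ n \<le> measure (leb n) (symbody K c n)"
  proof (rule count_le_measure[OF L cov])
    show "bdd n (symbody K c n)" "symbody K c n \<in> sets borel" using body_symbody[OF K ce] by (auto simp: body_def)
    show "- c \<in> espace n" by (intro espace_closed ce)
    fix y d assume y: "y \<in> B1" "d \<in> cube n g"
    have d: "d \<in> cube n (\<kappa> * \<eta>)" "- d \<in> cube n (\<kappa> * \<eta>)" using y(2) g(2) by (auto simp: cube_def espace_def)
    have "(c + y) + d \<in> K" "(c - y) + (- d) \<in> K"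
      using K1_cube[of "c + y" d] K1_cube[of "c - y" "- d"] y(1) d unfolding B1_def symbody_def by blast+
    moreover have "y + d \<in> espace n" using y by (auto simp: B1_def symbody_def cube_def intro: espace_closed)
    ultimately show "y + d \<in> symbody K c n" by (simp add: symbody_def algebra_simps)
  qed
  ultimately have Q: "real (card Q) * g ^ n \<le> measure (leb n) (symbody K c n)" by simp
  have gn: "g ^ n > 0" using g by simp
  have "(((1 - \<kappa>)\<^sup>2) ^ n * V)\<^sup>2 \<le> (real (card P) * g ^ n)\<^sup>2" using lower Vn by (intro power_mono) auto
  also have "\<dots> = real (card P) ^ 2 * (g ^ n)\<^sup>2" by (simp add: power_mult_distrib)
  also have "\<dots> \<le> (real (card Z) * real (card Q)) * (g ^ n)\<^sup>2" using z(2) by (intro mult_right_mono) (auto simp: Q_def)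
  also have "\<dots> = (real (card Z) * g ^ n) * (real (card Q) * g ^ n)" by (simp add: power2_eq_square)
  also have "\<dots> \<le> (3 ^ n * V) * measure (leb n) (symbody K c n)" by (rule mult_mono[OF upper Q]) (use V gn in auto)
  finally have "(((1 - \<kappa>)\<^sup>2) ^ n)\<^sup>2 * V * V \<le> 3 ^ n * measure (leb n) (symbody K c n) * V"
    by (simp add: power_mult_distrib power2_eq_square mult_ac)
  then have f: "(((1 - \<kappa>)\<^sup>2) ^ n)\<^sup>2 * V \<le> 3 ^ n * measure (leb n) (symbody K c n)" using V by simp
  have "(3 / 4) ^ n \<le> (((1 - \<kappa>)\<^sup>2) ^ n)\<^sup>2"
  proof -
    have "(((1 - \<kappa>)\<^sup>2) ^ n)\<^sup>2 = ((1 - \<kappa>) ^ 4) ^ n" by (simp flip: power_mult add: mult_ac)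
    moreover have "3 / 4 \<le> (1 - \<kappa>) ^ 4" by (simp add: \<kappa>_def eval_nat_numeral)
    ultimately show ?thesis by (simp add: power_mono)
  qed
  then have "(3 / 4) ^ n * V \<le> (((1 - \<kappa>)\<^sup>2) ^ n)\<^sup>2 * V" using V by (intro mult_right_mono) auto
  then have "(3 / 4) ^ n * V \<le> 3 ^ n * measure (leb n) (symbody K c n)" using f by linarith
  then have "V \<le> 4 ^ n * measure (leb n) (symbody K c n)" by (simp add: power_divide field_simps)
  moreover have "c + d \<in> K" if "d \<in> cube n (\<kappa> * \<eta>)" for d by (rule K1_cube[OF cK1 that])
  moreover have "\<kappa> * \<eta> > 0" using \<eta> by (simp add: \<kappa>_def)
  ultimately show ?thesis using ce unfolding V_def by blast
qed

text \<open>
  Twice the difference body. A lattice that meets it only in the origin has at most one point in any translate of \<open>2 K\<close>.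
\<close>

definition diff2 :: "(nat \<Rightarrow> real) set \<Rightarrow> (nat \<Rightarrow> real) set" where
  "diff2 K = {sc 2 (x - y) | x y. x \<in> K \<and> y \<in> K}"

lemma bdd_diff2: "bdd n K \<Longrightarrow> bdd n (diff2 K)"
proof -
  assume "bdd n K"
  from bdd_sc[OF bdd_diff[OF this this], of 2] show ?thesis
    by (rule bdd_subset) (auto simp: diff2_def)
qed

text \<open>
  For \<open>a = 2 (k - k')\<close>, the set \<open>4 K \<inter> (4 K + a)\<close> contains a translate of \<open>2 K\<close>, so \<open>a\<close> is a difference of points of
  \<open>4 K\<close> in many ways. Double counting of the pairs of grid points in \<open>4 K\<close> gives an elementary bound for the difference
  body of the kind of the Rogers--Shephard inequality.
\<close>

theorem difference_count:
  assumes K: "body n K" and cubeK: "cube n r \<subseteq> K" and r: "r > 0" and g: "g > 0" "g \<le> r"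
  shows "real (card {l\<in>zgrid n g. l \<in> diff2 K}) * g ^ n \<le> 25 ^ n * measure (leb n) K"
proof -
  define V where "V = measure (leb n) K"
  have V: "V > 0" unfolding V_def by (rule body_measure_pos[OF K cubeK r])
  have cK: "cvx K" and Ke: "K \<subseteq> espace n" and bK: "bdd n K" using K by (auto simp: body_def bdd_def)
  define G where "G = zgrid n g"
  have L: "lat n G (g ^ n)" unfolding G_def by (rule lat_zgrid[OF g(1)])
  have cov: "covers n G (cube n g)" unfolding G_def by (rule zgrid_covers[OF g(1)])
  define P where "P = {l\<in>G. l \<in> sc 4 ` K}"
  define A where "A = {l\<in>G. l \<in> diff2 K}"
  have finP: "finite P" unfolding P_def using finite_lattice_points[OF L, of "sc 4 ` K" 0] bdd_sc[OF bK] by simp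
  have finA: "finite A" unfolding A_def using finite_lattice_points[OF L, of "diff2 K" 0] bdd_diff2[OF bK] by simp
  have "real (lcount G (sc 4 ` K) 0) * g ^ n \<le> measure (leb n) (sc 5 ` K)"
  proof (rule count_le_measure[OF L cov])
    show "bdd n (sc 5 ` K)" "sc 5 ` K \<in> sets borel" using body_sc[OF K, of 5] by (auto simp: body_def)
    fix x d assume "x \<in> sc 4 ` K" "d \<in> cube n g"
    then have "x + d \<in> sc (4 + 1) ` K" using g by (intro sc_image_add_cube[OF cK cubeK r]) auto
    then show "x + d \<in> sc 5 ` K" by simp
  qed simp
  also have "measure (leb n) (sc 5 ` K) = 5 ^ n * V" unfolding V_def by (rule measure_sc[OF K]) simp
  finally have upper: "real (card P) * g ^ n \<le> 5 ^ n * V" by (simp add: P_def lcount_def)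
  have T: "V \<le> real (card {x\<in>P. x - a \<in> P}) * g ^ n" if aA: "a \<in> A" for a
  proof -
    obtain k k' where k: "a = sc 2 (k - k')" "k \<in> K" "k' \<in> K" using aA by (auto simp: A_def diff2_def)
    have aG: "a \<in> G" using aA by (simp add: A_def)
    have "V \<le> real (lcount G (sc 2 ` K) (- sc 2 k)) * g ^ n" unfolding V_def
    proof (rule measure_le_count[OF L cov bdd_sc[OF bK] bK])
      show "K \<in> sets borel" using K by (simp add: body_def)
      show "- sc 2 k \<in> espace n" using Ke k by (intro espace_closed) auto
      fix y d assume "y \<in> K" "d \<in> cube n g"
      then have "y + d \<in> sc (1 + 1) ` K" using g by (intro sc_image_add_cube[OF cK cubeK r]) auto
      then show "y + d \<in> sc 2 ` K" by simp
    qed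
    moreover have "lcount G (sc 2 ` K) (- sc 2 k) \<le> card {x\<in>P. x - a \<in> P}"
      unfolding lcount_def
    proof (rule card_mono)
      show "finite {x\<in>P. x - a \<in> P}" using finP by simp
      show "{l \<in> G. - sc 2 k + l \<in> sc 2 ` K} \<subseteq> {x\<in>P. x - a \<in> P}"
      proof
        fix l assume l: "l \<in> {l \<in> G. - sc 2 k + l \<in> sc 2 ` K}"
        have m1: "sc 2 k + (- sc 2 k + l) \<in> sc (2 + 2) ` K" by (rule sc_image_add[OF cK]) (use l k in auto)
        have m2: "sc 2 k' + (- sc 2 k + l) \<in> sc (2 + 2) ` K" by (rule sc_image_add[OF cK]) (use l k in auto)
        have eq: "sc 2 k' + (- sc 2 k + l) = l - a" unfolding k by (simp add: sc_diff)
        have "l \<in> sc 4 ` K" using m1 by simp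
        moreover have "l - a \<in> sc 4 ` K" using m2 unfolding eq by simp
        moreover have "l - a \<in> G" using lat_group(3)[OF L] l aG by simp
        ultimately show "l \<in> {x\<in>P. x - a \<in> P}" using l by (simp add: P_def)
      qed
    qed
    then have "real (lcount G (sc 2 ` K) (- sc 2 k)) * g ^ n \<le> real (card {x\<in>P. x - a \<in> P}) * g ^ n"
      using g by (intro mult_right_mono) auto
    ultimately show ?thesis by linarith
  qed
  have "card (Sigma A (\<lambda>a. {x\<in>P. x - a \<in> P})) \<le> card (P \<times> P)"
    by (rule card_inj_on_le[where f="\<lambda>(a,x). (x, x - a)"]) (use finP in \<open>auto simp: inj_on_def\<close>)
  then have "(\<Sum>a\<in>A. card {x\<in>P. x - a \<in> P}) \<le> card P * card P"
    using finA finP by (simp add: card_cartesian_product)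
  then have le: "(\<Sum>a\<in>A. real (card {x\<in>P. x - a \<in> P})) \<le> real (card P) * real (card P)"
    by (simp flip: of_nat_mult of_nat_sum)
  have "real (card A) * V = (\<Sum>a\<in>A. V)" by simp
  also have "\<dots> \<le> (\<Sum>a\<in>A. real (card {x\<in>P. x - a \<in> P}) * g ^ n)" by (intro sum_mono T)
  also have "\<dots> = (\<Sum>a\<in>A. real (card {x\<in>P. x - a \<in> P})) * g ^ n" by (rule sum_distrib_right[symmetric])
  also have "\<dots> \<le> (real (card P) * real (card P)) * g ^ n" using le g by (intro mult_right_mono) auto
  finally have "real (card A) * V * g ^ n \<le> (real (card P) * real (card P)) * g ^ n * g ^ n"
    using g by (intro mult_right_mono) auto
  also have "\<dots> = (real (card P) * g ^ n) * (real (card P) * g ^ n)" by simp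
  also have "\<dots> \<le> (5 ^ n * V) * (5 ^ n * V)" by (rule mult_mono[OF upper upper]) (use g V in auto)
  also have "\<dots> = 25 ^ n * V * V" by (simp flip: power_mult_distrib)
  finally have "(real (card A) * g ^ n) * V \<le> (25 ^ n * V) * V" by (simp add: mult_ac)
  then have "real (card A) * g ^ n \<le> 25 ^ n * V" using V by simp
  then show ?thesis by (simp add: A_def G_def V_def)
qed

section \<open>Random cyclic codes modulo a prime\<close>

definition zmod :: "nat \<Rightarrow> nat \<Rightarrow> (nat \<Rightarrow> int) \<Rightarrow> nat \<Rightarrow> int" where
  "zmod n P v = (\<lambda>i\<in>{..<n}. v i mod int P)"

lemma zmod_in_zbox: "P > 0 \<Longrightarrow> zmod n P v \<in> zbox n P"
  by (auto simp: zmod_def zbox_def)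

lemma zmod_eq_iff: "zmod n P v = zmod n P w \<longleftrightarrow> (\<forall>i<n. int P dvd v i - w i)"
proof
  assume eq: "zmod n P v = zmod n P w"
  show "\<forall>i<n. int P dvd v i - w i"
  proof (intro allI impI)
    fix i assume "i < n"
    then show "int P dvd v i - w i" using fun_cong[OF eq, of i] by (simp add: zmod_def mod_eq_dvd_iff)
  qed
next
  assume "\<forall>i<n. int P dvd v i - w i"
  then show "zmod n P v = zmod n P w" by (auto simp: zmod_def mod_eq_dvd_iff fun_eq_iff)
qed

lemma zbox_eqI:
  assumes "v \<in> zbox n P" "w \<in> zbox n P" "\<And>i. i < n \<Longrightarrow> int P dvd v i - w i"
  shows "v = w"
proof (rule PiE_ext)
  show v: "v \<in> PiE {..<n} (\<lambda>_. {0..<int P})" "w \<in> PiE {..<n} (\<lambda>_. {0..<int P})"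
    using assms by (simp_all add: zbox_def)
  fix i assume i: "i \<in> {..<n}"
  have "v i mod int P = w i mod int P" using assms(3) i by (simp add: mod_eq_dvd_iff)
  then show "v i = w i" using PiE_mem[OF v(1) i] PiE_mem[OF v(2) i] by simp
qed

lemma inj_on_zbox_bij:
  assumes "inj_on f (zbox n P)" "f ` zbox n P \<subseteq> zbox n P"
  shows "bij_betw f (zbox n P) (zbox n P)"
  using assms by (simp add: bij_betw_def endo_inj_surj)

lemma card_preimage_bij:
  assumes "bij_betw f W W" "E \<subseteq> W"
  shows "card {w\<in>W. f w \<in> E} = card E"
proof -
  have "f ` {w\<in>W. f w \<in> E} = E" using assms by (auto simp: bij_betw_def)
  moreover have "inj_on f {w\<in>W. f w \<in> E}" using assms by (auto simp: bij_betw_def inj_on_def)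
  ultimately show ?thesis by (metis card_image)
qed

lemma bij_add_zbox:
  assumes "P > 0"
  shows "bij_betw (\<lambda>x. zmod n P (\<lambda>i. x i + v i)) (zbox n P) (zbox n P)"
proof (rule inj_on_zbox_bij)
  show "inj_on (\<lambda>x. zmod n P (\<lambda>i. x i + v i)) (zbox n P)"
    by (rule inj_onI) (rule zbox_eqI, auto simp: zmod_eq_iff)
qed (use zmod_in_zbox[OF assms] in auto)

lemma bij_mult_zbox:
  assumes "prime P" "\<not> int P dvd j"
  shows "bij_betw (\<lambda>h. zmod n P (\<lambda>i. j * h i)) (zbox n P) (zbox n P)"
proof (rule inj_on_zbox_bij)
  have pr: "prime (int P)" using assms by simp
  show "inj_on (\<lambda>h. zmod n P (\<lambda>i. j * h i)) (zbox n P)"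
  proof (rule inj_onI, rule zbox_eqI)
    fix x y i assume "zmod n P (\<lambda>i. j * x i) = zmod n P (\<lambda>i. j * y i)" "i < n"
    then have "int P dvd j * (x i - y i)" by (simp add: zmod_eq_iff right_diff_distrib)
    then show "int P dvd x i - y i" using assms(2) prime_dvd_multD[OF pr] by blast
  qed
qed (use zmod_in_zbox prime_gt_0_nat[OF assms(1)] in auto)

lemma small_not_dvd:
  assumes "j \<noteq> j'" "j < P" "j' < (P::nat)" shows "\<not> int P dvd int j - int j'"
  using assms zdvd_not_zless[of "\<bar>int j - int j'\<bar>" "int P"] by auto

text \<open>
  The matrix \<open>(1 j; 1 j')\<close> is invertible modulo \<open>P\<close>. In terms of random \<open>x\<close> and \<open>h\<close>, this is pairwise independence
  of the points \<open>x + j h\<close>.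
\<close>

lemma bij_pair_zbox:
  assumes "prime P" "j \<noteq> j'" "j < P" "j' < P"
  shows "bij_betw (\<lambda>(x,h). (zmod n P (\<lambda>i. x i + int j * h i), zmod n P (\<lambda>i. x i + int j' * h i)))
    (zbox n P \<times> zbox n P) (zbox n P \<times> zbox n P)"
proof -
  let ?f = "\<lambda>(x,h). (zmod n P (\<lambda>i. x i + int j * h i), zmod n P (\<lambda>i. x i + int j' * h i))"
  have pr: "prime (int P)" using assms by simp
  have P0: "P > 0" using assms by simp
  have "inj_on ?f (zbox n P \<times> zbox n P)"
  proof (rule inj_onI, clarify)
    fix x h y k
    assume xh: "x \<in> zbox n P" "h \<in> zbox n P" "y \<in> zbox n P" "k \<in> zbox n P"
      and e1: "zmod n P (\<lambda>i. x i + int j * h i) = zmod n P (\<lambda>i. y i + int j * k i)"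
      and e2: "zmod n P (\<lambda>i. x i + int j' * h i) = zmod n P (\<lambda>i. y i + int j' * k i)"
    have hk: "int P dvd h i - k i" if "i < n" for i
    proof -
      have "int P dvd (x i + int j * h i) - (y i + int j * k i)" "int P dvd (x i + int j' * h i) - (y i + int j' * k i)"
        using e1 e2 that by (simp_all add: zmod_eq_iff)
      from dvd_diff[OF this] have "int P dvd (int j - int j') * (h i - k i)" by (simp add: algebra_simps)
      then show ?thesis using small_not_dvd[OF assms(2-4)] prime_dvd_multD[OF pr] by blast
    qed
    have "int P dvd x i - y i" if "i < n" for i
    proof -
      have "int P dvd (x i + int j * h i) - (y i + int j * k i)" using e1 that by (simp add: zmod_eq_iff)
      from dvd_diff[OF this dvd_mult[OF hk[OF that], of "int j"]] show ?thesis by (simp add: algebra_simps)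
    qed
    then show "x = y \<and> h = k" using zbox_eqI[OF xh(1,3)] zbox_eqI[OF xh(2,4) hk] by blast
  qed
  moreover have "?f ` (zbox n P \<times> zbox n P) \<subseteq> zbox n P \<times> zbox n P" using zmod_in_zbox[OF P0] by auto
  ultimately show ?thesis by (simp add: bij_betw_def endo_inj_surj)
qed

text \<open>
  A random \<open>h\<close> satisfies the first claim with probability at least one half, because each nonzero multiple of \<open>h\<close> is uniformly
  distributed. For the second one, the number \<open>Z (x, h)\<close> of indices \<open>j\<close> with \<open>x + j h \<in> E\<close> has mean \<open>\<mu> = P |E| / P\<^sup>n\<close> and,
  by pairwise independence, variance at most \<open>\<mu>\<close>. Chebyshev's inequality bounds the proportion of the pairs with \<open>Z = 0\<close> by
  \<open>1 / \<mu>\<close>; conditioning on the first claim at most doubles it.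
\<close>

theorem random_line_code:
  fixes P n :: nat
  assumes P: "prime P" and E: "E \<subseteq> zbox n P" and A: "A \<subseteq> zbox n P" "2 * P * card A \<le> P ^ n"
  shows "\<exists>h\<in>zbox n P. (\<forall>j\<in>{1..<P}. zmod n P (\<lambda>i. int j * h i) \<notin> A) \<and>
     card {x\<in>zbox n P. \<forall>j<P. zmod n P (\<lambda>i. x i + int j * h i) \<notin> E} * card E * P \<le> 2 * P ^ (2 * n)"
proof -
  have P0: "P > 0" using prime_gt_0_nat[OF P] .
  define B where "B = zbox n P"
  define W where "W = B \<times> B"
  have fB: "finite B" "card B = P ^ n" unfolding B_def by simp_all
  have fW: "finite W" "card W = P ^ (2 * n)" unfolding W_def using fB by (simp_all add: power_mult power2_eq_square power_mult_distrib mult_2 power_add)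
  define S where "S = (\<lambda>j. {w\<in>W. zmod n P (\<lambda>i. fst w i + int j * snd w i) \<in> E})"
  have cS: "card (S j) = P ^ n * card E" for j
  proof -
    have "card (S j) = (\<Sum>h\<in>B. card {x\<in>B. zmod n P (\<lambda>i. x i + int j * h i) \<in> E})"
    proof -
      have "S j = (\<lambda>(h,x). (x,h)) ` Sigma B (\<lambda>h. {x\<in>B. zmod n P (\<lambda>i. x i + int j * h i) \<in> E})"
        unfolding S_def W_def by force
      then have "card (S j) = card (Sigma B (\<lambda>h. {x\<in>B. zmod n P (\<lambda>i. x i + int j * h i) \<in> E}))"
        by (simp add: card_image inj_on_def split_beta prod_eq_iff)
      then show ?thesis using fB by simp
    qed
    also have "\<dots> = (\<Sum>h\<in>B. card E)"
      unfolding B_def by (intro sum.cong refl card_preimage_bij[OF bij_add_zbox[OF P0] E])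
    finally show ?thesis using fB by simp
  qed
  have cSS: "card (S j \<inter> S j') = card E * card E" if "j \<noteq> j'" "j < P" "j' < P" for j j'
  proof -
    have "S j \<inter> S j' = {w\<in>W. (\<lambda>(x,h). (zmod n P (\<lambda>i. x i + int j * h i), zmod n P (\<lambda>i. x i + int j' * h i))) w \<in> E \<times> E}"
      unfolding S_def by auto
    then have "card (S j \<inter> S j') = card (E \<times> E)"
      unfolding W_def B_def using card_preimage_bij[OF bij_pair_zbox[OF P that, of n], of "E \<times> E"] E by auto
    then show ?thesis by (simp add: card_cartesian_product)
  qed
  define Z where "Z = (\<lambda>w. \<Sum>j<P. (if w \<in> S j then 1 else 0) :: real)"
  define e where "e = real (card E)"
  define q where "q = real P"
  have fS: "finite (S j)" for j unfolding S_def using fW by simp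
  have SW: "S j \<subseteq> W" for j unfolding S_def by auto
  have sumZ: "(\<Sum>w\<in>W. Z w) = q * q ^ n * e"
  proof -
    have "(\<Sum>w\<in>W. Z w) = (\<Sum>j<P. \<Sum>w\<in>W. if w \<in> S j then 1 else 0)" unfolding Z_def by (rule sum.swap)
    also have "\<dots> = (\<Sum>j<P. real (card (S j)))"
      using fW SW by (intro sum.cong refl) (simp add: sum.If_cases Int_absorb1)
    finally show ?thesis by (simp add: cS q_def e_def)
  qed
  have sumZ2: "(\<Sum>w\<in>W. (Z w)\<^sup>2) \<le> q * q ^ n * e + q\<^sup>2 * e\<^sup>2"
  proof -
    have "(\<Sum>w\<in>W. (Z w)\<^sup>2) = (\<Sum>w\<in>W. \<Sum>j<P. \<Sum>j'<P. if w \<in> S j \<inter> S j' then 1 else 0)"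
      unfolding Z_def power2_eq_square sum_product by (intro sum.cong refl) auto
    also have "\<dots> = (\<Sum>j<P. \<Sum>j'<P. \<Sum>w\<in>W. if w \<in> S j \<inter> S j' then 1 else 0)"
      by (subst sum.swap, intro sum.cong refl, rule sum.swap)
    also have "\<dots> = (\<Sum>j<P. \<Sum>j'<P. real (card (S j \<inter> S j')))"
    proof (intro sum.cong refl)
      fix j j'
      have "W \<inter> {w. w \<in> S j \<inter> S j'} = S j \<inter> S j'" using SW by blast
      then show "(\<Sum>w\<in>W. if w \<in> S j \<inter> S j' then 1 else 0) = real (card (S j \<inter> S j'))"
        using fW(1) by (simp only: sum.If_cases) simp
    qed
    also have "\<dots> \<le> (\<Sum>j<P. \<Sum>j'<P. (if j = j' then q ^ n * e else 0) + e\<^sup>2)"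
    proof (intro sum_mono)
      fix j j' assume "j \<in> {..<P}" "j' \<in> {..<P}"
      then show "real (card (S j \<inter> S j')) \<le> (if j = j' then q ^ n * e else 0) + e\<^sup>2"
        using cS[of j] cSS[of j j'] by (cases "j = j'") (auto simp: q_def e_def power2_eq_square)
    qed
    also have "\<dots> = q * q ^ n * e + q\<^sup>2 * e\<^sup>2"
      by (simp add: sum.distrib q_def power2_eq_square distrib_left mult.assoc)
    finally show ?thesis .
  qed
  define Unc where "Unc = (\<lambda>h. {x\<in>B. \<forall>j<P. zmod n P (\<lambda>i. x i + int j * h i) \<notin> E})"
  \<comment> \<open>The total number of pairs \<open>(x, h)\<close> with \<open>Z (x, h) = 0\<close>.\<close>
  define U where "U = (\<Sum>h\<in>B. card (Unc h))"
  have U: "real U * e * q \<le> q ^ (3 * n)"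
  proof (cases "card E = 0")
    case True
    then show ?thesis by (simp add: e_def q_def)
  next
    case False
    then have e0: "e > 0" by (simp add: e_def)
    have q0: "q > 0" using P0 by (simp add: q_def)
    define \<mu> where "\<mu> = q * e / q ^ n"
    have "(\<lambda>(h,x). (x,h)) ` Sigma B Unc = {w\<in>W. Z w = 0}"
    proof -
      have "Z w = 0 \<longleftrightarrow> (\<forall>j<P. w \<notin> S j)" for w
        unfolding Z_def by (subst sum_nonneg_eq_0_iff) auto
      then show ?thesis unfolding Unc_def S_def W_def by force
    qed
    then have cU: "card {w\<in>W. Z w = 0} = U"
      unfolding U_def using fB by (subst card_SigmaI[symmetric])
        (auto simp: Unc_def card_image inj_on_def split_beta prod_eq_iff dest!: arg_cong[of _ _ card])
    have "real U * \<mu>\<^sup>2 = (\<Sum>w\<in>{w\<in>W. Z w = 0}. (Z w - \<mu>)\<^sup>2)" using cU by simp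
    also have "\<dots> \<le> (\<Sum>w\<in>W. (Z w - \<mu>)\<^sup>2)" using fW by (intro sum_mono2) auto
    also have "\<dots> = (\<Sum>w\<in>W. (Z w)\<^sup>2) - 2 * \<mu> * (\<Sum>w\<in>W. Z w) + real (card W) * \<mu>\<^sup>2"
    proof -
      have "(\<Sum>w\<in>W. (Z w - \<mu>)\<^sup>2) = (\<Sum>w\<in>W. (Z w)\<^sup>2 - (2 * \<mu>) * Z w + \<mu>\<^sup>2)"
        by (simp add: power2_diff algebra_simps)
      also have "\<dots> = (\<Sum>w\<in>W. (Z w)\<^sup>2) - (2 * \<mu>) * (\<Sum>w\<in>W. Z w) + real (card W) * \<mu>\<^sup>2"
        by (simp only: sum.distrib sum_subtractf sum_distrib_left sum_constant)
      finally show ?thesis .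
    qed
    also have "\<dots> \<le> (q * q ^ n * e + q\<^sup>2 * e\<^sup>2) - 2 * \<mu> * (q * q ^ n * e) + q ^ (2 * n) * \<mu>\<^sup>2"
      using sumZ2 by (simp add: sumZ fW q_def)
    also have "2 * \<mu> * (q * q ^ n * e) = 2 * (q\<^sup>2 * e\<^sup>2)" using q0 by (simp add: \<mu>_def power2_eq_square)
    also have m2: "q ^ (2 * n) * \<mu>\<^sup>2 = q\<^sup>2 * e\<^sup>2"
      using q0 by (simp add: \<mu>_def power_mult_distrib power_divide power_mult[symmetric] mult.commute)
    finally have "real U * \<mu>\<^sup>2 \<le> q * q ^ n * e" by simp
    then have "real U * \<mu>\<^sup>2 * q ^ (2 * n) \<le> q * q ^ n * e * q ^ (2 * n)" using q0 by (intro mult_right_mono) auto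
    also have "real U * \<mu>\<^sup>2 * q ^ (2 * n) = real U * (q ^ (2 * n) * \<mu>\<^sup>2)" by (simp only: mult_ac)
    also have "\<dots> = (real U * e * q) * (q * e)" unfolding m2 by (simp add: power2_eq_square)
    also have "q * q ^ n * e * q ^ (2 * n) = q ^ (3 * n) * (q * e)"
      by (simp add: power_add[symmetric] mult_ac)
    finally show ?thesis using q0 e0 by (simp add: mult_ac)
  qed
  define H where "H = {h\<in>B. \<forall>j\<in>{1..<P}. zmod n P (\<lambda>i. int j * h i) \<notin> A}"
  have "B - H \<subseteq> (\<Union>j\<in>{1..<P}. {h\<in>B. zmod n P (\<lambda>i. int j * h i) \<in> A})" unfolding H_def by auto
  then have "card (B - H) \<le> card (\<Union>j\<in>{1..<P}. {h\<in>B. zmod n P (\<lambda>i. int j * h i) \<in> A})"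
    using fB by (intro card_mono) auto
  also have "\<dots> \<le> (\<Sum>j\<in>{1..<P}. card {h\<in>B. zmod n P (\<lambda>i. int j * h i) \<in> A})" by (rule card_UN_le) simp
  also have "\<dots> = (\<Sum>j\<in>{1..<P}. card A)"
  proof (intro sum.cong refl)
    fix j assume "j \<in> {1..<P}"
    then have "\<not> int P dvd int j" using small_not_dvd[of j 0 P] by simp
    then show "card {h\<in>B. zmod n P (\<lambda>i. int j * h i) \<in> A} = card A"
      unfolding B_def by (intro card_preimage_bij bij_mult_zbox P A(1))
  qed
  also have "\<dots> \<le> P * card A" by simp
  finally have "2 * card (B - H) \<le> P ^ n" using A(2) by simp
  moreover have "card (B - H) = P ^ n - card H" "card H \<le> P ^ n"
    using fB by (auto simp: card_Diff_subset H_def intro: card_mono finite_subset) (metis (no_types, lifting) card_mono fB mem_Collect_eq subsetI)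
  ultimately have cH: "P ^ n \<le> 2 * card H" by linarith
  have fH: "finite H" unfolding H_def using fB by simp
  have "\<exists>h\<in>H. card (Unc h) * card H \<le> U"
  proof (rule ccontr)
    assume "\<not> ?thesis"
    then have *: "\<And>h. h \<in> H \<Longrightarrow> U < card (Unc h) * card H" by (meson not_le)
    have "card H > 0" using cH P0 by (metis gr0I mult_0_right not_le zero_less_power)
    then have "H \<noteq> {}" by auto
    have "U * card H = (\<Sum>h\<in>H. U)" by simp
    also have "\<dots> < (\<Sum>h\<in>H. card (Unc h) * card H)" using * fH \<open>H \<noteq> {}\<close> by (intro sum_strict_mono) auto
    also have "\<dots> = (\<Sum>h\<in>H. card (Unc h)) * card H" by (simp add: sum_distrib_right)
    also have "\<dots> \<le> U * card H"
      unfolding U_def using fB by (intro mult_right_mono sum_mono2) (auto simp: H_def)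
    finally show False by simp
  qed
  then obtain h where h: "h \<in> H" "card (Unc h) * card H \<le> U" by blast
  have q0: "q > 0" using P0 by (simp add: q_def)
  have "real (card (Unc h)) * q ^ n \<le> real (card (Unc h)) * (2 * real (card H))"
    using cH unfolding q_def by (intro mult_left_mono) (auto simp flip: of_nat_power of_nat_le_iff)
  also have "\<dots> \<le> 2 * real U" using h(2) by (simp flip: of_nat_mult)
  finally have "(real (card (Unc h)) * q ^ n) * (e * q) \<le> (2 * real U) * (e * q)"
    using q0 by (intro mult_right_mono) (auto simp: e_def)
  also have "\<dots> \<le> 2 * q ^ (3 * n)" using U by simp
  also have "\<dots> = (2 * q ^ (2 * n)) * q ^ n" by (simp add: power_add[symmetric])
  finally have "(real (card (Unc h)) * e * q) * q ^ n \<le> (2 * q ^ (2 * n)) * q ^ n" by (simp add: mult_ac)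
  then have "real (card (Unc h)) * e * q \<le> 2 * q ^ (2 * n)" using q0 by simp
  then have "real (card (Unc h) * card E * P) \<le> real (2 * P ^ (2 * n))" by (simp add: e_def q_def)
  then have "card (Unc h) * card E * P \<le> 2 * P ^ (2 * n)" by (simp only: of_nat_le_iff)
  then show ?thesis using h(1) unfolding H_def Unc_def B_def by blast
qed

section \<open>A lattice that is packing for differences and covering\<close>

definition zvec :: "nat \<Rightarrow> real \<Rightarrow> (nat \<Rightarrow> int) \<Rightarrow> nat \<Rightarrow> real" where
  "zvec n g a = (\<lambda>i. if i < n then g * of_int (a i) else 0)"

text \<open>
  The class of a grid point modulo the sublattice \<open>zgrid n (g * real P)\<close>, by \<open>gres_eq_iff\<close>.
\<close>

definition gres :: "nat \<Rightarrow> real \<Rightarrow> nat \<Rightarrow> (nat \<Rightarrow> real) \<Rightarrow> nat \<Rightarrow> int" where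
  "gres n g P l = zmod n P (\<lambda>i. \<lfloor>l i / g\<rfloor>)"

lemma zvec_in_zgrid: "zvec n g a \<in> zgrid n g"
  by (auto simp: zvec_def zgrid_def espace_def)

lemma zgrid_eq_zvec: "g > 0 \<Longrightarrow> l \<in> zgrid n g \<Longrightarrow> l = zvec n g (\<lambda>i. \<lfloor>l i / g\<rfloor>)"
proof
  fix i assume g: "g > 0" and l: "l \<in> zgrid n g"
  show "l i = zvec n g (\<lambda>i. \<lfloor>l i / g\<rfloor>) i"
  proof (cases "i < n")
    case True
    then obtain m :: int where "l i = g * of_int m" using l by (auto simp: zgrid_def)
    then show ?thesis using g True by (simp add: zvec_def)
  qed (use l in \<open>auto simp: zvec_def zgrid_def espace_def\<close>)
qed

lemma zvec_in_multiple:
  assumes "g > 0" shows "zvec n g a \<in> zgrid n (g * real P) \<longleftrightarrow> (\<forall>i<n. int P dvd a i)"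
proof
  assume *: "zvec n g a \<in> zgrid n (g * real P)"
  show "\<forall>i<n. int P dvd a i"
  proof (intro allI impI)
    fix i assume i: "i < n"
    then obtain m :: int where "zvec n g a i = g * real P * of_int m" using * by (auto simp: zgrid_def)
    then have "real_of_int (a i) = of_int (int P * m)" using assms i by (simp add: zvec_def)
    then have "a i = int P * m" by (simp only: of_int_eq_iff)
    then show "int P dvd a i" by simp
  qed
next
  assume *: "\<forall>i<n. int P dvd a i"
  have "\<exists>m::int. zvec n g a i = g * real P * of_int m" if that': "i < n" for i
  proof -
    obtain m where "a i = int P * m" using *[rule_format, OF that'] by (auto elim: dvdE)
    then show ?thesis using that' by (intro exI[of _ m]) (simp add: zvec_def)
  qed
  then show "zvec n g a \<in> zgrid n (g * real P)" by (auto simp: zgrid_def zvec_def espace_def)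
qed

lemma gres_eq_iff:
  assumes g: "g > 0" and l: "l \<in> zgrid n g" "l' \<in> zgrid n g"
  shows "gres n g P l = gres n g P l' \<longleftrightarrow> l - l' \<in> zgrid n (g * real P)"
proof -
  have "l - l' = zvec n g (\<lambda>i. \<lfloor>l i / g\<rfloor> - \<lfloor>l' i / g\<rfloor>)"
    by (subst zgrid_eq_zvec[OF g l(1)], subst zgrid_eq_zvec[OF g l(2)])
      (auto simp: zvec_def fun_eq_iff algebra_simps)
  then show ?thesis unfolding gres_def zmod_eq_iff using zvec_in_multiple[OF g] by simp
qed

lemma gres_zvec: "g > 0 \<Longrightarrow> gres n g P (zvec n g a) = zmod n P a"
  unfolding gres_def zmod_eq_iff by (simp add: zvec_def)

lemma zgrid_add_zvec:
  assumes g: "g > 0" and l: "l \<in> zgrid n g"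
  shows "l + sc (real j) (zvec n g h) \<in> zgrid n g"
    "zmod n P (\<lambda>i. gres n g P l i + int j * h i) = gres n g P (l + sc (real j) (zvec n g h))"
proof -
  have eq: "l + sc (real j) (zvec n g h) = zvec n g (\<lambda>i. \<lfloor>l i / g\<rfloor> + int j * h i)"
    by (subst zgrid_eq_zvec[OF g l]) (auto simp: zvec_def fun_eq_iff algebra_simps)
  show "l + sc (real j) (zvec n g h) \<in> zgrid n g" unfolding eq by (rule zvec_in_zgrid)
  have "int P dvd (\<lfloor>l i / g\<rfloor> mod int P + int j * h i) - (\<lfloor>l i / g\<rfloor> + int j * h i)" for i
    by (simp add: mod_eq_dvd_iff[symmetric])
  then show "zmod n P (\<lambda>i. gres n g P l i + int j * h i) = gres n g P (l + sc (real j) (zvec n g h))"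
    unfolding eq gres_zvec[OF g] zmod_eq_iff by (simp add: gres_def zmod_def)
qed

lemma gres_multiple:
  assumes "g > 0" shows "zmod n P (\<lambda>i. int j * h i) = gres n g P (sc (real j) (zvec n g h))"
proof -
  have "sc (real j) (zvec n g h) = zvec n g (\<lambda>i. int j * h i)" by (auto simp: zvec_def fun_eq_iff)
  then show ?thesis using gres_zvec[OF assms] by simp
qed

lemma small_multiple_zero:
  assumes "T > 0" "l \<in> zgrid n T" "\<And>i. i < n \<Longrightarrow> \<bar>l i\<bar> < T"
  shows "l = 0"
proof
  fix i
  show "l i = 0 i"
  proof (cases "i < n")
    case True
    then obtain m :: int where m: "l i = T * of_int m" using assms(2) by (auto simp: zgrid_def)
    have "T * \<bar>of_int m\<bar> < T * 1" using assms(3)[OF True] assms(1) by (simp add: m abs_mult)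
    then have "\<bar>real_of_int m\<bar> < 1" using assms(1) by simp
    then have "m = 0" by linarith
    then show ?thesis by (simp add: m)
  qed (use assms(2) in \<open>auto simp: zgrid_def espace_def\<close>)
qed

text \<open>
  The mesh is determined by the condition that the lattice spanned by \<open>P\<close> times the grid and one more vector has covolume \<open>\<Delta>\<close>.
  For a large prime the grid becomes fine, while \<open>g * P\<close> exceeds any given bound.
\<close>

lemma choose_prime_and_mesh:
  assumes "\<Delta> > 0" "r0 > 0" "n \<ge> 2"
  shows "\<exists>P g. prime (P::nat) \<and> g > 0 \<and> g \<le> r0 \<and> g ^ n * real P ^ n = \<Delta> * real P \<and> M < g * real P"
proof -
  obtain N :: nat where N: "real N > max (\<Delta> / r0 ^ n) (\<bar>M\<bar> ^ n / \<Delta>)" using reals_Archimedean2 by blast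
  obtain P :: nat where P: "prime P" "P > N" using bigger_prime by blast
  have P0: "real P > 0" using prime_gt_0_nat[OF P(1)] by simp
  have PN: "real P > \<Delta> / r0 ^ n" "real P > \<bar>M\<bar> ^ n / \<Delta>" using N P(2) by auto
  define g where "g = root n (\<Delta> / real P ^ (n - 1))"
  have n0: "n > 0" using assms(3) by simp
  have gn: "g ^ n = \<Delta> / real P ^ (n - 1)" unfolding g_def using assms P0 n0 by (intro real_root_pow_pos2) auto
  have g0: "g > 0" unfolding g_def using assms P0 n0 by simp
  have Pn: "real P ^ n = real P ^ (n - 1) * real P" using n0 by (metis power_minus_mult)
  have prod: "g ^ n * real P ^ n = \<Delta> * real P" unfolding gn Pn using P0 by simp
  have "g ^ n \<le> r0 ^ n"
  proof -
    have "real P ^ 1 \<le> real P ^ (n - 1)" using prime_gt_0_nat[OF P(1)] assms(3) by (intro power_increasing) auto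
    then have "\<Delta> / real P ^ (n - 1) \<le> \<Delta> / real P" using assms P0 by (intro divide_left_mono) auto
    also have "\<dots> \<le> r0 ^ n" using PN(1) assms P0 by (simp add: field_simps)
    finally show ?thesis by (simp add: gn)
  qed
  then have "g \<le> r0" using assms(2) n0 power_mono_iff[of g r0 n] g0 by simp
  moreover have "M < g * real P"
  proof -
    have "\<bar>M\<bar> ^ n < \<Delta> * real P" using PN(2) assms(1) by (simp add: field_simps)
    also have "\<dots> = (g * real P) ^ n" by (simp add: power_mult_distrib prod)
    finally have "\<bar>M\<bar> < g * real P" by (rule power_less_imp_less_base) (use g0 P0 in simp)
    then show ?thesis by simp
  qed
  ultimately show ?thesis using P(1) g0 prod by blast
qed

text \<open>
  The lattice spanned by \<open>P\<close> times a grid and one grid vector \<open>w\<close>, with \<open>w\<close> taken from \<open>random_line_code\<close>. For its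
  covolume to suit the differences, \<open>\<Delta> \<ge> 2 * 25\<^sup>n V\<close> is enough. For the covering property, suppose that \<open>y\<close> is uncovered.
  Then every grid point of \<open>y + 2 S\<close>, and also every translate of it by a multiple of \<open>w\<close>, is uncovered by the smaller
  body, and these are distinct modulo \<open>P\<close> by the packing property. Their number contradicts the bound for uncovered points.
\<close>

theorem base_lattice:
  assumes K: "body n K" and cubeK: "cube n r0 \<subseteq> K" and r0: "r0 > 0" and n: "n \<ge> 2"
    and B: "measure (leb n) K \<le> 4 ^ n * measure (leb n) (symbody K 0 n)"
    and \<Delta>: "50 ^ n * measure (leb n) K \<le> \<Delta>" "\<Delta> \<le> 100 ^ n * measure (leb n) K"
  shows "\<exists>L. lat n L \<Delta> \<and> (\<forall>l\<in>L. l \<in> diff2 K \<longrightarrow> l = 0) \<and> covers n L (sc 320004 ` symbody K 0 n)"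
proof -
  define V where "V = measure (leb n) K"
  define S where "S = symbody K 0 n"
  have V: "V > 0" unfolding V_def by (rule body_measure_pos[OF K cubeK r0])
  have bK: "bdd n K" and Ke: "K \<subseteq> espace n" using K by (auto simp: body_def bdd_def)
  have bS: "body n S" unfolding S_def by (rule body_symbody[OF K]) simp
  have cS: "cvx S" and bdS: "bdd n S" using bS by (auto simp: body_def)
  have SK: "S \<subseteq> K" unfolding S_def symbody_def by auto
  have Sneg: "- x \<in> S" if "x \<in> S" for x using that by (auto simp: S_def symbody_def espace_closed)
  have cubeS: "cube n r0 \<subseteq> S"
  proof
    fix x assume x: "x \<in> cube n r0"
    then have "- x \<in> cube n r0" by (auto simp: cube_def espace_def)
    then show "x \<in> S" using x cubeK by (auto simp: S_def symbody_def cube_def)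
  qed
  have VS: "V \<le> 4 ^ n * measure (leb n) S" using B by (simp add: V_def S_def)
  have "\<Delta> > 0" using \<Delta>(1) V by (simp add: V_def) (meson less_le_trans mult_pos_pos zero_less_numeral zero_less_power)
  \<comment> \<open>The contradiction at the end needs \<open>320000 = 2 * (100 * 4)\<^sup>2\<close>; the additional units leave room for rounding to the grid.\<close>
  define \<rho> :: real where "\<rho> = 320001"
  obtain D1 where D1: "\<And>x i. x \<in> sc \<rho> ` S \<Longrightarrow> i < n \<Longrightarrow> \<bar>x i\<bar> \<le> D1"
    using bdd_sc[OF bdS, of \<rho>] unfolding bdd_def by blast
  obtain D2 where D2: "\<And>x i. x \<in> diff2 K \<Longrightarrow> i < n \<Longrightarrow> \<bar>x i\<bar> \<le> D2"
    using bdd_diff2[OF bK] unfolding bdd_def by blast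
  define D where "D = max D1 D2"
  obtain P g where P: "prime (P::nat)" and g: "g > 0" "g \<le> r0" and gP: "g ^ n * real P ^ n = \<Delta> * real P"
    and T: "2 * \<bar>D\<bar> < g * real P"
    using choose_prime_and_mesh[OF \<open>\<Delta> > 0\<close> r0 n] by blast
  have P0: "real P > 0" using prime_gt_0_nat[OF P] by simp
  define G where "G = zgrid n g"
  define L0 where "L0 = zgrid n (g * real P)"
  have LG: "lat n G (g ^ n)" unfolding G_def by (rule lat_zgrid[OF g(1)])
  have L0: "lat n L0 ((g * real P) ^ n)" unfolding L0_def by (rule lat_zgrid) (use g P0 in simp)
  have cov: "covers n G (cube n g)" unfolding G_def by (rule zgrid_covers[OF g(1)])
  have L0G: "L0 \<subseteq> G"
  proof
    fix x assume x: "x \<in> L0"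
    have "\<exists>m::int. x i = g * of_int m" if that': "i < n" for i
    proof -
      obtain m :: int where "x i = g * real P * of_int m" using x that' by (auto simp: L0_def zgrid_def)
      then show ?thesis by (intro exI[of _ "int P * m"]) simp
    qed
    then show "x \<in> G" using x by (auto simp: L0_def G_def zgrid_def)
  qed
  define f where "f = gres n g P"
  have f_eq: "f l = f l' \<longleftrightarrow> l - l' \<in> L0" if "l \<in> G" "l' \<in> G" for l l'
    using gres_eq_iff[OF g(1)] that by (simp add: f_def G_def L0_def)
  have f_box: "f l \<in> zbox n P" for l unfolding f_def gres_def by (rule zmod_in_zbox) (use prime_gt_0_nat[OF P] in simp)
  have inj: "card (f ` {l\<in>G. l \<in> X}) = card {l\<in>G. l \<in> X}" if X: "\<And>x i. x \<in> X \<Longrightarrow> i < n \<Longrightarrow> \<bar>x i\<bar> \<le> D" for X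
  proof (rule card_image, rule inj_onI)
    fix l l' assume l: "l \<in> {l\<in>G. l \<in> X}" "l' \<in> {l\<in>G. l \<in> X}" "f l = f l'"
    then have d: "l - l' \<in> L0" using f_eq by simp
    have "l - l' = 0"
    proof (rule small_multiple_zero)
      show "l - l' \<in> zgrid n (g * real P)" using d by (simp add: L0_def)
      show "0 < g * real P" using g P0 by simp
      fix i assume "i < n"
      then have "\<bar>l i\<bar> \<le> D" "\<bar>l' i\<bar> \<le> D" using X l by auto
      then show "\<bar>(l - l') i\<bar> < g * real P" using T by (simp add: abs_le_iff) linarith
    qed
    then show "l = l'" by simp
  qed
  define A where "A = f ` {l\<in>G. l \<in> diff2 K}"
  define E where "E = f ` {l\<in>G. l \<in> sc \<rho> ` S}"
  define E' where "E' = {l\<in>G. l \<in> sc 2 ` S}"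
  have cA: "card A = card {l\<in>G. l \<in> diff2 K}" unfolding A_def by (rule inj) (use D2 in \<open>auto simp: D_def le_max_iff_disj\<close>)
  have cE: "card E = card {l\<in>G. l \<in> sc \<rho> ` S}" unfolding E_def by (rule inj) (use D1 in \<open>auto simp: D_def le_max_iff_disj\<close>)
  have Abound: "real (card A) * g ^ n \<le> 25 ^ n * V"
    unfolding cA G_def V_def by (rule difference_count[OF K cubeK r0 g])
  have "2 * P * card A \<le> P ^ n"
  proof -
    have "(2::real) * 25 ^ n \<le> 50 ^ n"
    proof -
      have "(2::real) ^ 1 \<le> 2 ^ n" using n by (intro power_increasing) auto
      then have "(2::real) * 25 ^ n \<le> 2 ^ n * 25 ^ n" by simp
      then show ?thesis by (simp flip: power_mult_distrib)
    qed
    then have "2 * 25 ^ n * V \<le> \<Delta>" using \<Delta>(1) V unfolding V_def[symmetric]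
      by (meson less_imp_le mult_right_mono order_trans)
    then have "2 * (real (card A) * g ^ n) \<le> \<Delta>" using Abound by linarith
    then have "2 * (real (card A) * g ^ n) * real P \<le> g ^ n * real P ^ n"
      unfolding gP using P0 by (intro mult_right_mono) auto
    then have "g ^ n * (2 * real P * real (card A)) \<le> g ^ n * real P ^ n" by (simp add: mult_ac)
    then have "2 * real P * real (card A) \<le> real P ^ n" using g by simp
    then have "real (2 * P * card A) \<le> real (P ^ n)" by simp
    then show ?thesis by (simp only: of_nat_le_iff)
  qed
  moreover have "A \<subseteq> zbox n P" "E \<subseteq> zbox n P" using f_box by (auto simp: A_def E_def)
  ultimately obtain h where h: "h \<in> zbox n P" "\<And>j. j \<in> {1..<P} \<Longrightarrow> zmod n P (\<lambda>i. int j * h i) \<notin> A"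
    and unc: "card {x\<in>zbox n P. \<forall>j<P. zmod n P (\<lambda>i. x i + int j * h i) \<notin> E} * card E * P \<le> 2 * P ^ (2 * n)"
    using random_line_code[OF P, of E n A] by blast
  define w where "w = zvec n g h"
  have wG: "w \<in> G" unfolding w_def G_def by (rule zvec_in_zgrid)
  have we: "w \<in> espace n" using wG lat_espace[OF LG] by blast
  have jw: "zmod n P (\<lambda>i. int j * h i) = f (sc (real j) w)" for j unfolding f_def w_def by (rule gres_multiple[OF g(1)])
  have jwG: "sc (real j) w \<in> G" for j using lat_group(5)[OF LG wG, of "int j"] by simp
  have Pw: "sc (real P) w \<in> L0"
  proof -
    have "sc (real P) w = zvec n g (\<lambda>i. int P * h i)" by (auto simp: w_def zvec_def fun_eq_iff)
    then show ?thesis unfolding L0_def using zvec_in_multiple[OF g(1)] by simp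
  qed
  have "0 \<in> K" using cubeK cube_0[of r0 n] r0 by auto
  then have d0: "0 \<in> diff2 K" unfolding diff2_def by (intro CollectI exI[of _ 0]) simp
  have wL0: "w \<notin> L0"
  proof
    assume "w \<in> L0"
    then have "f (sc (real 1) w) = f 0" using f_eq[OF wG lat_group(1)[OF LG]] by simp
    moreover have "f 0 \<in> A" unfolding A_def using d0 lat_group(1)[OF LG] by blast
    moreover have "1 \<in> {1..<P}" using prime_gt_1_nat[OF P] by simp
    ultimately show False using h(2)[of 1] jw[of 1] by simp
  qed
  define L where "L = adjoin L0 w"
  have "(g * real P) ^ n / real P = \<Delta>" using gP P0 by (simp add: power_mult_distrib)
  then have latL: "lat n L \<Delta>" using adjoin_covolume[OF L0 P we Pw wL0] by (simp add: L_def)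
  have inL: "l + sc (of_int z) w \<in> L" if "l \<in> L0" for l z unfolding L_def adjoin_def using that by blast
  have pack: "l = 0" if l: "l \<in> L" "l \<in> diff2 K" for l
  proof -
    obtain l0 j where l0: "l0 \<in> L0" "j < P" "l = l0 + sc (real j) w"
      using adjoin_reps[OF L0 P Pw] l(1) unfolding L_def by blast
    have lG: "l \<in> G" unfolding l0(3) using lat_group(2)[OF LG] l0(1) L0G jwG by blast
    show ?thesis
    proof (cases "j = 0")
      case True
      then have "l \<in> L0" using l0 by simp
      then show ?thesis unfolding L0_def
      proof (rule small_multiple_zero[rotated])
        show "0 < g * real P" using g P0 by simp
        fix i assume "i < n"
        then have "\<bar>l i\<bar> \<le> D2" using D2 l by blast
        then show "\<bar>l i\<bar> < g * real P" using T by (simp add: D_def)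
      qed
    next
      case False
      then have "f (sc (real j) w) \<notin> A" using h(2)[of j] l0(2) jw by simp
      moreover have "f l = f (sc (real j) w)" using f_eq[OF lG jwG] l0 by simp
      moreover have "f l \<in> A" unfolding A_def using lG l(2) by blast
      ultimately show ?thesis by simp
    qed
  qed
  have covL: "covers n L (sc 320004 ` S)"
  proof (rule ccontr)
    assume "\<not> ?thesis"
    then obtain y where y: "y \<in> espace n" "\<And>l. l \<in> L \<Longrightarrow> y - l \<notin> sc 320004 ` S" by (auto simp: covers_def)
    obtain y' where y': "y' \<in> G" "y - y' \<in> cube n g" using cov y(1) by (auto simp: covers_def)
    have yS: "y - y' \<in> sc 1 ` S" using y'(2) cube_mono[OF g(2)] cubeS by auto
    define U where "U = {x\<in>zbox n P. \<forall>j<P. zmod n P (\<lambda>i. x i + int j * h i) \<notin> E}"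
    define \<psi> where "\<psi> = (\<lambda>(a, j). f (y' + a + sc (real j) w))"
    have E'G: "a \<in> G" if "a \<in> E'" for a using that by (simp add: E'_def)
    have mem: "y' + a + sc (real j) w \<in> G" if "a \<in> E'" for a j
      by (intro lat_group(2)[OF LG] y' E'G[OF that] jwG)
    have "inj_on \<psi> (E' \<times> {..<P})"
    proof (rule inj_onI)
      fix s t assume st: "s \<in> E' \<times> {..<P}" "t \<in> E' \<times> {..<P}" "\<psi> s = \<psi> t"
      obtain a j a' j' where s: "s = (a, j)" "t = (a', j')" by (cases s, cases t) simp
      have a: "a \<in> E'" "j \<in> {..<P}" "a' \<in> E'" "j' \<in> {..<P}" and eq: "\<psi> (a, j) = \<psi> (a', j')"
        using st unfolding s by blast+
      have "(y' + a + sc (real j) w) - (y' + a' + sc (real j') w) \<in> L0"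
        using eq f_eq[OF mem[OF a(1)] mem[OF a(3)]] by (simp add: \<psi>_def)
      moreover have "(y' + a + sc (real j) w) - (y' + a' + sc (real j') w) = (a - a') + sc (of_int (int j - int j')) w"
        by (simp add: fun_eq_iff algebra_simps)
      ultimately have d: "(a - a') + sc (of_int (int j - int j')) w \<in> L0" by simp
      have "((a - a') + sc (of_int (int j - int j')) w) + sc (of_int (int j' - int j)) w \<in> L" by (rule inL[OF d])
      moreover have "((a - a') + sc (of_int (int j - int j')) w) + sc (of_int (int j' - int j)) w = a - a'"
        by (simp add: fun_eq_iff algebra_simps)
      ultimately have "a - a' \<in> L" by (simp only:)
      moreover have "a - a' \<in> diff2 K"
      proof -
        obtain b b' where "a = sc 2 b" "a' = sc 2 b'" "b \<in> S" "b' \<in> S" using a by (auto simp: E'_def)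
        then show ?thesis unfolding diff2_def using SK by (intro CollectI exI[of _ b] exI[of _ b']) (auto simp: sc_diff)
      qed
      ultimately have aa: "a = a'" using pack[of "a - a'"] by simp
      then have "sc (of_int (int j - int j')) w \<in> L0" using d by simp
      moreover have "sc (of_int (int j - int j')) w + sc (real j') w = 0 + sc (real j) w"
        by (simp add: fun_eq_iff algebra_simps)
      ultimately have "j' = j" using adjoin_unique_rep[OF L0 P Pw wL0 _ _ lat_group(1)[OF L0]] a by simp
      then show "s = t" using aa by (simp add: s)
    qed
    moreover have "\<psi> ` (E' \<times> {..<P}) \<subseteq> U"
    proof (rule image_subsetI)
      fix s assume "s \<in> E' \<times> {..<P}"
      then obtain a j where s: "s = (a, j)" and a: "a \<in> E'" "j \<in> {..<P}" by blast
      have "zmod n P (\<lambda>i. \<psi> (a, j) i + int j' * h i) \<notin> E" for j'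
      proof
        assume "zmod n P (\<lambda>i. \<psi> (a, j) i + int j' * h i) \<in> E"
        moreover have "zmod n P (\<lambda>i. \<psi> (a, j) i + int j' * h i) = f ((y' + a + sc (real j) w) + sc (real j') w)"
          using zgrid_add_zvec(2)[OF g(1), of "y' + a + sc (real j) w" n P j' h] mem[OF a(1)]
          by (simp add: \<psi>_def f_def G_def w_def)
        ultimately obtain e where e: "e \<in> G" "e \<in> sc \<rho> ` S" "f ((y' + a + sc (real j) w) + sc (real j') w) = f e"
          unfolding E_def by auto
        have "(y' + a + sc (real j) w) + sc (real j') w \<in> G" by (intro lat_group(2)[OF LG] mem a jwG)
        then have "((y' + a + sc (real j) w) + sc (real j') w) - e \<in> L0" using f_eq e by blast
        from inL[OF this, of "- int j - int j'"]
        have "(((y' + a + sc (real j) w) + sc (real j') w) - e) + sc (of_int (- int j - int j')) w \<in> L" .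
        moreover have "(((y' + a + sc (real j) w) + sc (real j') w) - e) + sc (of_int (- int j - int j')) w = y' + a - e"
          by (simp add: fun_eq_iff algebra_simps)
        ultimately have lL: "y' + a - e \<in> L" by (simp only:)
        have "- a \<in> sc 2 ` S"
        proof -
          obtain b where "a = sc 2 b" "b \<in> S" using a by (auto simp: E'_def)
          then have "- a = sc 2 (- b)" "- b \<in> S" using Sneg by (auto simp: sc_minus)
          then show ?thesis by blast
        qed
        from sc_image_add[OF cS _ _ yS this] have "(y - y') + (- a) \<in> sc 3 ` S" by simp
        from sc_image_add[OF cS _ _ this e(2)] have "(y - y') + (- a) + e \<in> sc (3 + \<rho>) ` S" by (simp add: \<rho>_def)
        moreover have "(y - y') + (- a) + e = y - (y' + a - e)" by (simp add: algebra_simps)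
        ultimately show False using y(2)[OF lL] by (simp only: \<rho>_def) simp
      qed
      then show "\<psi> s \<in> U" unfolding U_def s using f_box by (auto simp: \<psi>_def)
    qed
    moreover have "finite U" unfolding U_def by simp
    ultimately have "card (E' \<times> {..<P}) \<le> card U" by (rule card_inj_on_le)
    then have cU: "card E' * P \<le> card U" by (simp add: card_cartesian_product)
    have "card U * card E * P \<le> 2 * P ^ (2 * n)" using unc by (simp add: U_def)
    moreover have "(card E' * P) * card E * P \<le> card U * card E * P" using cU by (intro mult_right_mono) auto
    ultimately have "(card E' * P) * card E * P \<le> 2 * P ^ (2 * n)" by (rule order_trans[rotated])
    then have "real ((card E' * P) * card E * P) \<le> real (2 * P ^ (2 * n))" by (simp only: of_nat_le_iff)
    moreover have "real ((card E' * P) * card E * P) = real (card E') * real (card E) * (real P)\<^sup>2"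
      by (simp add: power2_eq_square)
    moreover have "real (2 * P ^ (2 * n)) = 2 * (real P ^ n)\<^sup>2" by (simp add: power_even_eq)
    ultimately have main: "real (card E') * real (card E) * (real P)\<^sup>2 \<le> 2 * (real P ^ n)\<^sup>2" by (simp only:)
    have "real (card E') * real (card E) * (real P)\<^sup>2 * (g ^ n)\<^sup>2 \<le> 2 * (real P ^ n)\<^sup>2 * (g ^ n)\<^sup>2"
      using main g by (intro mult_right_mono) auto
    also have "2 * (real P ^ n)\<^sup>2 * (g ^ n)\<^sup>2 = 2 * (g ^ n * real P ^ n)\<^sup>2" by (simp add: power_mult_distrib)
    also have "\<dots> = 2 * \<Delta>\<^sup>2 * (real P)\<^sup>2" unfolding gP by (simp add: power_mult_distrib)
    finally have "((real (card E') * g ^ n) * (real (card E) * g ^ n)) * (real P)\<^sup>2 \<le> (2 * \<Delta>\<^sup>2) * (real P)\<^sup>2"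
      by (simp add: power2_eq_square mult_ac)
    then have EE: "(real (card E') * g ^ n) * (real (card E) * g ^ n) \<le> 2 * \<Delta>\<^sup>2" using P0 by simp
    have "measure (leb n) S \<le> real (lcount G (sc 2 ` S) 0) * g ^ n"
    proof (rule measure_le_count[OF LG cov bdd_sc[OF bdS] bdS])
      show "S \<in> sets borel" using bS by (simp add: body_def)
      fix x d assume "x \<in> S" "d \<in> cube n g"
      then have "x + d \<in> sc (1 + 1) ` S" using g by (intro sc_image_add_cube[OF cS cubeS r0]) auto
      then show "x + d \<in> sc 2 ` S" by simp
    qed simp
    then have e1: "measure (leb n) S \<le> real (card E') * g ^ n" by (simp add: E'_def lcount_def)
    have "measure (leb n) (sc 320000 ` S) \<le> real (lcount G (sc \<rho> ` S) 0) * g ^ n"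
    proof (rule measure_le_count[OF LG cov bdd_sc[OF bdS] bdd_sc[OF bdS]])
      show "sc 320000 ` S \<in> sets borel" using body_sc[OF bS, of 320000] by (simp add: body_def)
      fix x d assume "x \<in> sc 320000 ` S" "d \<in> cube n g"
      then have "x + d \<in> sc (320000 + 1) ` S" using g by (intro sc_image_add_cube[OF cS cubeS r0]) auto
      then show "x + d \<in> sc \<rho> ` S" by (simp add: \<rho>_def)
    qed simp
    then have e2: "320000 ^ n * measure (leb n) S \<le> real (card E) * g ^ n"
      using measure_sc[OF bS, of 320000] by (simp add: cE lcount_def)
    define m where "m = measure (leb n) S"
    have mV: "V \<le> 4 ^ n * m" using VS by (simp add: m_def)
    have m0: "m > 0" using V mV by (metis less_le_trans zero_less_mult_pos zero_less_numeral zero_less_power)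
    have "m * (320000 ^ n * m) \<le> 2 * \<Delta>\<^sup>2"
    proof -
      have "m * (320000 ^ n * m) \<le> (real (card E') * g ^ n) * (real (card E) * g ^ n)"
        by (rule mult_mono) (use e1 e2 m0 g in \<open>auto simp: m_def\<close>)
      then show ?thesis using EE by linarith
    qed
    also have "\<dots> \<le> 2 * (100 ^ n * V)\<^sup>2" using \<Delta>(2) \<open>\<Delta> > 0\<close> by (intro mult_left_mono power_mono) (auto simp: V_def)
    also have "\<dots> \<le> 2 * (100 ^ n * (4 ^ n * m))\<^sup>2" using mV V by (intro mult_left_mono power_mono) auto
    also have "\<dots> = 2 * 160000 ^ n * m * m"
    proof -
      have "(100 ^ n * (4 ^ n * m))\<^sup>2 = (100 * 4 * (100 * 4)) ^ n * m * m"
        by (simp only: power_mult_distrib power2_eq_square mult_ac)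
      then show ?thesis by simp
    qed
    finally have "320000 ^ n * (m * m) \<le> 2 * 160000 ^ n * (m * m)" by (simp add: mult_ac)
    then have "(320000::real) ^ n \<le> 2 * 160000 ^ n" using m0 by simp
    also have "(320000::real) ^ n = 2 ^ n * 160000 ^ n" by (simp flip: power_mult_distrib)
    finally have "(2::real) ^ n \<le> 2" by simp
    moreover have "(2::real) ^ 2 \<le> 2 ^ n" using n by (intro power_increasing) auto
    ultimately show False by simp
  qed
  show ?thesis using latL pack covL by (auto simp: S_def)
qed

section \<open>Lattices generated by fractional points\<close>

lemma sum_zbox_Suc:
  fixes F :: "(nat \<Rightarrow> int) \<Rightarrow> real"
  shows "(\<Sum>t\<in>zbox (Suc k) q. F t) = (\<Sum>s<q. \<Sum>t\<in>zbox k q. F (t(k := int s)))"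
proof -
  have int_image: "{0..<int q} = int ` {..<q}"
    using image_int_atLeastLessThan[of 0 q] by (simp add: atLeast0LessThan)
  have "(\<Sum>t\<in>zbox (Suc k) q. F t) = (\<Sum>y\<in>{0..<int q}. \<Sum>t\<in>zbox k q. F (t(k := y)))"
    unfolding zbox_def sum_PiE_lessThan_Suc by (rule sum.swap)
  also have "\<dots> = (\<Sum>s<q. \<Sum>t\<in>zbox k q. F (t(k := int s)))"
    unfolding int_image by (subst sum.reindex) auto
  finally show ?thesis .
qed

lemma iterated_adjoin_count:
  assumes L: "lat n L v" and q: "prime (q::nat)"
    and h: "\<And>l. l < k \<Longrightarrow> h l \<in> espace n" "\<And>l. l < k \<Longrightarrow> sc (real q) (h l) \<in> L"
  shows "\<exists>L' v'. lat n L' v' \<and> L \<subseteq> L' \<and> v \<le> real q ^ k * v' \<and>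
     (\<forall>X x. bdd n X \<longrightarrow> v' * real (lcount L' X x) =
        v / real q ^ k * (\<Sum>t\<in>zbox k q. real (lcount L X (x + (\<Sum>l<k. sc (of_int (t l)) (h l))))))"
  using h
proof (induction k)
  case 0
  have "lat n L v \<and> L \<subseteq> L \<and> v \<le> real q ^ 0 * v \<and>
     (\<forall>X x. bdd n X \<longrightarrow> v * real (lcount L X x) =
        v / real q ^ 0 * (\<Sum>t\<in>zbox 0 q. real (lcount L X (x + (\<Sum>l<0. sc (of_int (t l)) (h l))))))"
    using L by (simp add: zbox_def)
  then show ?case by (rule exI[of _ L, OF exI[of _ v]])
next
  case (Suc k)
  have hl: "h l \<in> espace n" "sc (real q) (h l) \<in> L" if "l < k" for l
    using Suc.prems(1)[of l] Suc.prems(2)[of l] that by (simp_all only: less_SucI)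
  have "\<exists>L1 v1. lat n L1 v1 \<and> L \<subseteq> L1 \<and> v \<le> real q ^ k * v1 \<and>
     (\<forall>X x. bdd n X \<longrightarrow> v1 * real (lcount L1 X x) =
        v / real q ^ k * (\<Sum>t\<in>zbox k q. real (lcount L X (x + (\<Sum>l<k. sc (of_int (t l)) (h l))))))"
    by (rule Suc.IH) (erule hl)+
  then obtain L1 v1 where L1v: "lat n L1 v1 \<and> L \<subseteq> L1 \<and> v \<le> real q ^ k * v1 \<and>
     (\<forall>X x. bdd n X \<longrightarrow> v1 * real (lcount L1 X x) =
        v / real q ^ k * (\<Sum>t\<in>zbox k q. real (lcount L X (x + (\<Sum>l<k. sc (of_int (t l)) (h l))))))"
    by (elim exE) (rule that)
  then have L1: "lat n L1 v1" "L \<subseteq> L1" "v \<le> real q ^ k * v1" by simp_all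
  have c1: "v1 * real (lcount L1 X x) =
        v / real q ^ k * (\<Sum>t\<in>zbox k q. real (lcount L X (x + (\<Sum>l<k. sc (of_int (t l)) (h l)))))" if "bdd n X" for X x
    using L1v that by simp
  have hk: "h k \<in> espace n" "sc (real q) (h k) \<in> L1"
    using Suc.prems(1)[of k] subsetD[OF L1(2) Suc.prems(2)[of k]] by blast+
  from adjoin_count[OF L1(1) q hk]
  obtain v2 where v2v: "lat n (adjoin L1 (h k)) v2 \<and> v1 \<le> real q * v2 \<and>
     (\<forall>X x. bdd n X \<longrightarrow> v2 * real (lcount (adjoin L1 (h k)) X x) =
        v1 / q * (\<Sum>s<q. real (lcount L1 X (x + sc (real s) (h k)))))"
    by (elim exE) (rule that)
  then have v2: "lat n (adjoin L1 (h k)) v2" "v1 \<le> real q * v2" by simp_all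
  have c2: "v2 * real (lcount (adjoin L1 (h k)) X x) =
        v1 / q * (\<Sum>s<q. real (lcount L1 X (x + sc (real s) (h k))))" if "bdd n X" for X x
    using v2v that by simp
  have sub: "L \<subseteq> adjoin L1 (h k)"
  proof
    fix l assume "l \<in> L"
    then show "l \<in> adjoin L1 (h k)" unfolding adjoin_def using L1(2)
      by (intro CollectI exI[of _ l] exI[of _ 0]) auto
  qed
  have q0: "real q > 0" using prime_gt_0_nat[OF q] by simp
  have "v \<le> real q ^ k * (real q * v2)"
    using L1(3) v2(2) q0 by (meson mult_left_mono order_trans zero_le_power less_imp_le)
  then have vv: "v \<le> real q ^ Suc k * v2" by (simp add: mult_ac)
  have "v2 * real (lcount (adjoin L1 (h k)) X x) = v / real q ^ Suc k *
      (\<Sum>t\<in>zbox (Suc k) q. real (lcount L X (x + (\<Sum>l<Suc k. sc (of_int (t l)) (h l)))))" if X: "bdd n X" for X x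
  proof -
    have "v2 * real (lcount (adjoin L1 (h k)) X x) = 1 / q * (\<Sum>s<q. v1 * real (lcount L1 X (x + sc (real s) (h k))))"
      by (simp add: c2[OF X] sum_distrib_left)
    also have "\<dots> = 1 / q * (\<Sum>s<q. v / real q ^ k *
        (\<Sum>t\<in>zbox k q. real (lcount L X (x + sc (real s) (h k) + (\<Sum>l<k. sc (of_int (t l)) (h l))))))"
      by (simp only: c1[OF X])
    also have "\<dots> = v / real q ^ Suc k * (\<Sum>s<q. \<Sum>t\<in>zbox k q.
        real (lcount L X (x + sc (real s) (h k) + (\<Sum>l<k. sc (of_int (t l)) (h l)))))"
      unfolding sum_distrib_left[symmetric] by simp
    also have "(\<Sum>s<q. \<Sum>t\<in>zbox k q. real (lcount L X (x + sc (real s) (h k) + (\<Sum>l<k. sc (of_int (t l)) (h l))))) =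
       (\<Sum>t\<in>zbox (Suc k) q. real (lcount L X (x + (\<Sum>l<Suc k. sc (of_int (t l)) (h l)))))"
      unfolding sum_zbox_Suc by (intro sum.cong refl) (simp add: add_ac)
    finally show ?thesis .
  qed
  with v2(1) sub vv show ?case by (intro exI[of _ "adjoin L1 (h k)"] exI[of _ v2]) blast
qed

text \<open>
  The point of \<open>(1 / q) L\<close> with coordinates \<open>z / q\<close>. It depends modulo \<open>L\<close> only on \<open>z\<close> modulo \<open>q\<close>, so that \<open>(1 / q) L\<close>
  modulo \<open>L\<close> is identified with the vectors modulo \<open>q\<close>.
\<close>

definition frac_point :: "nat \<Rightarrow> nat \<Rightarrow> (nat \<Rightarrow> nat \<Rightarrow> real) \<Rightarrow> (nat \<Rightarrow> int) \<Rightarrow> nat \<Rightarrow> real" where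
  "frac_point n q b z = lc n (\<lambda>j. of_int (z j) / real q) b"

lemma frac_point_add: "frac_point n q b (\<lambda>j. y j + z j) = frac_point n q b y + frac_point n q b z"
  unfolding frac_point_def lc_add[symmetric] by (simp add: add_divide_distrib)

lemma frac_point_scale: "frac_point n q b (\<lambda>j. c * z j) = sc (of_int c) (frac_point n q b z)"
  unfolding frac_point_def lc_sc[symmetric] by simp

lemma frac_point_sum:
  fixes k :: nat
  shows "frac_point n q b (\<lambda>i. a i + (\<Sum>l<k. t l * u l i)) =
   frac_point n q b a + (\<Sum>l<k. sc (of_int (t l)) (frac_point n q b (u l)))"
proof (induction k)
  case (Suc k)
  have "(\<lambda>i. a i + (\<Sum>l<Suc k. t l * u l i)) = (\<lambda>i. (a i + (\<Sum>l<k. t l * u l i)) + t k * u k i)"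
    by (simp add: add_ac)
  then have "frac_point n q b (\<lambda>i. a i + (\<Sum>l<Suc k. t l * u l i)) =
     frac_point n q b (\<lambda>i. a i + (\<Sum>l<k. t l * u l i)) + frac_point n q b (\<lambda>i. t k * u k i)"
    by (simp only: frac_point_add)
  then show ?case by (simp only: Suc.IH frac_point_scale sum.lessThan_Suc add.assoc)
qed (simp only: lessThan_0 sum.empty add_0_right)

lemma frac_point_multiple:
  assumes "q > 0" shows "frac_point n q b (\<lambda>j. int q * z j) = lc n (\<lambda>j. of_int (z j)) b"
  unfolding frac_point_def using assms by (intro lc_cong) simp

lemma frac_point_cong: "(\<And>j. j < n \<Longrightarrow> y j = z j) \<Longrightarrow> frac_point n q b y = frac_point n q b z"
  unfolding frac_point_def by (intro lc_cong) simp

lemma frac_point_range: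
  assumes "q > 0" shows "sc (1 / real q) ` zspan n b = range (frac_point n q b)"
proof -
  have "sc (1 / real q) (lc n (\<lambda>j. of_int (z j)) b) = frac_point n q b z" for z :: "nat \<Rightarrow> int"
    unfolding frac_point_def lc_sc[symmetric] by simp
  then show ?thesis unfolding zspan_def image_image by simp
qed

lemma lcount_periodic:
  assumes L: "lat n L v" "L = zspan n b" and q: "q > 0"
    and eq: "\<And>i. i < n \<Longrightarrow> int q dvd y i - z i"
  shows "lcount L X (frac_point n q b y) = lcount L X (frac_point n q b z)"
proof -
  define m where "m = (\<lambda>i. (y i - z i) div int q)"
  have "frac_point n q b y = frac_point n q b (\<lambda>i. z i + int q * m i)"
    by (rule frac_point_cong) (use eq in \<open>simp add: m_def\<close>)
  also have "\<dots> = frac_point n q b z + lc n (\<lambda>j. of_int (m j)) b"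
    by (simp only: frac_point_add frac_point_multiple[OF q])
  finally show ?thesis using lcount_lattice_shift[OF L(1)] L(2) by (auto simp: zspan_iff)
qed

text \<open>
  Sort the points of \<open>(1 / q) L\<close> according to their classes modulo \<open>L\<close>.
\<close>

lemma lcount_fraction_lattice:
  assumes L: "lat n L v" "L = zspan n b" "indep n b" and q: "q > 0" and X: "bdd n X"
  shows "(\<Sum>z\<in>zbox n q. real (lcount L X (frac_point n q b z))) = real (lcount (sc (1 / real q) ` L) X 0)"
proof -
  let ?P = "frac_point n q b"
  let ?S = "SIGMA z:zbox n q. {l \<in> L. ?P z + l \<in> X}"
  have "bij_betw (\<lambda>(z, l). ?P z + l) ?S {g \<in> sc (1 / real q) ` L. 0 + g \<in> X}"
    unfolding bij_betw_def
  proof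
    have rep: "?P z + lc n (\<lambda>j. of_int (m j)) b = ?P (\<lambda>j. z j + int q * m j)" for z m
      by (simp only: frac_point_add frac_point_multiple[OF q])
    show "inj_on (\<lambda>(z, l). ?P z + l) ?S"
    proof (rule inj_onI)
      fix s s' assume s: "s \<in> ?S" "s' \<in> ?S" "(\<lambda>(z, l). ?P z + l) s = (\<lambda>(z, l). ?P z + l) s'"
      obtain z l z' l' where zl: "s = (z, l)" "s' = (z', l')" by (cases s, cases s') simp
      have z: "z \<in> zbox n q" "z' \<in> zbox n q" and l: "l \<in> L" "l' \<in> L" using s(1,2) unfolding zl by auto
      obtain m m' :: "nat \<Rightarrow> int" where m: "l = lc n (\<lambda>j. of_int (m j)) b" "l' = lc n (\<lambda>j. of_int (m' j)) b"
        using l unfolding L(2) zspan_iff by blast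
      have P: "?P z + l = ?P z' + l'" using s(3) by (simp add: zl)
      then have e: "?P (\<lambda>j. z j + int q * m j) = ?P (\<lambda>j. z' j + int q * m' j)" unfolding m rep .
      have "z = z'"
      proof (rule PiE_ext[of z "{..<n}" "\<lambda>_. {0..<int q}" z'])
        fix j assume "j \<in> {..<n}"
        then have j: "j < n" by simp
        from lc_inj[OF L(3) e[unfolded frac_point_def] j] q
        have "real_of_int (z j + int q * m j) = of_int (z' j + int q * m' j)" by simp
        then have "z j + int q * m j = z' j + int q * m' j" by (simp only: of_int_eq_iff)
        then have "(z j + int q * m j) mod int q = (z' j + int q * m' j) mod int q" by simp
        moreover have "0 \<le> z j" "z j < int q" "0 \<le> z' j" "z' j < int q"
          using z j unfolding zbox_def by (auto dest!: PiE_mem[of _ _ _ j])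
        ultimately show "z j = z' j" by simp
      qed (use z in \<open>auto simp: zbox_def\<close>)
      with P show "s = s'" unfolding zl by simp
    qed
    show "(\<lambda>(z, l). ?P z + l) ` ?S = {g \<in> sc (1 / real q) ` L. 0 + g \<in> X}"
    proof (rule equalityI)
      show "(\<lambda>(z, l). ?P z + l) ` ?S \<subseteq> {g \<in> sc (1 / real q) ` L. 0 + g \<in> X}"
      proof (rule image_subsetI)
        fix s assume s: "s \<in> ?S"
        obtain z l where zl: "s = (z, l)" by (cases s)
        have l: "l \<in> L" "?P z + l \<in> X" using s unfolding zl by auto
        obtain m :: "nat \<Rightarrow> int" where m: "l = lc n (\<lambda>j. of_int (m j)) b"
          using l unfolding L(2) zspan_iff by blast
        have "?P z + l \<in> sc (1 / real q) ` L" unfolding m rep L(2) frac_point_range[OF q] by blast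
        then show "(\<lambda>(z, l). ?P z + l) s \<in> {g \<in> sc (1 / real q) ` L. 0 + g \<in> X}" using l(2) unfolding zl by simp
      qed
      show "{g \<in> sc (1 / real q) ` L. 0 + g \<in> X} \<subseteq> (\<lambda>(z, l). ?P z + l) ` ?S"
      proof
        fix g assume "g \<in> {g \<in> sc (1 / real q) ` L. 0 + g \<in> X}"
        then obtain w where w: "g = ?P w" "g \<in> X" unfolding L(2) frac_point_range[OF q] by auto
        define z where "z = (\<lambda>j\<in>{..<n}. w j mod int q)"
        define l where "l = lc n (\<lambda>j. of_int (w j div int q)) b"
        have z: "z \<in> zbox n q" unfolding z_def zbox_def using q by auto
        have lL: "l \<in> L" unfolding l_def L(2) zspan_def by (rule rangeI)
        have "?P z + l = ?P (\<lambda>j. z j + int q * (w j div int q))" unfolding l_def by (rule rep)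
        also have "\<dots> = ?P w" by (rule frac_point_cong) (simp add: z_def)
        finally have g: "?P z + l = g" using w by simp
        show "g \<in> (\<lambda>(z, l). ?P z + l) ` ?S"
          by (rule image_eqI[where x="(z, l)"]) (use g z lL w(2) in auto)
      qed
    qed
  qed
  then have "card ?S = lcount (sc (1 / real q) ` L) X 0" unfolding lcount_def by (rule bij_betw_same_card)
  moreover have "card ?S = (\<Sum>z\<in>zbox n q. lcount L X (?P z))"
    unfolding lcount_def by (rule card_SigmaI) (auto intro: finite_lattice_points[OF L(1) X])
  ultimately show ?thesis by (simp flip: of_nat_sum)
qed

lemma lcount_le_1:
  assumes L: "lat n L v" and K: "\<forall>l\<in>L. l \<in> diff2 K \<longrightarrow> l = 0" and X: "X \<subseteq> sc 2 ` K"
  shows "lcount L X x = 0 \<or> lcount L X x = 1"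
proof -
  have "l = l'" if l: "l \<in> L" "x + l \<in> X" "l' \<in> L" "x + l' \<in> X" for l l'
  proof -
    obtain a a' where a: "x + l = sc 2 a" "x + l' = sc 2 a'" "a \<in> K" "a' \<in> K" using l(2,4) X by blast
    have "l - l' = (x + l) - (x + l')" by simp
    also have "\<dots> = sc 2 (a - a')" unfolding a by (simp add: sc_diff)
    finally have "l - l' \<in> diff2 K" unfolding diff2_def using a(3,4) by blast
    then have "l - l' = 0" using K lat_group(3)[OF L l(1,3)] by blast
    then show ?thesis by simp
  qed
  then have "card {l \<in> L. x + l \<in> X} \<le> 1"
    by (cases "finite {l \<in> L. x + l \<in> X}") (auto simp: card_le_Suc0_iff_eq)
  then show ?thesis unfolding lcount_def by linarith
qed

lemma covers_scale:
  assumes "covers n L D" "c > 0" shows "covers n (sc c ` L) (sc c ` D)"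
  unfolding covers_def
proof
  fix x assume x: "x \<in> espace n"
  obtain l where l: "l \<in> L" "sc (1 / c) x - l \<in> D" using assms(1) espace_closed(4)[OF x] unfolding covers_def by blast
  have "x - sc c l = sc c (sc (1 / c) x - l)" using assms(2) by (simp add: sc_diff)
  then show "\<exists>l\<in>sc c ` L. x - l \<in> sc c ` D" using l by blast
qed

section \<open>Smooth lattices for convex bodies\<close>

lemma least_power_between:
  assumes q: "(q::nat) \<ge> 2" "real q \<le> 2 ^ n" and m: "1 < m" and n: "n \<ge> 1"
  shows "\<exists>k. 50 ^ n * m \<le> real q ^ k \<and> real q ^ k \<le> 100 ^ n * m"
proof -
  have ex: "\<exists>k. 50 ^ n * m \<le> real q ^ k"
    using real_arch_pow[of "real q" "50 ^ n * m"] q(1) by (auto intro: less_imp_le)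
  define k where "k = (LEAST k. 50 ^ n * m \<le> real q ^ k)"
  have k: "50 ^ n * m \<le> real q ^ k" unfolding k_def using ex by (rule LeastI_ex)
  have "(1::real) * 1 < 50 ^ n * m" using m by (intro mult_le_less_imp_less) auto
  then have k0: "k \<ge> 1" using k by (cases k) auto
  have "\<not> 50 ^ n * m \<le> real q ^ (k - 1)" unfolding k_def by (rule not_less_Least) (use k0 in \<open>simp add: k_def\<close>)
  then have "real q ^ (k - 1) * real q \<le> (50 ^ n * m) * 2 ^ n" using q m by (intro mult_mono) auto
  also have "real q ^ (k - 1) * real q = real q ^ k" using k0 by (metis power_minus_mult less_le_trans zero_less_one)
  also have "(50 ^ n * m) * 2 ^ n = 100 ^ n * m" by (simp flip: power_mult_distrib)
  finally show ?thesis using k by blast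
qed

lemma power_near_one:
  fixes r e :: real
  assumes "0 \<le> r" "2 * r * real n \<le> e" "e \<le> 1/2" "r \<le> 1/2"
  shows "1 - e \<le> (1 - 2 * r) ^ n" "(1 + 2 * r) ^ n \<le> 1 + 2 * e"
proof -
  have "1 + real n * (- 2 * r) \<le> (1 + (- 2 * r)) ^ n" using assms by (intro Bernoulli_inequality) auto
  moreover have "1 - e \<le> 1 + real n * (- 2 * r)" using assms(2) by (simp add: mult_ac)
  ultimately show "1 - e \<le> (1 - 2 * r) ^ n" by simp
  have e0: "0 \<le> e" using assms(1,2) by (meson mult_nonneg_nonneg of_nat_0_le_iff order_trans zero_le_numeral)
  have "(1 + 2 * r) ^ n \<le> exp (2 * r) ^ n" using assms by (intro power_mono) (auto simp: exp_ge_add_one_self)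
  also have "\<dots> = exp (2 * r * real n)" by (simp add: exp_of_nat_mult[symmetric] mult_ac)
  also have "\<dots> \<le> exp e" using assms by simp
  also have "\<dots> \<le> 1 + e + e\<^sup>2" using e0 assms by (intro exp_bound) auto
  also have "e\<^sup>2 \<le> e * 1" unfolding power2_eq_square using e0 assms by (intro mult_left_mono) auto
  finally show "(1 + 2 * r) ^ n \<le> 1 + 2 * e" by simp
qed

text \<open>
  Write \<open>K\<^sup>-\<close> and \<open>K\<^sup>+\<close> for \<open>(1 - \<rho>) K\<close> and \<open>(1 + \<rho>) K\<close>. The counts \<open>f\<close> and \<open>g\<close> of points of \<open>L\<close> in translates of
  \<open>K\<^sup>-\<close> and \<open>K\<^sup>+\<close> by points of \<open>L / q\<close> are functions modulo \<open>q\<close>, and their means times \<open>\<Delta>\<close> are close to \<open>V\<close>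
  because \<open>L / q\<close> is covering with respect to \<open>\<rho> S\<close>. The lattice generated by \<open>L\<close> and the vectors of an equidistributed
  flat counts both uniformly well. An arbitrary translate of \<open>K\<close> is squeezed between the translates of \<open>K\<^sup>-\<close> and
  \<open>K\<^sup>+\<close> by a nearby point of \<open>L / q\<close>.
\<close>

theorem smooth_lattice_for_centered_body:
  assumes K: "body n K" and cubeK: "cube n r0 \<subseteq> K" and r0: "r0 > 0" and n: "n \<ge> 2"
    and B: "measure (leb n) K \<le> 4 ^ n * measure (leb n) (symbody K 0 n)"
    and e: "0 < e" "e \<le> 1/2" and q: "prime q" "2 * 320004 * real n \<le> e * real q" "real q \<le> 2 ^ n"
  shows "\<exists>L v. lat n L v \<and> measure (leb n) K \<le> 33 * real n * real q / e\<^sup>2 * v \<and>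
    (\<forall>x\<in>espace n. \<bar>v * real (lcount L K x) - measure (leb n) K\<bar> \<le> 5 * e * measure (leb n) K)"
proof -
  define V where "V = measure (leb n) K"
  define S where "S = symbody K 0 n"
  have V: "V > 0" unfolding V_def by (rule body_measure_pos[OF K cubeK r0])
  have bK: "bdd n K" and cK: "cvx K" using K by (auto simp: body_def)
  have zK: "0 \<in> K" using cubeK cube_0[of r0 n] r0 by auto
  have SK: "S \<subseteq> K" unfolding S_def symbody_def by auto
  have Sneg: "- x \<in> S" if "x \<in> S" for x using that by (auto simp: S_def symbody_def espace_closed)
  have q0: "q > 0" "q \<ge> 2" using q(1) prime_gt_0_nat prime_ge_2_nat by auto
  define \<rho> where "\<rho> = 320004 / real q"
  have \<rho>0: "\<rho> > 0" unfolding \<rho>_def using q0 by simp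
  have \<rho>n: "2 * \<rho> * real n \<le> e" unfolding \<rho>_def using q(2) q0 by (simp add: divide_le_eq)
  have "2 * \<rho> * 1 \<le> 2 * \<rho> * real n" using n \<rho>0 by (intro mult_left_mono) auto
  then have \<rho>1: "\<rho> \<le> 1 / 4" using \<rho>n e by linarith
  note pow = power_near_one[OF less_imp_le[OF \<rho>0] \<rho>n e(2)]
  \<comment> \<open>The density that is aimed at. Since the mean \<open>\<sigma>\<close> satisfies \<open>\<sigma> q\<^sup>k \<ge> (1 - e) m \<ge> m / 2\<close>, the constant \<open>33 > 2 * 16\<close>
    suffices for the equidistribution theorem.\<close>
  define m where "m = 33 * real n * real q / e\<^sup>2"
  have e2: "e\<^sup>2 \<le> 1" using e by (intro power_le_one) auto
  have nq: "2 * 2 \<le> real n * real q" using n q0 by (intro mult_mono) auto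
  then have "33 * real n * real q > 1" by simp
  then have m1: "m > 1" unfolding m_def using e e2 by (simp add: less_divide_eq)
  obtain k where k: "50 ^ n * m \<le> real q ^ k" "real q ^ k \<le> 100 ^ n * m"
    using least_power_between[OF q0(2) q(3) m1] n by auto
  define \<Delta> where "\<Delta> = V * real q ^ k / m"
  have m0: "m > 0" using m1 by simp
  have qk0: "real q ^ k > 0" using q0 by simp
  have D: "50 ^ n * V \<le> \<Delta>" "\<Delta> \<le> 100 ^ n * V"
    unfolding \<Delta>_def using k m0 V by (simp_all add: divide_le_eq le_divide_eq mult_ac)
  have \<Delta>0: "\<Delta> > 0" unfolding \<Delta>_def using V m0 qk0 by simp
  obtain L where L: "lat n L \<Delta>" and pack: "\<forall>l\<in>L. l \<in> diff2 K \<longrightarrow> l = 0" and cov: "covers n L (sc 320004 ` S)"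
    using base_lattice[OF K cubeK r0 n B, of \<Delta>] D unfolding V_def S_def by blast
  obtain b where b: "indep n b" "L = zspan n b" using L by (auto simp: lat_def)
  define G where "G = sc (1 / real q) ` L"
  define w where "w = (1 / real q) ^ n * \<Delta>"
  have G: "lat n G w" unfolding G_def w_def by (rule lat_scale[OF L]) (use q0 in simp)
  have "covers n G (sc (1 / real q) ` sc 320004 ` S)" unfolding G_def by (rule covers_scale[OF cov]) (use q0 in simp)
  then have covG: "covers n G (sc \<rho> ` S)" by (simp add: image_image \<rho>_def)
  define P where "P = frac_point n q b"
  define Km where "Km = sc (1 - \<rho>) ` K"
  define Kp where "Kp = sc (1 + \<rho>) ` K"
  have bKm: "bdd n Km" "bdd n Kp" unfolding Km_def Kp_def by (intro bdd_sc bK)+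
  define f where "f = (\<lambda>z. real (lcount L Km (P z)))"
  define g where "g = (\<lambda>z. real (lcount L Kp (P z)))"
  \<comment> \<open>The translations between a point and the nearby point of \<open>L / q\<close> lie in \<open>\<rho> S \<subseteq> \<rho> K\<close>.\<close>
  have absorb: "x + d \<in> sc (t + \<rho>) ` K" if x: "x \<in> sc t ` K" "t \<ge> 0" and d: "d \<in> sc \<rho> ` S" for x d t
    by (rule sc_image_add[OF cK that(2) less_imp_le[OF \<rho>0] that(1)]) (use d SK in blast)
  define \<sigma> where "\<sigma> = (\<Sum>z\<in>zbox n q. f z) / real q ^ n"
  define \<tau> where "\<tau> = (\<Sum>z\<in>zbox n q. g z) / real q ^ n"
  have sumf: "(\<Sum>z\<in>zbox n q. f z) = real (lcount G Km 0)" "(\<Sum>z\<in>zbox n q. g z) = real (lcount G Kp 0)"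
    unfolding f_def g_def G_def P_def by (intro lcount_fraction_lattice[OF L b(2,1) q0(1)] bKm)+
  have cw: "real (lcount G Km 0) * w = \<sigma> * \<Delta>" "real (lcount G Kp 0) * w = \<tau> * \<Delta>"
    unfolding \<sigma>_def \<tau>_def sumf w_def by (simp_all add: power_one_over)
  have mK: "measure (leb n) (sc t ` K) = t ^ n * V" "sc t ` K \<in> sets borel" if "t > 0" for t
    using measure_sc[OF K that] body_sc[OF K that] by (simp_all add: V_def body_def)
  have z0: "(0::nat \<Rightarrow> real) \<in> espace n" by simp
  have "measure (leb n) (sc (1 - 2 * \<rho>) ` K) \<le> real (lcount G Km 0) * w"
  proof (rule measure_le_count[OF G covG bKm(1) bdd_sc[OF bK] mK(2) _ z0])
    show "0 < 1 - 2 * \<rho>" using \<rho>1 by simp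
    fix y d assume "y \<in> sc (1 - 2 * \<rho>) ` K" "d \<in> sc \<rho> ` S"
    from absorb[OF this(1) _ this(2)] \<rho>1 show "y + d \<in> Km" by (simp add: Km_def)
  qed
  then have "(1 - 2 * \<rho>) ^ n * V \<le> \<sigma> * \<Delta>" using mK(1)[of "1 - 2 * \<rho>"] \<rho>1 unfolding cw by simp
  moreover have "(1 - e) * V \<le> (1 - 2 * \<rho>) ^ n * V" using pow(1) \<rho>1 V by (intro mult_right_mono) auto
  ultimately have \<sigma>: "(1 - e) * V \<le> \<sigma> * \<Delta>" by linarith
  have "measure (leb n) (sc 1 ` K) \<le> real (lcount G Kp 0) * w"
  proof (rule measure_le_count[OF G covG bKm(2) bdd_sc[OF bK] mK(2) _ z0])
    fix y d assume "y \<in> sc 1 ` K" "d \<in> sc \<rho> ` S"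
    from absorb[OF this(1) _ this(2)] show "y + d \<in> Kp" by (simp add: Kp_def)
  qed simp
  then have \<tau>1: "V \<le> \<tau> * \<Delta>" unfolding cw by (simp add: V_def)
  have "real (lcount G Kp 0) * w \<le> measure (leb n) (sc (1 + 2 * \<rho>) ` K)"
  proof (rule count_le_measure[OF G covG bdd_sc[OF bK] mK(2) _ z0])
    show "0 < 1 + 2 * \<rho>" using \<rho>0 by simp
    fix y d assume "y \<in> Kp" "d \<in> sc \<rho> ` S"
    from absorb[OF this(1)[unfolded Kp_def] _ this(2)] \<rho>0 show "y + d \<in> sc (1 + 2 * \<rho>) ` K" by (simp add: add.assoc)
  qed
  then have "\<tau> * \<Delta> \<le> (1 + 2 * \<rho>) ^ n * V" using mK(1)[of "1 + 2 * \<rho>"] \<rho>0 unfolding cw by simp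
  moreover have "(1 + 2 * \<rho>) ^ n * V \<le> (1 + 2 * e) * V" using pow(2) \<rho>1 V by (intro mult_right_mono) auto
  ultimately have \<tau>2: "\<tau> * \<Delta> \<le> (1 + 2 * e) * V" by linarith
  have \<Delta>m: "\<Delta> * m = V * real q ^ k" unfolding \<Delta>_def using m0 by simp
  \<comment> \<open>Multiplication by \<open>q\<^sup>k / \<Delta> = m / V\<close>.\<close>
  have size: "c * m \<le> s * real q ^ k" if s: "c * V \<le> s * \<Delta>" for c s
  proof -
    have "c * V * m \<le> s * \<Delta> * m" using s m0 by (intro mult_right_mono) auto
    also have "s * \<Delta> * m = s * real q ^ k * V" using \<Delta>m by (simp add: mult.assoc) (simp add: mult_ac)?
    finally have "(c * m) * V \<le> (s * real q ^ k) * V" by (simp add: mult_ac)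
    then show ?thesis using V by simp
  qed
  have mm: "m = 33 * (real n * real q / e\<^sup>2)" unfolding m_def by simp
  have "real n * real q / e\<^sup>2 > 0" using nq e by simp
  then have big: "16 * real n * real q / e\<^sup>2 < (1 - e) * m" "16 * real n * real q / e\<^sup>2 < 1 * m"
  proof -
    assume *: "real n * real q / e\<^sup>2 > 0"
    have "(1 / 2) * m \<le> (1 - e) * m" using e m0 by (intro mult_right_mono) auto
    moreover have "16 * real n * real q / e\<^sup>2 < (1 / 2) * m" using * unfolding mm by simp
    ultimately show "16 * real n * real q / e\<^sup>2 < (1 - e) * m" by linarith
    show "16 * real n * real q / e\<^sup>2 < 1 * m" using * unfolding mm by simp
  qed
  have sub2: "Km \<subseteq> sc 2 ` K" "Kp \<subseteq> sc 2 ` K"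
    unfolding Km_def Kp_def using \<rho>0 \<rho>1 by (intro sc_image_mono[OF cK zK]; simp)+
  have "\<exists>u. \<forall>a. (1 - e) * \<sigma> * real q ^ k \<le> (\<Sum>t\<in>zbox k q. f (\<lambda>i. a i + (\<Sum>l<k. t l * u l i))) \<and>
                 (\<Sum>t\<in>zbox k q. g (\<lambda>i. a i + (\<Sum>l<k. t l * u l i))) \<le> (1 + e) * \<tau> * real q ^ k"
  proof (rule two_sided_equidistribution[OF q(1) _ e(1)])
    show "1 \<le> n" "e \<le> 1" using n e by auto
    show "f z = 0 \<or> f z = 1" for z unfolding f_def using lcount_le_1[OF L pack sub2(1), of "P z"] by auto
    show "g z = 0 \<or> g z = 1" for z unfolding g_def using lcount_le_1[OF L pack sub2(2), of "P z"] by auto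
    show "f y = f z" if eq: "\<And>i. i < n \<Longrightarrow> int q dvd y i - z i" for y z
      unfolding f_def P_def using lcount_periodic[OF L b(2) q0(1) eq] by simp
    show "g y = g z" if eq: "\<And>i. i < n \<Longrightarrow> int q dvd y i - z i" for y z
      unfolding g_def P_def using lcount_periodic[OF L b(2) q0(1) eq] by simp
    show "(\<Sum>z\<in>zbox n q. f z) = \<sigma> * real q ^ n" "(\<Sum>z\<in>zbox n q. g z) = \<tau> * real q ^ n"
      unfolding \<sigma>_def \<tau>_def using q0 by simp_all
    show "16 * real n * real q / e\<^sup>2 < \<sigma> * real q ^ k" using big(1) size[OF \<sigma>] by linarith
    show "16 * real n * real q / e\<^sup>2 < \<tau> * real q ^ k" using big(2) size[of 1 \<tau>] \<tau>1 by linarith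
  qed
  then obtain u where uf: "\<And>a. (1 - e) * \<sigma> * real q ^ k \<le> (\<Sum>t\<in>zbox k q. f (\<lambda>i. a i + (\<Sum>l<k. t l * u l i)))"
    and ug: "\<And>a. (\<Sum>t\<in>zbox k q. g (\<lambda>i. a i + (\<Sum>l<k. t l * u l i))) \<le> (1 + e) * \<tau> * real q ^ k" by blast
  have he: "P (u l) \<in> espace n" for l
    unfolding P_def frac_point_def using b(1) by (intro lc_espace) (simp add: indep_def)
  have hL: "sc (real q) (P (u l)) \<in> L" for l
    using frac_point_scale[of n q b "int q" "u l"] frac_point_multiple[OF q0(1), of n b "u l"] b(2)
    by (simp add: P_def zspan_iff) metis
  from iterated_adjoin_count[OF L q(1), of k "\<lambda>l. P (u l)", OF he hL]
  obtain L' v where L'v: "lat n L' v \<and> L \<subseteq> L' \<and> \<Delta> \<le> real q ^ k * v \<and> (\<forall>X x. bdd n X \<longrightarrow> v * real (lcount L' X x) =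
        \<Delta> / real q ^ k * (\<Sum>t\<in>zbox k q. real (lcount L X (x + (\<Sum>l<k. sc (of_int (t l)) (P (u l)))))))"
    by (elim exE) (rule that)
  then have L': "lat n L' v" "\<Delta> \<le> real q ^ k * v" by simp_all
  have count: "v * real (lcount L' X x) =
        \<Delta> / real q ^ k * (\<Sum>t\<in>zbox k q. real (lcount L X (x + (\<Sum>l<k. sc (of_int (t l)) (P (u l))))))" if "bdd n X" for X x
    using L'v that by simp
  have v0: "v > 0" using L'(1) by (simp add: lat_def)
  have dens: "V \<le> m * v"
  proof -
    have "V * real q ^ k = m * \<Delta>" using \<Delta>m by (simp add: mult.commute)
    also have "\<dots> \<le> m * (real q ^ k * v)" using L'(2) m0 by (intro mult_left_mono) auto
    finally have "V * real q ^ k \<le> (m * v) * real q ^ k" by (simp add: mult_ac)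
    then show ?thesis using qk0 by simp
  qed
  have "\<bar>v * real (lcount L' K x) - V\<bar> \<le> 5 * e * V" if x: "x \<in> espace n" for x
  proof -
    obtain \<gamma> where \<gamma>: "\<gamma> \<in> G" "x - \<gamma> \<in> sc \<rho> ` S" using covG x unfolding covers_def by blast
    obtain a where a: "\<gamma> = P a" using \<gamma>(1) unfolding G_def b(2) frac_point_range[OF q0(1)] P_def by blast
    have neg: "\<gamma> - x \<in> sc \<rho> ` S"
    proof -
      obtain s where "x - \<gamma> = sc \<rho> s" "s \<in> S" using \<gamma>(2) by blast
      then have "\<gamma> - x = sc \<rho> (- s)" by (metis minus_diff_eq sc_minus)
      then show ?thesis using Sneg[OF \<open>s \<in> S\<close>] by blast
    qed
    have fin: "finite {l \<in> L'. y + l \<in> X}" if "bdd n X" for X y by (rule finite_lattice_points[OF L'(1) that])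
    have "lcount L' Km \<gamma> \<le> lcount L' K x" unfolding lcount_def
    proof (rule card_mono[OF fin[OF bK]], safe)
      fix l assume "\<gamma> + l \<in> Km"
      from absorb[OF this[unfolded Km_def] _ \<gamma>(2)] \<rho>1 have "(\<gamma> + l) + (x - \<gamma>) \<in> K" by simp
      moreover have "(\<gamma> + l) + (x - \<gamma>) = x + l" by (simp add: algebra_simps)
      ultimately show "x + l \<in> K" by (simp only:)
    qed
    moreover have "lcount L' K x \<le> lcount L' Kp \<gamma>" unfolding lcount_def
    proof (rule card_mono[OF fin[OF bKm(2)]], safe)
      fix l assume "x + l \<in> K"
      then have "x + l \<in> sc 1 ` K" by simp
      from absorb[OF this _ neg] have "(x + l) + (\<gamma> - x) \<in> Kp" by (simp add: Kp_def)
      moreover have "(x + l) + (\<gamma> - x) = \<gamma> + l" by (simp add: algebra_simps)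
      ultimately show "\<gamma> + l \<in> Kp" by (simp only:)
    qed
    ultimately have mono: "v * real (lcount L' Km \<gamma>) \<le> v * real (lcount L' K x)"
        "v * real (lcount L' K x) \<le> v * real (lcount L' Kp \<gamma>)"
      using v0 by simp_all
    have cm: "v * real (lcount L' Km \<gamma>) = \<Delta> / real q ^ k * (\<Sum>t\<in>zbox k q. f (\<lambda>i. a i + (\<Sum>l<k. t l * u l i)))"
      unfolding count[OF bKm(1)] f_def a P_def frac_point_sum ..
    have cp: "v * real (lcount L' Kp \<gamma>) = \<Delta> / real q ^ k * (\<Sum>t\<in>zbox k q. g (\<lambda>i. a i + (\<Sum>l<k. t l * u l i)))"
      unfolding count[OF bKm(2)] g_def a P_def frac_point_sum ..
    have dq: "\<Delta> / real q ^ k \<ge> 0" using \<Delta>0 qk0 by simp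
    have "\<Delta> / real q ^ k * ((1 - e) * \<sigma> * real q ^ k) \<le> v * real (lcount L' Km \<gamma>)"
      unfolding cm by (rule mult_left_mono[OF uf dq])
    moreover have "\<Delta> / real q ^ k * ((1 - e) * \<sigma> * real q ^ k) = (1 - e) * (\<sigma> * \<Delta>)" using q0(1) by simp
    moreover have "(1 - e) * ((1 - e) * V) \<le> (1 - e) * (\<sigma> * \<Delta>)" using \<sigma> e by (intro mult_left_mono) auto
    moreover have "(1 - e) * ((1 - e) * V) = V - 2 * (e * V) + e * (e * V)" by (simp add: algebra_simps)
    moreover have eV: "0 \<le> e * V" "0 \<le> e * (e * V)" "e * (e * V) \<le> (1 / 2) * (e * V)"
      using e V by (auto intro!: mult_right_mono)
    ultimately have lower: "V - 2 * (e * V) \<le> v * real (lcount L' K x)" using mono(1) by linarith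
    have "v * real (lcount L' Kp \<gamma>) \<le> \<Delta> / real q ^ k * ((1 + e) * \<tau> * real q ^ k)"
      unfolding cp by (rule mult_left_mono[OF ug dq])
    moreover have "\<Delta> / real q ^ k * ((1 + e) * \<tau> * real q ^ k) = (1 + e) * (\<tau> * \<Delta>)" using q0(1) by simp
    moreover have "(1 + e) * (\<tau> * \<Delta>) \<le> (1 + e) * ((1 + 2 * e) * V)" using \<tau>2 e by (intro mult_left_mono) auto
    moreover have "(1 + e) * ((1 + 2 * e) * V) = V + 3 * (e * V) + 2 * (e * (e * V))" by (simp add: algebra_simps)
    ultimately have upper: "v * real (lcount L' K x) \<le> V + 4 * (e * V)" using mono(2) eV by linarith
    show ?thesis using lower upper eV by (simp add: abs_le_iff)
  qed
  note close = this
  show ?thesis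
  proof (intro exI[of _ L'] exI[of _ v] conjI ballI)
    show "lat n L' v" by (rule L'(1))
    show "measure (leb n) K \<le> 33 * real n * real q / e\<^sup>2 * v" using dens unfolding V_def m_def .
    show "\<bar>v * real (lcount L' K x) - measure (leb n) K\<bar> \<le> 5 * e * measure (leb n) K" if "x \<in> espace n" for x
      using close[OF that] unfolding V_def .
  qed
qed

lemma body_translate:
  assumes K: "body n K" and a: "a \<in> espace n"
  shows "body n {y. a + y \<in> K}" "measure (leb n) {y. a + y \<in> K} = measure (leb n) K"
proof -
  have Kb: "K \<in> sets borel" "bdd n K" "cvx K" using K by (auto simp: body_def)
  obtain D where D: "K \<subseteq> espace n" "\<And>x i. x \<in> K \<Longrightarrow> i < n \<Longrightarrow> \<bar>x i\<bar> \<le> D" using Kb(2) unfolding bdd_def by blast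
  have "bdd n {x - y | x y. x \<in> K \<and> y \<in> {a}}"
    by (rule bdd_diff[OF Kb(2)]) (use a in \<open>auto simp: bdd_def intro!: exI[of _ "\<Sum>i<n. \<bar>a i\<bar>"] member_le_sum\<close>)
  then have "bdd n {y. a + y \<in> K}"
  proof (rule bdd_subset, intro subsetI)
    fix y assume "y \<in> {y. a + y \<in> K}"
    then show "y \<in> {x - y | x y. x \<in> K \<and> y \<in> {a}}" by (intro CollectI exI[of _ "a + y"] exI[of _ a]) simp
  qed
  moreover have "cvx {y. a + y \<in> K}"
    unfolding cvx_def
  proof (intro ballI allI impI CollectI)
    fix x y u v assume xy: "x \<in> {y. a + y \<in> K}" "y \<in> {y. a + y \<in> K}" and uv: "(0::real) \<le> u" "(0::real) \<le> v" "u + v = 1"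
    have "sc u (a + x) + sc v (a + y) \<in> K" using Kb(3) xy uv unfolding cvx_def by blast
    moreover have "sc u (a + x) + sc v (a + y) = sc (u + v) a + (sc u x + sc v y)"
      by (simp add: sc_add sc_add_left)
    ultimately show "a + (sc u x + sc v y) \<in> K" by (simp only: uv(3) sc_1)
  qed
  ultimately show "body n {y. a + y \<in> K}" using borel_translate[OF Kb(1)] by (simp add: body_def)
  show "measure (leb n) {y. a + y \<in> K} = measure (leb n) K"
    using emeasure_leb_translate[OF Kb(1) a] by (simp add: measure_def)
qed

theorem smooth_lattice_for_body:
  assumes K: "body n K" and x0: "x0 \<in> espace n" "\<eta> > 0" "\<And>d. d \<in> cube n \<eta> \<Longrightarrow> x0 + d \<in> K" and n: "n \<ge> 2"
    and e: "0 < e" "e \<le> 1/2" and q: "prime q" "2 * 320004 * real n \<le> e * real q" "real q \<le> 2 ^ n"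
  shows "\<exists>L v. lat n L v \<and> measure (leb n) K > 0 \<and> measure (leb n) K \<le> 33 * real n * real q / e\<^sup>2 * v \<and>
    (\<forall>x\<in>espace n. \<bar>v * real (lcount L K x) - measure (leb n) K\<bar> \<le> 5 * e * measure (leb n) K)"
proof -
  define K1 where "K1 = {y. x0 + y \<in> K}"
  have K1: "body n K1" "measure (leb n) K1 = measure (leb n) K" unfolding K1_def by (rule body_translate[OF K x0(1)])+
  have cube1: "cube n \<eta> \<subseteq> K1" using x0(3) by (auto simp: K1_def)
  obtain c r where c: "c \<in> espace n" and r: "r > 0" "\<And>d. d \<in> cube n r \<Longrightarrow> c + d \<in> K1"
    and B: "measure (leb n) K1 \<le> 4 ^ n * measure (leb n) (symbody K1 c n)"
    using exists_center[OF K1(1) cube1 x0(2)] by blast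
  define K2 where "K2 = {y. c + y \<in> K1}"
  have K2: "body n K2" "measure (leb n) K2 = measure (leb n) K1" unfolding K2_def by (rule body_translate[OF K1(1) c])+
  have cube2: "cube n r \<subseteq> K2" using r(2) by (auto simp: K2_def)
  have "symbody K2 0 n = symbody K1 c n" by (simp add: symbody_def K2_def)
  then have B2: "measure (leb n) K2 \<le> 4 ^ n * measure (leb n) (symbody K2 0 n)" using B K2(2) by simp
  obtain L v where L: "lat n L v" "measure (leb n) K2 \<le> 33 * real n * real q / e\<^sup>2 * v"
    and cnt: "\<And>x. x \<in> espace n \<Longrightarrow> \<bar>v * real (lcount L K2 x) - measure (leb n) K2\<bar> \<le> 5 * e * measure (leb n) K2"
    using smooth_lattice_for_centered_body[OF K2(1) cube2 r(1) n B2 e q] by blast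
  have "\<bar>v * real (lcount L K x) - measure (leb n) K\<bar> \<le> 5 * e * measure (leb n) K" if x: "x \<in> espace n" for x
  proof -
    have "x - (x0 + c) \<in> espace n" using x x0(1) c by (intro espace_closed)
    moreover have "lcount L K2 (x - (x0 + c)) = lcount L K x"
      unfolding lcount_def K2_def K1_def by (simp add: algebra_simps)
    ultimately show ?thesis using cnt[of "x - (x0 + c)"] K2(2) K1(2) by simp
  qed
  moreover have "measure (leb n) K > 0" using body_measure_pos[OF K2(1) cube2 r(1)] K2(2) K1(2) by simp
  ultimately show ?thesis using L K2(2) K1(2) by auto
qed

section \<open>Extensional vectors\<close>

lemma continuous_map_ext0: "continuous_map (rtop n) euclidean (ext0 n)"
proof -
  have "continuous_map (rtop n) euclideanreal (\<lambda>x. ext0 n x i)" for i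
  proof (cases "i < n")
    case True
    then have "continuous_map (rtop n) euclideanreal (\<lambda>x. x i)"
      unfolding rtop_def by (intro continuous_map_product_projection) simp
    then show ?thesis using True by (simp add: ext0_def)
  qed (simp add: ext0_def)
  then show ?thesis unfolding euclidean_product_topology[symmetric] continuous_map_componentwise_UNIV by blast
qed

lemma ext0_convex_body:
  assumes K: "convex_body n K"
  shows "body n (ext0 n ` K)" and "K = (\<lambda>x. restrict x {..<n}) ` ext0 n ` K"
    and "\<exists>x0\<in>espace n. \<exists>\<eta>>0. \<forall>d\<in>cube n \<eta>. x0 + d \<in> ext0 n ` K"
proof -
  have cp: "compactin (rtop n) K" and cv: "convex_in n K" and ne: "rtop n interior_of K \<noteq> {}"
    using K by (auto simp: convex_body_def)
  have Kr: "K \<subseteq> rspace n" using cv by (simp add: convex_in_def)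
  have "compactin euclidean (ext0 n ` K)" by (rule image_compactin[OF cp continuous_map_ext0])
  then have comp: "compact (ext0 n ` K)" by simp
  then have borel: "ext0 n ` K \<in> sets borel" by (intro borel_closed compact_imp_closed)
  have cont: "continuous_on (ext0 n ` K) (\<lambda>x. \<Sum>i<n. \<bar>x i\<bar>)"
    by (intro continuous_intros continuous_on_subset[OF continuous_on_product_coordinates]) auto
  obtain D where D: "\<And>x. x \<in> ext0 n ` K \<Longrightarrow> \<bar>\<Sum>i<n. \<bar>x i\<bar>\<bar> \<le> D"
    using compact_imp_bounded[OF compact_continuous_image[OF cont comp]] unfolding bounded_iff by auto
  have "\<bar>x i\<bar> \<le> D" if "x \<in> ext0 n ` K" "i < n" for x i
  proof -
    have "\<bar>x i\<bar> \<le> (\<Sum>i<n. \<bar>x i\<bar>)" using that(2) by (intro member_le_sum) auto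
    then show ?thesis using D[OF that(1)] by linarith
  qed
  then have bdd: "bdd n (ext0 n ` K)" unfolding bdd_def by auto
  have "cvx (ext0 n ` K)" unfolding cvx_def
  proof (intro ballI allI impI)
    fix x y u v assume xy: "x \<in> ext0 n ` K" "y \<in> ext0 n ` K" and uv: "(0::real) \<le> u" "(0::real) \<le> v" "u + v = 1"
    obtain a b where ab: "x = ext0 n a" "y = ext0 n b" "a \<in> K" "b \<in> K" using xy by blast
    have "vadd n (vscale n u a) (vscale n v b) \<in> K" using cv ab(3,4) uv unfolding convex_in_def by blast
    moreover have "sc u x + sc v y = ext0 n (vadd n (vscale n u a) (vscale n v b))"
      unfolding ab by (auto simp: ext0_def vadd_def vscale_def fun_eq_iff)
    ultimately show "sc u x + sc v y \<in> ext0 n ` K" by blast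
  qed
  then show "body n (ext0 n ` K)" using borel bdd by (simp add: body_def)
  show "K = (\<lambda>x. restrict x {..<n}) ` ext0 n ` K"
    unfolding image_image using Kr by (simp add: restrict_ext0 subset_iff cong: image_cong_simp)
  obtain x where x: "x \<in> rtop n interior_of K" using ne by blast
  then obtain U where U: "openin (rtop n) U" "x \<in> U" "U \<subseteq> K" unfolding interior_of_def by blast
  then obtain W where W: "\<And>i. i < n \<Longrightarrow> open (W i)" "x \<in> Pi\<^sub>E {..<n} W" "Pi\<^sub>E {..<n} W \<subseteq> U"
    unfolding rtop_def openin_product_topology_alt by (metis lessThan_iff open_openin)
  have "\<exists>e>0. \<forall>y. \<bar>y - x i\<bar> < e \<longrightarrow> y \<in> W i" if i: "i < n" for i
  proof -
    have "x i \<in> W i" using W(2) i by (auto dest: PiE_mem)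
    then show ?thesis using W(1)[OF i] unfolding open_dist by (auto simp: dist_real_def)
  qed
  then obtain e where e: "\<And>i. i < n \<Longrightarrow> e i > 0" "\<And>i y. i < n \<Longrightarrow> \<bar>y - x i\<bar> < e i \<Longrightarrow> y \<in> W i" by metis
  define \<eta> where "\<eta> = Min (insert 1 (e ` {..<n})) / 2"
  have m0: "Min (insert 1 (e ` {..<n})) > 0" using e(1) by (subst Min_gr_iff) auto
  then have \<eta>0: "\<eta> > 0" by (simp add: \<eta>_def)
  have \<eta>e: "\<eta> < e i" if "i < n" for i
  proof -
    have "Min (insert 1 (e ` {..<n})) \<le> e i" using that by (intro Min_le) auto
    then show ?thesis using m0 unfolding \<eta>_def by linarith
  qed
  have "ext0 n x + d \<in> ext0 n ` K" if d: "d \<in> cube n \<eta>" for d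
  proof (rule image_eqI)
    have "ext0 n x + d \<in> espace n" using d by (intro espace_closed) (auto simp: cube_def)
    then show "ext0 n x + d = ext0 n (restrict (ext0 n x + d) {..<n})" by (simp only: ext0_restrict ext0_espace)
    have "restrict (ext0 n x + d) {..<n} \<in> Pi\<^sub>E {..<n} W"
    proof (rule PiE_I)
      fix i assume "i \<in> {..<n}"
      then have i: "i < n" by simp
      have "\<bar>d i\<bar> \<le> \<eta>" using d i by (auto simp: cube_def)
      then have "x i + d i \<in> W i" using e(2)[OF i, of "x i + d i"] \<eta>e[OF i] by simp
      then show "restrict (ext0 n x + d) {..<n} i \<in> W i" using i by (simp add: ext0_def)
    qed simp
    then show "restrict (ext0 n x + d) {..<n} \<in> K" using W(3) U(3) by blast
  qed
  then show "\<exists>x0\<in>espace n. \<exists>\<eta>>0. \<forall>d\<in>cube n \<eta>. x0 + d \<in> ext0 n ` K" using \<eta>0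
    by (intro bexI[of _ "ext0 n x"] exI[of _ \<eta>]) auto
qed

lemma restrict_inj_espace: "x \<in> espace n \<Longrightarrow> y \<in> espace n \<Longrightarrow> restrict x {..<n} = restrict y {..<n} \<Longrightarrow> x = y"
  by (metis ext0_restrict ext0_espace)

text \<open>
  A basis of extensional vectors is padded with zeros, and conversely.
\<close>

lemma lincomb_eq_restrict_lc: "lincomb n c b = restrict (lc n c (\<lambda>j. ext0 n (b j))) {..<n}"
  by (auto simp: lincomb_def lc_def ext0_def fun_eq_iff)

lemma lincomb_restrict_eq:
  "lincomb n c (\<lambda>j. restrict (b j) {..<n}) = restrict (lc n c b) {..<n}"
  by (auto simp: lincomb_def lc_def fun_eq_iff)

lemma lattice_basis_restrict:
  assumes "indep n b" shows "lattice_basis n (\<lambda>j. restrict (b j) {..<n}) ((\<lambda>x. restrict x {..<n}) ` zspan n b)"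
proof -
  have "c j = 0" if c: "lincomb n c (\<lambda>j. restrict (b j) {..<n}) = (\<lambda>i\<in>{..<n}. 0)" and j: "j < n" for c j
  proof -
    have "restrict (lc n c b) {..<n} = restrict 0 {..<n}" using c unfolding lincomb_restrict_eq by (auto simp: fun_eq_iff)
    moreover have "lc n c b \<in> espace n" using assms by (intro lc_espace) (simp add: indep_def)
    ultimately have "lc n c b = 0" using restrict_inj_espace espace_simps(1) by blast
    then show ?thesis using assms j unfolding indep_def by blast
  qed
  then have "lin_indep n (\<lambda>j. restrict (b j) {..<n})" unfolding lin_indep_def by blast
  moreover have "(\<lambda>x. restrict x {..<n}) ` zspan n b = {lincomb n (\<lambda>j. of_int (z j)) (\<lambda>j. restrict (b j) {..<n}) |z :: nat \<Rightarrow> int. True}"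
    unfolding lincomb_restrict_eq zspan_def by auto
  ultimately show ?thesis unfolding lattice_basis_def by simp
qed

text \<open>
  The definition of the covolume selects some basis. Padded with zeros, it becomes a basis of \<open>L\<close>, for which
  \<open>lat_any_basis\<close> gives the volume of the parallelepiped.
\<close>

lemma covolume_restrict:
  assumes L: "lat n L v"
  shows "full_rank_lattice n ((\<lambda>x. restrict x {..<n}) ` L)" "covolume n ((\<lambda>x. restrict x {..<n}) ` L) = v"
proof -
  let ?r = "\<lambda>x::nat \<Rightarrow> real. restrict x {..<n}"
  obtain b0 where "indep n b0" "L = zspan n b0" using L by (auto simp: lat_def)
  then have b0: "lattice_basis n (\<lambda>j. ?r (b0 j)) (?r ` L)" using lattice_basis_restrict by simp
  then show "full_rank_lattice n (?r ` L)" unfolding full_rank_lattice_def by (rule exI[of _ "\<lambda>j. ?r (b0 j)"])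
  define b where "b = (SOME b. lattice_basis n b (?r ` L))"
  have b: "lattice_basis n b (?r ` L)" unfolding b_def by (rule someI[of "\<lambda>b. lattice_basis n b (?r ` L)", OF b0])
  define c where "c = (\<lambda>j. ext0 n (b j))"
  have lin: "lincomb n t b = ?r (lc n t c)" for t unfolding c_def by (rule lincomb_eq_restrict_lc)
  have ce: "lc n t c \<in> espace n" for t by (rule lc_espace) (simp add: c_def)
  have ind: "indep n c" unfolding indep_def
  proof (intro conjI allI impI)
    show "c j \<in> espace n" for j by (simp add: c_def)
    fix t j assume "lc n t c = 0" "j < n"
    then have "lincomb n t b = (\<lambda>i\<in>{..<n}. 0)" unfolding lin by (auto simp: fun_eq_iff)
    then show "t j = 0" using b \<open>j < n\<close> unfolding lattice_basis_def lin_indep_def by blast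
  qed
  have imL: "?r ` L = ?r ` zspan n c"
  proof -
    have "?r ` L = {lincomb n (\<lambda>j. of_int (z j)) b |z :: nat \<Rightarrow> int. True}" using b unfolding lattice_basis_def by blast
    also have "\<dots> = ?r ` zspan n c" unfolding lin zspan_def by auto
    finally show ?thesis .
  qed
  have inj: "inj_on ?r (espace n)" by (rule inj_onI) (rule restrict_inj_espace)
  have Lc: "L = zspan n c"
    using inj_on_image_eq_iff[OF inj lat_espace[OF L] zspan_espace[OF ind]] imL by blast
  note any = lat_any_basis[OF L ind Lc]
  have t: "para n c \<in> sets borel" "para n c \<subseteq> espace n" using para_tiles[OF ind any(1)] by (auto simp: tiles_def)
  have "fund_parallelepiped n b = ?r ` para n c" unfolding fund_parallelepiped_def para_def lin by auto
  then have "covolume n (?r ` L) = measure (leb n) (para n c)"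
    unfolding covolume_def b_def[symmetric] using vol_restrict[OF t] by simp
  also have "\<dots> = v" using any(2) L by (simp add: measure_def lat_def)
  finally show "covolume n (?r ` L) = v" .
qed

lemma lattice_count_restrict:
  assumes L: "L \<subseteq> espace n" and x: "x \<in> rspace n"
  shows "lattice_count n ((\<lambda>x. restrict x {..<n}) ` L) K x = lcount L (ext0 n ` K) (- ext0 n x)"
proof -
  let ?r = "\<lambda>x::nat \<Rightarrow> real. restrict x {..<n}"
  have "?r ` L \<inter> (\<lambda>k. vadd n k x) ` K = ?r ` {l \<in> L. - ext0 n x + l \<in> ext0 n ` K}"
  proof (intro equalityI subsetI)
    fix y assume "y \<in> ?r ` L \<inter> (\<lambda>k. vadd n k x) ` K"
    then obtain l k where y: "y = ?r l" "l \<in> L" "k \<in> K" "?r l = vadd n k x" by auto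
    have "l = ext0 n (?r l)" using y(2) L by (subst ext0_restrict) (auto simp: ext0_espace)
    also have "\<dots> = ext0 n k + ext0 n x" unfolding y(4) by (auto simp: ext0_def vadd_def fun_eq_iff)
    finally have "- ext0 n x + l = ext0 n k" by simp
    then show "y \<in> ?r ` {l \<in> L. - ext0 n x + l \<in> ext0 n ` K}" using y by blast
  next
    fix y assume "y \<in> ?r ` {l \<in> L. - ext0 n x + l \<in> ext0 n ` K}"
    then obtain l k where y: "y = ?r l" "l \<in> L" "k \<in> K" "- ext0 n x + l = ext0 n k" by auto
    have "l = ext0 n k + ext0 n x" unfolding y(4)[symmetric] by simp
    then have "y = vadd n k x" unfolding y(1) by (auto simp: ext0_def vadd_def fun_eq_iff)
    then have "y \<in> (\<lambda>k. vadd n k x) ` K" using y(3) by (rule image_eqI)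
    moreover have "y \<in> ?r ` L" using y(1,2) by (rule image_eqI)
    ultimately show "y \<in> ?r ` L \<inter> (\<lambda>k. vadd n k x) ` K" by (rule IntI[rotated])
  qed
  moreover have "inj_on ?r {l \<in> L. - ext0 n x + l \<in> ext0 n ` K}"
    by (rule inj_onI) (use L in \<open>auto intro: restrict_inj_espace\<close>)
  ultimately show ?thesis unfolding lattice_count_def lcount_def by (simp add: card_image)
qed

text \<open>
  The error \<open>e = \<epsilon> / 10\<close> makes the relative deviation at most \<open>5 * e = \<epsilon> / 2\<close>, strictly less than \<open>\<epsilon>\<close>.
\<close>

theorem smooth_covering:
  assumes K: "convex_body n K" and n: "n \<ge> 2" and \<epsilon>: "0 < \<epsilon>" "\<epsilon> < 1"
    and q: "prime q" "6400080 * real n \<le> \<epsilon> * real q" "real q \<le> 2 ^ n"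
  shows "\<exists>L. full_rank_lattice n L \<and> eta n K L < ereal \<epsilon> \<and> cover_density n K L \<le> 3300 * real n * real q / \<epsilon>\<^sup>2"
proof -
  let ?r = "\<lambda>x::nat \<Rightarrow> real. restrict x {..<n}"
  define K1 where "K1 = ext0 n ` K"
  note E = ext0_convex_body[OF K, folded K1_def]
  obtain x0 \<eta> where x0: "x0 \<in> espace n" "\<eta> > 0" "\<And>d. d \<in> cube n \<eta> \<Longrightarrow> x0 + d \<in> K1" using E(3) by blast
  define V where "V = measure (leb n) K1"
  define e where "e = \<epsilon> / 10"
  have e: "0 < e" "e \<le> 1/2" and q2: "2 * 320004 * real n \<le> e * real q" using \<epsilon> q(2) by (simp_all add: e_def)
  obtain L v where L: "lat n L v" "V > 0" "V \<le> 33 * real n * real q / e\<^sup>2 * v"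
    and cnt: "\<And>x. x \<in> espace n \<Longrightarrow> \<bar>v * real (lcount L K1 x) - V\<bar> \<le> 5 * e * V"
    using smooth_lattice_for_body[OF E(1) x0 n e q(1) q2 q(3)] unfolding V_def by blast
  have v0: "v > 0" using L(1) by (simp add: lat_def)
  note cov = covolume_restrict[OF L(1)]
  have K1b: "K1 \<in> sets borel" "K1 \<subseteq> espace n" using E(1) by (auto simp: body_def bdd_def)
  have "vol n K = V" using vol_restrict[OF K1b] E(2) by (simp add: V_def)
  then have dens: "cover_density n K (?r ` L) = V / v" by (simp add: cover_density_def cov(2))
  have "\<bar>real (lattice_count n (?r ` L) K x) / (V / v) - 1\<bar> \<le> \<epsilon> / 2" if x: "x \<in> rspace n" for x
  proof -
    let ?N = "real (lattice_count n (?r ` L) K x)"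
    have "?N = real (lcount L K1 (- ext0 n x))"
      unfolding K1_def by (subst lattice_count_restrict[OF lat_espace[OF L(1)] x]) simp
    then have "\<bar>v * ?N - V\<bar> \<le> 5 * e * V" using cnt[of "- ext0 n x"] by (simp add: espace_closed)
    then have "\<bar>(v * ?N - V) / V\<bar> \<le> 5 * e" using L(2) by (simp add: abs_divide divide_le_eq)
    moreover have "(v * ?N - V) / V = ?N / (V / v) - 1" using L(2) v0 by (simp add: field_simps)
    ultimately show ?thesis by (simp add: e_def)
  qed
  then have "eta n K (?r ` L) \<le> ereal (\<epsilon> / 2)" unfolding eta_def dens by (intro SUP_least) simp
  also have "ereal (\<epsilon> / 2) < ereal \<epsilon>" using \<epsilon> by simp
  finally have eta: "eta n K (?r ` L) < ereal \<epsilon>" .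
  have "V / v \<le> 3300 * real n * real q / \<epsilon>\<^sup>2"
    using L(3) v0 by (simp add: e_def divide_le_eq power_divide mult_ac)
  with cov(1) eta show ?thesis unfolding dens[symmetric] by (intro exI[of _ "?r ` L"] conjI)
qed

text \<open>
  Take for \<open>q\<close> a prime between \<open>X\<close> and \<open>3 * X\<close>, where \<open>X\<close> is about \<open>6400080 * n / \<epsilon>\<close>, and \<open>n\<close> so large that
  such a prime exists and is at most \<open>2\<^sup>n\<close>.
\<close>

theorem corollary5p1:
  shows "\<exists>C'::real. \<forall>\<epsilon>::real. 0 < \<epsilon> \<and> \<epsilon> < 1 \<longrightarrow>
    (\<exists>n1::nat. \<forall>n\<ge>n1. \<forall>K. convex_body n K \<longrightarrow>
      (\<exists>L. full_rank_lattice n L \<and> eta n K L < ereal \<epsilon> \<and>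
           cover_density n K L \<le> C' * \<epsilon> powi (-4) * (real n)\<^sup>2))"
proof (rule exI[of _ "10 ^ 11"], intro allI impI)
  fix \<epsilon> :: real assume \<epsilon>: "0 < \<epsilon> \<and> \<epsilon> < 1"
  obtain X0 where X0: "\<And>X. X \<ge> X0 \<Longrightarrow> \<exists>p::nat. prime p \<and> X < p \<and> p \<le> 3 * X" using weak_bertrand by blast
  have "eventually (\<lambda>n::nat. 19200243 / \<epsilon> * real n \<le> 2 ^ n) at_top" by real_asymp
  then obtain n2 where n2: "\<And>n. n \<ge> n2 \<Longrightarrow> 19200243 / \<epsilon> * real n \<le> 2 ^ n" by (auto simp: eventually_at_top_linorder)
  have "\<exists>L. full_rank_lattice n L \<and> eta n K L < ereal \<epsilon> \<and> cover_density n K L \<le> 10 ^ 11 * \<epsilon> powi (-4) * (real n)\<^sup>2"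
    if n: "n \<ge> max 2 (max n2 X0)" and K: "convex_body n K" for n K
  proof -
    define X where "X = nat \<lceil>6400080 * real n / \<epsilon>\<rceil>"
    have n2': "n \<ge> 2" using n by simp
    have ne: "real n \<le> real n / \<epsilon>" using \<epsilon> by (simp add: le_divide_eq mult_left_le)
    have Xl: "6400080 * real n / \<epsilon> \<le> real X" unfolding X_def by (rule real_nat_ceiling_ge)
    have "real X \<le> 6400080 * real n / \<epsilon> + 1" unfolding X_def using \<epsilon> by (simp add: of_nat_nat)
    then have Xu: "real X \<le> 6400081 * (real n / \<epsilon>)" using ne n2' by simp
    have "real n \<le> real X" using ne Xl n2' by simp
    then have "X \<ge> X0" using n by simp
    then obtain p where p: "prime p" "X < p" "p \<le> 3 * X" using X0 by blast
    have "real p \<le> 3 * real X" using p(3) by (metis of_nat_le_iff of_nat_mult of_nat_numeral)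
    then have pu: "real p \<le> 19200243 * (real n / \<epsilon>)" using Xu by simp
    moreover have "19200243 * (real n / \<epsilon>) \<le> 2 ^ n" using n2[of n] n by simp
    ultimately have p2: "real p \<le> 2 ^ n" by (rule order_trans)
    have "6400080 * real n / \<epsilon> \<le> real p" using Xl p(2) by simp
    then have p1: "6400080 * real n \<le> \<epsilon> * real p" using \<epsilon> by (simp add: divide_le_eq mult.commute)
    have e: "0 < \<epsilon>" "\<epsilon> < 1" using \<epsilon> by auto
    have "3300 * real n * real p / \<epsilon>\<^sup>2 \<le> 3300 * real n * (19200243 * (real n / \<epsilon>)) / \<epsilon>\<^sup>2"
      using pu by (intro divide_right_mono mult_left_mono) auto
    also have "\<dots> = 63360801900 * (real n)\<^sup>2 * (\<epsilon> / \<epsilon> ^ 4)" using e by (simp add: field_simps eval_nat_numeral)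
    also have "\<dots> \<le> 10 ^ 11 * (real n)\<^sup>2 * (1 / \<epsilon> ^ 4)"
      using e by (intro mult_mono divide_right_mono) auto
    also have "\<dots> = 10 ^ 11 * \<epsilon> powi (-4) * (real n)\<^sup>2" by (simp add: power_int_minus field_simps)
    finally have le: "3300 * real n * real p / \<epsilon>\<^sup>2 \<le> 10 ^ 11 * \<epsilon> powi (-4) * (real n)\<^sup>2" .
    obtain L where L: "full_rank_lattice n L" "eta n K L < ereal \<epsilon>" "cover_density n K L \<le> 3300 * real n * real p / \<epsilon>\<^sup>2"
      using smooth_covering[OF K n2' e p(1) p1 p2] by (elim exE conjE) (rule that)
    show ?thesis using L(1,2) order_trans[OF L(3) le] by (intro exI[of _ L] conjI)
  qed
  then show "\<exists>n1::nat. \<forall>n\<ge>n1. \<forall>K. convex_body n K \<longrightarrow>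
      (\<exists>L. full_rank_lattice n L \<and> eta n K L < ereal \<epsilon> \<and>
           cover_density n K L \<le> 10 ^ 11 * \<epsilon> powi (-4) * (real n)\<^sup>2)" by blast
qed

end
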